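(* Let $S$, $T$, $\Psi$, $S^q$ and $\mathcal F^{S^q}_K$ be as in the context. Let $\kappa>0$ and let $\{\Phi^q\}_{q\ge Q}$ satisfy $\Phi^q\in\mathcal F^{S^q}_{K_q}$ where $K_q=1+O(2^{-q\kappa})$. Then $\Phi^q\circ\Psi^{-1}:T\to T$ converges uniformly on every compact subset of the interior of $T$ to the identity map of $T$.
   Context: $S\subset\mathbb R^d$ is a compact polyhedral surface homeomorphic to a closed disk, triangulated as $(V,E,F)$ with planar triangular faces; three distinct boundary vertices $v_1,v_2,v_3$, positively ordered, are marked. $T$ is the closed equilateral triangle with corners $t_\ell=e^{i(\ell-1)2\pi/3}$. For a vertex $v_i$, $\theta_{i,j}$ is the angle at $v_i$ of incident face $f_j$, $\theta_i=\sum_j\theta_{i,j}$; $\Theta_i=2\pi$ (interior), $\pi$ (other boundary vertices), $\pi/3$ ($v_1,v_2,v_3$); $\gamma_i=\Theta_i/\theta_i$. Fix $0<\zeta<1/4$; $\Omega_i$ is the (relative) interior of the convex hull over the surface of $v_i$ and the points $\zeta v_i+(1-\zeta)v_{i'}$, $v_{i'}$ neighbours of $v_i$; $\varphi_i:\Omega_i\to\mathbb C$ unfolds the faces around $v_i$ isometrically into the plane with $v_i$ at $0$ and applies $re^{i\phi}\mapsto r^{\gamma_i}e^{i\gamma_i\phi}$ (continuously). $\Psi:S\to T$ is the unique homeomorphism conformal in the interior with respect to these charts with $\Psi(v_\ell)=t_\ell$. $S^0=S$, $S^{q+1}$ is obtained from $S^q=(V^q,E^q,F^q)$ by 1-to-4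 midpoint subdivision. Each $f_j\in F^2$ is associated with a chart $i=i_j$ ($v_i$ a vertex of the original face containing $f_j$, $\overline{f_j}\subset\Omega_i$); faces of $F^q$, $q>2$, inherit their $F^2$-ancestor's chart. For $f_j\in F^q$ with vertices $v_{j_\ell}$, $z_\ell=\varphi_{i_j}(v_{j_\ell})$; for a continuous $\Phi$ affine on faces of $S^q$, $A_j$ is the affine map with $A_j(z_\ell)=\Phi(v_{j_\ell})$ and $\mathrm{DCD}(\Phi|_{f_j})$ is the ratio of the larger to smaller singular value of its linear part. $\mathcal F^{S^q}_K$ is the set of continuous maps $S\to\mathbb C$, affine on each face of $S^q$, mapping $\partial S$ bijectively onto $\partial T$ with $v_\ell\mapsto t_\ell$, which are orientation-preserving homeomorphisms onto $T$ with $\mathrm{DCD}(\Phi|_{f_j})\le K$ for all $f_j\in F^q$. Standing assumption: $S$ has been refined so that for every vertex $v_i$ and incident face $f_j$, $\lceil\gamma_i\rceil\theta_{i,j}<\pi/2$ and $\theta_{i,j}<60.4^\circ$, and every face incident to a vertex $v_i$ with $\gamma_i\neq1$ is isosceles with equal sides meeting at $v_i$. *)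

theory Defs
  imports "HOL-Complex_Analysis.Complex_Analysis" "HOL-Library.Landau_Symbols"
begin

text \<open>A face is an ordered triple of points of the ambient Euclidean space; the
cyclic order of the triple fixes the orientation of the face.\<close>

type_synonym 'a tri = "'a \<times> 'a \<times> 'a"

fun tverts :: "'a tri \<Rightarrow> 'a set" where
  "tverts (a, b, c) = {a, b, c}"

definition tconv :: "'a::real_vector tri \<Rightarrow> 'a set" where
  "tconv f = convex hull (tverts f)"

fun dedges_face :: "'a tri \<Rightarrow> ('a \<times> 'a) set" where
  "dedges_face (a, b, c) = {(a, b), (b, c), (c, a)}"

definition dedges :: "'a tri set \<Rightarrow> ('a \<times> 'a) set" where
  "dedges F = \<Union> (dedges_face ` F)"

text \<open>Boundary edges (directed as induced by the orientation): edges lying in exactly one face.\<close>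
definition bd_edges :: "'a tri set \<Rightarrow> ('a \<times> 'a) set" where
  "bd_edges F = {(x, y). (x, y) \<in> dedges F \<and> (y, x) \<notin> dedges F}"

definition surface :: "'a::real_vector tri set \<Rightarrow> 'a set" where
  "surface F = \<Union> (tconv ` F)"

definition bdry :: "'a::real_vector tri set \<Rightarrow> 'a set" where
  "bdry F = (\<Union>(x, y) \<in> bd_edges F. closed_segment x y)"

definition verts :: "'a tri set \<Rightarrow> 'a set" where
  "verts F = \<Union> (tverts ` F)"

definition oriented_triangulation :: "'a::euclidean_space tri set \<Rightarrow> bool" where
  "oriented_triangulation F \<longleftrightarrow>
     finite F \<and> F \<noteq> {} \<and>
     (\<forall>f\<in>F. \<not> collinear (tverts f)) \<and>
     inj_on tverts F \<and>
     (\<forall>f\<in>F. \<forall>g\<in>F. f \<noteq> g \<longrightarrow> tconv f \<inter> tconv g = convex hull (tverts f \<inter> tverts g)) \<and>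
     (\<forall>f\<in>F. \<forall>g\<in>F. f \<noteq> g \<longrightarrow> dedges_face f \<inter> dedges_face g = {})"

definition pos_ordered :: "'a tri set \<Rightarrow> 'a \<Rightarrow> 'a \<Rightarrow> 'a \<Rightarrow> bool" where
  "pos_ordered F v1 v2 v3 \<longleftrightarrow>
     (\<exists>ws. ws \<noteq> [] \<and> distinct ws \<and> hd ws = v1 \<and> last ws = v3 \<and> v2 \<in> set ws \<and>
        (\<forall>i. Suc i < length ws \<longrightarrow> (ws ! i, ws ! Suc i) \<in> bd_edges F))"

fun opp :: "'a \<Rightarrow> 'a tri \<Rightarrow> 'a \<times> 'a" where
  "opp v (a, b, c) = (if v = a then (b, c) else if v = b then (c, a) else (a, b))"

definition vec_angle :: "'a::real_inner \<Rightarrow> 'a \<Rightarrow> real" where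
  "vec_angle u w = arccos ((u \<bullet> w) / (norm u * norm w))"

definition corner_angle :: "'a::euclidean_space \<Rightarrow> 'a tri \<Rightarrow> real" where
  "corner_angle v f = vec_angle (fst (opp v f) - v) (snd (opp v f) - v)"

definition total_angle :: "'a::euclidean_space tri set \<Rightarrow> 'a \<Rightarrow> real" where
  "total_angle F v = (\<Sum>f\<in>{f\<in>F. v \<in> tverts f}. corner_angle v f)"

definition target_angle :: "'a::euclidean_space tri set \<Rightarrow> 'a \<Rightarrow> 'a \<Rightarrow> 'a \<Rightarrow> 'a \<Rightarrow> real" where
  "target_angle F v1 v2 v3 v =
     (if v \<in> {v1, v2, v3} then pi / 3 else if v \<in> bdry F then pi else 2 * pi)"

definition cone_gamma :: "'a::euclidean_space tri set \<Rightarrow> 'a \<Rightarrow> 'a \<Rightarrow> 'a \<Rightarrow> 'a \<Rightarrow> real" where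
  "cone_gamma F v1 v2 v3 v = target_angle F v1 v2 v3 v / total_angle F v"

definition Omega :: "'a::euclidean_space tri set \<Rightarrow> real \<Rightarrow> 'a \<Rightarrow> 'a set" where
  "Omega F \<zeta> v = top_of_set (surface F) interior_of
     (\<Union>f\<in>{f\<in>F. v \<in> tverts f}.
        convex hull {v, \<zeta> *\<^sub>R v + (1 - \<zeta>) *\<^sub>R fst (opp v f), \<zeta> *\<^sub>R v + (1 - \<zeta>) *\<^sub>R snd (opp v f)})"

text \<open>phi_i: on each incident face f = (v,b,c) the isometric unfolding puts x at
polar coordinates (|x - v|, beta_f + angle(b - v, x - v)), followed by the power map
r e^{i t} |-> r^gamma e^{i gamma t}; the offsets beta_f are such that the result is
continuous on Omega_i.  This determines phi_i up to a rotation.\<close>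
definition is_chart :: "'a::euclidean_space tri set \<Rightarrow> 'a \<Rightarrow> 'a \<Rightarrow> 'a \<Rightarrow> real \<Rightarrow> 'a \<Rightarrow> ('a \<Rightarrow> complex) \<Rightarrow> bool" where
  "is_chart F v1 v2 v3 \<zeta> v \<phi> \<longleftrightarrow>
     continuous_on (Omega F \<zeta> v) \<phi> \<and>
     (\<forall>f\<in>F. v \<in> tverts f \<longrightarrow>
        (\<exists>\<beta>::real. \<forall>x \<in> Omega F \<zeta> v \<inter> tconv f.
           \<phi> x = complex_of_real (norm (x - v) powr cone_gamma F v1 v2 v3 v) *
                 cis (cone_gamma F v1 v2 v3 v * (\<beta> + vec_angle (fst (opp v f) - v) (x - v)))))"

definition chart :: "'a::euclidean_space tri set \<Rightarrow> 'a \<Rightarrow> 'a \<Rightarrow> 'a \<Rightarrow> real \<Rightarrow> 'a \<Rightarrow> 'a \<Rightarrow> complex" where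
  "chart F v1 v2 v3 \<zeta> v = (SOME \<phi>. is_chart F v1 v2 v3 \<zeta> v \<phi>)"

fun subdiv_face :: "'a::real_vector tri \<Rightarrow> 'a tri set" where
  "subdiv_face (a, b, c) =
     {(a, midpoint a b, midpoint c a), (midpoint a b, b, midpoint b c),
      (midpoint c a, midpoint b c, c), (midpoint a b, midpoint b c, midpoint c a)}"

definition refine :: "'a::real_vector tri set \<Rightarrow> 'a tri set" where
  "refine F = \<Union> (subdiv_face ` F)"

definition level :: "'a::real_vector tri set \<Rightarrow> nat \<Rightarrow> 'a tri set" where
  "level F q = (refine ^^ q) F"

definition tcorner :: "nat \<Rightarrow> complex" where
  "tcorner l = cis ((real l - 1) * 2 * pi / 3)"

definition Tri :: "complex set" where
  "Tri = convex hull {tcorner 1, tcorner 2, tcorner 3}"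

definition lin_part :: "complex \<Rightarrow> complex \<Rightarrow> complex \<Rightarrow> complex \<Rightarrow> complex \<Rightarrow> complex \<Rightarrow> (complex \<Rightarrow> complex)" where
  "lin_part z1 z2 z3 w1 w2 w3 =
     (THE L. linear L \<and> L (z2 - z1) = w2 - w1 \<and> L (z3 - z1) = w3 - w1)"

definition dcd :: "(complex \<Rightarrow> complex) \<Rightarrow> real" where
  "dcd L = onorm L / (INF u\<in>{u. norm u = 1}. norm (L u))"

text \<open>Positive determinant.\<close>
definition orient_pos :: "(complex \<Rightarrow> complex) \<Rightarrow> bool" where
  "orient_pos L \<longleftrightarrow> Im (cnj (L 1) * L \<i>) > 0"

fun face_lin :: "('a \<Rightarrow> complex) \<Rightarrow> ('a \<Rightarrow> complex) \<Rightarrow> 'a tri \<Rightarrow> (complex \<Rightarrow> complex)" where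
  "face_lin \<Phi> \<phi> (a, b, c) = lin_part (\<phi> a) (\<phi> b) (\<phi> c) (\<Phi> a) (\<Phi> b) (\<Phi> c)"

definition admissible_assoc :: "'a::euclidean_space tri set \<Rightarrow> real \<Rightarrow> ('a tri \<Rightarrow> 'a) \<Rightarrow> bool" where
  "admissible_assoc F \<zeta> assoc \<longleftrightarrow>
     (\<forall>g\<in>level F 2. (\<exists>f\<in>F. tconv g \<subseteq> tconv f \<and> assoc g \<in> tverts f) \<and>
                    closure (tconv g) \<subseteq> Omega F \<zeta> (assoc g))"

text \<open>The class F^{S^q}_K.  A face f of F^q (q >= 2) uses the chart of its (unique)
ancestor g in F^2, i.e. the face g of F^2 with tconv f contained in tconv g.\<close>
definition FK :: "'a::euclidean_space tri set \<Rightarrow> 'a \<Rightarrow> 'a \<Rightarrow> 'a \<Rightarrow> real \<Rightarrow> ('a tri \<Rightarrow> 'a) \<Rightarrow>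
                  nat \<Rightarrow> real \<Rightarrow> ('a \<Rightarrow> complex) set" where
  "FK F v1 v2 v3 \<zeta> assoc q K =
     {\<Phi>. continuous_on (surface F) \<Phi> \<and>
          (\<forall>f\<in>level F q. \<exists>L c. linear L \<and> (\<forall>x\<in>tconv f. \<Phi> x = L x + c)) \<and>
          bij_betw \<Phi> (bdry F) (frontier Tri) \<and>
          \<Phi> v1 = tcorner 1 \<and> \<Phi> v2 = tcorner 2 \<and> \<Phi> v3 = tcorner 3 \<and>
          (\<exists>\<Phi>'. homeomorphism (surface F) Tri \<Phi> \<Phi>') \<and>
          (\<forall>f\<in>level F q. \<forall>g\<in>level F 2. tconv f \<subseteq> tconv g \<longrightarrow>
              orient_pos (face_lin \<Phi> (chart F v1 v2 v3 \<zeta> (assoc g)) f) \<and>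
              dcd (face_lin \<Phi> (chart F v1 v2 v3 \<zeta> (assoc g)) f) \<le> K)}"

end

theory Submission
  imports Defs
begin

text \<open>Set \<open>h\<^sub>q = \<Phi>\<^sup>q \<circ> \<Psi>\<inverse>\<close>.  On a fixed face of \<open>S\<close>, away from the vertices, the charts are conformal in the
isometric planar coordinate and almost constant on the scale of a face of \<open>S\<^sup>q\<close>, so a distortion
tending to \<open>1\<close> in the charts makes every affine piece of \<open>\<Phi>\<^sup>q\<close> almost complex linear in that coordinate.
Each piece then covers an area comparable to the square of its diameter.  As the total area is at
most that of \<open>T\<close>, the squared diameters of the images of the lattice cells are summable uniformly in
\<open>q\<close>, and the length-area method gives short image curves around every point of the surface that is
not a vertex, hence equicontinuity by the maximum principle for injective maps (also at boundary
points, on half boxes).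

A locally uniform limit \<open>h\<close> of a subsequence has vanishing contour integrals over rectangles, because
the integral over a cell is at most a small multiple of (image diameter) times (mesh size).  Thus \<open>h\<close>
is holomorphic off the images of the vertices; edges are crossed by pasting along a line in the
unfolded pair of faces.  Moreover \<open>h\<close> maps each side of \<open>T\<close> into itself in the limit.

Such an \<open>h\<close> is the identity: along side \<open>l\<close> the real part of \<open>y = cnj t\<^sub>l * (h z - z)\<close> tends to \<open>0\<close>, hence so does
that of \<open>y\<^sup>3 = (h z - z)\<^sup>3\<close>, because \<open>t\<^sub>l\<^sup>3 = 1\<close>; a bounded holomorphic function whose real part has
boundary values \<open>0\<close> off a finite set is constant.  Every subsequence thus has a further
subsequence converging to the identity off the vertices, and the maximum principle on small
circles extends the convergence across them.\<close>

section \<open>Boundary values on the equilateral triangle\<close>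

text \<open>No compactness theorem for quasiconformal maps is invoked. In barycentric coordinates of
  a face of \<open>F\<close> the faces of level q are exactly the halves of the cells of a square
  lattice of mesh 1/2^q, so the length-area method and Morera's theorem become finite sums over
  lattice cells. Area is measured by disjoint round balls, one in the image of each half cell,
  instead of an integral of Jacobians. If the two affine pieces on a cell have antilinear
  coefficients \<beta> and \<beta>', the contour integral around the cell is exactly proportional to
  \<beta> + \<beta>'. The obstacle is the vertices: where \<gamma> \<noteq> 1 the derivative of the
  power map tends to 0 or infinity, so estimates are uniform only on faces with discs about the
  vertices removed, and the images of the vertices stay a finite exceptional set \<open>E\<close>
  until the end. A second difficulty is that \<open>chart\<close> is an arbitrary choice among all
  solutions. Its shape has to be recovered first, which needs the cyclic order of the faces about a
  vertex and hence that the surface is a disk.\<close>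

definition side_fn :: "nat => complex => real" where
 "side_fn l w = tcorner l \<bullet> w + 1/2"

lemma tcorner_simps:
 "tcorner 1 = 1" "tcorner (Suc 0) = 1"
 "tcorner 2 = Complex (-1/2) (sqrt 3 / 2)" "tcorner 3 = Complex (-1/2) (- sqrt 3 / 2)"
proof -
 have c3: "cos (pi * 4 / 3) = - 1/2" "sin (pi * 4 / 3) = - sqrt 3 / 2"
  using cos_periodic_pi[of "pi/3"] sin_periodic_pi[of "pi/3"] cos_60 sin_60
  by (simp_all add: field_simps)
 have c2: "cos (pi * 2 / 3) = - 1/2" "sin (pi * 2 / 3) = sqrt 3 / 2"
  using cos_120 sin_120 by (simp_all add: mult.commute)
 show "tcorner 1 = 1" "tcorner (Suc 0) = 1" by (simp_all add: tcorner_def)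
 show "tcorner 2 = Complex (-1/2) (sqrt 3 / 2)"
  using c2 by (auto simp: tcorner_def complex_eq_iff mult.commute)
 show "tcorner 3 = Complex (-1/2) (- sqrt 3 / 2)"
  using c3 by (auto simp: tcorner_def complex_eq_iff mult.commute)
qed

lemma side_fn_simps:
 "side_fn 1 w = Re w + 1/2" "side_fn (Suc 0) w = Re w + 1/2"
 "side_fn 2 w = - Re w / 2 + sqrt 3 / 2 * Im w + 1/2"
 "side_fn 3 w = - Re w / 2 - sqrt 3 / 2 * Im w + 1/2"
 by (simp_all add: side_fn_def tcorner_simps inner_complex_def)

lemma cube_tcorner: "l \<in> {1,2,3} ==> tcorner l ^ 3 = 1"
proof -
 assume "l \<in> {1,2,3}"
 have "tcorner l ^ 3 = cis (3 * ((real l - 1) * 2 * pi / 3))"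
  using Complex.DeMoivre[of "(real l - 1) * 2 * pi / 3" 3] by (simp add: tcorner_def)
 also have "3 * ((real l - 1) * 2 * pi / 3) = (real l - 1) * (2 * pi)" by simp
 also have "cis ((real l - 1) * (2*pi)) = 1"
  using \<open>l \<in> {1,2,3}\<close> cis_multiple_2pi[of "real l - 1"] by (auto simp: mult_ac)
 finally show ?thesis .
qed

lemma norm_tcorner [simp]: "norm (tcorner l) = 1"
 by (simp add: tcorner_def)

text \<open>Each side has distance 1/2 from the centre, so \<open>side_fn l\<close> is the signed
  distance to the side opposite to \<open>tcorner l\<close>. The numbers
  \<open>2/3 * side_fn l w\<close> are the barycentric coordinates of \<open>w\<close>, which gives
  both inclusions.\<close>

lemma Tri_eq: "Tri = {w. \<forall>l\<in>{1,2,3}. side_fn l w \<ge> 0}"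
proof (intro set_eqI iffI; clarify)
 fix w assume "w \<in> Tri"
 then obtain u v x where w: "w = u *\<^sub>R tcorner 1 + v *\<^sub>R tcorner 2 + x *\<^sub>R tcorner 3"
  and "u \<ge> 0" "v \<ge> 0" "x \<ge> 0" "u + v + x = 1"
  unfolding Tri_def convex_hull_3 by auto
 then have x: "x = 1 - u - v" by simp
 have "side_fn 1 w = 3/2 * u" "side_fn 2 w = 3/2 * v" "side_fn 3 w = 3/2 * x"
  unfolding w x by (simp_all only: side_fn_simps tcorner_simps) (simp_all add: field_simps)
 then show "\<And>l. l \<in> {1,2,3} ==> side_fn l w \<ge> 0" using \<open>u \<ge> 0\<close> \<open>v \<ge> 0\<close> \<open>x \<ge> 0\<close> by auto
next
 fix w assume a: "\<forall>l\<in>{1,2,3}. side_fn l w \<ge> 0"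
 have "w = (2/3 * side_fn 1 w) *\<^sub>R tcorner 1 + (2/3 * side_fn 2 w) *\<^sub>R tcorner 2 + (2/3 * side_fn 3 w) *\<^sub>R tcorner 3"
  by (simp only: side_fn_simps tcorner_simps complex_eq_iff) (simp add: algebra_simps)
 moreover have "2/3 * side_fn 1 w + 2/3 * side_fn 2 w + 2/3 * side_fn 3 w = 1"
  by (simp only: side_fn_simps) (simp add: algebra_simps)
 moreover have "2/3 * side_fn 1 w \<ge> 0" "2/3 * side_fn 2 w \<ge> 0" "2/3 * side_fn 3 w \<ge> 0"
  using a by auto
 ultimately show "w \<in> Tri" unfolding Tri_def convex_hull_3 by blast
qed

lemma interior_Tri: "interior Tri = {w. \<forall>l\<in>{1,2,3}. side_fn l w > 0}"
proof -
 have sf: "side_fn l w \<ge> 0 \<longleftrightarrow> tcorner l \<bullet> w \<ge> -1/2" "side_fn l w > 0 \<longleftrightarrow> tcorner l \<bullet> w > -1/2" for l w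
  by (auto simp: side_fn_def)
 have "Tri = (\<Inter>l\<in>{1,2,3}. {w. tcorner l \<bullet> w \<ge> -1/2})"
  unfolding Tri_eq sf by blast
 then have "interior Tri = (\<Inter>l\<in>{1,2,3}. interior {w. tcorner l \<bullet> w \<ge> -1/2})"
 proof -
  assume "Tri = (\<Inter>l\<in>{1,2,3}. {w. tcorner l \<bullet> w \<ge> -1/2})"
  then have "interior Tri = interior (\<Inter>l\<in>{1,2,3}. {w. tcorner l \<bullet> w \<ge> -1/2})" by (rule arg_cong)
  then show ?thesis by (simp only: INT_insert INT_empty interior_Int interior_UNIV)
 qed
 moreover have "interior {w. tcorner l \<bullet> w \<ge> -1/2} = {w. tcorner l \<bullet> w > -1/2}" for l
  by (rule interior_halfspace_ge) (metis norm_tcorner norm_zero zero_neq_one)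
 ultimately show ?thesis unfolding sf by blast
qed

lemma compact_Tri: "compact Tri" unfolding Tri_def by (simp add: compact_convex_hull)
lemma closed_Tri: "closed Tri" using compact_Tri compact_imp_closed by blast
lemma convex_Tri: "convex Tri" unfolding Tri_def by simp

lemma frontier_Tri: "frontier Tri = {w\<in>Tri. \<exists>l\<in>{1,2,3}. side_fn l w = 0}"
proof -
 have "w \<in> interior Tri \<longleftrightarrow> \<not> (\<exists>l\<in>{1,2,3}. side_fn l w = 0)" if "w \<in> Tri" for w
  using that unfolding interior_Tri unfolding Tri_eq by force
 then show ?thesis unfolding frontier_def closure_closed[OF closed_Tri] by blast
qed

lemma Tri_norm: "w \<in> Tri ==> norm w \<le> 1"
proof -
 have "Tri \<subseteq> cball 0 1" unfolding Tri_def by (intro hull_minimal) auto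
 then show "w \<in> Tri ==> norm w \<le> 1" by auto
qed

lemma zero_interior_Tri: "0 \<in> interior Tri"
 unfolding interior_Tri side_fn_def by simp

lemma corner_sides:
 assumes "l \<in> {1,2,3::nat}" "m \<in> {1,2,3}"
 shows "side_fn m (tcorner l) = (if l = m then 3/2 else 0)"
 using assms by (auto simp: side_fn_simps tcorner_simps)

lemma continuous_side_fn [continuous_intros]:
 "continuous_on S f ==> continuous_on S (\<lambda>x. side_fn l (f x))"
 unfolding side_fn_def by (intro continuous_intros)

text \<open>The set where the modulus is at least \<open>norm (g z0)\<close> cannot accumulate at
  the frontier, so it is compact and the supremum is attained inside D. The maximum modulus
  principle makes g constant, which contradicts the bound near a frontier point. The hypothesis is
  an upper limit because g need not extend to the frontier.\<close>

lemma maximum_modulus_limsup: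
 fixes g :: "complex => complex"
 assumes D: "open D" "connected D" "bounded D" and hol: "g holomorphic_on D"
  and lim: "\<And>\<zeta> e. \<zeta> \<in> frontier D ==> e > 0 ==> eventually (\<lambda>z. norm (g z) < 1 + e) (at \<zeta> within D)"
  and z0: "z0 \<in> D"
 shows "norm (g z0) \<le> 1"
proof (rule ccontr)
 assume "\<not> norm (g z0) \<le> 1"
 define e where "e = norm (g z0) - 1"
 have e: "e > 0" using \<open>\<not> _\<close> by (simp add: e_def)
 have contg: "continuous_on D g" using hol holomorphic_on_imp_continuous_on by blast
 define K where "K = {z\<in>D. norm (g z) \<ge> 1 + e}"
 have "closed K"
  unfolding closed_sequential_limits
 proof (intro allI impI; elim conjE)
  fix x l assume x: "\<forall>n. x n \<in> K" and xl: "x \<longlonglongrightarrow> l"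
  have lc: "l \<in> closure D"
   using x xl unfolding closure_sequential K_def by blast
  show "l \<in> K"
  proof (cases "l \<in> D")
   case True
   have "(\<lambda>n. norm (g (x n))) \<longlonglongrightarrow> norm (g l)"
    using contg True xl x by (intro tendsto_norm continuous_on_tendsto_compose[OF contg]) (auto simp: K_def)
   then have "norm (g l) \<ge> 1 + e"
    by (rule tendsto_lowerbound) (use x K_def in auto)
   then show ?thesis using True K_def by auto
  next
   case False
   then have "l \<in> frontier D" using lc D(1) by (simp add: frontier_def interior_open)
   from lim[OF this e] obtain d where d: "d > 0" "\<And>z. z \<in> D ==> z \<noteq> l ==> dist z l < d ==> norm (g z) < 1 + e"
    unfolding eventually_at by auto
   obtain n where "dist (x n) l < d" using metric_LIMSEQ_D[OF xl d(1)] by blast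
   then have "norm (g (x n)) < 1 + e" using x False by (intro d(2)) (auto simp: K_def)
   moreover have "norm (g (x n)) \<ge> 1 + e" using x by (auto simp: K_def)
   ultimately show ?thesis by simp
  qed
 qed
 moreover have "bounded K" using D(3) K_def bounded_subset by (metis (no_types, lifting) mem_Collect_eq subsetI)
 ultimately have cK: "compact K" by (simp add: compact_eq_bounded_closed)
 have z0K: "z0 \<in> K" using z0 by (simp add: K_def e_def)
 have "continuous_on K (\<lambda>z. norm (g z))"
  by (rule continuous_on_norm, rule continuous_on_subset[OF contg]) (auto simp: K_def)
 then obtain \<xi> where \<xi>: "\<xi> \<in> K" "\<And>z. z \<in> K ==> norm (g z) \<le> norm (g \<xi>)"
  using continuous_attains_sup[OF cK] z0K by blast
 have mx: "norm (g z) \<le> norm (g \<xi>)" if "z \<in> D" for z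
 proof (cases "z \<in> K")
  case False
  then have "norm (g z) < 1 + e" using that by (auto simp: K_def)
  also have "\<dots> \<le> norm (g \<xi>)" using \<xi>(1) by (simp add: K_def)
  finally show ?thesis by simp
 qed (use \<xi> in auto)
 have "\<xi> \<in> D" using \<xi>(1) by (simp add: K_def)
 have "g constant_on D"
  using maximum_modulus_principle[OF hol D(1,2) D(1) order_refl \<open>\<xi> \<in> D\<close>] mx by blast
 then have cst: "g z = g z0" if "z \<in> D" for z using that z0 unfolding constant_on_def by metis
 have "D \<noteq> UNIV" using D(3) not_bounded_UNIV by blast
 then have "frontier D \<noteq> {}" using z0 frontier_eq_empty by auto
 then obtain \<zeta> where \<zeta>: "\<zeta> \<in> frontier D" by auto
 have "\<zeta> \<in> closure D" "\<zeta> \<notin> D" using \<zeta> D(1) by (auto simp: frontier_def interior_open)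
 then have nb: "at \<zeta> within D \<noteq> bot" by (simp add: at_within_eq_bot_iff closure_insert)
 have "eventually (\<lambda>z. norm (g z) < 1 + e \<and> z \<in> D) (at \<zeta> within D)"
  using lim[OF \<zeta> e] by (auto simp: eventually_at_filter elim: eventually_mono)
 then obtain z where "norm (g z) < 1 + e" "z \<in> D"
  using nb eventually_happens by blast
 then show False using cst[of z] e_def by simp
qed

text \<open>A Phragmen-Lindelof argument. The modulus of \<open>exp (n * f)\<close> tends to 1 at
  the good frontier points and is merely bounded near E; a polynomial vanishing on E repairs this.
  It costs a factor that does not depend on n, so \<open>n * Re (f z)\<close> stays bounded and
  \<open>Re (f z)\<close> cannot be positive.\<close>

lemma real_boundary_values_imp_le:
 fixes f :: "complex => complex"
 assumes D: "open D" "connected D" "bounded D" and E: "finite E" "D \<inter> E = {}" and hol: "f holomorphic_on D"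
  and bnd: "\<And>z. z \<in> D ==> norm (f z) \<le> B"
  and lim: "\<And>\<zeta>. \<zeta> \<in> frontier D - E ==> ((\<lambda>z. Re (f z)) \<longlongrightarrow> 0) (at \<zeta> within D)"
  and z: "z \<in> D"
 shows "Re (f z) \<le> 0"
proof -
 obtain R0 where R0: "R0 > 0" "\<And>z. z \<in> D ==> norm z \<le> R0" using D(3) bounded_pos by metis
 obtain R1 where R1: "R1 > 0" "\<And>z. z \<in> E ==> norm z \<le> R1"
  using finite_imp_bounded[OF E(1)] bounded_pos by metis
 define R where "R = R0 + R1"
 have R: "R > 0" using R0 R1 R_def by auto
 \<comment> \<open>R bounds all distances between points of D and points of E, so every factor has
   modulus at most 1 on D.\<close>
 define P where "P z = (\<Prod>\<zeta>\<in>E. (z - \<zeta>) / of_real R)" for z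
 have fac: "norm ((z - \<zeta>) / of_real R) \<le> 1" if "z \<in> D" "\<zeta> \<in> E" for z \<zeta>
 proof -
  have "norm (z - \<zeta>) \<le> R"
   using R0(2)[OF that(1)] R1(2)[OF that(2)] norm_triangle_ineq4[of z \<zeta>] by (simp add: R_def)
  then show ?thesis using R by (simp add: norm_divide)
 qed
 have P1: "norm (P z) \<le> 1" if "z \<in> D" for z
  unfolding P_def prod_norm[symmetric] using fac[OF that] by (intro prod_le_1) auto
 have P0: "P z \<noteq> 0" using z E R unfolding P_def by auto
 have contP: "continuous_on UNIV P" unfolding P_def using R by (intro continuous_intros) auto
 have main: "norm (exp (of_nat n * f z) * P z) \<le> 1" for n
 proof (rule maximum_modulus_limsup[OF D _ _ z, where g = "\<lambda>z. exp (of_nat n * f z) * P z"])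
  show "(\<lambda>z. exp (of_nat n * f z) * P z) holomorphic_on D"
   unfolding P_def using R by (intro holomorphic_intros hol) auto
  fix \<zeta> and e :: real assume \<zeta>: "\<zeta> \<in> frontier D" and e: "e > 0"
  have inD: "eventually (\<lambda>z. z \<in> D) (at \<zeta> within D)" by (simp add: eventually_at_filter)
  show "eventually (\<lambda>z. norm (exp (of_nat n * f z) * P z) < 1 + e) (at \<zeta> within D)"
  proof (cases "\<zeta> \<in> E")
   case False
   have "((\<lambda>z. exp (of_nat n * Re (f z))) \<longlongrightarrow> exp (of_nat n * 0)) (at \<zeta> within D)"
    using lim \<zeta> False by (intro tendsto_intros) auto
   then have "eventually (\<lambda>z. exp (of_nat n * Re (f z)) < 1 + e) (at \<zeta> within D)"
    using e by (intro order_tendstoD(2)) auto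
   with inD show ?thesis
   proof eventually_elim
    case (elim z)
    have "norm (exp (of_nat n * f z) * P z) \<le> exp (of_nat n * Re (f z)) * 1"
     unfolding norm_mult norm_exp_eq_Re using P1[OF elim(1)] by (intro mult_mono) auto
    then show ?case using elim(2) by simp
   qed
  next
   case True
   have "P \<zeta> = 0" using True E unfolding P_def by auto
   have "(P \<longlongrightarrow> P \<zeta>) (at \<zeta> within D)"
    using contP by (meson UNIV_I continuous_on_def subset_UNIV tendsto_within_subset)
   then have "((\<lambda>z. norm (P z)) \<longlongrightarrow> 0) (at \<zeta> within D)"
    using \<open>P \<zeta> = 0\<close> tendsto_norm_zero by metis
   then have "((\<lambda>z. exp (of_nat n * B) * norm (P z)) \<longlongrightarrow> exp (of_nat n * B) * 0) (at \<zeta> within D)"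
    by (intro tendsto_intros)
   then have "eventually (\<lambda>z. exp (of_nat n * B) * norm (P z) < 1 + e) (at \<zeta> within D)"
    using e by (intro order_tendstoD(2)) auto
   with inD show ?thesis
   proof eventually_elim
    case (elim z)
    have "Re (f z) \<le> B" using bnd[OF elim(1)] complex_Re_le_cmod order_trans by blast
    then have "norm (exp (of_nat n * f z) * P z) \<le> exp (of_nat n * B) * norm (P z)"
     unfolding norm_mult norm_exp_eq_Re by (intro mult_mono) (auto simp: mult_left_mono)
    then show ?case using elim(2) by simp
   qed
  qed
 qed
 show ?thesis
 proof (rule ccontr)
  assume "\<not> ?thesis"
  then have pos: "Re (f z) > 0" by simp
  have "of_nat n * Re (f z) \<le> ln (1 / norm (P z))" for n
  proof -
   have "exp (of_nat n * Re (f z)) * norm (P z) \<le> 1" using main[of n] by (simp add: norm_mult)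
   then have "exp (of_nat n * Re (f z)) \<le> 1 / norm (P z)" using P0 by (simp add: field_simps)
   then show ?thesis using P0 by (subst ln_ge_iff) auto
  qed
  moreover obtain n :: nat where "of_nat n * Re (f z) > ln (1 / norm (P z))"
   using reals_Archimedean3[OF pos] by blast
  ultimately show False by (meson not_le)
 qed
qed

text \<open>\<open>Re (y^3) = Re y * ((Re y)^2 - 3 * (Im y)^2)\<close>: the real part splits off as
  a factor. The other factor contains the imaginary part, which need not be small, hence the bound
  on the norm.\<close>

lemma cube_Re_tendsto_0:
 fixes y :: "'b => complex"
 assumes "((\<lambda>z. Re (y z)) \<longlongrightarrow> 0) F" and "eventually (\<lambda>z. norm (y z) \<le> B) F"
 shows "((\<lambda>z. Re (y z ^ 3)) \<longlongrightarrow> 0) F"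
proof (rule Lim_null_comparison)
 have "((\<lambda>z. \<bar>Re (y z)\<bar> * (4 * B\<^sup>2)) \<longlongrightarrow> \<bar>0\<bar> * (4 * B\<^sup>2)) F"
  using assms by (intro tendsto_intros)
 then show "((\<lambda>z. \<bar>Re (y z)\<bar> * (4 * B\<^sup>2)) \<longlongrightarrow> 0) F" by simp
 show "eventually (\<lambda>z. norm (Re (y z ^ 3)) \<le> \<bar>Re (y z)\<bar> * (4 * B\<^sup>2)) F"
  using assms(2)
 proof eventually_elim
  case (elim z)
  have e: "Re (y z ^ 3) = Re (y z) * ((Re (y z))\<^sup>2 - 3 * (Im (y z))\<^sup>2)"
   by (simp add: power3_eq_cube power2_eq_square algebra_simps)
  have "(Re (y z))\<^sup>2 \<le> B\<^sup>2" "(Im (y z))\<^sup>2 \<le> B\<^sup>2"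
   using elim abs_Re_le_cmod[of "y z"] abs_Im_le_cmod[of "y z"]
   by (metis power2_abs power_mono abs_ge_zero order_trans)+
  then have "\<bar>(Re (y z))\<^sup>2 - 3 * (Im (y z))\<^sup>2\<bar> \<le> 4 * B\<^sup>2"
   by (smt (verit) zero_le_power2)
  then show ?case unfolding e by (simp add: abs_mult mult_left_mono)
 qed
qed

lemma holomorphic_Tri_identity:
 fixes h :: "complex => complex"
 assumes E: "finite E" and hol: "h holomorphic_on (interior Tri - E)"
  and hT: "\<And>z. z \<in> interior Tri - E ==> h z \<in> Tri"
  and lim: "\<And>\<zeta> l. l \<in> {1,2,3} ==> \<zeta> \<in> frontier Tri - E ==> side_fn l \<zeta> = 0 ==>
    ((\<lambda>z. side_fn l (h z)) \<longlongrightarrow> 0) (at \<zeta> within (interior Tri - E))"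
  and corn: "tcorner 1 \<in> E" "tcorner 2 \<in> E" "tcorner 3 \<in> E"
  and z: "z \<in> interior Tri - E"
 shows "h z = z"
proof -
 define D where "D = interior Tri - E"
 have oD: "open D" unfolding D_def using E by (simp add: finite_imp_closed open_Diff)
 have cD: "connected D" unfolding D_def
  using E by (intro connected_open_diff_countable convex_connected convex_interior convex_Tri countable_finite) auto
 have bD: "bounded D" unfolding D_def
  by (rule bounded_subset[OF compact_imp_bounded[OF compact_Tri]]) (use interior_subset in blast)
 have frD: "frontier D \<subseteq> frontier Tri \<union> E"
 proof -
  have "closure D \<subseteq> Tri" unfolding D_def by (rule closure_minimal[OF _ closed_Tri]) (use interior_subset in blast)
  moreover have "frontier D = closure D - D" by (simp add: frontier_def interior_open[OF oD])
  moreover have "frontier Tri = Tri - interior Tri" by (simp add: frontier_def closed_Tri)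
  ultimately show ?thesis unfolding D_def by blast
 qed
 define f where "f z = (h z - z)^3" for z
 have holf: "f holomorphic_on D" unfolding f_def D_def by (intro holomorphic_intros hol)
 have bd2: "norm (h z - z) \<le> 2" if "z \<in> D" for z
  using Tri_norm[OF hT[OF that[unfolded D_def]]] Tri_norm[of z] that norm_triangle_ineq4[of "h z" z] interior_subset[of Tri]
  unfolding D_def by force
 have bf: "norm (f z) \<le> 8" if "z \<in> D" for z
  using power_mono[OF bd2[OF that], of 3] by (simp add: f_def norm_power)
 have inD: "eventually (\<lambda>z. z \<in> D) (at \<zeta> within D)" for \<zeta> by (simp add: eventually_at_filter)
 have side0: "((\<lambda>z. Re (cnj (tcorner l) * (h z - z))) \<longlongrightarrow> 0) (at \<zeta> within D)"
  if "\<zeta> \<in> frontier Tri - E" "l \<in> {1,2,3}" "side_fn l \<zeta> = 0" for \<zeta> l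
 proof -
  have "((\<lambda>z. side_fn l (h z) - side_fn l z) \<longlongrightarrow> 0 - side_fn l \<zeta>) (at \<zeta> within D)"
   unfolding D_def by (intro tendsto_diff lim that) (unfold side_fn_def, intro tendsto_intros)
  moreover have "side_fn l (h z) - side_fn l z = Re (cnj (tcorner l) * (h z - z))" for z
   by (simp add: side_fn_def inner_complex_def algebra_simps)
  ultimately show ?thesis using that(3) by simp
 qed
 have limf: "((\<lambda>z. Re (f z)) \<longlongrightarrow> 0) (at \<zeta> within D)" if "\<zeta> \<in> frontier D - E" for \<zeta>
 proof -
  have \<zeta>: "\<zeta> \<in> frontier Tri - E" using that frD by auto
  then obtain l where l: "l \<in> {1,2,3}" "side_fn l \<zeta> = 0" unfolding frontier_Tri by auto
  have "((\<lambda>z. Re ((cnj (tcorner l) * (h z - z))^3)) \<longlongrightarrow> 0) (at \<zeta> within D)"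
   by (rule cube_Re_tendsto_0[OF side0[OF \<zeta> l], where B = 2])
    (rule eventually_mono[OF inD], use bd2 in \<open>simp add: norm_mult\<close>)
  moreover have "(cnj (tcorner l) * (h z - z))^3 = f z" for z
   using cube_tcorner[OF l(1)] unfolding f_def power_mult_distrib complex_cnj_power[symmetric] by simp
  ultimately show ?thesis by simp
 qed
 have "Re (f z) = 0" if "z \<in> D" for z
 proof -
  have "Re (f z) \<le> 0"
   by (rule real_boundary_values_imp_le[OF oD cD bD E _ holf bf limf that]) (auto simp: D_def)
  moreover have "Re (- f z) \<le> 0"
  proof (rule real_boundary_values_imp_le[OF oD cD bD E _ _ _ _ that, where f = "\<lambda>z. - f z" and B = 8])
   show "((\<lambda>z. Re (- f z)) \<longlongrightarrow> 0) (at \<zeta> within D)" if "\<zeta> \<in> frontier D - E" for \<zeta>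
    using tendsto_minus[OF limf[OF that]] by simp
  qed (use bf in \<open>auto simp: D_def intro!: holomorphic_intros holf[unfolded D_def]\<close>)
  ultimately show ?thesis by simp
 qed
 \<comment> \<open>A nonconstant holomorphic function has an open image, but the imaginary axis has
   no interior.\<close>
 then have im: "f ` D \<subseteq> {w. Re w = 0}" by auto
 have "f constant_on D"
 proof (rule ccontr)
  assume "\<not> f constant_on D"
  then have "open (f ` D)" using open_mapping_thm[OF holf oD cD oD order_refl] by blast
  then have "f ` D \<subseteq> interior {w. Re w = 0}" using im by (simp add: interior_maximal)
  also have "\<dots> = {}" using interior_hyperplane[of "1::complex" 0] by (simp add: inner_complex_def)
  finally show False using z D_def by auto
 qed
 then obtain c where c: "\<And>z. z \<in> D ==> f z = c" unfolding constant_on_def by auto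
 \<comment> \<open>All values of \<open>h z - z\<close> are cube roots of one number, hence finitely
   many, and D is connected.\<close>
 have "(\<lambda>z. h z - z) constant_on D"
 proof (rule continuous_finite_range_constant[OF cD])
  show "continuous_on D (\<lambda>z. h z - z)"
   using hol unfolding D_def by (intro continuous_intros holomorphic_on_imp_continuous_on)
  have "(\<lambda>z. h z - z) ` D \<subseteq> {w. w^3 = c}" using c f_def by auto
  moreover have "finite {w::complex. w^3 = c}" using finite_nth_roots[of 3] by simp
  ultimately show "finite ((\<lambda>z. h z - z) ` D)" using finite_subset by blast
 qed
 then obtain k where k: "\<And>z. z \<in> D ==> h z - z = k" unfolding constant_on_def by blast
 \<comment> \<open>A side is infinite, so it contains a point off E; the boundary condition there
   makes k orthogonal to \<open>tcorner l\<close>. Two independent corners then force k = 0.\<close>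
 have "Re (cnj (tcorner l) * k) = 0" if l: "l \<in> {1,2,3}" for l
 proof -
  define S where "S = {w\<in>Tri. side_fn l w = 0}"
  have "infinite S"
  proof -
   define m where "m = (if l = 1 then 2 else 1::nat)"
   define n where "n = (if l = 3 then 2 else 3::nat)"
   have mn: "m \<in> {1,2,3}" "n \<in> {1,2,3}" "m \<noteq> l" "n \<noteq> l" "m \<noteq> n" using l by (auto simp: m_def n_def)
   have "closed_segment (tcorner m) (tcorner n) \<subseteq> S"
   proof
    fix w assume "w \<in> closed_segment (tcorner m) (tcorner n)"
    then obtain u where u: "w = (1-u) *\<^sub>R tcorner m + u *\<^sub>R tcorner n" "0 \<le> u" "u \<le> 1"
     unfolding closed_segment_def by auto
    have sf: "side_fn j w = (1-u) * side_fn j (tcorner m) + u * side_fn j (tcorner n)" for j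
     unfolding u side_fn_def by (simp add: inner_add_right algebra_simps diff_divide_distrib)
    have "side_fn j w \<ge> 0" if "j \<in> {1,2,3}" for j
     unfolding sf corner_sides[OF mn(1) that] corner_sides[OF mn(2) that] using u by auto
    moreover have "side_fn l w = 0"
     unfolding sf corner_sides[OF mn(1) l] corner_sides[OF mn(2) l] using mn by auto
    ultimately show "w \<in> S" unfolding S_def Tri_eq by auto
   qed
   moreover have "tcorner m \<noteq> tcorner n"
    using corner_sides[OF mn(1) mn(1)] corner_sides[OF mn(2) mn(1)] mn(5) by auto
   ultimately show ?thesis
    using infinite_super[OF _ uncountable_infinite[OF uncountable_closed_segment]] by blast
  qed
  then have "\<not> S \<subseteq> E" using E finite_subset by blast
  then obtain \<zeta> where \<zeta>: "\<zeta> \<in> S" "\<zeta> \<notin> E" by auto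
  then have \<zeta>f: "\<zeta> \<in> frontier Tri - E" "side_fn l \<zeta> = 0" using l unfolding S_def frontier_Tri by auto
  have "\<zeta> \<in> closure (interior Tri)"
   using \<zeta>(1) convex_closure_interior[OF convex_Tri] zero_interior_Tri closure_closed[OF closed_Tri] S_def by auto
  moreover have "closure (interior Tri) \<subseteq> closure D \<union> E"
  proof -
   have "closure (interior Tri) \<subseteq> closure (D \<union> E)" by (rule closure_mono) (auto simp: D_def)
   then show ?thesis using E by (simp add: finite_imp_closed closure_closed)
  qed
  ultimately have "\<zeta> \<in> closure D" using \<zeta>(2) by blast
  moreover have "\<zeta> \<notin> D" using \<zeta>f unfolding D_def frontier_def by auto
  ultimately have nb: "at \<zeta> within D \<noteq> bot" by (simp add: at_within_eq_bot_iff closure_insert)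
  have "((\<lambda>z. Re (cnj (tcorner l) * k)) \<longlongrightarrow> 0) (at \<zeta> within D)"
   by (rule Lim_transform_eventually[OF side0[OF \<zeta>f(1) l \<zeta>f(2)]])
    (rule eventually_mono[OF inD], simp add: k)
  then show ?thesis using nb tendsto_const tendsto_unique by blast
 qed
 from this[of 1] this[of 2] have "Re k = 0" "Im k = 0"
  by (simp_all add: tcorner_simps)
 then have "k = 0" by (simp add: complex_eq_iff)
 then show ?thesis using k z D_def by auto
qed

section \<open>Vanishing circulation\<close>

text \<open>In the planar coordinate \<open>u = x B + y C\<close> this is the contour integral of \<open>G du\<close> around the image of a box.\<close>
definition circ :: "complex => complex => (complex => complex) => real => real => real => real => complex" where
 "circ B C G x0 x1 y0 y1 =
  B * (contour_integral (linepath (Complex x0 y0) (Complex x1 y0)) G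
     - contour_integral (linepath (Complex x0 y1) (Complex x1 y1)) G)
 + (C / \<i>) * (contour_integral (linepath (Complex x1 y0) (Complex x1 y1)) G
     - contour_integral (linepath (Complex x0 y0) (Complex x0 y1)) G)"

lemma in_cbox_Complex: "z \<in> cbox (Complex a b) (Complex c d) \<longleftrightarrow> a \<le> Re z \<and> Re z \<le> c \<and> b \<le> Im z \<and> Im z \<le> d"
 by (auto simp: in_cbox_complex_iff)

lemma segment_in_cbox:
 assumes "x0 \<le> x1" "y0 \<le> y1" "x \<in> {x0..x1}" "x' \<in> {x0..x1}" "y \<in> {y0..y1}" "y' \<in> {y0..y1}"
 shows "closed_segment (Complex x y) (Complex x' y') \<subseteq> cbox (Complex x0 y0) (Complex x1 y1)"
 using assms by (intro closed_segment_subset convex_box) (auto simp: in_cbox_Complex)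

lemma circ_split_x:
 assumes "continuous_on (cbox (Complex x0 y0) (Complex x2 y1)) G" "x0 \<le> x1" "x1 \<le> x2" "y0 \<le> y1"
 shows "circ B C G x0 x2 y0 y1 = circ B C G x0 x1 y0 y1 + circ B C G x1 x2 y0 y1"
proof -
 have sp: "contour_integral (linepath (Complex x0 y) (Complex x2 y)) G =
  contour_integral (linepath (Complex x0 y) (Complex x1 y)) G + contour_integral (linepath (Complex x1 y) (Complex x2 y)) G"
  if "y \<in> {y0..y1}" for y
 proof (rule contour_integral_split_linepath)
  show "continuous_on (closed_segment (Complex x0 y) (Complex x2 y)) G"
   using assms that by (intro continuous_on_subset[OF assms(1)] segment_in_cbox) auto
  show "Complex x1 y \<in> closed_segment (Complex x0 y) (Complex x2 y)"
   using assms by (auto simp: closed_segment_same_Im closed_segment_eq_real_ivl)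
 qed
 show ?thesis unfolding circ_def using assms by (simp add: sp algebra_simps)
qed

lemma circ_split_y:
 assumes "continuous_on (cbox (Complex x0 y0) (Complex x1 y2)) G" "x0 \<le> x1" "y0 \<le> y1" "y1 \<le> y2"
 shows "circ B C G x0 x1 y0 y2 = circ B C G x0 x1 y0 y1 + circ B C G x0 x1 y1 y2"
proof -
 have sp: "contour_integral (linepath (Complex x y0) (Complex x y2)) G =
  contour_integral (linepath (Complex x y0) (Complex x y1)) G + contour_integral (linepath (Complex x y1) (Complex x y2)) G"
  if "x \<in> {x0..x1}" for x
 proof (rule contour_integral_split_linepath)
  show "continuous_on (closed_segment (Complex x y0) (Complex x y2)) G"
   using assms that by (intro continuous_on_subset[OF assms(1)] segment_in_cbox) auto
  show "Complex x y1 \<in> closed_segment (Complex x y0) (Complex x y2)"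
   using assms by (auto simp: closed_segment_same_Re closed_segment_eq_real_ivl)
 qed
 show ?thesis unfolding circ_def using assms by (simp add: sp algebra_simps)
qed

abbreviation cell_circ :: "complex => complex => (complex => complex) => real => int \<times> int => complex" where
 "cell_circ B C G N c \<equiv> circ B C G (of_int (fst c) / N) (of_int (fst c + 1) / N) (of_int (snd c) / N) (of_int (snd c + 1) / N)"

abbreviation lat_cell :: "real => int \<times> int => complex set" where
 "lat_cell N c \<equiv> cbox (Complex (of_int (fst c) / N) (of_int (snd c) / N)) (Complex (of_int (fst c + 1) / N) (of_int (snd c + 1) / N))"

lemma circ_lattice_row:
 assumes N: "N > 0" and "continuous_on (cbox (Complex (of_int i / N) y0) (Complex (of_int (i + int m) / N) y1)) G" "y0 \<le> y1"
 shows "circ B C G (of_int i / N) (of_int (i + int m) / N) y0 y1 =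
    (\<Sum>k\<in>{i..<i + int m}. circ B C G (of_int k / N) (of_int (k+1) / N) y0 y1)"
 using assms(2)
proof (induction m)
 case 0
 then show ?case by (simp add: circ_def)
next
 case (Suc m)
 have le: "of_int i / N \<le> of_int (i + int m) / N" "of_int (i + int m) / N \<le> of_int (i + int (Suc m)) / N"
  using N by (auto intro!: divide_right_mono)
 have "cbox (Complex (of_int i / N) y0) (Complex (of_int (i + int m) / N) y1) \<subseteq> cbox (Complex (of_int i / N) y0) (Complex (of_int (i + int (Suc m)) / N) y1)"
  using le(2) by (auto simp: in_cbox_Complex)
 then have IH: "circ B C G (of_int i / N) (of_int (i + int m) / N) y0 y1 =
    (\<Sum>k\<in>{i..<i + int m}. circ B C G (of_int k / N) (of_int (k+1) / N) y0 y1)"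
  using Suc continuous_on_subset by blast
 have "{i..<i + int (Suc m)} = insert (i + int m) {i..<i + int m}" by auto
 then show ?case
  by (simp only: circ_split_x[OF Suc.prems le \<open>y0 \<le> y1\<close>] IH) (simp add: algebra_simps)
qed

lemma circ_lattice_rect:
 assumes N: "N > 0" and "continuous_on (cbox (Complex (of_int i / N) (of_int j / N)) (Complex (of_int (i + int m) / N) (of_int (j + int n) / N))) G"
 shows "circ B C G (of_int i / N) (of_int (i + int m) / N) (of_int j / N) (of_int (j + int n) / N) =
    (\<Sum>c\<in>{i..<i + int m} \<times> {j..<j + int n}. cell_circ B C G N c)"
 using assms(2)
proof (induction n)
 case 0
 then show ?case by (simp add: circ_def)
next
 case (Suc n)
 have le: "of_int j / N \<le> of_int (j + int n) / N" "of_int (j + int n) / N \<le> of_int (j + int (Suc n)) / N"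
  "of_int i / N \<le> of_int (i + int m) / N"
  using N by (auto intro!: divide_right_mono)
 let ?R = "\<lambda>n. cbox (Complex (of_int i / N) (of_int j / N)) (Complex (of_int (i + int m) / N) (of_int (j + int n) / N))"
 have "?R n \<subseteq> ?R (Suc n)" using le by (auto simp: in_cbox_Complex)
 then have IH: "circ B C G (of_int i / N) (of_int (i + int m) / N) (of_int j / N) (of_int (j + int n) / N) =
    (\<Sum>c\<in>{i..<i + int m} \<times> {j..<j + int n}. cell_circ B C G N c)"
  using Suc continuous_on_subset by blast
 have sub: "cbox (Complex (of_int i / N) (of_int (j + int n) / N)) (Complex (of_int (i + int m) / N) (of_int (j + int (Suc n)) / N)) \<subseteq> ?R (Suc n)"
  using le by (auto simp: in_cbox_Complex)
 have row: "circ B C G (of_int i / N) (of_int (i + int m) / N) (of_int (j + int n) / N) (of_int (j + int (Suc n)) / N)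
  = (\<Sum>k\<in>{i..<i + int m}. circ B C G (of_int k / N) (of_int (k+1) / N) (of_int (j + int n) / N) (of_int (j + int (Suc n)) / N))"
  by (rule circ_lattice_row[OF N continuous_on_subset[OF Suc.prems sub] le(2)])
 have "{i..<i + int m} \<times> {j..<j + int (Suc n)} = {i..<i + int m} \<times> {j..<j + int n} \<union> {i..<i + int m} \<times> {j + int n}" by auto
 moreover have "{i..<i + int m} \<times> {j..<j + int n} \<inter> {i..<i + int m} \<times> {j + int n} = {}" by auto
 moreover have "(\<Sum>c\<in>{i..<i + int m} \<times> {j + int n}. cell_circ B C G N c) = circ B C G (of_int i / N) (of_int (i + int m) / N) (of_int (j + int n) / N) (of_int (j + int (Suc n)) / N)"
 proof -
  have "{i..<i + int m} \<times> {j + int n} = (\<lambda>k. (k, j + int n)) ` {i..<i + int m}" by auto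
  then show ?thesis unfolding row by (simp add: sum.reindex inj_on_def algebra_simps)
 qed
 ultimately show ?case
  by (simp only: circ_split_y[OF Suc.prems le(3,1,2)] IH) (subst sum.union_disjoint, auto)
qed

lemma contour_integral_linepath_mean:
 "contour_integral (linepath p q) f = (q - p) * integral {0..1} (\<lambda>t. f (linepath p q t))"
 by (simp add: contour_integral_integral mult.commute)

text \<open>The endpoints move with n because a given rectangle is going to be approximated by
  lattice rectangles. Hypothesis \<open>lim\<close> is continuous convergence, which makes the
  integrands converge pointwise along the moving segments; the bound 1 dominates them.\<close>

lemma contour_integral_linepath_tendsto:
 fixes Gn :: "nat => complex => complex"
 assumes V: "open V" and seg: "closed_segment p q \<subseteq> V"
  and pn: "pn \<longlonglongrightarrow> p" and qn: "qn \<longlonglongrightarrow> q"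
  and cont: "\<And>n. continuous_on V (Gn n)" and bnd: "\<And>n z. z \<in> V ==> norm (Gn n z) \<le> 1"
  and lim: "\<And>x z. z \<in> V ==> x \<longlonglongrightarrow> z ==> (\<lambda>n. Gn n (x n)) \<longlonglongrightarrow> G z"
  and segn: "\<And>n. closed_segment (pn n) (qn n) \<subseteq> V"
 shows "(\<lambda>n. contour_integral (linepath (pn n) (qn n)) (Gn n)) \<longlonglongrightarrow> contour_integral (linepath p q) G"
 unfolding contour_integral_linepath_mean
proof (intro tendsto_intros pn qn)
 have inV: "linepath (pn n) (qn n) t \<in> V" if "t \<in> {0..1}" for n t
  using linepath_in_path[OF that] segn by blast
 show "(\<lambda>n. integral {0..1} (\<lambda>t. Gn n (linepath (pn n) (qn n) t))) \<longlonglongrightarrow> integral {0..1} (\<lambda>t. G (linepath p q t))"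
 proof (rule dominated_convergence(2)[where h = "\<lambda>_. 1"])
  show "(\<lambda>t. Gn n (linepath (pn n) (qn n) t)) integrable_on {0..1}" for n
   using inV by (intro integrable_continuous_real continuous_on_compose2[OF cont] continuous_on_linepath) auto
  show "norm (Gn n (linepath (pn n) (qn n) t)) \<le> 1" if "t \<in> {0..1}" for n t
   using bnd inV that by blast
  show "(\<lambda>n. Gn n (linepath (pn n) (qn n) t)) \<longlonglongrightarrow> G (linepath p q t)" if "t \<in> {0..1}" for t
  proof (rule lim)
   show "linepath p q t \<in> V" using linepath_in_path[OF that] seg by blast
   show "(\<lambda>n. linepath (pn n) (qn n) t) \<longlonglongrightarrow> linepath p q t"
    unfolding linepath_def by (intro tendsto_intros pn qn)
  qed
 qed auto
qed

lemma floor_div_tendsto: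
 assumes N: "filterlim (N :: nat => real) at_top sequentially" "\<And>n. N n > 0"
 shows "(\<lambda>n. of_int \<lfloor>x * N n\<rfloor> / N n) \<longlonglongrightarrow> x"
proof -
 have i0: "(\<lambda>n. 1 / N n) \<longlonglongrightarrow> 0"
  using N(1) by (intro tendsto_divide_0[OF tendsto_const] filterlim_at_top_imp_at_infinity)
 have "(\<lambda>n. of_int \<lfloor>x * N n\<rfloor> / N n - x) \<longlonglongrightarrow> 0"
 proof (rule Lim_null_comparison[OF _ i0], rule always_eventually, rule allI)
  fix n
  have "\<bar>of_int \<lfloor>x * N n\<rfloor> - x * N n\<bar> \<le> 1" by linarith
  then have "\<bar>of_int \<lfloor>x * N n\<rfloor> - x * N n\<bar> / N n \<le> 1 / N n" using N(2)[of n] by (intro divide_right_mono) auto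
  moreover have "\<bar>of_int \<lfloor>x * N n\<rfloor> - x * N n\<bar> / N n = \<bar>of_int \<lfloor>x * N n\<rfloor> / N n - x\<bar>"
  proof -
   have "of_int \<lfloor>x * N n\<rfloor> / N n - x = (of_int \<lfloor>x * N n\<rfloor> - x * N n) / N n"
    using N(2)[of n] by (simp add: diff_divide_distrib)
   then show ?thesis using N(2)[of n] by (simp add: abs_divide)
  qed
  ultimately show "norm (of_int \<lfloor>x * N n\<rfloor> / N n - x) \<le> 1 / N n" by simp
 qed
 then show ?thesis by (simp add: LIM_zero_iff)
qed

text \<open>Circulation is additive, so on a lattice rectangle it is bounded by the sum over its
  cells, which \<open>cells\<close> makes small. Rounding the corners down to the lattice moves each
  coordinate by at most 1/N, and the four side integrals pass to the limit.\<close>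

lemma circ_limit_zero:
 fixes Gn :: "nat => complex => complex"
 assumes V: "open V" and cont: "\<And>n. continuous_on V (Gn n)" and bnd: "\<And>n z. z \<in> V ==> norm (Gn n z) \<le> 1"
  and lim: "\<And>x z. z \<in> V ==> x \<longlonglongrightarrow> z ==> (\<lambda>n. Gn n (x n)) \<longlonglongrightarrow> G z"
  and N: "filterlim (N :: nat => real) at_top sequentially" "\<And>n. N n > 0"
  and cells: "\<And>K e. compact K ==> K \<subseteq> V ==> e > 0 ==>
   eventually (\<lambda>n. \<forall>S. finite S --> (\<forall>c\<in>S. lat_cell (N n) c \<subseteq> K) --> (\<Sum>c\<in>S. norm (cell_circ B C (Gn n) (N n) c)) \<le> e) sequentially"
  and le: "x0 \<le> x1" "y0 \<le> y1" and box: "cbox (Complex x0 y0) (Complex x1 y1) \<subseteq> V"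
 shows "circ B C G x0 x1 y0 y1 = 0"
proof -
 let ?f = "\<lambda>x n. of_int \<lfloor>x * N n\<rfloor> / N n :: real"
 obtain e where e: "e > 0" "(\<Union>x\<in>cbox (Complex x0 y0) (Complex x1 y1). cball x e) \<subseteq> V"
  using compact_subset_open_imp_cball_epsilon_subset[OF compact_cbox V box] by auto
 \<comment> \<open>Half of e: a point of the enlarged box may be off by d in each coordinate, and
   the modulus is at most the sum of the two deviations.\<close>
 define d where "d = e / 2"
 have d0: "d > 0" using e by (simp add: d_def)
 define K where "K = cbox (Complex (x0 - d) (y0 - d)) (Complex (x1 + d) (y1 + d))"
 have KV: "K \<subseteq> V"
 proof
  fix z assume z: "z \<in> K"
  define w where "w = Complex (max x0 (min x1 (Re z))) (max y0 (min y1 (Im z)))"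
  have "w \<in> cbox (Complex x0 y0) (Complex x1 y1)" using le by (auto simp: w_def in_cbox_Complex)
  moreover have "dist w z \<le> e"
  proof -
   have "\<bar>Re (w - z)\<bar> \<le> d" "\<bar>Im (w - z)\<bar> \<le> d" using z le d0 by (auto simp: w_def K_def in_cbox_Complex max_def min_def)
   then show ?thesis using cmod_le[of "w - z"] by (simp add: dist_norm d_def)
  qed
  ultimately show "z \<in> V" using e(2) by (meson UN_I mem_cball subsetD)
 qed
 have fl: "?f x \<longlonglongrightarrow> x" for x by (rule floor_div_tendsto[OF N])
 have ev: "eventually (\<lambda>n. \<bar>?f x n - x\<bar> < d) sequentially" for x
  using fl[of x] d0 unfolding tendsto_iff dist_real_def by blast
 have "eventually (\<lambda>n. \<bar>?f x0 n - x0\<bar> < d \<and> \<bar>?f x1 n - x1\<bar> < d \<and> \<bar>?f y0 n - y0\<bar> < d \<and> \<bar>?f y1 n - y1\<bar> < d) sequentially"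
  using ev[of x0] ev[of x1] ev[of y0] ev[of y1] by eventually_elim auto
 then obtain M where M: "\<And>n. n \<ge> M ==> \<bar>?f x0 n - x0\<bar> < d \<and> \<bar>?f x1 n - x1\<bar> < d \<and> \<bar>?f y0 n - y0\<bar> < d \<and> \<bar>?f y1 n - y1\<bar> < d"
  unfolding eventually_sequentially by auto
 have fle: "?f x0 n \<le> ?f x1 n" "?f y0 n \<le> ?f y1 n" for n
  using le N(2)[of n] by (auto intro!: divide_right_mono floor_mono mult_right_mono)
 have boxK: "cbox (Complex (?f x0 n) (?f y0 n)) (Complex (?f x1 n) (?f y1 n)) \<subseteq> K" if "n \<ge> M" for n
  using M[OF that] by (auto simp: in_cbox_Complex K_def)
 \<comment> \<open>The index shift by M puts every rounded box inside K, hence inside V, from the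
   start.\<close>
 have seglim: "(\<lambda>n. contour_integral (linepath (Complex (?f a (n+M)) (?f b (n+M))) (Complex (?f c (n+M)) (?f d' (n+M)))) (Gn (n+M)))
   \<longlonglongrightarrow> contour_integral (linepath (Complex a b) (Complex c d')) G"
  if "a \<in> {x0,x1}" "c \<in> {x0,x1}" "b \<in> {y0,y1}" "d' \<in> {y0,y1}" for a b c d'
 proof (rule contour_integral_linepath_tendsto[OF V])
  have fl': "(\<lambda>n. ?f x (n+M)) \<longlonglongrightarrow> x" for x using LIMSEQ_ignore_initial_segment[OF fl] .
  show "closed_segment (Complex a b) (Complex c d') \<subseteq> V"
   using that le by (intro order_trans[OF segment_in_cbox box]) auto
  show "(\<lambda>n. Complex (?f a (n+M)) (?f b (n+M))) \<longlonglongrightarrow> Complex a b" by (intro tendsto_intros fl')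
  show "(\<lambda>n. Complex (?f c (n+M)) (?f d' (n+M))) \<longlonglongrightarrow> Complex c d'" by (intro tendsto_intros fl')
  show "continuous_on V (Gn (n+M))" for n using cont .
  show "norm (Gn (n+M) z) \<le> 1" if "z \<in> V" for n z using bnd that .
  show "(\<lambda>n. Gn (n+M) (x n)) \<longlonglongrightarrow> G z" if z: "z \<in> V" and x: "x \<longlonglongrightarrow> z" for x z
  proof -
   have "(\<lambda>n. x (n - M)) \<longlonglongrightarrow> z" using x LIMSEQ_offset[of "\<lambda>n. x (n - M)" M z] by simp
   from LIMSEQ_ignore_initial_segment[OF lim[OF z this], of M] show ?thesis by simp
  qed
  show "closed_segment (Complex (?f a (n+M)) (?f b (n+M))) (Complex (?f c (n+M)) (?f d' (n+M))) \<subseteq> V" for n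
  proof -
   have "n + M \<ge> M" by simp
   from boxK[OF this] KV show ?thesis
    using that fle[of "n+M"] by (intro order_trans[OF segment_in_cbox[OF fle]]) auto
  qed
 qed
 have "(\<lambda>n. circ B C (Gn (n+M)) (?f x0 (n+M)) (?f x1 (n+M)) (?f y0 (n+M)) (?f y1 (n+M))) \<longlonglongrightarrow> circ B C G x0 x1 y0 y1"
  unfolding circ_def
  by (rule tendsto_add[OF tendsto_mult[OF tendsto_const tendsto_diff[OF seglim[of x0 x1 y0 y0] seglim[of x0 x1 y1 y1]]]
     tendsto_mult[OF tendsto_const tendsto_diff[OF seglim[of x1 x1 y0 y1] seglim[of x0 x0 y0 y1]]]]) simp_all
 moreover have "(\<lambda>n. circ B C (Gn (n+M)) (?f x0 (n+M)) (?f x1 (n+M)) (?f y0 (n+M)) (?f y1 (n+M))) \<longlonglongrightarrow> 0"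
 proof (rule tendstoI)
  fix e :: real assume "e > 0"
  have cK: "compact K" by (simp add: K_def)
  have e2: "e/2 > 0" using \<open>e > 0\<close> by simp
  from sequentially_offset[OF cells[OF cK KV e2], of M]
  show "eventually (\<lambda>n. dist (circ B C (Gn (n+M)) (?f x0 (n+M)) (?f x1 (n+M)) (?f y0 (n+M)) (?f y1 (n+M))) 0 < e) sequentially"
  proof eventually_elim
   case (elim n)
   define n' where "n' = n + M"
   have n': "n' \<ge> M" by (simp add: n'_def)
   have Np: "N n' > 0" by (rule N)
   define i where "i = \<lfloor>x0 * N n'\<rfloor>"
   define j where "j = \<lfloor>y0 * N n'\<rfloor>"
   define m where "m = nat (\<lfloor>x1 * N n'\<rfloor> - i)"
   define k where "k = nat (\<lfloor>y1 * N n'\<rfloor> - j)"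
   have "i \<le> \<lfloor>x1 * N n'\<rfloor>" "j \<le> \<lfloor>y1 * N n'\<rfloor>"
    using le Np unfolding i_def j_def by (auto intro!: floor_mono mult_right_mono)
   then have im: "\<lfloor>x1 * N n'\<rfloor> = i + int m" "\<lfloor>y1 * N n'\<rfloor> = j + int k" by (auto simp: m_def k_def)
   have "circ B C (Gn n') (?f x0 n') (?f x1 n') (?f y0 n') (?f y1 n') = (\<Sum>c\<in>{i..<i + int m} \<times> {j..<j + int k}. cell_circ B C (Gn n') (N n') c)"
    unfolding im i_def[symmetric] j_def[symmetric]
    by (rule circ_lattice_rect[OF Np continuous_on_subset[OF cont]])
     (use boxK[OF n'] KV in \<open>simp add: im flip: i_def j_def\<close>)
   then have "norm (circ B C (Gn n') (?f x0 n') (?f x1 n') (?f y0 n') (?f y1 n')) \<le> (\<Sum>c\<in>{i..<i + int m} \<times> {j..<j + int k}. norm (cell_circ B C (Gn n') (N n') c))"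
    by (simp only: norm_sum)
   moreover have "(\<Sum>c\<in>{i..<i + int m} \<times> {j..<j + int k}. norm (cell_circ B C (Gn n') (N n') c)) \<le> e/2"
   proof -
    have "lat_cell (N n') c \<subseteq> K" if "c \<in> {i..<i + int m} \<times> {j..<j + int k}" for c
    proof -
     have "i \<le> fst c" "fst c + 1 \<le> i + int m" "j \<le> snd c" "snd c + 1 \<le> j + int k" using that by auto
     then have "lat_cell (N n') c \<subseteq> cbox (Complex (?f x0 n') (?f y0 n')) (Complex (?f x1 n') (?f y1 n'))"
      unfolding im i_def[symmetric] j_def[symmetric] subset_box_complex using Np
      by (auto intro!: divide_right_mono simp del: of_int_add)
     then show ?thesis using boxK[OF n'] by blast
    qed
    then show ?thesis using elim[rule_format, of "{i..<i + int m} \<times> {j..<j + int k}"] unfolding n'_def by simp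
   qed
   ultimately have "norm (circ B C (Gn n') (?f x0 n') (?f x1 n') (?f y0 n') (?f y1 n')) \<le> e/2"
    by (rule order_trans)
   then show ?case using \<open>e > 0\<close> unfolding n'_def norm_conv_dist[symmetric] by linarith
  qed
 qed
 ultimately show ?thesis using LIMSEQ_unique by blast
qed

lemma contour_integral_horizontal_segment:
 assumes "a < b"
 shows "contour_integral (linepath (Complex a y) (Complex b y)) f = integral {a..b} (\<lambda>x. f (Complex x y))"
proof -
 have ri: "of_real x + \<i> * of_real y = Complex x y" for x y by (simp add: complex_eq_iff)
 have "contour_integral (linepath (Complex a y) (Complex b y)) f =
    contour_integral (linepath (of_real a) (of_real b)) (\<lambda>z. f (z + \<i> * of_real y))"
  unfolding contour_integral_linepath_mean
  by (simp add: linepath_def ri[symmetric] scaleR_conv_of_real algebra_simps)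
 also have "\<dots> = integral {a..b} (\<lambda>x. f (of_real x + \<i> * of_real y))"
  by (subst contour_integral_linepath_Reals_eq) (use assms in auto)
 finally show ?thesis by (simp add: ri)
qed

text \<open>Morera's theorem for parallelograms. A primitive of \<open>G du\<close>, with
  \<open>u = x B + y C\<close>, is built in the coordinates x, y; its partial derivatives are
  \<open>B * G\<close> and \<open>C * G\<close>, so its differential at u sends
  \<open>p B + q C\<close> to G times that vector and is complex linear. Thus
  \<open>G \<circ> P\<close> is the derivative of a holomorphic function.\<close>

lemma holomorphic_if_circ_zero:
 fixes G :: "complex => complex" and P :: "complex => complex"
 assumes V: "open V" and cont: "continuous_on V G"
  and circ0: "\<And>x0 x1 y0 y1. x0 \<le> x1 ==> y0 \<le> y1 ==> cbox (Complex x0 y0) (Complex x1 y1) \<subseteq> V ==> circ B C G x0 x1 y0 y1 = 0"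
  and P: "linear P" "\<And>u. Re (P u) *\<^sub>R B + Im (P u) *\<^sub>R C = u"
 shows "(G \<circ> P) holomorphic_on (P -` V)"
proof -
 have blP: "bounded_linear P" using P(1) by (simp add: linear_conv_bounded_linear)
 have contP: "continuous_on UNIV P" using blP linear_continuous_on by blast
 have oPV: "open (P -` V)" using V contP by (simp add: continuous_on_open_vimage)
 have hl: "\<exists>S. open S \<and> u0 \<in> S \<and> (G \<circ> P) holomorphic_on S" if "u0 \<in> P -` V" for u0
 proof -
  define z0 where "z0 = P u0"
  have "z0 \<in> V" using that by (simp add: z0_def)
  then obtain a b where ab: "cbox a b \<subseteq> V" "z0 \<in> box a b"
   using open_contains_cbox[OF V] by metis
  define a1 where "a1 = Re a" define a2 where "a2 = Im a" define b1 where "b1 = Re b" define b2 where "b2 = Im b"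
  have box: "cbox (Complex a1 a2) (Complex b1 b2) \<subseteq> V" using ab(1) by (simp add: a1_def a2_def b1_def b2_def)
  have in_box: "z \<in> box a b \<longleftrightarrow> a1 < Re z \<and> Re z < b1 \<and> a2 < Im z \<and> Im z < b2" for z
   by (auto simp: in_box_complex_iff a1_def a2_def b1_def b2_def)
  define X where "X = {a1..b1}" define Y where "Y = {a2..b2}"
  have XY: "Complex x y \<in> V" if "x \<in> X" "y \<in> Y" for x y
   using box that by (auto simp: in_cbox_Complex X_def Y_def)
  have contG2: "continuous_on (X \<times> Y) (\<lambda>(x, y). G (Complex x y))"
   unfolding case_prod_beta
   by (rule continuous_on_compose2[OF cont]) (use XY in \<open>auto intro!: continuous_intros\<close>)
  have contx: "continuous_on X (\<lambda>x. G (Complex x y))" if "y \<in> Y" for y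
   by (rule continuous_on_compose2[OF cont]) (use XY that in \<open>auto intro!: continuous_intros\<close>)
  have conty: "continuous_on Y (\<lambda>y. G (Complex x y))" if "x \<in> X" for x
   by (rule continuous_on_compose2[OF cont]) (use XY that in \<open>auto intro!: continuous_intros\<close>)
  have horiz: "contour_integral (linepath (Complex a1 y) (Complex x y)) G = integral {a1..x} (\<lambda>t. G (Complex t y))"
   if "x \<in> X" for x y
   using that contour_integral_horizontal_segment[of a1 x y G]
   by (cases "a1 = x") (auto simp: X_def)
  have vert: "contour_integral (linepath (Complex x a2) (Complex x y)) G = \<i> * integral {a2..y} (\<lambda>t. G (Complex x t))"
   if "y \<in> Y" for x y
   using that contour_integral_linepath_same_Re[of "Complex x a2" x "Complex x y" a2 y G]
   by (cases "a2 = y") (auto simp: Y_def)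
  \<comment> \<open>The route along the bottom and then upwards shows the derivative in y. Vanishing
    circulation allows the route upwards first (\<open>W2\<close>), which shows the derivative in
    x.\<close>
  define W where "W x y = B * integral {a1..x} (\<lambda>t. G (Complex t a2)) + C * integral {a2..y} (\<lambda>t. G (Complex x t))" for x y
  have W2: "W x y = C * integral {a2..y} (\<lambda>t. G (Complex a1 t)) + B * integral {a1..x} (\<lambda>t. G (Complex t y))"
   if x: "x \<in> X" and y: "y \<in> Y" for x y
  proof -
   have "circ B C G a1 x a2 y = 0"
    by (rule circ0) (use x y box in \<open>auto simp: X_def Y_def in_cbox_Complex\<close>)
   then show ?thesis unfolding circ_def W_def horiz[OF x] vert[OF y] by (simp add: algebra_simps)
  qed
  have dx: "((\<lambda>x. W x y) has_derivative (\<lambda>p. p *\<^sub>R (B * G (Complex x y)))) (at x within X)"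
   if x: "x \<in> X" and y: "y \<in> Y" for x y
  proof -
   have "((\<lambda>x. integral {a1..x} (\<lambda>t. G (Complex t y))) has_vector_derivative G (Complex x y)) (at x within {a1..b1})"
    by (rule integral_has_vector_derivative) (use contx[OF y] x in \<open>auto simp: X_def\<close>)
   then have "((\<lambda>x. C * integral {a2..y} (\<lambda>t. G (Complex a1 t)) + B * integral {a1..x} (\<lambda>t. G (Complex t y))) has_vector_derivative 0 + B * G (Complex x y)) (at x within X)"
    unfolding X_def by (intro derivative_intros)
   then have *: "((\<lambda>x. C * integral {a2..y} (\<lambda>t. G (Complex a1 t)) + B * integral {a1..x} (\<lambda>t. G (Complex t y))) has_vector_derivative B * G (Complex x y)) (at x within X)"
    by simp
   have "((\<lambda>x. W x y) has_vector_derivative B * G (Complex x y)) (at x within X)"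
    by (rule has_vector_derivative_transform[OF x _ *]) (use W2[OF _ y] in simp)
   then show ?thesis by (simp add: has_vector_derivative_def)
  qed
  have dy: "((\<lambda>y. W x y) has_derivative blinfun_apply (blinfun_scaleR_left (C * G (Complex x y)))) (at y within Y)"
   if x: "x \<in> X" and y: "y \<in> Y" for x y
  proof -
   have "((\<lambda>y. integral {a2..y} (\<lambda>t. G (Complex x t))) has_vector_derivative G (Complex x y)) (at y within {a2..b2})"
    by (rule integral_has_vector_derivative) (use conty[OF x] y in \<open>auto simp: Y_def\<close>)
   then have "((\<lambda>y. B * integral {a1..x} (\<lambda>t. G (Complex t a2)) + C * integral {a2..y} (\<lambda>t. G (Complex x t))) has_vector_derivative 0 + C * G (Complex x y)) (at y within Y)"
    unfolding Y_def by (intro derivative_intros)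
   then show ?thesis unfolding W_def by (simp add: has_vector_derivative_def)
  qed
  have contfy: "continuous_on (X \<times> Y) (\<lambda>(x, y). blinfun_scaleR_left (C * G (Complex x y)))"
   using contG2 unfolding case_prod_beta
   by (intro bounded_linear.continuous_on[OF bounded_linear_blinfun_scaleR_left] continuous_intros)
  have dW: "((\<lambda>(x,y). W x y) has_derivative (\<lambda>(p,q). p *\<^sub>R (B * G (Complex x y)) + blinfun_apply (blinfun_scaleR_left (C * G (Complex x y))) q)) (at (x,y) within X \<times> Y)"
   if x: "x \<in> X" and y: "y \<in> Y" for x y
  proof (rule has_derivative_partialsI[where fx = "\<lambda>p. p *\<^sub>R (B * G (Complex x y))" and fy = "\<lambda>x y. blinfun_scaleR_left (C * G (Complex x y))"])
   show "((\<lambda>x. W x y) has_derivative (\<lambda>p. p *\<^sub>R (B * G (Complex x y)))) (at x within X)"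
    by (rule dx[OF x y])
   show "((\<lambda>y. W x y) has_derivative blinfun_apply (blinfun_scaleR_left (C * G (Complex x y)))) (at y within Y)"
    if "x \<in> X" "y \<in> Y" for x y by (rule dy[OF that])
   show "continuous (at (x, y) within X \<times> Y) (\<lambda>(x, y). blinfun_scaleR_left (C * G (Complex x y)))"
    by (rule contfy[unfolded continuous_on_eq_continuous_within, THEN bspec, OF SigmaI[OF x y]])
   show "y \<in> Y" by fact
   show "convex Y" by (simp add: Y_def)
  qed
  define S where "S = P -` box a b"
  have oS: "open S" unfolding S_def using contP by (simp add: continuous_on_open_vimage open_box)
  define Wc where "Wc u = W (Re (P u)) (Im (P u))" for u
  have der: "(Wc has_field_derivative G (P u)) (at u)" if u: "u \<in> S" for u
  proof -
   define x where "x = Re (P u)" define y where "y = Im (P u)"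
   have bx: "a1 < x" "x < b1" "a2 < y" "y < b2" using u in_box by (auto simp: S_def x_def y_def)
   then have xy: "x \<in> X" "y \<in> Y" by (auto simp: X_def Y_def)
   have "(x, y) \<in> interior (X \<times> Y)" using bx by (simp add: interior_Times X_def Y_def)
   then have awi: "at (x, y) within X \<times> Y = at (x, y)" by (rule at_within_interior)
   have d: "((\<lambda>(x,y). W x y) has_derivative (\<lambda>(p,q). p *\<^sub>R (B * G (Complex x y)) + q *\<^sub>R (C * G (Complex x y)))) (at (x,y))"
    using dW[OF xy] unfolding awi by (simp only: blinfun_scaleR_left.rep_eq)
   have dP: "((\<lambda>u. (Re (P u), Im (P u))) has_derivative (\<lambda>h. (Re (P h), Im (P h)))) (at u)"
    by (intro has_derivative_Pair has_derivative_Re has_derivative_Im bounded_linear_imp_has_derivative blP)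
   have "((\<lambda>u. (\<lambda>(x,y). W x y) (Re (P u), Im (P u))) has_derivative (\<lambda>h. (\<lambda>(p,q). p *\<^sub>R (B * G (Complex x y)) + q *\<^sub>R (C * G (Complex x y))) (Re (P h), Im (P h)))) (at u)"
    by (rule has_derivative_compose[OF dP]) (use d in \<open>simp add: x_def y_def\<close>)
   moreover have "(\<lambda>(p,q). p *\<^sub>R (B * G (Complex x y)) + q *\<^sub>R (C * G (Complex x y))) (Re (P h), Im (P h)) = G (P u) * h" for h
   proof -
    have "Complex x y = P u" by (simp add: x_def y_def)
    then have "(\<lambda>(p,q). p *\<^sub>R (B * G (Complex x y)) + q *\<^sub>R (C * G (Complex x y))) (Re (P h), Im (P h))
      = Re (P h) *\<^sub>R (B * G (P u)) + Im (P h) *\<^sub>R (C * G (P u))" by (simp only: case_prod_conv)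
    also have "\<dots> = (Re (P h) *\<^sub>R B + Im (P h) *\<^sub>R C) * G (P u)"
     by (simp only: distrib_right mult_scaleR_left)
    also have "\<dots> = G (P u) * h" by (simp only: P(2) mult.commute)
    finally show ?thesis .
   qed
   ultimately show ?thesis unfolding has_field_derivative_def Wc_def by (simp only: case_prod_conv)
  qed
  have "Wc holomorphic_on S"
   using der oS by (auto simp: holomorphic_on_open)
  then have "deriv Wc holomorphic_on S" using oS by (rule holomorphic_deriv)
  moreover have "deriv Wc u = (G \<circ> P) u" if "u \<in> S" for u using DERIV_imp_deriv[OF der[OF that]] by simp
  ultimately have "(G \<circ> P) holomorphic_on S" by (rule holomorphic_transform)
  moreover have "u0 \<in> S" using ab(2) by (simp add: S_def z0_def)
  ultimately show ?thesis using oS by blast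
 qed
 show ?thesis
 proof (rule holomorphic_on_open[OF oPV, THEN iffD2], intro ballI)
  fix u assume "u \<in> P -` V"
  from hl[OF this] obtain S where "open S" "u \<in> S" "(G \<circ> P) holomorphic_on S" by blast
  then show "\<exists>f'. ((G \<circ> P) has_field_derivative f') (at u)" by (auto simp: holomorphic_on_open)
 qed
qed

section \<open>The length-area method on a lattice\<close>

text \<open>A cell is named by its lower left corner, so (i, j) covers [i, i+1] x [j, j+1], and
  \<open>- i\<close> and \<open>i + 1\<close> are its extents to the left and right of the origin.
  The set is the layer of cells along the inside of the boundary of the square [-k, k]^2.\<close>

definition ring :: "nat => (int \<times> int) set" where
 "ring k = {c. Max {- fst c, fst c + 1, - snd c, snd c + 1} = int k}"

lemma ring_iff: "(i, j) \<in> ring k \<longleftrightarrow>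
 - i \<le> int k \<and> i + 1 \<le> int k \<and> - j \<le> int k \<and> j + 1 \<le> int k \<and>
 (- i = int k \<or> i + 1 = int k \<or> - j = int k \<or> j + 1 = int k)"
 unfolding ring_def by (auto simp: max_def)

lemma ring_subset: "ring k \<subseteq> {- int k..int k - 1} \<times> {- int k, int k - 1} \<union> {- int k, int k - 1} \<times> {- int k..int k - 1}"
 by (auto simp: ring_iff)

lemma finite_ring [simp]: "finite (ring k)"
 by (rule finite_subset[OF ring_subset]) auto

lemma card_ring: "card (ring k) \<le> 8 * k"
proof -
 have c2: "card {- int k, int k - 1} \<le> 2" by (simp add: card_insert_if)
 have "card (ring k) \<le> card ({- int k..int k - 1} \<times> {- int k, int k - 1} \<union> {- int k, int k - 1} \<times> {- int k..int k - 1})"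
  by (intro card_mono ring_subset) auto
 also have "\<dots> \<le> card ({- int k..int k - 1} \<times> {- int k, int k - 1}) + card ({- int k, int k - 1} \<times> {- int k..int k - 1})"
  by (rule card_Un_le)
 also have "\<dots> = 2 * (2 * k * card {- int k, int k - 1})"
  by (simp add: card_cartesian_product nat_mult_distrib)
 also have "\<dots> \<le> 2 * (2 * k * 2)" using c2 by (intro mult_left_mono) auto
 finally show ?thesis by simp
qed

lemma disjoint_rings: "k \<noteq> l ==> ring k \<inter> ring l = {}"
 unfolding ring_def by auto

text \<open>The length-area argument: by Cauchy-Schwarz the squared length of the \<open>k\<close>-th ring is at most
 \<open>8 k\<close> times its area, and the harmonic series diverges.\<close>
lemma exists_short_ring:
 fixes r :: "int \<times> int => real"
 assumes A: "\<And>S. finite S ==> (\<forall>c\<in>S. \<exists>k\<in>{m<..M}. c \<in> ring k) ==> (\<Sum>c\<in>S. (r c)\<^sup>2) \<le> A"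
  and s: "s > 0" and big: "8 * A < s\<^sup>2 * (\<Sum>k\<in>{m<..M}. 1 / real k)"
 obtains k where "k \<in> {m<..M}" "(\<Sum>c\<in>ring k. r c) < s"
proof -
 have "\<exists>k\<in>{m<..M}. (\<Sum>c\<in>ring k. r c) < s"
 proof (rule ccontr)
  assume "\<not> ?thesis"
  then have ge: "(\<Sum>c\<in>ring k. r c) \<ge> s" if "k \<in> {m<..M}" for k using that by force
  have "s\<^sup>2 * (1 / real k) \<le> 8 * (\<Sum>c\<in>ring k. (r c)\<^sup>2)" if k: "k \<in> {m<..M}" for k
  proof -
   have "k > 0" using k by auto
   have "s\<^sup>2 \<le> (\<Sum>c\<in>ring k. r c)\<^sup>2" using ge[OF k] s by (intro power_mono) auto
   also have "\<dots> = (\<Sum>c\<in>ring k. 1 * r c)\<^sup>2" by simp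
   also have "\<dots> \<le> (\<Sum>c\<in>ring k. 1\<^sup>2) * (\<Sum>c\<in>ring k. (r c)\<^sup>2)" by (rule Cauchy_Schwarz_ineq_sum)
   also have "\<dots> \<le> (8 * real k) * (\<Sum>c\<in>ring k. (r c)\<^sup>2)"
    using card_ring[of k] by (intro mult_right_mono sum_nonneg) (auto simp flip: of_nat_mult)
   finally show ?thesis using \<open>k > 0\<close> by (simp add: field_simps)
  qed
  then have "s\<^sup>2 * (\<Sum>k\<in>{m<..M}. 1 / real k) \<le> (\<Sum>k\<in>{m<..M}. 8 * (\<Sum>c\<in>ring k. (r c)\<^sup>2))"
   unfolding sum_distrib_left by (intro sum_mono)
  also have "\<dots> = 8 * (\<Sum>c\<in>(\<Union>k\<in>{m<..M}. ring k). (r c)\<^sup>2)"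
   by (subst sum.UNION_disjoint) (auto simp: sum_distrib_left dest: disjoint_rings)
  also have "\<dots> \<le> 8 * A" by (intro mult_left_mono A) auto
  finally show False using big by simp
 qed
 then show ?thesis using that by blast
qed

text \<open>Between the radii \<open>\<delta> * N\<close> and \<open>d * N\<close> the harmonic sum
  is about \<open>ln (d / \<delta>)\<close>, whatever N is, so an exponentially small \<delta> makes
  it exceed B. The margins 1 leave room for rounding the centre of the rings to a lattice
  point.\<close>

lemma exists_harmonic_gt:
 fixes B :: real and d :: real
 assumes "d > 0"
 obtains \<delta> N0 where "\<delta> > 0" "\<delta> < d"
  "\<And>N::nat. N \<ge> N0 ==> \<exists>m M. \<delta> * real N + 1 \<le> real m \<and> real M \<le> d * real N - 1 \<and> B < (\<Sum>k\<in>{m<..M}. 1 / real k)"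
proof -
 define b where "b = max B 0"
 have b: "b \<ge> 0" "B \<le> b" by (auto simp: b_def)
 \<comment> \<open>The extra \<open>exp (-3)\<close> and the factor 1/4 beyond
   \<open>exp (- b)\<close> absorb the rounding of both radii to integers.\<close>
 define \<delta> where "\<delta> = min (d / 2) (d * exp (- b - 3)) / 4"
 have \<delta>: "\<delta> > 0" "\<delta> < d" using assms by (auto simp: \<delta>_def min_def)
 have \<delta>2: "4 * \<delta> \<le> d * exp (- b - 3)" by (simp add: \<delta>_def)
 obtain N0 :: nat where N0: "real N0 > 4 / \<delta>" using reals_Archimedean2 by blast
 have "\<exists>m M. \<delta> * real N + 1 \<le> real m \<and> real M \<le> d * real N - 1 \<and> B < (\<Sum>k\<in>{m<..M}. 1 / real k)" if "N \<ge> N0" for N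
 proof -
  have N: "\<delta> * real N > 4" using N0 that \<delta>
   by (smt (verit) of_nat_mono pos_divide_less_eq mult.commute)
  define m where "m = nat \<lceil>\<delta> * real N + 1\<rceil>"
  define M where "M = nat \<lfloor>d * real N - 1\<rfloor>"
  have dN: "d * real N \<ge> \<delta> * real N" using \<delta> by (intro mult_right_mono) auto
  have "real m = of_int \<lceil>\<delta> * real N + 1\<rceil>" using N unfolding m_def by (subst of_nat_nat) auto
  then have m: "real m \<ge> \<delta> * real N + 1" "real m \<le> \<delta> * real N + 2" by linarith+
  have M: "real M \<le> d * real N - 1" "real M + 1 \<ge> d * real N - 1" using N dN by (auto simp: M_def; linarith)+
  have ineq: "ln (real (Suc k)) - ln (real k) \<le> 1 / real k" if "k > 0" for k
  proof -
   have "ln (real (Suc k)) - ln (real k) = ln (1 + 1 / real k)"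
    using that ln_div[of "real (Suc k)" "real k"] by (simp add: add_divide_distrib add.commute)
   also have "\<dots> \<le> 1 / real k" using that by (intro ln_add_one_self_le_self) auto
   finally show ?thesis .
  qed
  have harm: "ln (real (Suc M)) - ln (real (Suc m)) \<le> (\<Sum>k\<in>{m<..M}. 1 / real k)" if "m \<le> M" for m M
   using that
  proof (induction M rule: dec_induct)
   case (step M)
   have "{m<..Suc M} = insert (Suc M) {m<..M}" using step by auto
   then show ?case using step ineq[of "Suc M"] by simp
  qed auto
  have dd: "2 * \<delta> * exp (b + 2) * 2 \<le> d * exp (-1)"
   using mult_right_mono[OF \<delta>2, of "exp (b + 2)"] by (simp add: mult.assoc exp_add[symmetric] algebra_simps flip: exp_add)
  have e1: "exp (-1::real) \<le> 1/2" using exp_ge_add_one_self[of 1] by (simp add: exp_minus field_simps)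
  have sm: "real (Suc m) \<le> 2 * \<delta> * real N" using m N by simp
  have "real (Suc m) * exp (b + 1) < real (Suc M)"
  proof -
   have "real (Suc m) * exp (b + 1) \<le> real (Suc m) * exp (b + 2)" by (intro mult_left_mono) auto
   also have "\<dots> \<le> (2 * \<delta> * real N) * exp (b + 2)" using sm by (intro mult_right_mono) auto
   also have "\<dots> \<le> d * (exp (-1) / 2) * real N" using mult_right_mono[OF dd, of "real N"] by (simp add: algebra_simps)
   also have "\<dots> \<le> d * (1/4) * real N" using e1 assms by (intro mult_right_mono mult_left_mono) auto
   also have "\<dots> < d * real N - 1" using N dN by simp
   finally show ?thesis using M by simp
  qed
  moreover have "real (Suc m) * exp (b + 1) > 0" by (intro mult_pos_pos) auto
  ultimately have "ln (real (Suc m) * exp (b + 1)) < ln (real (Suc M))"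
   by (subst ln_less_cancel_iff) auto
  then have lt: "ln (real (Suc m)) + (b + 1) < ln (real (Suc M))"
   by (subst (asm) ln_mult) auto
  have "m \<le> M"
  proof (rule ccontr)
   assume "\<not> m \<le> M"
   then have "ln (real (Suc M)) \<le> ln (real (Suc m))" by (intro ln_mono) auto
   then show False using lt b(1) by linarith
  qed
  have "B < (\<Sum>k\<in>{m<..M}. 1 / real k)" using harm[OF \<open>m \<le> M\<close>] lt b by simp
  then show ?thesis using m M by blast
 qed
 then show ?thesis using that \<delta> by blast
qed

section \<open>Images of lattice rings\<close>

definition pt :: "real => int => int => complex" where
 "pt N i j = Complex (of_int i / N) (of_int j / N)"

abbreviation lcell :: "real => int => int => complex set" where
 "lcell N i j \<equiv> cbox (pt N i j) (pt N (i+1) (j+1))"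

text \<open>Weaker than being affine on the segment, but enough: a ball containing both image
  endpoints contains the image of the whole segment (\<open>seg_ok_cball\<close>).\<close>

definition seg_ok :: "(complex => complex) => real => complex => complex => bool" where
 "seg_ok G s a b \<longleftrightarrow> norm (G a - G b) \<le> s \<and> G ` closed_segment a b \<subseteq> closed_segment (G a) (G b)"

fun cell_ok :: "(complex => complex) => real => (int \<times> int => real) => int \<times> int => bool" where
 "cell_ok G N r (i, j) \<longleftrightarrow>
  seg_ok G (r (i, j)) (pt N i j) (pt N (i+1) j) \<and> seg_ok G (r (i, j)) (pt N i (j+1)) (pt N (i+1) (j+1)) \<and>
  seg_ok G (r (i, j)) (pt N i j) (pt N i (j+1)) \<and> seg_ok G (r (i, j)) (pt N (i+1) j) (pt N (i+1) (j+1))"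

text \<open>Injectivity of g charges every cell for at most one step of the chain, so any two points
  of the chain are closer than the sum of all weights.\<close>

lemma chain_bound:
 fixes f :: "nat => complex" and r :: "'c => real"
 assumes step: "\<And>l. l < n ==> norm (f (Suc l) - f l) \<le> r (g l)"
  and g: "inj_on g {..<n}" "g ` {..<n} \<subseteq> R" and R: "finite R" "\<And>c. c \<in> R ==> r c \<ge> 0"
  and mm: "m \<le> n" "m' \<le> n"
 shows "norm (f m - f m') \<le> (\<Sum>c\<in>R. r c)"
proof -
 have main: "norm (f b - f a) \<le> (\<Sum>c\<in>R. r c)" if "a \<le> b" "b \<le> n" for a b
 proof -
  have "f b - f a = (\<Sum>l\<in>{a..<b}. f (Suc l) - f l)" using \<open>a \<le> b\<close> by (simp add: sum_Suc_diff')
  then have "norm (f b - f a) \<le> (\<Sum>l\<in>{a..<b}. norm (f (Suc l) - f l))" by (simp only: norm_sum)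
  also have "\<dots> \<le> (\<Sum>l\<in>{a..<b}. r (g l))" using step that by (intro sum_mono) auto
  also have "\<dots> = (\<Sum>c\<in>g ` {a..<b}. r c)"
   using that by (subst sum.reindex) (auto intro: inj_on_subset[OF g(1)])
  also have "\<dots> \<le> (\<Sum>c\<in>R. r c)" using R g(2) that by (intro sum_mono2) auto
  finally show ?thesis .
 qed
 show ?thesis
  using main[of m m'] main[of m' m] mm by (cases "m \<le> m'") (auto simp: norm_minus_commute)
qed

lemma between_lattice:
 assumes N: "(N::real) > 0" and x: "of_int i / N \<le> x" "x \<le> of_int (i + int n) / N" and n: "n > 0"
 obtains l where "l < n" "of_int (i + int l) / N \<le> x" "x \<le> of_int (i + int (Suc l)) / N"
proof -
 define m where "m = nat (\<lfloor>x * N\<rfloor> - i)"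
 have xi: "of_int i \<le> x * N" "x * N \<le> of_int (i + int n)" using x N by (auto simp: field_simps)
 then have "i \<le> \<lfloor>x * N\<rfloor>" by (simp add: le_floor_iff)
 then have fl: "\<lfloor>x * N\<rfloor> = i + int m" by (simp add: m_def)
 show ?thesis
 proof (cases "m < n")
  case True
  have "of_int (i + int m) \<le> x * N" "x * N \<le> of_int (i + int (Suc m))" using fl by linarith+
  then show ?thesis using that[OF True] N by (simp add: field_simps)
 next
  case False
  then have "x * N \<ge> of_int (i + int n)" using fl by linarith
  then have "x * N = of_int (i + int n)" using xi by simp
  then have xe: "x = of_int (i + int n) / N" using N by (simp add: field_simps)
  show ?thesis
   by (rule that[of "n - 1"]) (use n N in \<open>auto simp: xe of_nat_diff intro!: divide_right_mono\<close>)
 qed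
qed

lemma seg_ok_cball:
 assumes "seg_ok G s a b" "norm (G a - c) \<le> B" "norm (G b - c) \<le> B" "z \<in> closed_segment a b"
 shows "norm (G z - c) \<le> B"
proof -
 have "closed_segment (G a) (G b) \<subseteq> cball c B"
  using assms(2,3) by (intro closed_segment_subset) (auto simp: dist_norm norm_minus_commute)
 then show ?thesis using assms(1,4) unfolding seg_ok_def by (force simp: dist_norm norm_minus_commute)
qed

lemma on_horizontal_segment: "a \<le> x ==> x \<le> b ==> Complex x y \<in> closed_segment (Complex a y) (Complex b y)"
 by (simp add: closed_segment_same_Im closed_segment_eq_real_ivl)

lemma on_vertical_segment: "a \<le> y ==> y \<le> b ==> Complex x y \<in> closed_segment (Complex x a) (Complex x b)"
 by (simp add: closed_segment_same_Re closed_segment_eq_real_ivl)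

text \<open>The left, top and right sides of the half ring are chains of edges of ring cells, each
  with image length at most S, and consecutive sides share a corner. They are estimated separately
  because a corner cell serves two sides. The bottom stays open: with its mirror image the bound
  covers a full ring, and by itself it serves for half boxes at the boundary.\<close>

lemma upper_ring_bound:
 fixes G :: "complex => complex"
 assumes N: "N > 0" and k: "k > 0" and r: "\<And>c. r c \<ge> 0"
  and ok: "\<And>i j. (i, j) \<in> ring k ==> j \<ge> 0 ==> cell_ok G N r (i0 + i, j0 + j)"
  and S: "S = (\<Sum>(i,j)\<in>ring k. r (i0 + i, j0 + j))"
  and z: "of_int (i0 - int k) / N \<le> Re z" "Re z \<le> of_int (i0 + int k) / N"
     "of_int j0 / N \<le> Im z" "Im z \<le> of_int (j0 + int k) / N"
  and bd: "Re z = of_int (i0 - int k) / N \<or> Re z = of_int (i0 + int k) / N \<or> Im z = of_int (j0 + int k) / N"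
 shows "norm (G z - G (pt N (i0 - int k) j0)) \<le> 3 * S"
proof -
 define r' where "r' = (\<lambda>(i,j). r (i0 + i, j0 + j))"
 have S': "S = (\<Sum>c\<in>ring k. r' c)" unfolding S r'_def by simp
 have r0: "r' c \<ge> 0" for c using r by (cases c) (auto simp: r'_def)
 have S0: "S \<ge> 0" unfolding S' using r0 by (intro sum_nonneg) auto
 define fl where "fl l = G (pt N (i0 - int k) (j0 + int l))" for l
 define ft where "ft l = G (pt N (i0 - int k + int l) (j0 + int k))" for l
 define fr where "fr l = G (pt N (i0 + int k) (j0 + int l))" for l
 have okl: "seg_ok G (r' (- int k, int l)) (pt N (i0 - int k) (j0 + int l)) (pt N (i0 - int k) (j0 + int (Suc l)))" if "l < k" for l
 proof -
  have "(- int k, int l) \<in> ring k" using that by (auto simp: ring_iff)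
  from ok[OF this] show ?thesis by (simp add: r'_def algebra_simps)
 qed
 have okr: "seg_ok G (r' (int k - 1, int l)) (pt N (i0 + int k) (j0 + int l)) (pt N (i0 + int k) (j0 + int (Suc l)))" if "l < k" for l
 proof -
  have "(int k - 1, int l) \<in> ring k" using that by (auto simp: ring_iff)
  from ok[OF this] show ?thesis by (simp add: r'_def algebra_simps)
 qed
 have okt: "seg_ok G (r' (- int k + int l, int k - 1)) (pt N (i0 - int k + int l) (j0 + int k)) (pt N (i0 - int k + int (Suc l)) (j0 + int k))" if "l < 2 * k" for l
 proof -
  have "(- int k + int l, int k - 1) \<in> ring k" using that k by (auto simp: ring_iff)
  from ok[OF this] k show ?thesis by (simp add: r'_def algebra_simps)
 qed
 have bl: "norm (fl m - fl m') \<le> S" if "m \<le> k" "m' \<le> k" for m m'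
  unfolding S'
 proof (rule chain_bound[where n = k and g = "\<lambda>l. (- int k, int l)"])
  show "norm (fl (Suc l) - fl l) \<le> r' (- int k, int l)" if "l < k" for l
   using okl[OF that] by (simp add: seg_ok_def fl_def norm_minus_commute)
 qed (use that r0 in \<open>auto simp: inj_on_def ring_iff\<close>)
 have br: "norm (fr m - fr m') \<le> S" if "m \<le> k" "m' \<le> k" for m m'
  unfolding S'
 proof (rule chain_bound[where n = k and g = "\<lambda>l. (int k - 1, int l)"])
  show "norm (fr (Suc l) - fr l) \<le> r' (int k - 1, int l)" if "l < k" for l
   using okr[OF that] by (simp add: seg_ok_def fr_def norm_minus_commute)
 qed (use that r0 in \<open>auto simp: inj_on_def ring_iff\<close>)
 have bt: "norm (ft m - ft m') \<le> S" if "m \<le> 2 * k" "m' \<le> 2 * k" for m m'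
  unfolding S'
 proof (rule chain_bound[where n = "2 * k" and g = "\<lambda>l. (- int k + int l, int k - 1)"])
  show "norm (ft (Suc l) - ft l) \<le> r' (- int k + int l, int k - 1)" if "l < 2 * k" for l
   using okt[OF that] by (simp add: seg_ok_def ft_def norm_minus_commute)
 qed (use that r0 k in \<open>auto simp: inj_on_def ring_iff\<close>)
 have e1: "fl k = ft 0" by (simp add: fl_def ft_def)
 have e2: "ft (2 * k) = fr k" by (simp add: fr_def ft_def add.commute)
 have e0: "G (pt N (i0 - int k) j0) = fl 0" by (simp add: fl_def)
 have L: "norm (fl m - fl 0) \<le> 3 * S" if "m \<le> k" for m using bl[of m 0] that S0 by simp
 have T2: "norm (ft m - fl 0) \<le> 2 * S" if "m \<le> 2 * k" for m
  using bt[OF that, of 0] bl[of k 0] e1 norm_triangle_ineq[of "ft m - ft 0" "fl k - fl 0"] by simp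
 then have T: "norm (ft m - fl 0) \<le> 3 * S" if "m \<le> 2 * k" for m using that S0 by force
 have R: "norm (fr m - fl 0) \<le> 3 * S" if "m \<le> k" for m
  using br[OF that, of k] T2[of "2 * k"] e2 norm_triangle_ineq[of "fr m - fr k" "ft (2 * k) - fl 0"] by simp
 from bd show ?thesis
 proof (elim disjE)
  assume a: "Re z = of_int (i0 - int k) / N"
  obtain l where l: "l < k" "of_int (j0 + int l) / N \<le> Im z" "Im z \<le> of_int (j0 + int (Suc l)) / N"
   using between_lattice[OF N z(3,4) k] by blast
  have "z \<in> closed_segment (pt N (i0 - int k) (j0 + int l)) (pt N (i0 - int k) (j0 + int (Suc l)))"
   using on_vertical_segment[OF l(2,3), of "Re z"] unfolding pt_def a[symmetric] by simp
  then show ?thesis unfolding e0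
   using seg_ok_cball[OF okl[OF l(1)] _ _, of "fl 0" "3 * S" z] L[of l] L[of "Suc l"] l(1) by (simp add: fl_def)
 next
  assume a: "Re z = of_int (i0 + int k) / N"
  obtain l where l: "l < k" "of_int (j0 + int l) / N \<le> Im z" "Im z \<le> of_int (j0 + int (Suc l)) / N"
   using between_lattice[OF N z(3,4) k] by blast
  have "z \<in> closed_segment (pt N (i0 + int k) (j0 + int l)) (pt N (i0 + int k) (j0 + int (Suc l)))"
   using on_vertical_segment[OF l(2,3), of "Re z"] unfolding pt_def a[symmetric] by simp
  then show ?thesis unfolding e0
   using seg_ok_cball[OF okr[OF l(1)] _ _, of "fl 0" "3 * S" z] R[of l] R[of "Suc l"] l(1) by (simp add: fr_def)
 next
  assume a: "Im z = of_int (j0 + int k) / N"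
  have "Re z \<le> of_int (i0 - int k + int (2 * k)) / N" using z(2) by (simp add: add.commute)
  from between_lattice[OF N z(1) this] k
  obtain l where l: "l < 2 * k" "of_int (i0 - int k + int l) / N \<le> Re z" "Re z \<le> of_int (i0 - int k + int (Suc l)) / N"
   by auto
  have "z \<in> closed_segment (pt N (i0 - int k + int l) (j0 + int k)) (pt N (i0 - int k + int (Suc l)) (j0 + int k))"
   using on_horizontal_segment[OF l(2,3), of "Im z"] unfolding pt_def a[symmetric] by simp
  then show ?thesis unfolding e0
   using seg_ok_cball[OF okt[OF l(1)] _ _, of "fl 0" "3 * S" z] T[of l] T[of "Suc l"] l(1) by (simp add: ft_def)
 qed
qed

lemma cell_ok_cnj:
 assumes "cell_ok G N r (i, - 1 - j)"
 shows "cell_ok (G \<circ> cnj) N (\<lambda>(i, j). r (i, - 1 - j)) (i, j)"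
proof -
 have cp: "cnj (pt N i j) = pt N i (- j)" for i j by (simp add: pt_def complex_eq_iff)
 have seg: "seg_ok (G \<circ> cnj) s a b \<longleftrightarrow> seg_ok G s (cnj a) (cnj b)" for s a b
 proof -
  have "cnj ` closed_segment a b = closed_segment (cnj a) (cnj b)"
   using closed_segment_linear_image[of cnj a b] bounded_linear.linear[OF bounded_linear_cnj] by metis
  then have "(G \<circ> cnj) ` closed_segment a b = G ` closed_segment (cnj a) (cnj b)"
   by (simp only: image_comp[symmetric])
  then show ?thesis unfolding seg_ok_def by (simp only: o_apply)
 qed
 have "seg_ok G s a b \<longleftrightarrow> seg_ok G s b a" for s a b
  unfolding seg_ok_def by (simp add: closed_segment_commute norm_minus_commute)
 then show ?thesis using assms by (simp add: seg cp add.commute)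
qed

text \<open>Conjugation reduces this to \<open>upper_ring_bound\<close>; row j goes to row -1 - j
  because cells are named by their lower edge. Both bounds compare with the same point, at the left
  end of the middle line, so together they put the image of the whole ring into one ball.\<close>

lemma lower_ring_bound:
 fixes G :: "complex => complex"
 assumes N: "N > 0" and k: "k > 0" and r: "\<And>c. r c \<ge> 0"
  and ok: "\<And>i j. (i, j) \<in> ring k ==> j < 0 ==> cell_ok G N r (i0 + i, j0 + j)"
  and S: "S = (\<Sum>(i,j)\<in>ring k. r (i0 + i, j0 + j))"
  and z: "of_int (i0 - int k) / N \<le> Re z" "Re z \<le> of_int (i0 + int k) / N"
     "of_int (j0 - int k) / N \<le> Im z" "Im z \<le> of_int j0 / N"
  and bd: "Re z = of_int (i0 - int k) / N \<or> Re z = of_int (i0 + int k) / N \<or> Im z = of_int (j0 - int k) / N"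
 shows "norm (G z - G (pt N (i0 - int k) j0)) \<le> 3 * S"
proof -
 define r' where "r' = (\<lambda>(i, j). r (i, - 1 - j))"
 have "norm ((G \<circ> cnj) (cnj z) - (G \<circ> cnj) (pt N (i0 - int k) (- j0))) \<le> 3 * S"
 proof (rule upper_ring_bound[where r = r' and G = "G \<circ> cnj", OF N k])
  show "r' c \<ge> 0" for c using r by (cases c) (simp add: r'_def)
  fix i j assume "(i, j) \<in> ring k" "j \<ge> 0"
  then have "(i, - 1 - j) \<in> ring k" by (auto simp: ring_iff)
  then have "cell_ok G N r (i0 + i, j0 + (- 1 - j))" using \<open>j \<ge> 0\<close> by (intro ok) auto
  then have "cell_ok G N r (i0 + i, - 1 - (- j0 + j))" by (simp add: algebra_simps)
  then show "cell_ok (G \<circ> cnj) N r' (i0 + i, - j0 + j)" unfolding r'_def by (rule cell_ok_cnj)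
 next
  show "S = (\<Sum>(i,j)\<in>ring k. r' (i0 + i, - j0 + j))"
   unfolding S
  proof (rule sum.reindex_bij_witness[of _ "\<lambda>(i,j). (i, - 1 - j)" "\<lambda>(i,j). (i, - 1 - j)"])
   fix c assume c: "c \<in> ring k"
   then show "(case c of (i, j) => (i, - 1 - j)) \<in> ring k" by (cases c) (simp add: ring_iff, presburger)
   then show "(case c of (i, j) => (i, - 1 - j)) \<in> ring k" .
   show "(case case c of (i, j) => (i, - 1 - j) of (i, j) => (i, - 1 - j)) = c" by (cases c) simp
   then show "(case case c of (i, j) => (i, - 1 - j) of (i, j) => (i, - 1 - j)) = c" .
   show "(case case c of (i, j) => (i, - 1 - j) of (i, j) => r' (i0 + i, - j0 + j)) = (case c of (i, j) => r (i0 + i, j0 + j))"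
    by (cases c) (simp add: r'_def add.commute)
  qed
 next
  show "of_int (i0 - int k) / N \<le> Re (cnj z)" "Re (cnj z) \<le> of_int (i0 + int k) / N" using z by simp_all
  show "of_int (- j0) / N \<le> Im (cnj z)" "Im (cnj z) \<le> of_int (- j0 + int k) / N" using z(3,4)
   by (simp_all add: diff_divide_distrib add_divide_distrib)
  show "Re (cnj z) = of_int (i0 - int k) / N \<or> Re (cnj z) = of_int (i0 + int k) / N \<or> Im (cnj z) = of_int (- j0 + int k) / N"
   using bd by (simp add: diff_divide_distrib add_divide_distrib) argo
 qed
 moreover have "cnj (pt N (i0 - int k) (- j0)) = pt N (i0 - int k) j0" by (simp add: pt_def complex_eq_iff)
 ultimately show ?thesis by simp
qed

text \<open>The image of U is open by invariance of domain, so a functional cannot attain its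
  maximum over R in U: a small step in the direction \<open>a\<close> stays in the image.
  Injectivity takes the place of holomorphy.\<close>

lemma linear_max_principle:
 fixes G :: "complex => complex"
 assumes R: "compact R" "open U" "U \<subseteq> R" "continuous_on R G" "inj_on G U" and a: "a \<noteq> 0"
  and b: "\<And>z. z \<in> R - U ==> a \<bullet> G z \<le> b" and z: "z \<in> R"
 shows "a \<bullet> G z \<le> b"
proof -
 obtain \<xi> where \<xi>: "\<xi> \<in> R" "\<And>w. w \<in> R ==> a \<bullet> G w \<le> a \<bullet> G \<xi>"
 proof -
  have "continuous_on R (\<lambda>z. a \<bullet> G z)" by (intro continuous_intros R(4))
  then show ?thesis using continuous_attains_sup[OF R(1), of "\<lambda>z. a \<bullet> G z"] z that by blast
 qed
 have "\<xi> \<notin> U"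
 proof
  assume "\<xi> \<in> U"
  have "open (G ` U)" by (rule invariance_of_domain) (use R continuous_on_subset in auto)
  then obtain e where e: "e > 0" "ball (G \<xi>) e \<subseteq> G ` U" using \<open>\<xi> \<in> U\<close> open_contains_ball by blast
  define w where "w = G \<xi> + (e / (2 * norm a)) *\<^sub>R a"
  have "w \<in> ball (G \<xi>) e" using e a by (simp add: w_def dist_norm)
  then obtain u where "u \<in> U" "G u = w" using e(2) by auto
  then have "a \<bullet> w \<le> a \<bullet> G \<xi>" using \<xi>(2)[of u] R(3) by auto
  then have "(e / (2 * norm a)) * (a \<bullet> a) \<le> 0" by (simp add: w_def inner_add_right)
  moreover have "(e / (2 * norm a)) * (a \<bullet> a) > 0" using e a by simp
  ultimately show False by simp
 qed
 then show ?thesis using b[of \<xi>] \<xi> z by force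
qed

text \<open>The linear version in the direction \<open>G z - c\<close>; by Cauchy-Schwarz the ball
  bound on \<open>R - U\<close> is also a half plane bound in that direction.\<close>

lemma norm_max_principle:
 fixes G :: "complex => complex"
 assumes R: "compact R" "open U" "U \<subseteq> R" "continuous_on R G" "inj_on G U"
  and b: "\<And>z. z \<in> R - U ==> norm (G z - c) \<le> B" and z: "z \<in> R" and B: "B \<ge> 0"
 shows "norm (G z - c) \<le> B"
proof (cases "G z = c")
 case False
 define a where "a = G z - c"
 have a: "a \<noteq> 0" using False by (simp add: a_def)
 have "a \<bullet> G z \<le> a \<bullet> c + norm a * B"
 proof (rule linear_max_principle[OF R a _ z])
  fix w assume "w \<in> R - U"
  have "a \<bullet> (G w - c) \<le> norm a * norm (G w - c)" by (rule norm_cauchy_schwarz)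
  also have "\<dots> \<le> norm a * B" using b[OF \<open>w \<in> R - U\<close>] by (intro mult_left_mono) auto
  finally show "a \<bullet> G w \<le> a \<bullet> c + norm a * B" by (simp add: inner_diff_right)
 qed
 then have "a \<bullet> a \<le> norm a * B" by (simp add: a_def inner_diff_right)
 then show ?thesis using a by (simp add: power2_norm_eq_inner[symmetric] power2_eq_square a_def)
qed (use B in simp)

section \<open>Uniform weights and short rings in a box\<close>

definition sbox :: "complex => real => complex set" where
 "sbox z0 d = {z. \<bar>Re z - Re z0\<bar> \<le> d \<and> \<bar>Im z - Im z0\<bar> \<le> d}"

definition ring_region :: "real => int => int => nat => complex set" where
 "ring_region N i0 j0 k = cbox (Complex (of_int (i0 - int k) / N) (of_int (j0 - int k) / N))
                (Complex (of_int (i0 + int k) / N) (of_int (j0 + int k) / N))"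

text \<open>The rings are centred at \<open>z0\<close> rounded down to the lattice, an error of less
  than one cell in each coordinate; the summands 1 in the hypotheses pay for it.\<close>

lemma ring_region_facts:
 fixes N :: nat and z0 :: complex
 assumes N: "real N > 0" and d: "\<delta> * real N + 1 \<le> real k" "real k + 1 \<le> d * real N"
  and i0: "i0 = \<lfloor>Re z0 * real N\<rfloor>" and j0: "j0 = \<lfloor>Im z0 * real N\<rfloor>"
 shows "ring_region (real N) i0 j0 k \<subseteq> sbox z0 d" "sbox z0 \<delta> \<subseteq> ring_region (real N) i0 j0 k"
proof -
 have f: "of_int i0 \<le> Re z0 * N" "Re z0 * N < of_int i0 + 1" "of_int j0 \<le> Im z0 * N" "Im z0 * N < of_int j0 + 1"
  unfolding i0 j0 by linarith+
 show "ring_region (real N) i0 j0 k \<subseteq> sbox z0 d"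
 proof
  fix z assume "z \<in> ring_region (real N) i0 j0 k"
  then have z: "of_int i0 - real k \<le> Re z * N" "Re z * N \<le> of_int i0 + real k" "of_int j0 - real k \<le> Im z * N" "Im z * N \<le> of_int j0 + real k"
   using N by (auto simp: ring_region_def in_cbox_complex_iff field_simps)
  have "\<bar>Re z * N - Re z0 * N\<bar> \<le> d * N" "\<bar>Im z * N - Im z0 * N\<bar> \<le> d * N"
   using z f d by linarith+
  then have "\<bar>Re z - Re z0\<bar> * N \<le> d * N" "\<bar>Im z - Im z0\<bar> * N \<le> d * N"
   using N by (simp_all add: abs_mult left_diff_distrib[symmetric])
  then show "z \<in> sbox z0 d" using N by (simp add: sbox_def)
 qed
 show "sbox z0 \<delta> \<subseteq> ring_region (real N) i0 j0 k"
 proof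
  fix z assume "z \<in> sbox z0 \<delta>"
  then have "\<bar>Re z - Re z0\<bar> * N \<le> \<delta> * N" "\<bar>Im z - Im z0\<bar> * N \<le> \<delta> * N"
   using N by (simp_all add: sbox_def)
  then have "\<bar>Re z * N - Re z0 * N\<bar> \<le> \<delta> * N" "\<bar>Im z * N - Im z0 * N\<bar> \<le> \<delta> * N"
   using N by (simp_all add: abs_mult left_diff_distrib[symmetric])
  then have "of_int i0 - real k \<le> Re z * N" "Re z * N \<le> of_int i0 + real k" "of_int j0 - real k \<le> Im z * N" "Im z * N \<le> of_int j0 + real k"
   using f d by linarith+
  then show "z \<in> ring_region (real N) i0 j0 k"
   using N by (auto simp: ring_region_def in_cbox_complex_iff field_simps)
 qed
qed

lemma ring_cell_subset:
 assumes N: "real N > 0" and c: "(i, j) \<in> ring l" and lk: "l \<le> k"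
 shows "cbox (pt (real N) (i0 + i) (j0 + j)) (pt (real N) (i0 + i + 1) (j0 + j + 1)) \<subseteq> ring_region (real N) i0 j0 k"
proof -
 have "- int k \<le> i" "i + 1 \<le> int k" "- int k \<le> j" "j + 1 \<le> int k" using c lk by (auto simp: ring_iff)
 then have "i0 - int k \<le> i0 + i" "i0 + i + 1 \<le> i0 + int k" "j0 - int k \<le> j0 + j" "j0 + j + 1 \<le> j0 + int k" by auto
 then show ?thesis
  unfolding ring_region_def pt_def subset_box_complex using N by (auto intro!: divide_right_mono simp del: of_int_add of_int_diff)
qed

lemma compact_ring_region [simp]: "compact (ring_region N i0 j0 k)"
 by (simp add: ring_region_def)

text \<open>\<open>r\<close> bounds the image diameters of the cells in \<open>Q\<close>; the bound \<open>A\<close> on the sum of their squares is to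
 be independent of the mesh \<open>N\<close>.\<close>
definition lat_weights :: "(complex => complex) => nat => real => (int \<times> int => real) => complex set => bool" where
 "lat_weights G N A r Q \<longleftrightarrow> (\<forall>c. r c \<ge> 0) \<and>
  (\<forall>i j. lcell (real N) i j \<subseteq> Q --> cell_ok G (real N) r (i, j)) \<and>
  (\<forall>S. finite S --> (\<forall>(i,j)\<in>S. lcell (real N) i j \<subseteq> Q) --> (\<Sum>c\<in>S. (r c)\<^sup>2) \<le> A)"

lemma lat_weightsD:
 assumes "lat_weights G N A r Q"
 shows "r c \<ge> 0"
  and "lcell (real N) i j \<subseteq> Q ==> cell_ok G (real N) r (i, j)"
  and "finite S ==> (\<And>i j. (i,j) \<in> S ==> lcell (real N) i j \<subseteq> Q) ==> (\<Sum>c\<in>S. (r c)\<^sup>2) \<le> A"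
 using assms unfolding lat_weights_def by blast+

text \<open>\<delta> and N0 depend only on d, e and the area bound A, not on the map, the mesh or
  the centre; this uniformity is what becomes equicontinuity. The set Y allows weights that are
  controlled on a part of the box only: it is everything at interior points and the closed upper
  half plane at boundary points.\<close>

lemma short_ring_in_box:
 assumes d: "d > 0" and e: "e > 0"
 obtains \<delta> N0 where "\<delta> > 0" "\<delta> < d"
  "\<And>N G r z0 Y. N \<ge> N0 ==> lat_weights G N A r (sbox z0 d \<inter> Y) ==>
   (\<And>i j. lcell (real N) i j \<subseteq> sbox z0 d ==> r (i,j) \<noteq> 0 ==> lcell (real N) i j \<subseteq> Y) ==>
   \<exists>k>0. (\<Sum>(i,j)\<in>ring k. r (\<lfloor>Re z0 * real N\<rfloor> + i, \<lfloor>Im z0 * real N\<rfloor> + j)) < e \<and> real N > 0 \<and>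
    \<delta> * real N + 1 \<le> real k \<and> real k + 1 \<le> d * real N"
proof -
 obtain \<delta> N0 where \<delta>: "\<delta> > 0" "\<delta> < d"
  "\<And>N::nat. N \<ge> N0 ==> \<exists>m M. \<delta> * real N + 1 \<le> real m \<and> real M \<le> d * real N - 1 \<and> 8 * A / e\<^sup>2 < (\<Sum>k\<in>{m<..M}. 1 / real k)"
  using exists_harmonic_gt[OF d, of "8 * A / e\<^sup>2"] by blast
 show ?thesis
 proof (rule that[of \<delta> "max N0 1", OF \<delta>(1,2)])
  fix N :: nat and G r z0 Y
  assume NN: "N \<ge> max N0 1" and lw: "lat_weights G N A r (sbox z0 d \<inter> Y)"
   and Y: "\<And>i j. lcell (real N) i j \<subseteq> sbox z0 d ==> r (i,j) \<noteq> 0 ==> lcell (real N) i j \<subseteq> Y"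
  have N: "real N > 0" using NN by simp
  define i0 where "i0 = \<lfloor>Re z0 * real N\<rfloor>"
  define j0 where "j0 = \<lfloor>Im z0 * real N\<rfloor>"
  have "N \<ge> N0" using NN by simp
  from \<delta>(3)[OF this] obtain m M where mM: "\<delta> * real N + 1 \<le> real m" "real M \<le> d * real N - 1"
   "8 * A / e\<^sup>2 < (\<Sum>k\<in>{m<..M}. 1 / real k)" by blast
  have big: "8 * A < e\<^sup>2 * (\<Sum>k\<in>{m<..M}. 1 / real k)" using mM(3) e by (simp add: field_simps)
  define r' where "r' = (\<lambda>(i,j). r (i0 + i, j0 + j))"
  have sub: "cbox (pt (real N) (i0 + i) (j0 + j)) (pt (real N) (i0 + i + 1) (j0 + j + 1)) \<subseteq> sbox z0 d"
   if "(i, j) \<in> ring l" "l \<in> {m<..M}" for i j l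
  proof -
   have "real l \<le> real M" "real m \<le> real l" using that by auto
   then have "\<delta> * real N + 1 \<le> real l" "real l + 1 \<le> d * real N" using mM by linarith+
   from ring_region_facts(1)[OF N this i0_def j0_def] show ?thesis
    using ring_cell_subset[OF N that(1) order_refl] by blast
  qed
  obtain k where k: "k \<in> {m<..M}" "(\<Sum>c\<in>ring k. r' c) < e"
  proof (rule exists_short_ring[OF _ e big, of r'])
   fix S assume S: "finite S" "\<forall>c\<in>S. \<exists>k\<in>{m<..M}. c \<in> ring k"
   \<comment> \<open>Cells of weight zero may leave Y, where the area bound says nothing, so they
     are dropped first.\<close>
   define S' where "S' = {c\<in>S. r' c \<noteq> 0}"
   define T where "T = (\<lambda>(i,j). (i0 + i, j0 + j)) ` S'"
   have "(\<Sum>c\<in>S. (r' c)\<^sup>2) = (\<Sum>c\<in>S'. (r' c)\<^sup>2)"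
    unfolding S'_def using S by (intro sum.mono_neutral_right) auto
   also have "\<dots> = (\<Sum>c\<in>T. (r c)\<^sup>2)"
    unfolding T_def by (subst sum.reindex) (auto simp: inj_on_def r'_def case_prod_beta)
   also have "\<dots> \<le> A"
   proof -
    have "finite T" using S by (simp add: T_def S'_def)
    moreover have "lcell (real N) i j \<subseteq> sbox z0 d \<inter> Y" if ij: "(i, j) \<in> T" for i j
    proof -
     obtain a b where ab: "(a, b) \<in> S" "r' (a, b) \<noteq> 0" "i = i0 + a" "j = j0 + b"
      using ij unfolding T_def S'_def by auto
     obtain l where l: "l \<in> {m<..M}" "(a, b) \<in> ring l" using S(2) ab(1) by blast
     have "lcell (real N) i j \<subseteq> sbox z0 d"
      using sub[OF l(2,1)] ab by simp
     moreover have "r (i, j) \<noteq> 0" using ab by (simp add: r'_def)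
     ultimately show ?thesis using Y by blast
    qed
    ultimately show ?thesis by (rule lat_weightsD(3)[OF lw])
   qed
   finally show "(\<Sum>c\<in>S. (r' c)\<^sup>2) \<le> A" .
  qed
  have kk: "real m + 1 \<le> real k" "real k \<le> real M" using k(1) by auto
  have "(\<Sum>(i,j)\<in>ring k. r (i0 + i, j0 + j)) < e" using k(2) by (simp add: r'_def)
  moreover have "k > 0" using k(1) by auto
  moreover have "\<delta> * real N + 1 \<le> real k" "real k + 1 \<le> d * real N" using kk mM by linarith+
  ultimately show "\<exists>k>0. (\<Sum>(i,j)\<in>ring k. r (\<lfloor>Re z0 * real N\<rfloor> + i, \<lfloor>Im z0 * real N\<rfloor> + j)) < e \<and> real N > 0 \<and>
    \<delta> * real N + 1 \<le> real k \<and> real k + 1 \<le> d * real N"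
   using N unfolding i0_def j0_def by blast
 qed
qed

text \<open>A ring with short image encloses the box of size \<delta>; by the maximum principle the
  image of the enclosed region stays in the ball that contains the image of the ring.\<close>

lemma equicontinuity_at_point:
 assumes d: "d > 0" and e: "e > 0"
 obtains \<delta> N0 where "\<delta> > 0" "\<delta> < d"
  "\<And>N G r z0 z. N \<ge> N0 ==> lat_weights G N A r (sbox z0 d) ==> continuous_on (sbox z0 d) G ==> inj_on G (sbox z0 d) ==>
    z \<in> sbox z0 \<delta> ==> norm (G z - G z0) \<le> e"
proof -
 \<comment> \<open>Six is the factor 3 lost in \<open>upper_ring_bound\<close> times 2 for comparing
   two points with the reference point.\<close>
 have e6: "e / 6 > 0" using e by simp
 obtain \<delta> N0 where \<delta>: "\<delta> > 0" "\<delta> < d" and sr: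
  "\<And>N G r z0 Y. N \<ge> N0 ==> lat_weights G N A r (sbox z0 d \<inter> Y) ==>
   (\<And>i j. lcell (real N) i j \<subseteq> sbox z0 d ==> r (i,j) \<noteq> 0 ==> lcell (real N) i j \<subseteq> Y) ==>
   \<exists>k>0. (\<Sum>(i,j)\<in>ring k. r (\<lfloor>Re z0 * real N\<rfloor> + i, \<lfloor>Im z0 * real N\<rfloor> + j)) < e / 6 \<and> real N > 0 \<and>
    \<delta> * real N + 1 \<le> real k \<and> real k + 1 \<le> d * real N"
  using short_ring_in_box[OF d e6, of A] by blast
 show ?thesis
 proof (rule that[OF \<delta>])
  fix N G r z0 z
  assume NN: "N \<ge> N0" and lw: "lat_weights G N A r (sbox z0 d)" and cont: "continuous_on (sbox z0 d) G"
   and inj: "inj_on G (sbox z0 d)" and z: "z \<in> sbox z0 \<delta>"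
  define i0 where "i0 = \<lfloor>Re z0 * real N\<rfloor>"
  define j0 where "j0 = \<lfloor>Im z0 * real N\<rfloor>"
  have "lat_weights G N A r (sbox z0 d \<inter> UNIV)" using lw by simp
  then have "\<exists>k>0. (\<Sum>(i,j)\<in>ring k. r (\<lfloor>Re z0 * real N\<rfloor> + i, \<lfloor>Im z0 * real N\<rfloor> + j)) < e / 6 \<and> real N > 0 \<and>
    \<delta> * real N + 1 \<le> real k \<and> real k + 1 \<le> d * real N"
   by (rule sr[OF NN]) simp
  then obtain k where k: "k > 0" "(\<Sum>(i,j)\<in>ring k. r (i0 + i, j0 + j)) < e / 6" "real N > 0"
   "\<delta> * real N + 1 \<le> real k" "real k + 1 \<le> d * real N"
   unfolding i0_def j0_def by blast
  define S where "S = (\<Sum>(i,j)\<in>ring k. r (i0 + i, j0 + j))"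
  define R where "R = ring_region (real N) i0 j0 k"
  have R1: "R \<subseteq> sbox z0 d" and R2: "sbox z0 \<delta> \<subseteq> R"
   using ring_region_facts[OF k(3,4,5) i0_def j0_def] by (auto simp: R_def)
  have r0: "r c \<ge> 0" for c by (rule lat_weightsD(1)[OF lw])
  have S0: "S \<ge> 0" unfolding S_def using r0 by (intro sum_nonneg) (auto simp: case_prod_beta)
  have ok: "cell_ok G (real N) r (i0 + i, j0 + j)" if "(i, j) \<in> ring k" for i j
   using ring_cell_subset[OF k(3) that order_refl, of i0 j0] R1 lw unfolding R_def lat_weights_def by blast
  define U where "U = interior R"
  have Ue: "U = box (Complex (of_int (i0 - int k) / N) (of_int (j0 - int k) / N)) (Complex (of_int (i0 + int k) / N) (of_int (j0 + int k) / N))"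
   by (simp add: U_def R_def ring_region_def)
  define c where "c = G (pt (real N) (i0 - int k) j0)"
  have bnd: "norm (G w - c) \<le> 3 * S" if "w \<in> R - U" for w
  proof -
   have w: "of_int (i0 - int k) / N \<le> Re w" "Re w \<le> of_int (i0 + int k) / N" "of_int (j0 - int k) / N \<le> Im w" "Im w \<le> of_int (j0 + int k) / N"
    and bd: "Re w = of_int (i0 - int k) / N \<or> Re w = of_int (i0 + int k) / N \<or> Im w = of_int (j0 - int k) / N \<or> Im w = of_int (j0 + int k) / N"
    using that unfolding Ue R_def ring_region_def in_cbox_complex_iff in_box_complex_iff Diff_iff complex.sel
     atLeastAtMost_iff greaterThanLessThan_iff by linarith+
   show ?thesis
   proof (cases "Im w \<ge> of_int j0 / N")
    case True
    have "of_int (j0 - int k) / real N < of_int j0 / N" using k by (intro divide_strict_right_mono) auto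
    then have "Re w = of_int (i0 - int k) / N \<or> Re w = of_int (i0 + int k) / N \<or> Im w = of_int (j0 + int k) / N"
     using bd True by linarith
    then show ?thesis unfolding c_def
     by (intro upper_ring_bound[OF k(3,1) r0 ok S_def w(1,2) True w(4)])
   next
    case False
    have "of_int j0 / N < of_int (j0 + int k) / real N" using k by (intro divide_strict_right_mono) auto
    then have "Re w = of_int (i0 - int k) / N \<or> Re w = of_int (i0 + int k) / N \<or> Im w = of_int (j0 - int k) / N"
     using bd False by linarith
    moreover have "Im w \<le> of_int j0 / N" using False by simp
    ultimately show ?thesis unfolding c_def
     by (intro lower_ring_bound[OF k(3,1) r0 ok S_def w(1,2,3)])
   qed
  qed
  have main: "norm (G w - c) \<le> 3 * S" if "w \<in> R" for w
  proof (rule norm_max_principle[OF _ _ _ _ _ bnd that])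
   show "compact R" "open U" "U \<subseteq> R" by (auto simp: R_def U_def interior_subset)
   show "continuous_on R G" using cont R1 continuous_on_subset by blast
   show "inj_on G U" using inj R1 interior_subset[of R] unfolding U_def by (meson inj_on_subset order_trans)
  qed (use S0 in auto)
  have "z \<in> R" "z0 \<in> R" using z R2 \<delta> by (auto simp: sbox_def subset_iff)
  then have "norm (G z - c) \<le> 3 * S" "norm (G z0 - c) \<le> 3 * S" by (auto intro: main)
  moreover have "norm (G z - G z0) \<le> norm (G z - c) + norm (G z0 - c)"
   using norm_triangle_ineq4[of "G z - c" "G z0 - c"] by simp
  ultimately show "norm (G z - G z0) \<le> e" using k(2) unfolding S_def by linarith
 qed
qed

text \<open>The part of a ring above the axis cuts off a half box. Its image is short and begins on
  the axis, where the functional is at most b; the rest of the boundary lies on the axis itself. The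
  image of the axis may be long, so only one functional is controlled and not the distance of image
  points.\<close>

lemma boundary_bound_at_point:
 assumes d: "d > 0" and e: "e > 0"
 obtains \<delta> N0 where "\<delta> > 0" "\<delta> < d"
  "\<And>N G r z0 z a b. N \<ge> N0 ==> Im z0 = 0 ==> lat_weights G N A r (sbox z0 d \<inter> {z. Im z \<ge> 0}) ==>
    continuous_on (sbox z0 d \<inter> {z. Im z \<ge> 0}) G ==> inj_on G (sbox z0 d \<inter> {z. Im z \<ge> 0}) ==>
    norm a = 1 ==> (\<And>x. x \<in> sbox z0 d ==> Im x = 0 ==> a \<bullet> G x \<le> b) ==>
    z \<in> sbox z0 \<delta> ==> Im z \<ge> 0 ==> a \<bullet> G z \<le> b + e"
proof -
 have e3: "e / 3 > 0" using e by simp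
 obtain \<delta> N0 where \<delta>: "\<delta> > 0" "\<delta> < d" and sr:
  "\<And>N G r z0 Y. N \<ge> N0 ==> lat_weights G N A r (sbox z0 d \<inter> Y) ==>
   (\<And>i j. lcell (real N) i j \<subseteq> sbox z0 d ==> r (i,j) \<noteq> 0 ==> lcell (real N) i j \<subseteq> Y) ==>
   \<exists>k>0. (\<Sum>(i,j)\<in>ring k. r (\<lfloor>Re z0 * real N\<rfloor> + i, \<lfloor>Im z0 * real N\<rfloor> + j)) < e / 3 \<and> real N > 0 \<and>
    \<delta> * real N + 1 \<le> real k \<and> real k + 1 \<le> d * real N"
  using short_ring_in_box[OF d e3, of A] by blast
 show ?thesis
 proof (rule that[of \<delta> "max N0 1", OF \<delta>])
  fix N :: nat and G r z0 z a b
  assume NN: "N \<ge> max N0 1" and z0: "Im z0 = 0" and lw: "lat_weights G N A r (sbox z0 d \<inter> {z. Im z \<ge> 0})"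
   and cont: "continuous_on (sbox z0 d \<inter> {z. Im z \<ge> 0}) G"
   and inj: "inj_on G (sbox z0 d \<inter> {z. Im z \<ge> 0})" and a: "norm a = 1"
   and ab: "\<And>x. x \<in> sbox z0 d ==> Im x = 0 ==> a \<bullet> G x \<le> b"
   and z: "z \<in> sbox z0 \<delta>" "Im z \<ge> 0"
  let ?Y = "{z::complex. Im z \<ge> 0}"
  define i0 where "i0 = \<lfloor>Re z0 * real N\<rfloor>"
  have j00: "\<lfloor>Im z0 * real N\<rfloor> = 0" by (simp add: z0)
  have N1: "real N > 0" using NN by simp
  \<comment> \<open>Weight zero below the axis makes the sum over a full ring equal to the sum over
    its upper half, so the argument for full rings applies.\<close>
  define r' where "r' c = (if snd c \<ge> 0 then r c else 0)" for c
  have r0: "r c \<ge> 0" for c by (rule lat_weightsD(1)[OF lw])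
  have r0': "r' c \<ge> 0" for c using r0 by (simp add: r'_def)
  have cellY: "j \<ge> 0" if "lcell (real N) i j \<subseteq> Q \<inter> ?Y" for i j Q
  proof -
   have "pt (real N) i j \<in> lcell (real N) i j"
    using N1 by (auto simp: pt_def in_cbox_complex_iff divide_right_mono)
   then have "Im (pt (real N) i j) \<ge> 0" using that by blast
   then show ?thesis using N1 by (simp add: pt_def zero_le_divide_iff)
  qed
  have lw': "lat_weights G N A r' (sbox z0 d \<inter> ?Y)"
   unfolding lat_weights_def
  proof (intro conjI allI impI)
   fix i j assume c: "lcell (real N) i j \<subseteq> sbox z0 d \<inter> ?Y"
   then have "cell_ok G (real N) r (i, j)" using lw by (auto simp: lat_weights_def)
   then show "cell_ok G (real N) r' (i, j)" using cellY[OF c] by (simp add: r'_def)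
  next
   fix S assume S: "finite S" "\<forall>(i,j)\<in>S. lcell (real N) i j \<subseteq> sbox z0 d \<inter> ?Y"
   have "(\<Sum>c\<in>S. (r' c)\<^sup>2) \<le> (\<Sum>c\<in>S. (r c)\<^sup>2)"
    by (intro sum_mono) (simp add: r'_def)
   also have "\<dots> \<le> A" by (rule lat_weightsD(3)[OF lw S(1)]) (use S(2) in fast)
   finally show "(\<Sum>c\<in>S. (r' c)\<^sup>2) \<le> A" .
  qed (rule r0')
  have Ycell: "lcell (real N) i j \<subseteq> ?Y" if "r' (i, j) \<noteq> 0" for i j
  proof -
   have "j \<ge> 0" using that by (auto simp: r'_def split: if_splits)
   then have "of_int j / real N \<ge> 0" by simp
   then show ?thesis by (auto simp: pt_def in_cbox_complex_iff)
  qed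
  have "N \<ge> N0" using NN by simp
  then have "\<exists>k>0. (\<Sum>(i,j)\<in>ring k. r' (\<lfloor>Re z0 * real N\<rfloor> + i, \<lfloor>Im z0 * real N\<rfloor> + j)) < e / 3 \<and> real N > 0 \<and>
    \<delta> * real N + 1 \<le> real k \<and> real k + 1 \<le> d * real N"
   by (rule sr[OF _ lw']) (rule Ycell)
  then obtain k where k: "k > 0" "(\<Sum>(i,j)\<in>ring k. r' (i0 + i, 0 + j)) < e / 3" "real N > 0"
   "\<delta> * real N + 1 \<le> real k" "real k + 1 \<le> d * real N"
   unfolding i0_def j00 by blast
  define S where "S = (\<Sum>(i,j)\<in>ring k. r' (i0 + i, 0 + j))"
  have R1: "ring_region (real N) i0 0 k \<subseteq> sbox z0 d" and R2: "sbox z0 \<delta> \<subseteq> ring_region (real N) i0 0 k"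
   using ring_region_facts[OF k(3,4,5) i0_def j00[symmetric]] by auto
  define R where "R = ring_region (real N) i0 0 k \<inter> ?Y"
  have Re: "R = cbox (Complex (of_int (i0 - int k) / N) 0) (Complex (of_int (i0 + int k) / N) (of_int (int k) / N))"
  proof -
   have "of_int (0 - int k) / real N \<le> 0" by simp
   then show ?thesis unfolding R_def ring_region_def by (auto simp: in_cbox_complex_iff)
  qed
  have RY: "R \<subseteq> sbox z0 d \<inter> ?Y" using R1 by (auto simp: R_def)
  define U where "U = interior R"
  have Ue: "U = box (Complex (of_int (i0 - int k) / N) 0) (Complex (of_int (i0 + int k) / N) (of_int (int k) / N))"
   by (simp add: U_def Re)
  have ok: "cell_ok G (real N) r' (i0 + i, 0 + j)" if "(i, j) \<in> ring k" "j \<ge> 0" for i j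
  proof -
   have "of_int (0 + j) / real N \<ge> 0" using that by simp
   then have "cbox (pt (real N) (i0 + i) (0 + j)) (pt (real N) (i0 + i + 1) (0 + j + 1)) \<subseteq> ?Y"
    by (auto simp: pt_def in_cbox_complex_iff)
   then show ?thesis
    using ring_cell_subset[OF k(3) that(1) order_refl, of i0 0] R1 by (intro lat_weightsD(2)[OF lw']) blast
  qed
  define p where "p = pt (real N) (i0 - int k) 0"
  have pR: "p \<in> ring_region (real N) i0 0 k"
   using k by (auto simp: p_def pt_def ring_region_def in_cbox_complex_iff divide_right_mono)
  then have ap: "a \<bullet> G p \<le> b" using R1 by (intro ab) (auto simp: p_def pt_def)
  have S0: "S \<ge> 0" unfolding S_def using r0' by (intro sum_nonneg) (auto simp: case_prod_beta)
  have bnd: "a \<bullet> G w \<le> b + 3 * S" if wR: "w \<in> R - U" for w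
  proof -
   have w: "of_int (i0 - int k) / N \<le> Re w" "Re w \<le> of_int (i0 + int k) / N" "0 \<le> Im w" "Im w \<le> of_int (int k) / N"
    and bd: "Re w = of_int (i0 - int k) / N \<or> Re w = of_int (i0 + int k) / N \<or> Im w = 0 \<or> Im w = of_int (int k) / N"
    using that unfolding Ue Re in_cbox_complex_iff in_box_complex_iff Diff_iff complex.sel
     atLeastAtMost_iff greaterThanLessThan_iff by linarith+
   show ?thesis
   proof (cases "Im w = 0")
    case True
    then have "a \<bullet> G w \<le> b" using wR RY by (intro ab) auto
    then show ?thesis using S0 by simp
   next
    case False
    have "norm (G w - G p) \<le> 3 * S" unfolding p_def
     by (rule upper_ring_bound[OF k(3,1) r0' ok S_def w(1,2)]) (use w bd False in auto)
    moreover have "a \<bullet> (G w - G p) \<le> norm a * norm (G w - G p)" by (rule norm_cauchy_schwarz)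
    ultimately show ?thesis using ap a by (simp add: inner_diff_right)
   qed
  qed
  have "a \<bullet> G z \<le> b + 3 * S"
  proof (rule linear_max_principle[OF _ _ _ _ _ _ bnd])
   show "compact R" by (simp add: Re)
   show "open U" by (simp add: U_def)
   show "U \<subseteq> R" unfolding U_def by (rule interior_subset)
   show "continuous_on R G" using cont RY continuous_on_subset by blast
   show "inj_on G U" using inj RY interior_subset[of R] unfolding U_def by (meson inj_on_subset order_trans)
   show "a \<noteq> 0" using a by auto
   show "z \<in> R" using z R2 by (auto simp: R_def)
  qed
  then show "a \<bullet> G z \<le> b + e" using k(2) unfolding S_def by linarith
 qed
qed

section \<open>Nearly conformal affine maps\<close>

text \<open>Passes from barycentric coordinates, where refined faces form a square lattice, to the
  planar coordinate of the unfolded face with edge vectors B and C. Conformality refers to the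
  latter.\<close>

definition tmap :: "complex => complex => complex => complex" where
 "tmap B C z = Re z *\<^sub>R B + Im z *\<^sub>R C"

lemma linear_tmap: "linear (tmap B C)"
 by (rule linearI) (simp_all add: tmap_def algebra_simps)

lemma complex_linear_decomp:
 assumes "linear (L :: complex => complex)"
 obtains \<alpha> \<beta> where "\<And>z. L z = \<alpha> * z + \<beta> * cnj z"
proof -
 interpret linear L by fact
 have L: "L z = Re z *\<^sub>R L 1 + Im z *\<^sub>R L \<i>" for z
 proof -
  have "z = Re z *\<^sub>R 1 + Im z *\<^sub>R \<i>" by (simp add: complex_eq_iff)
  then have "L z = L (Re z *\<^sub>R 1 + Im z *\<^sub>R \<i>)" by simp
  then show ?thesis by (simp only: add scale)
 qed
 show ?thesis
 proof (rule that[of "(L 1 - \<i> * L \<i>) / 2" "(L 1 + \<i> * L \<i>) / 2"])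
  fix z
  have "(L 1 - \<i> * L \<i>) / 2 * z + (L 1 + \<i> * L \<i>) / 2 * cnj z = L 1 * ((z + cnj z) / 2) + L \<i> * (\<i> * (cnj z - z) / 2)"
   by (simp add: field_simps)
  also have "\<dots> = Re z *\<^sub>R L 1 + Im z *\<^sub>R L \<i>"
   by (simp add: complex_add_cnj complex_eq_iff)
  finally show "L z = (L 1 - \<i> * L \<i>) / 2 * z + (L 1 + \<i> * L \<i>) / 2 * cnj z" using L[of z] by simp
 qed
qed

text \<open>Rotating by half the difference of the arguments makes the two summands parallel, so the
  largest stretch of a real linear map in the form \<open>a z + b cnj z\<close> is attained
  explicitly.\<close>

lemma exists_aligned_unit:
 obtains u :: complex where "norm u = 1" "norm (a * u + b * cnj u) = norm a + norm b"
proof -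
 define v where "v = cis ((Arg b - Arg a) / 2)"
 have a: "c = of_real (norm c) * cis (Arg c)" for c :: complex using rcis_cmod_Arg[of c] by (simp add: rcis_def)
 have "a * v + b * cnj v = (of_real (norm a) * cis (Arg a)) * v + (of_real (norm b) * cis (Arg b)) * cnj v"
  using a[of a] a[of b] by simp
 also have "\<dots> = of_real (norm a) * (cis (Arg a) * v) + of_real (norm b) * (cis (Arg b) * cnj v)"
  by (simp only: mult.assoc)
 also have "cis (Arg a) * v = cis ((Arg a + Arg b) / 2)" by (simp add: v_def cis_mult field_simps)
 also have "cis (Arg b) * cnj v = cis ((Arg a + Arg b) / 2)" by (simp add: v_def cis_cnj cis_mult field_simps)
 finally have "a * v + b * cnj v = of_real (norm a + norm b) * cis ((Arg a + Arg b) / 2)" by (simp add: distrib_right)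
 then have "norm (a * v + b * cnj v) = norm a + norm b" by (simp add: norm_mult del: of_real_add)
 then show ?thesis using that[of v] by (simp add: v_def)
qed

text \<open>The determinant of this map is
  \<open>(norm \<alpha>)^2 - (norm \<beta>)^2\<close>.\<close>

lemma orient_pos_iff: "orient_pos (\<lambda>z. \<alpha> * z + \<beta> * cnj z) \<longleftrightarrow> norm \<beta> < norm \<alpha>"
proof -
 have "Im (cnj (\<alpha> * 1 + \<beta> * cnj 1) * (\<alpha> * \<i> + \<beta> * cnj \<i>)) = (norm \<alpha>)\<^sup>2 - (norm \<beta>)\<^sup>2"
  unfolding cmod_power2 by (simp add: power2_eq_square algebra_simps)
 moreover have "(norm \<beta>)\<^sup>2 < (norm \<alpha>)\<^sup>2 \<longleftrightarrow> norm \<beta> < norm \<alpha>"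
  using power2_less_imp_less[of "norm \<beta>" "norm \<alpha>"] power_strict_mono[of "norm \<beta>" "norm \<alpha>" 2] by auto
 ultimately show ?thesis unfolding orient_pos_def by simp
qed

lemma complex_parallelogram_law: "(norm (a - b))\<^sup>2 + (norm (a + b))\<^sup>2 = 2 * ((norm a)\<^sup>2 + (norm (b::complex))\<^sup>2)"
 unfolding cmod_power2 by (simp add: power2_eq_square algebra_simps)

text \<open>The singular values are \<open>norm \<alpha> + norm \<beta>\<close> and
  \<open>norm \<alpha> - norm \<beta>\<close>. By the parallelogram law the smaller one is attained
  at \<i> times the unit vector that attains the larger one.\<close>

lemma dcd_bound:
 assumes \<beta>: "norm \<beta> < norm \<alpha>" and K: "dcd (\<lambda>z. \<alpha> * z + \<beta> * cnj z) \<le> K"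
 shows "norm \<alpha> + norm \<beta> \<le> K * (norm \<alpha> - norm \<beta>)"
proof -
 define L where "L = (\<lambda>z. \<alpha> * z + \<beta> * cnj z)"
 have "linear L" by (rule linearI) (simp_all add: L_def algebra_simps scaleR_conv_of_real)
 then have bl: "bounded_linear L" by (simp add: linear_conv_bounded_linear)
 obtain u where u: "norm u = 1" "norm (L u) = norm \<alpha> + norm \<beta>"
  using exists_aligned_unit[of \<alpha> \<beta>] unfolding L_def by blast
 have on: "norm \<alpha> + norm \<beta> \<le> onorm L" using onorm[OF bl, of u] u by simp
 obtain v where v: "norm v = 1" "norm (\<alpha> * v + (- \<beta>) * cnj v) = norm \<alpha> + norm (- \<beta>)"
  using exists_aligned_unit[of \<alpha> "- \<beta>"] by blast
 have lb: "norm \<alpha> - norm \<beta> \<le> norm (L w)" if "norm w = 1" for w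
  using norm_diff_ineq[of "\<alpha> * w" "\<beta> * cnj w"] that by (simp add: L_def norm_mult)
 define I where "I = (INF u\<in>{u. norm u = 1}. norm (L u))"
 have I1: "norm \<alpha> - norm \<beta> \<le> I" unfolding I_def
  by (rule cINF_greatest) (use lb u in auto)
 have I2: "I \<le> norm \<alpha> - norm \<beta>"
 proof -
  have "I \<le> norm (L (\<i> * u))" unfolding I_def
   by (rule cINF_lower) (use u in \<open>auto simp: norm_mult intro!: bdd_belowI[of _ 0]\<close>)
  also have "L (\<i> * u) = \<i> * (\<alpha> * u - \<beta> * cnj u)" by (simp add: L_def algebra_simps)
  also have "norm (\<i> * (\<alpha> * u - \<beta> * cnj u)) = norm (\<alpha> * u - \<beta> * cnj u)" by (simp add: norm_mult)
  also have "norm (\<alpha> * u - \<beta> * cnj u) = norm \<alpha> - norm \<beta>"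
  proof -
   have "(norm (\<alpha> * u - \<beta> * cnj u))\<^sup>2 + (norm (\<alpha> * u + \<beta> * cnj u))\<^sup>2 = 2 * ((norm \<alpha>)\<^sup>2 + (norm \<beta>)\<^sup>2)"
    using complex_parallelogram_law[of "\<alpha> * u" "\<beta> * cnj u"] u(1) by (simp add: norm_mult)
   moreover have "norm (\<alpha> * u + \<beta> * cnj u) = norm \<alpha> + norm \<beta>" using u(2) by (simp add: L_def)
   ultimately have "(norm (\<alpha> * u - \<beta> * cnj u))\<^sup>2 = (norm \<alpha> - norm \<beta>)\<^sup>2"
    by (simp add: power2_eq_square algebra_simps)
   then show ?thesis using \<beta> by (simp add: power2_eq_iff_nonneg)
  qed
  finally show ?thesis .
 qed
 have I: "I = norm \<alpha> - norm \<beta>" using I1 I2 by simp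
 have "onorm L / I \<le> K" using K unfolding dcd_def I_def L_def .
 then have "onorm L \<le> K * I" using I \<beta> by (simp add: pos_divide_le_eq)
 then show ?thesis using on I by simp
qed

lemma lin_part_props:
 assumes "Im (cnj (z2 - z1) * (z3 - z1)) \<noteq> 0"
 shows "linear (lin_part z1 z2 z3 w1 w2 w3)"
  and "lin_part z1 z2 z3 w1 w2 w3 (z2 - z1) = w2 - w1"
  and "lin_part z1 z2 z3 w1 w2 w3 (z3 - z1) = w3 - w1"
proof -
 define d2 where "d2 = z2 - z1" define d3 where "d3 = z3 - z1"
 define D where "D = Im (cnj d2 * d3)"
 have D: "D \<noteq> 0" using assms by (simp add: D_def d2_def d3_def)
 have rep: "z = (Im (cnj z * d3) / D) *\<^sub>R d2 + (Im (cnj d2 * z) / D) *\<^sub>R d3" for z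
 proof -
  have "D *\<^sub>R z = Im (cnj z * d3) *\<^sub>R d2 + Im (cnj d2 * z) *\<^sub>R d3"
   by (simp add: D_def complex_eq_iff algebra_simps)
  then have "z = (1 / D) *\<^sub>R (Im (cnj z * d3) *\<^sub>R d2 + Im (cnj d2 * z) *\<^sub>R d3)"
   using D by (metis divide_self_if one_divide_eq_0_iff scaleR_one scaleR_scaleR times_divide_eq_left mult_1)
  then show ?thesis by (simp add: scaleR_add_right)
 qed
 let ?P = "\<lambda>L. linear L \<and> L d2 = w2 - w1 \<and> L d3 = w3 - w1"
 define L where "L z = (Im (cnj z * d3) / D) *\<^sub>R (w2 - w1) + (Im (cnj d2 * z) / D) *\<^sub>R (w3 - w1)" for z
 have "linear L" by (rule linearI) (simp_all add: L_def algebra_simps add_divide_distrib diff_divide_distrib)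
 moreover have z: "Im (cnj d2 * d2) = 0" "Im (cnj d3 * d3) = 0" by simp_all
 moreover have "L d2 = w2 - w1" "L d3 = w3 - w1"
  unfolding L_def z D_def[symmetric] using D by simp_all
 ultimately have PL: "?P L" by simp
 have un: "L' = L" if "?P L'" for L'
 proof
  fix z
  interpret L': linear L' using that by simp
  have "L' z = L' ((Im (cnj z * d3) / D) *\<^sub>R d2 + (Im (cnj d2 * z) / D) *\<^sub>R d3)" using rep[of z] by simp
  also have "\<dots> = L z" using that by (simp only: L'.add L'.scale L_def)
  finally show "L' z = L z" .
 qed
 have "?P (lin_part z1 z2 z3 w1 w2 w3)"
  unfolding lin_part_def d2_def[symmetric] d3_def[symmetric] by (rule theI[of ?P, OF PL un])
 then show "linear (lin_part z1 z2 z3 w1 w2 w3)"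
  "lin_part z1 z2 z3 w1 w2 w3 (z2 - z1) = w2 - w1"
  "lin_part z1 z2 z3 w1 w2 w3 (z3 - z1) = w3 - w1" by (simp_all add: d2_def d3_def)
qed

text \<open>Only differences of points matter, although the definition singles out the first one.
  This is needed because the triple of a refined face is known only up to cyclic rotation of the
  lattice triangle that it fills.\<close>

lemma lin_part_rotate: "lin_part z2 z3 z1 w2 w3 w1 = lin_part z1 z2 z3 w1 w2 w3"
proof -
 have "(linear L \<and> L (z3 - z2) = w3 - w2 \<and> L (z1 - z2) = w1 - w2) \<longleftrightarrow> (linear L \<and> L (z2 - z1) = w2 - w1 \<and> L (z3 - z1) = w3 - w1)" for L
 proof (cases "linear L")
  case True
  then have "L (z3 - z2) = L z3 - L z2" "L (z1 - z2) = L z1 - L z2" "L (z2 - z1) = L z2 - L z1" "L (z3 - z1) = L z3 - L z1"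
   by (simp_all add: linear_diff)
  moreover have "(c - b = w3 - w2 \<and> a - b = w1 - w2) \<longleftrightarrow> (b - a = w2 - w1 \<and> c - a = w3 - w1)" for a b c :: complex
  proof -
   have e: "b - a = - (a - b)" "c - a = (c - b) - (a - b)" "a - b = - (b - a)" "c - b = (c - a) - (b - a)" by simp_all
   show ?thesis
   proof
    assume "c - b = w3 - w2 \<and> a - b = w1 - w2"
    then show "b - a = w2 - w1 \<and> c - a = w3 - w1" unfolding e(1,2) by simp
   next
    assume "b - a = w2 - w1 \<and> c - a = w3 - w1"
    then show "c - b = w3 - w2 \<and> a - b = w1 - w2" unfolding e(3,4) by simp
   qed
  qed
  ultimately show ?thesis using True by simp
 qed simp
 then show ?thesis unfolding lin_part_def by simp
qed

lemma norm_combination_lower: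
 assumes \<Delta>: "Im (cnj D2 * D3) = \<Delta>" "\<Delta> > 0" and M: "norm D2 \<le> M" "norm D3 \<le> M"
 shows "\<Delta> * (\<bar>s\<bar> + \<bar>t\<bar>) \<le> 2 * M * norm (s *\<^sub>R D2 + t *\<^sub>R D3)"
proof -
 define z where "z = s *\<^sub>R D2 + t *\<^sub>R D3"
 have "Im (cnj z * D3) = s * \<Delta>" "Im (cnj D2 * z) = t * \<Delta>"
  using \<Delta>(1) by (simp_all add: z_def algebra_simps)
 then have "\<bar>s\<bar> * \<Delta> = \<bar>Im (cnj z * D3)\<bar>" "\<bar>t\<bar> * \<Delta> = \<bar>Im (cnj D2 * z)\<bar>"
  using \<Delta>(2) by (simp_all add: abs_mult)
 moreover have "\<bar>Im (cnj z * D3)\<bar> \<le> norm z * M"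
  using abs_Im_le_cmod[of "cnj z * D3"] M(2) mult_left_mono[OF M(2), of "norm z"] by (simp add: norm_mult)
 moreover have "\<bar>Im (cnj D2 * z)\<bar> \<le> norm z * M"
  using abs_Im_le_cmod[of "cnj D2 * z"] mult_right_mono[OF M(1), of "norm z"] by (simp add: norm_mult mult.commute)
 ultimately show ?thesis unfolding z_def[symmetric] by (simp add: algebra_simps)
qed

text \<open>A real linear map that nearly agrees with multiplication by \<open>a\<close> on a basis
  does so on all unit vectors, with a loss that depends on the shape of the basis through M and
  \<Delta>. Of the constant 4, one factor 2 comes from expanding a unit vector in the basis, the
  other from replacing \<open>norm a\<close> by \<open>2 * norm \<alpha>\<close>.\<close>

lemma near_conformal:
 assumes L: "linear L" and \<Delta>: "Im (cnj D2 * D3) = \<Delta>" "\<Delta> > 0" and M: "norm D2 \<le> M" "norm D3 \<le> M"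
  and dev: "norm (L D2 - a * D2) \<le> \<tau> * norm a" "norm (L D3 - a * D3) \<le> \<tau> * norm a"
  and \<tau>: "\<tau> \<ge> 0" "4 * M * \<tau> \<le> \<Delta>"
 obtains \<alpha> \<beta> where "\<And>z. L z = \<alpha> * z + \<beta> * cnj z" "norm \<beta> \<le> (4 * M * \<tau> / \<Delta>) * norm \<alpha>"
proof -
 obtain \<alpha> \<beta> where L': "\<And>z. L z = \<alpha> * z + \<beta> * cnj z" using complex_linear_decomp[OF L] by blast
 \<comment> \<open>Aligned so that a single evaluation bounds \<open>norm (\<alpha> - a)\<close> and
   \<open>norm \<beta>\<close> together.\<close>
 obtain u where u: "norm u = 1" "norm ((\<alpha> - a) * u + \<beta> * cnj u) = norm (\<alpha> - a) + norm \<beta>"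
  using exists_aligned_unit[of "\<alpha> - a" \<beta>] by blast
 define s where "s = Im (cnj u * D3) / \<Delta>" define t where "t = Im (cnj D2 * u) / \<Delta>"
 have ust: "u = s *\<^sub>R D2 + t *\<^sub>R D3"
 proof -
  have "\<Delta> *\<^sub>R u = Im (cnj u * D3) *\<^sub>R D2 + Im (cnj D2 * u) *\<^sub>R D3"
   unfolding \<Delta>(1)[symmetric] by (simp add: complex_eq_iff algebra_simps)
  then have "(1 / \<Delta>) *\<^sub>R (\<Delta> *\<^sub>R u) = s *\<^sub>R D2 + t *\<^sub>R D3" by (simp add: s_def t_def scaleR_add_right)
  then show ?thesis using \<Delta>(2) by simp
 qed
 interpret linear L by fact
 have "(\<alpha> - a) * u + \<beta> * cnj u = L u - a * u" by (simp add: L' algebra_simps)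
 also have "\<dots> = s *\<^sub>R (L D2 - a * D2) + t *\<^sub>R (L D3 - a * D3)"
  unfolding ust add scale by (simp add: algebra_simps)
 also have "norm \<dots> \<le> \<bar>s\<bar> * (\<tau> * norm a) + \<bar>t\<bar> * (\<tau> * norm a)"
  by (rule order_trans[OF norm_triangle_ineq]) (use dev in \<open>auto intro!: add_mono mult_left_mono\<close>)
 also have "\<dots> = (\<bar>s\<bar> + \<bar>t\<bar>) * (\<tau> * norm a)" by (simp add: algebra_simps)
 also have "\<dots> \<le> (2 * M / \<Delta>) * (\<tau> * norm a)"
  using norm_combination_lower[OF \<Delta> M, of s t] ust u(1) \<Delta>(2) \<tau>(1) by (intro mult_right_mono) (auto simp: field_simps)
 finally have *: "norm (\<alpha> - a) + norm \<beta> \<le> (2 * M * \<tau> / \<Delta>) * norm a" using u(2) by simp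
 have half: "2 * M * \<tau> / \<Delta> \<le> 1 / 2" using \<tau>(2) \<Delta>(2) by (simp add: field_simps)
 have "(2 * M * \<tau> / \<Delta>) * norm a \<le> norm a / 2" using mult_right_mono[OF half, of "norm a"] by simp
 moreover have "norm a \<le> norm \<alpha> + norm (\<alpha> - a)" using norm_triangle_ineq4[of \<alpha> "\<alpha> - a"] by simp
 ultimately have a2: "norm a \<le> 2 * norm \<alpha>" using * norm_ge_zero[of \<beta>] by linarith
 have M0: "M \<ge> 0" using M(1) norm_ge_zero order_trans by blast
 have "norm \<beta> \<le> (2 * M * \<tau> / \<Delta>) * norm a" using * norm_ge_zero[of "\<alpha> - a"] by linarith
 also have "\<dots> \<le> (2 * M * \<tau> / \<Delta>) * (2 * norm \<alpha>)" using a2 M0 \<tau> \<Delta> by (intro mult_left_mono) auto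
 finally show ?thesis using that L' by simp
qed

text \<open>The error is relative to \<open>norm (deriv \<psi> u)\<close>, whose minimum over the
  compact set is positive; this keeps later estimates independent of the scale of the chart. Uniform
  continuity of the derivative is taken on a closed neighbourhood of K, since the segment from u to
  v may leave K.\<close>

lemma uniform_complex_derivative:
 fixes \<psi> :: "complex => complex"
 assumes V: "open V" and hol: "\<psi> holomorphic_on V" and K: "compact K" "K \<subseteq> V"
  and nz: "\<And>u. u \<in> K ==> deriv \<psi> u \<noteq> 0" and e: "e > 0"
 obtains d where "d > 0" "\<And>u v. u \<in> K ==> norm (v - u) < d ==> norm (\<psi> v - \<psi> u - deriv \<psi> u * (v - u)) \<le> e * norm (deriv \<psi> u) * norm (v - u)"
proof (cases "K = {}")
 case True
 then show ?thesis using that[of 1] by simp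
next
 case False
 have hd: "deriv \<psi> holomorphic_on V" using hol V by (rule holomorphic_deriv)
 have contd: "continuous_on V (deriv \<psi>)" using hd holomorphic_on_imp_continuous_on by blast
 obtain r where r: "r > 0" "(\<Union>x\<in>K. cball x r) \<subseteq> V"
  using compact_subset_open_imp_cball_epsilon_subset[OF K(1) V K(2)] by blast
 define K' where "K' = (\<Union>x\<in>K. cball x r)"
 have cK': "compact K'" unfolding K'_def
 proof -
  have "(\<Union>x\<in>K. cball x r) = {x + y |x y. x \<in> K \<and> y \<in> cball 0 r}"
  proof (intro set_eqI iffI)
   fix w assume "w \<in> (\<Union>x\<in>K. cball x r)"
   then obtain x where "x \<in> K" "dist x w \<le> r" by auto
   then show "w \<in> {x + y |x y. x \<in> K \<and> y \<in> cball 0 r}"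
    by (intro CollectI exI[of _ x] exI[of _ "w - x"]) (simp add: dist_norm norm_minus_commute)
  next
   fix w assume "w \<in> {x + y |x y. x \<in> K \<and> y \<in> cball 0 r}"
   then obtain x y where xy: "w = x + y" "x \<in> K" "norm y \<le> r" by auto
   then have "w \<in> cball x r" by (simp add: dist_norm)
   then show "w \<in> (\<Union>x\<in>K. cball x r)" using xy by blast
  qed
  then show "compact (\<Union>x\<in>K. cball x r)" using compact_sums[OF K(1) compact_cball, of 0 r] by (simp only:)
 qed
 have uc: "uniformly_continuous_on K' (deriv \<psi>)"
  using compact_uniformly_continuous[OF continuous_on_subset[OF contd] cK'] r(2) K'_def by blast
 have "continuous_on K (\<lambda>u. norm (deriv \<psi> u))" using contd K(2) by (intro continuous_on_norm continuous_on_subset[OF contd])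
 then obtain u0 where u0: "u0 \<in> K" "\<And>u. u \<in> K ==> norm (deriv \<psi> u0) \<le> norm (deriv \<psi> u)"
  using continuous_attains_inf[OF K(1) False] by blast
 define m where "m = norm (deriv \<psi> u0)"
 have m: "m > 0" using nz[OF u0(1)] by (simp add: m_def)
 obtain d where d: "d > 0" "\<And>x y. x \<in> K' ==> y \<in> K' ==> dist y x < d ==> dist (deriv \<psi> y) (deriv \<psi> x) < e * m"
  using uc[unfolded uniformly_continuous_on_def, rule_format, of "e * m"] e m by (metis mult_pos_pos)
 show ?thesis
 proof (rule that[of "min d r"])
  fix u v assume u: "u \<in> K" and v: "norm (v - u) < min d r"
  have sub: "cball u (norm (v - u)) \<subseteq> K'" using u v by (auto simp: K'_def intro!: bexI[of _ u])
  have "norm ((\<psi> v - deriv \<psi> u * v) - (\<psi> u - deriv \<psi> u * u)) \<le> (e * m) * norm (v - u)"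
  proof (rule field_differentiable_bound[where S = "cball u (norm (v - u))"])
   fix x assume x: "x \<in> cball u (norm (v - u))"
   then have xK: "x \<in> K'" using sub by blast
   then have "x \<in> V" using r(2) K'_def by blast
   then have "(\<psi> has_field_derivative deriv \<psi> x) (at x)" using hol V by (simp add: holomorphic_derivI)
   then show "((\<lambda>x. \<psi> x - deriv \<psi> u * x) has_field_derivative deriv \<psi> x - deriv \<psi> u) (at x within cball u (norm (v - u)))"
    by (auto intro!: derivative_eq_intros intro: has_field_derivative_at_within)
   have "u \<in> K'" using u r by (auto simp: K'_def intro!: bexI[of _ u])
   moreover have "dist x u < d" using x v by (simp add: dist_commute)
   ultimately show "norm (deriv \<psi> x - deriv \<psi> u) \<le> e * m" using d(2)[of u x] xK by (simp add: dist_norm less_imp_le)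
  qed (auto simp: dist_norm norm_minus_commute)
  also have "\<dots> \<le> (e * norm (deriv \<psi> u)) * norm (v - u)"
   using u0(2)[OF u] e by (intro mult_right_mono mult_left_mono) (auto simp: m_def)
  finally show "norm (\<psi> v - \<psi> u - deriv \<psi> u * (v - u)) \<le> e * norm (deriv \<psi> u) * norm (v - u)"
   by (simp add: algebra_simps)
 qed (use d r in auto)
qed

text \<open>In the chart the small triangle is nearly a similar copy of its planar shape, scaled by
  the derivative of \<psi>, and the bound on the distortion makes the affine map from the chart
  nearly complex linear. Their composition sends D2 and D3 nearly to the same complex multiple of
  themselves, so \<open>near_conformal\<close> applies.\<close>

lemma distortion_estimate:
 fixes \<psi> :: "complex => complex"
 assumes V: "open V" and hol: "\<psi> holomorphic_on V" and Kc: "compact Kc" "Kc \<subseteq> V"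
  and nz: "\<And>u. u \<in> Kc ==> deriv \<psi> u \<noteq> 0" and \<tau>: "\<tau> > 0" and \<Delta>: "\<Delta> > 0" and M: "M > 0"
 obtains \<eta> h0 where "\<eta> > 0" "h0 > 0"
  "\<And>K h u D2 D3 w1 w2 w3. K \<le> 1 + \<eta> ==> 0 < h ==> h < h0 ==> u \<in> Kc ==> norm D2 \<le> M ==> norm D3 \<le> M ==>
   Im (cnj D2 * D3) = \<Delta> ==>
   orient_pos (lin_part (\<psi> u) (\<psi> (u + of_real h * D2)) (\<psi> (u + of_real h * D3)) w1 w2 w3) ==>
   dcd (lin_part (\<psi> u) (\<psi> (u + of_real h * D2)) (\<psi> (u + of_real h * D3)) w1 w2 w3) \<le> K ==>
   \<exists>\<alpha> \<beta>. norm \<beta> \<le> \<tau> * norm \<alpha> \<and> w2 - w1 = \<alpha> * (of_real h * D2) + \<beta> * cnj (of_real h * D2) \<and>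
      w3 - w1 = \<alpha> * (of_real h * D3) + \<beta> * cnj (of_real h * D3)"
proof -
 \<comment> \<open>The second entry keeps the triangle in the chart nondegenerate; the third makes
   the accumulated error \<open>3 * \<epsilon> * M\<close> small enough for
   \<open>near_conformal\<close> to return \<tau>.\<close>
 define \<epsilon> where "\<epsilon> = min 1 (min (\<Delta> / (4 * M * M)) (min \<tau> 1 * \<Delta> / (16 * M * M)))"
 have \<epsilon>: "\<epsilon> > 0" using \<Delta> M \<tau> by (simp add: \<epsilon>_def)
 have \<epsilon>1: "\<epsilon> \<le> 1" "\<epsilon> * (4 * M * M) \<le> \<Delta>" "\<epsilon> * (16 * M * M) \<le> min \<tau> 1 * \<Delta>"
  using M by (auto simp: \<epsilon>_def min_le_iff_disj pos_le_divide_eq[symmetric])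
 obtain d where d: "d > 0" "\<And>u v. u \<in> Kc ==> norm (v - u) < d ==> norm (\<psi> v - \<psi> u - deriv \<psi> u * (v - u)) \<le> \<epsilon> * norm (deriv \<psi> u) * norm (v - u)"
  using uniform_complex_derivative[OF V hol Kc nz \<epsilon>] by blast
 show ?thesis
 proof (rule that[of \<epsilon> "d / M", OF \<epsilon>])
  show "d / M > 0" using d M by simp
  fix K h u D2 D3 w1 w2 w3
  assume K: "K \<le> 1 + \<epsilon>" and h: "0 < h" "h < d / M" and u: "u \<in> Kc" and D: "norm D2 \<le> M" "norm D3 \<le> M"
   and \<Delta>D: "Im (cnj D2 * D3) = \<Delta>"
   and op: "orient_pos (lin_part (\<psi> u) (\<psi> (u + of_real h * D2)) (\<psi> (u + of_real h * D3)) w1 w2 w3)"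
   and dc: "dcd (lin_part (\<psi> u) (\<psi> (u + of_real h * D2)) (\<psi> (u + of_real h * D3)) w1 w2 w3) \<le> K"
  define m where "m = deriv \<psi> u"
  have m: "m \<noteq> 0" using nz[OF u] by (simp add: m_def)
  define err where "err D = (\<psi> (u + of_real h * D) - \<psi> u) / (m * of_real h) - D" for D
  have eq: "\<psi> (u + of_real h * D) - \<psi> u = of_real h * (m * (D + err D))" for D
   using m h by (simp add: err_def field_simps)
  have errb: "norm (err D) \<le> \<epsilon> * M" if "norm D \<le> M" for D
  proof -
   have "h * norm D < d"
   proof -
    have "h * M < d" using h M by (simp add: pos_less_divide_eq)
    moreover have "h * norm D \<le> h * M" using that h by (intro mult_left_mono) auto
    ultimately show ?thesis by linarith
   qed
   then have "norm (\<psi> (u + of_real h * D) - \<psi> u - m * (of_real h * D)) \<le> \<epsilon> * norm m * (h * norm D)"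
    using d(2)[OF u, of "u + of_real h * D"] h by (simp add: m_def norm_mult)
   moreover have "\<psi> (u + of_real h * D) - \<psi> u - m * (of_real h * D) = of_real h * m * err D"
    unfolding eq by (simp add: algebra_simps)
   ultimately have "(h * norm m) * norm (err D) \<le> (h * norm m) * (\<epsilon> * norm D)" using h by (simp add: norm_mult algebra_simps)
   then have "norm (err D) \<le> \<epsilon> * norm D" using h m by simp
   also have "\<dots> \<le> \<epsilon> * M" using that \<epsilon> by simp
   finally show ?thesis .
  qed
  define e2 where "e2 = err D2" define e3 where "e3 = err D3"
  have e23: "norm e2 \<le> \<epsilon> * M" "norm e3 \<le> \<epsilon> * M" using errb D by (auto simp: e2_def e3_def)
  have det: "Im (cnj (D2 + e2) * (D3 + e3)) \<noteq> 0"
  proof -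
   have "\<bar>Im (cnj (D2 + e2) * (D3 + e3)) - \<Delta>\<bar> = \<bar>Im (cnj e2 * D3 + cnj D2 * e3 + cnj e2 * e3)\<bar>"
    unfolding \<Delta>D[symmetric] by (simp add: algebra_simps)
   also have "\<dots> \<le> norm (cnj e2 * D3 + cnj D2 * e3 + cnj e2 * e3)" by (rule abs_Im_le_cmod)
   also have "\<dots> \<le> norm e2 * norm D3 + norm D2 * norm e3 + norm e2 * norm e3"
    by (rule order_trans[OF norm_triangle_ineq add_mono[OF norm_triangle_ineq[THEN order_trans] order_refl, THEN order_trans]]) (auto simp: norm_mult)
   also have "\<dots> \<le> \<epsilon> * M * M + M * (\<epsilon> * M) + \<epsilon> * M * (\<epsilon> * M)"
    using e23 D \<epsilon> M by (intro add_mono mult_mono) auto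
   also have "\<dots> \<le> 3 * (\<epsilon> * M * M)"
    using mult_right_mono[OF \<epsilon>1(1), of "\<epsilon> * M * M"] \<epsilon> M by (simp add: algebra_simps)
   also have "\<dots> < \<epsilon> * (4 * M * M)" using \<epsilon> M by simp
   finally show ?thesis using \<epsilon>1(2) by linarith
  qed
  define L' where "L' = lin_part (\<psi> u) (\<psi> (u + of_real h * D2)) (\<psi> (u + of_real h * D3)) w1 w2 w3"
  have det': "Im (cnj (\<psi> (u + of_real h * D2) - \<psi> u) * (\<psi> (u + of_real h * D3) - \<psi> u)) \<noteq> 0"
  proof -
   have "cnj (\<psi> (u + of_real h * D2) - \<psi> u) * (\<psi> (u + of_real h * D3) - \<psi> u)
     = of_real (h\<^sup>2 * (norm m)\<^sup>2) * (cnj (D2 + e2) * (D3 + e3))"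
    unfolding eq e2_def[symmetric] e3_def[symmetric]
    using complex_norm_square[of m] by (simp add: power2_eq_square algebra_simps)
   moreover have "Im (of_real r * w) = r * Im w" for r w by simp
   ultimately have "Im (cnj (\<psi> (u + of_real h * D2) - \<psi> u) * (\<psi> (u + of_real h * D3) - \<psi> u)) = (h\<^sup>2 * (norm m)\<^sup>2) * Im (cnj (D2 + e2) * (D3 + e3))"
    by (simp only:)
   then show ?thesis using det h m by (simp del: complex_cnj_add complex_cnj_diff)
  qed
  note lp = lin_part_props[OF det', of w1 w2 w3, folded L'_def]
  obtain \<alpha>' \<beta>' where L': "\<And>z. L' z = \<alpha>' * z + \<beta>' * cnj z" using complex_linear_decomp[OF lp(1)] by blast
  have L'fun: "L' = (\<lambda>z. \<alpha>' * z + \<beta>' * cnj z)" using L' by (simp add: fun_eq_iff)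
  have b1: "norm \<beta>' < norm \<alpha>'" using op unfolding L'_def[symmetric] unfolding L'fun orient_pos_iff .
  have "norm \<alpha>' + norm \<beta>' \<le> K * (norm \<alpha>' - norm \<beta>')"
   using dcd_bound[OF b1, of K] dc unfolding L'_def[symmetric] unfolding L'fun .
  also have "\<dots> \<le> (1 + \<epsilon>) * (norm \<alpha>' - norm \<beta>')" using K b1 by (intro mult_right_mono) auto
  finally have "(2 + \<epsilon>) * norm \<beta>' \<le> \<epsilon> * norm \<alpha>'" by (simp add: algebra_simps)
  moreover have "1 * norm \<beta>' \<le> (2 + \<epsilon>) * norm \<beta>'" using \<epsilon> by (intro mult_right_mono) auto
  ultimately have b2: "norm \<beta>' \<le> \<epsilon> * norm \<alpha>'" by linarith
  define a where "a = \<alpha>' * m"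
  have dev: "norm (D' - a * D) \<le> (3 * \<epsilon> * M) * norm a" if DM: "norm D \<le> M" and D': "of_real h * D' = L' (\<psi> (u + of_real h * D) - \<psi> u)" for D D'
  proof -
   have "of_real h * D' = of_real h * (\<alpha>' * (m * (D + err D)) + \<beta>' * cnj (m * (D + err D)))"
    unfolding D' eq L' by (simp add: algebra_simps)
   then have "D' = \<alpha>' * (m * (D + err D)) + \<beta>' * cnj (m * (D + err D))" using h by simp
   then have "D' - a * D = a * err D + \<beta>' * cnj m * cnj (D + err D)" by (simp add: a_def algebra_simps)
   also have "norm \<dots> \<le> norm a * norm (err D) + norm \<beta>' * norm m * norm (D + err D)"
    by (rule order_trans[OF norm_triangle_ineq]) (simp add: norm_mult del: complex_cnj_add)
   also have "\<dots> \<le> norm a * (\<epsilon> * M) + (\<epsilon> * norm \<alpha>') * norm m * (M + \<epsilon> * M)"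
    using errb[OF DM] DM b2 \<epsilon> norm_triangle_ineq[of D "err D"]
    by (intro add_mono mult_mono) (auto simp: mult_nonneg_nonneg)
   also have "\<dots> = norm a * (\<epsilon> * M) * (2 + \<epsilon>)" by (simp add: a_def norm_mult algebra_simps)
   also have "\<dots> \<le> norm a * (\<epsilon> * M) * 3" using \<epsilon>1 \<epsilon> M by (intro mult_left_mono) auto
   finally show ?thesis by (simp add: algebra_simps)
  qed
  \<comment> \<open>The affine piece as a linear map in the planar coordinate, rescaled by 1/h:
    Cramer's rule expands z in D2 and D3, these are replaced by the edges of the triangle in the
    chart, and L' is applied.\<close>
  define L where "L z = L' (of_real (Im (cnj z * D3) / \<Delta>) * (\<psi> (u + of_real h * D2) - \<psi> u) + of_real (Im (cnj D2 * z) / \<Delta>) * (\<psi> (u + of_real h * D3) - \<psi> u)) / of_real h" for z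
  have linL: "linear L"
   by (rule linearI) (simp_all add: L_def L' algebra_simps add_divide_distrib diff_divide_distrib scaleR_conv_of_real)
  have LD2: "of_real h * L D2 = L' (\<psi> (u + of_real h * D2) - \<psi> u)" and LD3: "of_real h * L D3 = L' (\<psi> (u + of_real h * D3) - \<psi> u)"
  proof -
   have "Im (cnj D2 * D2) = 0" "Im (cnj D3 * D3) = 0" by simp_all
   then show "of_real h * L D2 = L' (\<psi> (u + of_real h * D2) - \<psi> u)" "of_real h * L D3 = L' (\<psi> (u + of_real h * D3) - \<psi> u)"
    using h \<Delta> unfolding L_def \<Delta>D by simp_all
  qed
  have t1: "3 * \<epsilon> * M \<ge> 0" using \<epsilon> M by simp
  have t2: "4 * M * (3 * \<epsilon> * M) \<le> min \<tau> 1 * \<Delta>"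
  proof -
   have "4 * M * (3 * \<epsilon> * M) \<le> \<epsilon> * (16 * M * M)" using \<epsilon> M by (simp add: algebra_simps)
   then show ?thesis using \<epsilon>1(3) by linarith
  qed
  have t3: "4 * M * (3 * \<epsilon> * M) \<le> \<Delta>"
  proof -
   have "min \<tau> 1 * \<Delta> \<le> 1 * \<Delta>" using \<Delta> by (intro mult_right_mono) auto
   then show ?thesis using t2 by linarith
  qed
  obtain \<alpha> \<beta> where ab: "\<And>z. L z = \<alpha> * z + \<beta> * cnj z" "norm \<beta> \<le> (4 * M * (3 * \<epsilon> * M) / \<Delta>) * norm \<alpha>"
   using near_conformal[OF linL \<Delta>D \<Delta> D dev[OF D(1) LD2] dev[OF D(2) LD3] t1 t3] by blast
  have "4 * M * (3 * \<epsilon> * M) / \<Delta> \<le> \<tau>"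
  proof -
   have "min \<tau> 1 * \<Delta> \<le> \<tau> * \<Delta>" using \<Delta> by (intro mult_right_mono) auto
   then have "4 * M * (3 * \<epsilon> * M) \<le> \<tau> * \<Delta>" using t2 by linarith
   then show ?thesis using \<Delta> by (simp add: pos_divide_le_eq)
  qed
  then have "norm \<beta> \<le> \<tau> * norm \<alpha>" using ab(2) mult_right_mono[of _ \<tau> "norm \<alpha>"] by (meson norm_ge_zero order_trans)
  moreover have "w2 - w1 = of_real h * L D2" "w3 - w1 = of_real h * L D3" using lp(2,3) LD2 LD3 by simp_all
  then have "w2 - w1 = \<alpha> * (of_real h * D2) + \<beta> * cnj (of_real h * D2)"
    "w3 - w1 = \<alpha> * (of_real h * D3) + \<beta> * cnj (of_real h * D3)"
   unfolding ab(1) by (simp_all add: algebra_simps)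
  ultimately show "\<exists>\<alpha> \<beta>. norm \<beta> \<le> \<tau> * norm \<alpha> \<and> w2 - w1 = \<alpha> * (of_real h * D2) + \<beta> * cnj (of_real h * D2) \<and>
      w3 - w1 = \<alpha> * (of_real h * D3) + \<beta> * cnj (of_real h * D3)" by blast
 qed
qed

text \<open>Disjoint balls in the unit disc have total area at most pi. This is the only place where
  area is measured.\<close>

lemma ball_packing:
 fixes x :: "'i => complex"
 assumes I: "finite I" and \<rho>: "\<And>i. i \<in> I ==> \<rho> i \<ge> 0" and sub: "\<And>i. i \<in> I ==> ball (x i) (\<rho> i) \<subseteq> cball 0 1"
  and disj: "\<And>i j. i \<in> I ==> j \<in> I ==> i \<noteq> j ==> ball (x i) (\<rho> i) \<inter> ball (x j) (\<rho> j) = {}"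
 shows "(\<Sum>i\<in>I. (\<rho> i)\<^sup>2) \<le> 1"
proof -
 have m: "measure lborel (ball (x i) (\<rho> i)) = pi * (\<rho> i)\<^sup>2" if "i \<in> I" for i
  using content_ball[OF \<rho>[OF that], of "x i"] by (simp add: unit_ball_vol_2)
 have "pi * (\<Sum>i\<in>I. (\<rho> i)\<^sup>2) = (\<Sum>i\<in>I. measure lborel (ball (x i) (\<rho> i)))"
  unfolding sum_distrib_left using m by simp
 also have "\<dots> = measure lborel (\<Union>i\<in>I. ball (x i) (\<rho> i))"
 proof (rule measure_finite_Union[symmetric, OF I])
  show "emeasure lborel (ball (x i) (\<rho> i)) \<noteq> \<infinity>" for i
   using emeasure_bounded_finite[OF bounded_ball, of "x i" "\<rho> i"] by force
 qed (use disj in \<open>auto simp: disjoint_family_on_def\<close>)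
 also have "\<dots> \<le> measure lborel (cball (0::complex) 1)"
 proof (rule measure_mono_fmeasurable)
  show "(\<Union>i\<in>I. ball (x i) (\<rho> i)) \<subseteq> cball 0 1" using sub by blast
  show "cball (0::complex) 1 \<in> fmeasurable lborel"
   using emeasure_bounded_finite[OF bounded_cball, of "0::complex" 1] by (intro fmeasurableI) auto
 qed (use I in auto)
 also have "\<dots> = pi" using content_cball[of 1 "0::complex"] by (simp add: unit_ball_vol_2)
 finally show ?thesis by simp
qed

text \<open>Affine in the planar coordinate, not in the lattice coordinate: \<alpha> is the complex
  linear coefficient there, and \<beta> measures the failure to be conformal.\<close>

definition aff_on :: "(complex => complex) => complex => complex => complex => complex => complex set => bool" where
 "aff_on G B C \<alpha> \<beta> S \<longleftrightarrow> (\<forall>p\<in>S. \<forall>q\<in>S. G p - G q = \<alpha> * tmap B C (p - q) + \<beta> * cnj (tmap B C (p - q)))"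

definition up_tri :: "real => int => int => complex set" where
 "up_tri N i j = convex hull {pt N i j, pt N (i+1) j, pt N i (j+1)}"

definition down_tri :: "real => int => int => complex set" where
 "down_tri N i j = convex hull {pt N (i+1) j, pt N (i+1) (j+1), pt N i (j+1)}"

lemma in_up_tri:
 assumes N: "N > 0" and "of_int i \<le> Re z * N" "of_int j \<le> Im z * N" "Re z * N + Im z * N \<le> of_int i + of_int j + 1"
 shows "z \<in> up_tri N i j"
proof -
 define u where "u = Re z * N - of_int i" define v where "v = Im z * N - of_int j"
 have "z = (1 - u - v) *\<^sub>R pt N i j + u *\<^sub>R pt N (i+1) j + v *\<^sub>R pt N i (j+1)"
  using N by (simp add: complex_eq_iff pt_def u_def v_def field_simps)
 moreover have "0 \<le> 1 - u - v" "0 \<le> u" "0 \<le> v" using assms by (simp_all add: u_def v_def)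
 moreover have "1 - u - v + u + v = 1" by simp
 ultimately show ?thesis unfolding up_tri_def convex_hull_3 by blast
qed

lemma in_down_tri:
 assumes N: "N > 0" and "Re z * N \<le> of_int i + 1" "Im z * N \<le> of_int j + 1" "Re z * N + Im z * N \<ge> of_int i + of_int j + 1"
 shows "z \<in> down_tri N i j"
proof -
 define u where "u = of_int i + 1 - Re z * N" define v where "v = of_int j + 1 - Im z * N"
 have "z = v *\<^sub>R pt N (i+1) j + (1 - u - v) *\<^sub>R pt N (i+1) (j+1) + u *\<^sub>R pt N i (j+1)"
  using N by (simp add: complex_eq_iff pt_def u_def v_def field_simps)
 moreover have "0 \<le> 1 - u - v" "0 \<le> u" "0 \<le> v" using assms by (simp_all add: u_def v_def)
 moreover have "v + (1 - u - v) + u = 1" by simp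
 ultimately show ?thesis unfolding down_tri_def convex_hull_3 by blast
qed

lemma aff_on_seg_ok:
 assumes aff: "aff_on G B C \<alpha> \<beta> S" and S: "convex S" "p \<in> S" "q \<in> S"
  and \<beta>: "norm \<beta> \<le> norm \<alpha>" and s: "2 * norm \<alpha> * norm (tmap B C (p - q)) \<le> s"
 shows "seg_ok G s p q"
 unfolding seg_ok_def
proof
 have "norm (G p - G q) \<le> norm \<alpha> * norm (tmap B C (p - q)) + norm \<beta> * norm (tmap B C (p - q))"
  using aff S unfolding aff_on_def by (simp add: norm_mult norm_triangle_ineq[THEN order_trans])
 also have "\<dots> \<le> norm \<alpha> * norm (tmap B C (p - q)) + norm \<alpha> * norm (tmap B C (p - q))"
  using \<beta> by (intro add_mono mult_right_mono) auto
 finally show "norm (G p - G q) \<le> s" using s by simp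
 show "G ` closed_segment p q \<subseteq> closed_segment (G p) (G q)"
 proof clarify
  fix w assume w: "w \<in> closed_segment p q"
  then obtain t where t: "w = (1 - t) *\<^sub>R p + t *\<^sub>R q" "0 \<le> t" "t \<le> 1" unfolding closed_segment_def by auto
  have wS: "w \<in> S" using w S closed_segment_subset by blast
  have wp: "w - p = t *\<^sub>R (q - p)" unfolding t by (simp add: algebra_simps)
  have "G w - G p = \<alpha> * tmap B C (w - p) + \<beta> * cnj (tmap B C (w - p))" using aff wS S unfolding aff_on_def by blast
  also have "\<dots> = t *\<^sub>R (\<alpha> * tmap B C (q - p) + \<beta> * cnj (tmap B C (q - p)))"
   unfolding wp linear_scale[OF linear_tmap] by (simp add: scaleR_add_right)
  also have "\<alpha> * tmap B C (q - p) + \<beta> * cnj (tmap B C (q - p)) = G q - G p" using aff S unfolding aff_on_def by metis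
  finally have "G w = (1 - t) *\<^sub>R G p + t *\<^sub>R G q" by (simp add: algebra_simps)
  then show "G w \<in> closed_segment (G p) (G q)" unfolding closed_segment_def using t by blast
 qed
qed

text \<open>As \<open>norm \<beta> \<le> norm \<alpha> / 2\<close>, planar vectors are stretched at
  least by \<open>norm \<alpha> / 2\<close>, and \<open>tmap\<close> stretches at least by
  \<open>\<Delta> / (2 * M)\<close>. The linear part is thus bijective, and the preimage of a point
  within the scaled radius lies in the ball.\<close>

lemma image_contains_ball:
 assumes aff: "aff_on G B C \<alpha> \<beta> S" and sub: "ball c d \<subseteq> S" and d: "d > 0"
  and \<Delta>: "Im (cnj B * C) = \<Delta>" "\<Delta> > 0" and M: "norm B \<le> M" "norm C \<le> M"
  and \<beta>: "norm \<beta> \<le> norm \<alpha> / 2"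
 shows "ball (G c) (norm \<alpha> * \<Delta> / (4 * M) * d) \<subseteq> G ` ball c d"
proof (cases "\<alpha> = 0")
 case False
 have "B \<noteq> 0" using \<Delta> by auto
 then have M0: "M > 0" using M(1) by (meson less_le_trans zero_less_norm_iff)
 define L where "L z = \<alpha> * tmap B C z + \<beta> * cnj (tmap B C z)" for z
 have "linear L" unfolding L_def
  by (rule linearI) (simp_all add: linear_add[OF linear_tmap] linear_scale[OF linear_tmap] algebra_simps)
 have low: "norm (L z) \<ge> (norm \<alpha> * \<Delta> / (4 * M)) * norm z" for z
 proof -
  have "\<Delta> * norm z \<le> \<Delta> * (\<bar>Re z\<bar> + \<bar>Im z\<bar>)" using cmod_le[of z] \<Delta> by (intro mult_left_mono) auto
  also have "\<dots> \<le> 2 * M * norm (tmap B C z)" unfolding tmap_def by (rule norm_combination_lower[OF \<Delta> M])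
  finally have 1: "\<Delta> / (2 * M) * norm z \<le> norm (tmap B C z)" using M0 by (simp add: field_simps)
  have "norm \<alpha> * norm (tmap B C z) - norm \<beta> * norm (tmap B C z) \<le> norm (L z)"
   using norm_diff_ineq[of "\<alpha> * tmap B C z" "\<beta> * cnj (tmap B C z)"] by (simp add: L_def norm_mult)
  moreover have "norm \<beta> * norm (tmap B C z) \<le> norm \<alpha> / 2 * norm (tmap B C z)" using \<beta> by (intro mult_right_mono) auto
  ultimately have "norm \<alpha> / 2 * norm (tmap B C z) \<le> norm (L z)" by simp
  moreover have "norm \<alpha> / 2 * (\<Delta> / (2 * M) * norm z) \<le> norm \<alpha> / 2 * norm (tmap B C z)"
   using 1 by (intro mult_left_mono) auto
  moreover have "(norm \<alpha> * \<Delta> / (4 * M)) * norm z = norm \<alpha> / 2 * (\<Delta> / (2 * M) * norm z)" by simp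
  ultimately show ?thesis by linarith
 qed
 have pos: "norm \<alpha> * \<Delta> / (4 * M) > 0" using False \<Delta> M0 by simp
 have inj: "inj L"
 proof (rule linear_injective_0[OF \<open>linear L\<close>, THEN iffD2], intro allI impI)
  fix z assume "L z = 0"
  then have "(norm \<alpha> * \<Delta> / (4 * M)) * norm z \<le> 0" using low[of z] by simp
  then have "norm z \<le> 0" using pos mult_pos_pos[OF pos, of "norm z"] by linarith
  then show "z = 0" by simp
 qed
 have "surj L" using linear_injective_imp_surjective[OF \<open>linear L\<close> inj] by blast
 show ?thesis
 proof
  fix y assume y: "y \<in> ball (G c) (norm \<alpha> * \<Delta> / (4 * M) * d)"
  obtain v where v: "y - G c = L v" using \<open>surj L\<close> by (meson surjD)
  have "(norm \<alpha> * \<Delta> / (4 * M)) * norm v < (norm \<alpha> * \<Delta> / (4 * M)) * d"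
   using low[of v] y v by (simp add: dist_norm norm_minus_commute)
  then have "norm v < d" using pos mult_less_cancel_left_pos by blast
  then have vb: "c + v \<in> ball c d" by (simp add: dist_norm)
  have "G (c + v) - G c = L v" using aff sub vb d unfolding aff_on_def L_def
   by (metis add_diff_cancel_left' centre_in_ball subsetD)
  then have "G (c + v) = y" using v by (simp add: algebra_simps)
  then show "y \<in> G ` ball c d" using vb by blast
 qed
qed (use M in simp)

text \<open>The centres at 1/4 and 3/4 of the diagonal lie in the lower left and the upper right
  half of the cell. With radius 1/8 of the mesh each ball stays in its half, so all of them are
  disjoint.\<close>

definition sub_ball :: "real => (int \<times> int) \<times> bool => complex set" where
 "sub_ball N = (\<lambda>((i, j), b). ball (pt N i j + of_real ((if b then 3/4 else 1/4) / N) * (1 + \<i>)) (1 / (8 * N)))"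

lemma sub_ball_bounds:
 assumes N: "N > 0" and w: "w \<in> sub_ball N ((i, j), b)"
 defines "t \<equiv> if b then 3/4 else 1/4"
 shows "of_int i + t - 1/8 < Re w * N" "Re w * N < of_int i + t + 1/8"
  "of_int j + t - 1/8 < Im w * N" "Im w * N < of_int j + t + 1/8"
proof -
 define c where "c = pt N i j + of_real (t / N) * (1 + \<i>)"
 have wc: "norm (w - c) < 1 / (8 * N)"
  using w unfolding sub_ball_def c_def t_def by (simp add: dist_norm norm_minus_commute)
 have c: "Re c = of_int i / N + t / N" "Im c = of_int j / N + t / N" by (simp_all add: c_def pt_def)
 have "\<bar>Re w - Re c\<bar> < 1 / (8 * N)" "\<bar>Im w - Im c\<bar> < 1 / (8 * N)"
  using wc abs_Re_le_cmod[of "w - c"] abs_Im_le_cmod[of "w - c"] by simp_all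
 then have "\<bar>Re w - Re c\<bar> * N < 1 / 8" "\<bar>Im w - Im c\<bar> * N < 1 / 8" using N by (simp_all add: field_simps)
 then have "\<bar>(Re w - Re c) * N\<bar> < 1 / 8" "\<bar>(Im w - Im c) * N\<bar> < 1 / 8" using N by (simp_all add: abs_mult)
 moreover have "(Re w - Re c) * N = Re w * N - of_int i - t" "(Im w - Im c) * N = Im w * N - of_int j - t"
  unfolding c using N by (simp_all add: field_simps)
 ultimately have "\<bar>Re w * N - of_int i - t\<bar> < 1/8" "\<bar>Im w * N - of_int j - t\<bar> < 1/8" by simp_all
 then show "of_int i + t - 1/8 < Re w * N" "Re w * N < of_int i + t + 1/8"
  "of_int j + t - 1/8 < Im w * N" "Im w * N < of_int j + t + 1/8" by linarith+
qed

lemma sub_ball_subset: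
 assumes N: "N > 0"
 shows "sub_ball N ((i, j), False) \<subseteq> up_tri N i j" "sub_ball N ((i, j), True) \<subseteq> down_tri N i j"
  "sub_ball N ((i, j), b) \<subseteq> lcell N i j"
proof -
 show "sub_ball N ((i, j), False) \<subseteq> up_tri N i j"
 proof
  fix w assume "w \<in> sub_ball N ((i, j), False)"
  from sub_ball_bounds[OF N this] show "w \<in> up_tri N i j" by (intro in_up_tri[OF N]) simp_all
 qed
 show "sub_ball N ((i, j), True) \<subseteq> down_tri N i j"
 proof
  fix w assume "w \<in> sub_ball N ((i, j), True)"
  from sub_ball_bounds[OF N this] show "w \<in> down_tri N i j" by (intro in_down_tri[OF N]) simp_all
 qed
 show "sub_ball N ((i, j), b) \<subseteq> lcell N i j"
 proof
  fix w assume "w \<in> sub_ball N ((i, j), b)"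
  note b = sub_ball_bounds[OF N this]
  have "of_int i \<le> Re w * N" "Re w * N \<le> of_int (i+1)" "of_int j \<le> Im w * N" "Im w * N \<le> of_int (j+1)"
   using b by (cases b; simp)+
  then show "w \<in> lcell N i j"
   using N by (simp add: in_cbox_complex_iff pt_def pos_divide_le_eq pos_le_divide_eq)
 qed
qed

lemma sub_ball_disjoint:
 assumes N: "N > 0" and w: "w \<in> sub_ball N ((i, j), b)" "w \<in> sub_ball N ((i', j'), b')"
 shows "((i, j), b) = ((i', j'), b')"
proof -
 note b = sub_ball_bounds[OF N w(1)] sub_ball_bounds[OF N w(2)]
 have "\<lfloor>Re w * N\<rfloor> = i" "\<lfloor>Im w * N\<rfloor> = j" "\<lfloor>Re w * N\<rfloor> = i'" "\<lfloor>Im w * N\<rfloor> = j'"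
  using b by (intro floor_unique; cases b; cases b'; simp)+
 then have "i = i'" "j = j'" by simp_all
 moreover have "b \<longleftrightarrow> b'" using b \<open>i = i'\<close> by (cases b; cases b'; simp)
 ultimately show ?thesis by simp
qed

lemma contour_integral_affine_segment:
 assumes "\<And>t. t \<in> {0..1} ==> G (linepath p q t) = (1 - t) *\<^sub>R G p + t *\<^sub>R G q"
 shows "contour_integral (linepath p q) G = (q - p) * ((G p + G q) / 2)"
proof -
 have "((\<lambda>t. G p + t *\<^sub>R (G q - G p)) has_integral (G p + G q) / 2) {0..1}"
 proof -
  have "((\<lambda>t. t *\<^sub>R G p + (t\<^sup>2 / 2) *\<^sub>R (G q - G p)) has_vector_derivative G p + t *\<^sub>R (G q - G p)) (at t within {0..1})" for t
   by (auto intro!: derivative_eq_intros simp: algebra_simps)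
  from fundamental_theorem_of_calculus[OF zero_le_one this] show ?thesis
   by (simp add: scaleR_conv_of_real field_simps)
 qed
 then have "((\<lambda>t. G (linepath p q t)) has_integral (G p + G q) / 2) {0..1}"
  by (rule has_integral_eq[rotated]) (simp add: assms algebra_simps)
 then show ?thesis unfolding contour_integral_linepath_mean by (simp add: integral_unique)
qed

lemma aff_on_contour_integral:
 assumes aff: "aff_on G B C \<alpha> \<beta> S" and S: "convex S" "p \<in> S" "q \<in> S"
 shows "contour_integral (linepath p q) G = (q - p) * ((G p + G q) / 2)"
proof (rule contour_integral_affine_segment)
 fix t :: real assume t: "t \<in> {0..1}"
 define w where "w = linepath p q t"
 have wS: "w \<in> S" using linepath_in_path[OF t, of p q] S closed_segment_subset[of p S q] by (auto simp: w_def)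
 have wp: "w - p = t *\<^sub>R (q - p)" unfolding w_def linepath_def by (simp add: algebra_simps)
 have "G w - G p = \<alpha> * tmap B C (w - p) + \<beta> * cnj (tmap B C (w - p))" using aff wS S unfolding aff_on_def by blast
 also have "\<dots> = t *\<^sub>R (\<alpha> * tmap B C (q - p) + \<beta> * cnj (tmap B C (q - p)))"
  unfolding wp linear_scale[OF linear_tmap] by (simp add: scaleR_add_right)
 also have "\<alpha> * tmap B C (q - p) + \<beta> * cnj (tmap B C (q - p)) = G q - G p" using aff S unfolding aff_on_def by metis
 finally show "G (linepath p q t) = (1 - t) *\<^sub>R G p + t *\<^sub>R G q" unfolding w_def by (simp add: algebra_simps)
qed

text \<open>Green's formula in finite form. The trapezoidal rule is exact for affine functions; the
  terms with \<alpha> cancel as \<open>C * B - B * C\<close>, and those with \<beta> leave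
  \<open>C * cnj B - B * cnj C\<close>, which is 2 \<i> times the area of the parallelogram.\<close>

lemma cell_circ_affine:
 assumes N: "N > 0" and up: "aff_on G B C \<alpha> \<beta> (up_tri N i j)" and down: "aff_on G B C \<alpha>' \<beta>' (down_tri N i j)"
 shows "norm (cell_circ B C G N (i, j)) = norm (\<beta> + \<beta>') * \<bar>Im (cnj B * C)\<bar> / N\<^sup>2"
proof -
 obtain d where d0: "d = Im (cnj B * C)" by simp
 let ?p = "pt N i j" and ?q = "pt N (i+1) j" and ?r = "pt N i (j+1)" and ?s = "pt N (i+1) (j+1)"
 have cv: "convex (up_tri N i j)" "convex (down_tri N i j)" by (simp_all add: up_tri_def down_tri_def)
 have mem: "?p \<in> up_tri N i j" "?q \<in> up_tri N i j" "?r \<in> up_tri N i j" "?q \<in> down_tri N i j" "?r \<in> down_tri N i j" "?s \<in> down_tri N i j"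
  by (simp_all add: up_tri_def down_tri_def hull_inc)
 define h where "h = 1 / N"
 have d: "?q - ?p = of_real h" "?r - ?p = \<i> * of_real h" "?s - ?r = of_real h" "?s - ?q = \<i> * of_real h"
  using N by (simp_all add: pt_def complex_eq_iff h_def field_simps)
 have T: "tmap B C (of_real h) = of_real h * B" "tmap B C (\<i> * of_real h) = of_real h * C"
  by (simp_all add: tmap_def scaleR_conv_of_real)
 have g1: "G ?q - G ?p = \<alpha> * (of_real h * B) + \<beta> * cnj (of_real h * B)"
  and g2: "G ?r - G ?p = \<alpha> * (of_real h * C) + \<beta> * cnj (of_real h * C)"
  using up mem(1-3) unfolding aff_on_def by (metis d(1) T(1), metis d(2) T(2))
 have g3: "G ?s - G ?r = \<alpha>' * (of_real h * B) + \<beta>' * cnj (of_real h * B)"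
  and g4: "G ?s - G ?q = \<alpha>' * (of_real h * C) + \<beta>' * cnj (of_real h * C)"
  using down mem(4-6) unfolding aff_on_def by (metis d(3) T(1), metis d(4) T(2))
 have "cell_circ B C G N (i, j) = B * (of_real h * ((G ?p + G ?q) / 2) - of_real h * ((G ?r + G ?s) / 2))
  + C / \<i> * (\<i> * of_real h * ((G ?q + G ?s) / 2) - \<i> * of_real h * ((G ?p + G ?r) / 2))"
  unfolding circ_def fst_conv snd_conv pt_def[symmetric]
  by (simp only: aff_on_contour_integral[OF up cv(1) mem(1,2)] aff_on_contour_integral[OF up cv(1) mem(1,3)]
    aff_on_contour_integral[OF down cv(2) mem(5,6)] aff_on_contour_integral[OF down cv(2) mem(4,6)] d)
 also have "\<dots> = of_real h / 2 * (C * ((G ?q - G ?p) + (G ?s - G ?r)) - B * ((G ?r - G ?p) + (G ?s - G ?q)))"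
  by (simp add: field_simps)
 also have "\<dots> = of_real (h\<^sup>2) / 2 * ((\<beta> + \<beta>') * (C * cnj B - B * cnj C))"
  unfolding g1 g2 g3 g4 by (simp add: power2_eq_square algebra_simps)
 also have "C * cnj B - B * cnj C = \<i> * of_real (2 * d)"
  by (simp add: complex_eq_iff d0)
 finally have "norm (cell_circ B C G N (i, j)) = norm (of_real (h\<^sup>2) / 2 * ((\<beta> + \<beta>') * (\<i> * complex_of_real (2 * d))))"
  by (rule arg_cong)
 also have "\<dots> = h\<^sup>2 / 2 * (norm (\<beta> + \<beta>') * (2 * \<bar>d\<bar>))"
  by (simp add: norm_mult norm_divide abs_mult norm_power)
 finally show ?thesis unfolding d0[symmetric] by (simp add: h_def power_divide)
qed

text \<open>The weight of a cell is proportional to the sum of \<open>norm \<alpha> / N\<close> over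
  its halves, and the image of each half contains a ball of proportional radius, so
  \<open>ball_packing\<close> bounds the sum of squares. The constant is \<open>8 * M^2\<close>,
  from the factor \<open>2 * M\<close> in the weight and
  \<open>(x + y)^2 \<le> 2 * (x^2 + y^2)\<close>, times \<open>(32 * M / \<Delta>)^2\<close> from
  the radius of the balls. The same weight controls the circulation because \<beta> is at most
  \<tau> times \<alpha> in norm.\<close>

lemma cell_weights:
 fixes N :: nat
 assumes \<Delta>: "Im (cnj B * C) = \<Delta>" "\<Delta> > 0" and M: "norm B \<le> M" "norm C \<le> M" and \<tau>: "0 \<le> \<tau>" "\<tau> \<le> 1/2"
  and N: "N > 0" and inj: "inj_on G Q" and GQ: "G ` Q \<subseteq> cball 0 1"
  and aff: "\<And>i j. lcell (real N) i j \<subseteq> Q ==> \<exists>\<alpha> \<beta> \<alpha>' \<beta>'. norm \<beta> \<le> \<tau> * norm \<alpha> \<and> norm \<beta>' \<le> \<tau> * norm \<alpha>' \<and>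
    aff_on G B C \<alpha> \<beta> (up_tri (real N) i j) \<and> aff_on G B C \<alpha>' \<beta>' (down_tri (real N) i j)"
 obtains r where "lat_weights G N (8192 * M^4 / \<Delta>\<^sup>2) r Q"
  "\<And>i j. lcell (real N) i j \<subseteq> Q ==> norm (cell_circ B C G (real N) (i, j)) \<le> \<tau> * (\<Delta> / M) * (r (i, j) / real N)"
proof -
 have "B \<noteq> 0" using \<Delta> by auto
 then have M0: "M > 0" using M(1) by (meson less_le_trans zero_less_norm_iff)
 have N0: "real N > 0" using N by simp
 define P where "P = {c. lcell (real N) (fst c) (snd c) \<subseteq> Q}"
 have "\<forall>c. \<exists>\<alpha> \<beta> \<alpha>' \<beta>'. c \<in> P --> norm \<beta> \<le> \<tau> * norm \<alpha> \<and> norm \<beta>' \<le> \<tau> * norm \<alpha>' \<and>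
    aff_on G B C \<alpha> \<beta> (up_tri (real N) (fst c) (snd c)) \<and> aff_on G B C \<alpha>' \<beta>' (down_tri (real N) (fst c) (snd c))"
  using aff unfolding P_def by blast
 then obtain a b a' b' where ab: "\<And>c. c \<in> P ==> norm (b c) \<le> \<tau> * norm (a c) \<and> norm (b' c) \<le> \<tau> * norm (a' c) \<and>
    aff_on G B C (a c) (b c) (up_tri (real N) (fst c) (snd c)) \<and> aff_on G B C (a' c) (b' c) (down_tri (real N) (fst c) (snd c))"
  by metis
 define al where "al = (\<lambda>(c, t). if t then a' c else a c)"
 have \<tau>h: "\<tau> * x \<le> x / 2" if "x \<ge> 0" for x using mult_right_mono[OF \<tau>(2) that] by simp
 have bl: "norm (b c) \<le> norm (a c) / 2" "norm (b' c) \<le> norm (a' c) / 2" if "c \<in> P" for c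
  using ab[OF that] \<tau>h[of "norm (a c)"] \<tau>h[of "norm (a' c)"] by auto
 define cen where "cen = (\<lambda>((i, j), t). pt (real N) i j + of_real ((if t then 3/4 else 1/4) / real N) * (1 + \<i>))"
 define \<rho> where "\<rho> x = norm (al x) * \<Delta> / (4 * M) * (1 / (8 * real N))" for x
 have sbc: "sub_ball (real N) x = ball (cen x) (1 / (8 * real N))" for x
  by (cases x) (auto simp: sub_ball_def cen_def)
 have img: "ball (G (cen x)) (\<rho> x) \<subseteq> G ` sub_ball (real N) x" if "fst x \<in> P" for x
 proof -
  obtain i j t where x: "x = ((i, j), t)" by (metis prod.exhaust)
  have c: "(i, j) \<in> P" using that x by simp
  have d0: "1 / (8 * real N) > 0" using N0 by simp
  show ?thesis
  proof (cases t)
   case True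
   then have xt: "x = ((i, j), True)" "al x = a' (i, j)" by (simp_all add: x al_def)
   have s: "ball (cen x) (1 / (8 * real N)) \<subseteq> down_tri (real N) i j"
    using sub_ball_subset(2)[OF N0, of i j] unfolding xt(1)[symmetric] sbc .
   have f: "aff_on G B C (a' (i, j)) (b' (i, j)) (down_tri (real N) i j)" using ab[OF c] by simp
   show ?thesis unfolding sbc \<rho>_def xt(2) by (rule image_contains_ball[OF f s d0 \<Delta> M bl(2)[OF c]])
  next
   case False
   then have xt: "x = ((i, j), False)" "al x = a (i, j)" by (simp_all add: x al_def)
   have s: "ball (cen x) (1 / (8 * real N)) \<subseteq> up_tri (real N) i j"
    using sub_ball_subset(1)[OF N0, of i j] unfolding xt(1)[symmetric] sbc .
   have f: "aff_on G B C (a (i, j)) (b (i, j)) (up_tri (real N) i j)" using ab[OF c] by simp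
   show ?thesis unfolding sbc \<rho>_def xt(2) by (rule image_contains_ball[OF f s d0 \<Delta> M bl(1)[OF c]])
  qed
 qed
 have sbQ: "sub_ball (real N) x \<subseteq> Q" if "fst x \<in> P" for x
 proof -
  obtain i j t where x: "x = ((i, j), t)" by (metis prod.exhaust)
  show ?thesis using sub_ball_subset(3)[OF N0, of i j t] that unfolding x P_def by auto
 qed
 have pack: "(\<Sum>x\<in>S \<times> UNIV. (\<rho> x)\<^sup>2) \<le> 1" if S: "finite S" "S \<subseteq> P" for S
 proof (rule ball_packing[where x = "\<lambda>x. G (cen x)"])
  show "finite (S \<times> (UNIV :: bool set))" using S by simp
  show "\<rho> x \<ge> 0" for x using \<Delta> M0 by (simp add: \<rho>_def)
  show "ball (G (cen x)) (\<rho> x) \<subseteq> cball 0 1" if "x \<in> S \<times> UNIV" for x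
  proof -
   have "fst x \<in> P" using that S by auto
   then show ?thesis using img[of x] sbQ[of x] GQ by blast
  qed
  show "ball (G (cen x)) (\<rho> x) \<inter> ball (G (cen y)) (\<rho> y) = {}" if "x \<in> S \<times> UNIV" "y \<in> S \<times> UNIV" "x \<noteq> y" for x y
  proof (rule ccontr)
   assume "\<not> ?thesis"
   have P: "fst x \<in> P" "fst y \<in> P" using that S by auto
   from \<open>\<not> ?thesis\<close> obtain w where w: "w \<in> G ` sub_ball (real N) x" "w \<in> G ` sub_ball (real N) y"
    using img[OF P(1)] img[OF P(2)] by blast
   obtain u where u: "w = G u" "u \<in> sub_ball (real N) x" using w(1) by (rule imageE)
   obtain v where v: "w = G v" "v \<in> sub_ball (real N) y" using w(2) by (rule imageE)
   have uv: "u \<in> sub_ball (real N) x" "v \<in> sub_ball (real N) y" "G u = w" "G v = w" using u v by simp_all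
   have "u = v"
    by (rule inj_onD[OF inj _ subsetD[OF sbQ[OF P(1)] uv(1)] subsetD[OF sbQ[OF P(2)] uv(2)]]) (simp add: uv)
   then have "u \<in> sub_ball (real N) x" "u \<in> sub_ball (real N) y" using uv by auto
   then show False using sub_ball_disjoint[OF N0, of u "fst (fst x)" "snd (fst x)" "snd x" "fst (fst y)" "snd (fst y)" "snd y"] that(3)
    by simp
  qed
 qed
 \<comment> \<open>A cell edge has planar length at most M / N, and an affine piece stretches by at
   most \<open>2 * norm \<alpha>\<close>. Adding both halves gives one weight for all four
   edges.\<close>
 define r where "r c = (if c \<in> P then 2 * M * (norm (a c) + norm (a' c)) / real N else 0)" for c
 have r0: "r c \<ge> 0" for c using M0 by (simp add: r_def)
 have tm: "norm (tmap B C (pt (real N) (i+1) j - pt (real N) i j)) \<le> M / real N"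
     "norm (tmap B C (pt (real N) i j - pt (real N) (i+1) j)) \<le> M / real N"
     "norm (tmap B C (pt (real N) i (j+1) - pt (real N) i j)) \<le> M / real N"
     "norm (tmap B C (pt (real N) i j - pt (real N) i (j+1))) \<le> M / real N" for i j
  using M N0 by (simp_all add: tmap_def pt_def diff_divide_distrib[symmetric] divide_right_mono)
 have "lat_weights G N (8192 * M^4 / \<Delta>\<^sup>2) r Q"
  unfolding lat_weights_def
 proof (intro conjI allI impI)
  show "r c \<ge> 0" for c by (rule r0)
  fix i j assume "lcell (real N) i j \<subseteq> Q"
  then have c: "(i, j) \<in> P" by (simp add: P_def)
  have cv: "convex (up_tri (real N) i j)" "convex (down_tri (real N) i j)" by (simp_all add: up_tri_def down_tri_def)
  have rr: "2 * norm (a (i, j)) * x \<le> r (i, j)" "2 * norm (a' (i, j)) * x \<le> r (i, j)" if "x \<le> M / real N" for x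
  proof -
   have "2 * norm (a (i, j)) * x \<le> 2 * norm (a (i, j)) * (M / real N)" "2 * norm (a' (i, j)) * x \<le> 2 * norm (a' (i, j)) * (M / real N)"
    by (rule mult_left_mono[OF that], simp)+
   moreover have "r (i, j) = 2 * norm (a (i, j)) * (M / real N) + 2 * norm (a' (i, j)) * (M / real N)"
    using c by (simp add: r_def add_divide_distrib distrib_left mult_ac)
   moreover have "2 * norm (a (i, j)) * (M / real N) \<ge> 0" "2 * norm (a' (i, j)) * (M / real N) \<ge> 0" using M0 by auto
   ultimately show "2 * norm (a (i, j)) * x \<le> r (i, j)" "2 * norm (a' (i, j)) * x \<le> r (i, j)" by linarith+
  qed
  have bb: "norm (b (i, j)) \<le> norm (a (i, j))" "norm (b' (i, j)) \<le> norm (a' (i, j))"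
   using bl[OF c] norm_ge_zero[of "a (i, j)"] norm_ge_zero[of "a' (i, j)"] by linarith+
  have aff': "aff_on G B C (a (i, j)) (b (i, j)) (up_tri (real N) i j)" "aff_on G B C (a' (i, j)) (b' (i, j)) (down_tri (real N) i j)"
   using ab[OF c] by auto
  show "cell_ok G (real N) r (i, j)"
  proof -
   have mem: "pt N i j \<in> up_tri N i j" "pt N (i+1) j \<in> up_tri N i j" "pt N i (j+1) \<in> up_tri N i j"
    "pt N (i+1) j \<in> down_tri N i j" "pt N i (j+1) \<in> down_tri N i j" "pt N (i+1) (j+1) \<in> down_tri N i j"
    by (simp_all add: up_tri_def down_tri_def hull_inc)
   show ?thesis unfolding cell_ok.simps
    using aff_on_seg_ok[OF aff'(1) cv(1) mem(1,2) bb(1) rr(1)[OF tm(2)]]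
     aff_on_seg_ok[OF aff'(2) cv(2) mem(5,6) bb(2) rr(2)[OF tm(2)]]
     aff_on_seg_ok[OF aff'(1) cv(1) mem(1,3) bb(1) rr(1)[OF tm(4)]]
     aff_on_seg_ok[OF aff'(2) cv(2) mem(4,6) bb(2) rr(2)[OF tm(4)]] by blast
  qed
 next
  fix S assume S: "finite S" "\<forall>(i, j)\<in>S. lcell (real N) i j \<subseteq> Q"
  have SP: "S \<subseteq> P"
  proof
   fix c assume "c \<in> S"
   from bspec[OF S(2) this] show "c \<in> P" unfolding P_def mem_Collect_eq case_prod_beta .
  qed
  define k where "k = 8192 * M^4 / \<Delta>\<^sup>2"
  have "(r c)\<^sup>2 \<le> k * ((\<rho> (c, False))\<^sup>2 + (\<rho> (c, True))\<^sup>2)" if "c \<in> S" for c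
  proof -
   have c: "c \<in> P" using that SP by auto
   define x where "x = norm (a c)" define y where "y = norm (a' c)"
   have "(r c)\<^sup>2 = (4 * M\<^sup>2 / (real N)\<^sup>2) * (x + y)\<^sup>2" using c by (simp add: r_def x_def y_def power_divide power_mult_distrib)
   also have "\<dots> \<le> (4 * M\<^sup>2 / (real N)\<^sup>2) * (2 * (x\<^sup>2 + y\<^sup>2))"
    using sum_squares_ge_zero[of "x - y" 0] by (intro mult_left_mono) (auto simp: power2_eq_square algebra_simps)
   also have "\<dots> = k * ((x * \<Delta> / (4 * M) * (1 / (8 * real N)))\<^sup>2 + (y * \<Delta> / (4 * M) * (1 / (8 * real N)))\<^sup>2)"
    using \<Delta>(2) M0 N0 by (simp add: k_def power2_eq_square power4_eq_xxxx field_simps)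
   finally show ?thesis by (simp add: \<rho>_def al_def x_def y_def)
  qed
  then have "(\<Sum>c\<in>S. (r c)\<^sup>2) \<le> (\<Sum>c\<in>S. k * ((\<rho> (c, False))\<^sup>2 + (\<rho> (c, True))\<^sup>2))" by (rule sum_mono)
  also have "\<dots> = k * (\<Sum>c\<in>S. \<Sum>t\<in>UNIV. (\<rho> (c, t))\<^sup>2)" by (simp add: UNIV_bool sum_distrib_left)
  also have "\<dots> = k * (\<Sum>x\<in>S \<times> UNIV. (\<rho> x)\<^sup>2)" by (simp add: sum.cartesian_product)
  also have "\<dots> \<le> k * 1" using pack[OF S(1) SP] by (intro mult_left_mono) (auto simp: k_def)
  finally show "(\<Sum>c\<in>S. (r c)\<^sup>2) \<le> 8192 * M^4 / \<Delta>\<^sup>2" by (simp add: k_def)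
 qed
 moreover have "norm (cell_circ B C G (real N) (i, j)) \<le> \<tau> * (\<Delta> / M) * (r (i, j) / real N)" if "lcell (real N) i j \<subseteq> Q" for i j
 proof -
  have c: "(i, j) \<in> P" using that by (simp add: P_def)
  define x where "x = norm (a (i, j))" define y where "y = norm (a' (i, j))"
  have "norm (cell_circ B C G (real N) (i, j)) = norm (b (i, j) + b' (i, j)) * \<bar>\<Delta>\<bar> / (real N)\<^sup>2"
   using cell_circ_affine[OF N0, of G B C "a (i,j)" "b (i,j)" i j "a' (i,j)" "b' (i,j)"] ab[OF c] \<Delta> by simp
  also have "\<dots> \<le> (\<tau> * (x + y)) * \<bar>\<Delta>\<bar> / (real N)\<^sup>2"
   using ab[OF c] norm_triangle_ineq[of "b (i, j)" "b' (i, j)"]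
   by (intro divide_right_mono mult_right_mono) (auto simp: x_def y_def distrib_left)
  also have "\<dots> = \<tau> * (\<Delta> / M) * ((M * (x + y) / real N) / real N)"
   using \<Delta>(2) M0 N0 by (simp add: power2_eq_square)
  also have "\<dots> \<le> \<tau> * (\<Delta> / M) * (r (i, j) / real N)"
  proof -
   have "M * (x + y) \<ge> 0" using M0 by (simp add: x_def y_def)
   then have "M * (x + y) / real N \<le> r (i, j)"
    unfolding r_def if_P[OF c] x_def[symmetric] y_def[symmetric] by (intro divide_right_mono) auto
   then show ?thesis using \<tau> \<Delta>(2) M0 by (intro mult_left_mono divide_right_mono) auto
  qed
  finally show ?thesis .
 qed
 ultimately show ?thesis using that by blast
qed

section \<open>Barycentric coordinates and subdivision\<close>

fun rotl :: "'a tri => 'a tri" where "rotl (a, b, c) = (b, c, a)"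

definition rot :: "'a tri => 'a tri => bool" where
 "rot f t \<longleftrightarrow> t = f \<or> t = rotl f \<or> t = rotl (rotl f)"

lemma rot_cases:
 assumes "rot f (a, b, c)"
 obtains "f = (a, b, c)" | "f = (b, c, a)" | "f = (c, a, b)"
 using assms by (cases f) (auto simp: rot_def)

lemma rot_refl [simp]: "rot f f" by (simp add: rot_def)
lemma rot_sym: "rot f t ==> rot t f" by (cases f; cases t) (auto simp: rot_def)
lemma rot_trans: "rot f t ==> rot t u ==> rot f u" by (cases f; cases t; cases u) (auto simp: rot_def)

lemma rot_tverts: "rot f t ==> tverts t = tverts f" by (cases f; cases t) (auto simp: rot_def)
lemma rot_tconv: "rot f t ==> tconv t = tconv f" by (simp add: tconv_def rot_tverts)
lemma rot_dedges: "rot f t ==> dedges_face t = dedges_face f" by (cases f; cases t) (auto simp: rot_def)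

lemma tverts_subset_tconv: "tverts f \<subseteq> tconv f" by (simp add: tconv_def hull_subset)

text \<open>Two barycentric coordinates packed into one complex number, so that lattice cells,
  contour integrals and boxes can be used for faces in any dimension.\<close>

definition xm :: "'a::real_vector => 'a => 'a => complex => 'a" where
 "xm a b c z = a + Re z *\<^sub>R (b - a) + Im z *\<^sub>R (c - a)"

definition Del :: "complex set" where
 "Del = {z. 0 \<le> Re z \<and> 0 \<le> Im z \<and> Re z + Im z \<le> 1}"

definition nondeg :: "'a::real_vector => 'a => 'a => bool" where
 "nondeg a b c \<longleftrightarrow> (\<forall>s t. s *\<^sub>R (b - a) + t *\<^sub>R (c - a) = 0 --> s = 0 \<and> t = 0)"

lemma tconv_eq: "tconv (a, b, c) = xm a b c ` Del"
proof -
 have "xm a b c ` Del = {a + u *\<^sub>R (b - a) + v *\<^sub>R (c - a) | u v. 0 \<le> u \<and> 0 \<le> v \<and> u + v \<le> 1}"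
 proof (intro equalityI subsetI)
  fix w assume "w \<in> {a + u *\<^sub>R (b - a) + v *\<^sub>R (c - a) | u v. 0 \<le> u \<and> 0 \<le> v \<and> u + v \<le> 1}"
  then obtain u v where "w = xm a b c (Complex u v)" "Complex u v \<in> Del" by (auto simp: xm_def Del_def)
  then show "w \<in> xm a b c ` Del" by blast
 qed (auto simp: xm_def Del_def)
 then show ?thesis by (simp add: tconv_def convex_hull_3_alt)
qed

lemma nondeg_iff_not_collinear: "nondeg a b (c :: 'a::euclidean_space) \<longleftrightarrow> \<not> collinear {a, b, c}"
proof -
 have e: "collinear {a, b, c} \<longleftrightarrow> collinear {0, b - a, c - a}"
  using collinear_3[of b a c] by (simp add: insert_commute)
 show ?thesis
 proof
  assume nd: "nondeg a b c"
  show "\<not> collinear {a, b, c}"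
  proof
   assume "collinear {a, b, c}"
   then consider "b - a = 0" | "c - a = 0" | u where "c - a = u *\<^sub>R (b - a)" unfolding e collinear_lemma by blast
   then show False
   proof cases
    case 1
    then have "1 *\<^sub>R (b - a) + 0 *\<^sub>R (c - a) = 0" by simp
    then show False using nd unfolding nondeg_def by (metis zero_neq_one)
   next
    case 2
    then have "0 *\<^sub>R (b - a) + 1 *\<^sub>R (c - a) = 0" by simp
    then show False using nd unfolding nondeg_def by (metis zero_neq_one)
   next
    case 3
    then have "(- u) *\<^sub>R (b - a) + 1 *\<^sub>R (c - a) = 0" by simp
    then show False using nd unfolding nondeg_def by (metis zero_neq_one)
   qed
  qed
 next
  assume nc: "\<not> collinear {a, b, c}"
  show "nondeg a b c" unfolding nondeg_def
  proof (intro allI impI)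
   fix s t assume st: "s *\<^sub>R (b - a) + t *\<^sub>R (c - a) = 0"
   have "t = 0"
   proof (rule ccontr)
    assume "t \<noteq> 0"
    have "t *\<^sub>R (c - a) = (- s) *\<^sub>R (b - a)" using st by (simp add: add_eq_0_iff2)
    then have "(1 / t) *\<^sub>R (t *\<^sub>R (c - a)) = (1 / t) *\<^sub>R ((- s) *\<^sub>R (b - a))" by (rule arg_cong)
    then have "c - a = (- s / t) *\<^sub>R (b - a)" using \<open>t \<noteq> 0\<close> by simp
    then show False using nc unfolding e collinear_lemma by blast
   qed
   moreover have "b - a \<noteq> 0" using nc unfolding e collinear_lemma by blast
   ultimately show "s = 0 \<and> t = 0" using st by simp
  qed
 qed
qed

lemma xm_diff: "xm a b c z - xm a b c w = Re (z - w) *\<^sub>R (b - a) + Im (z - w) *\<^sub>R (c - a)"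
 by (simp add: xm_def algebra_simps)

lemma xm_inj: "nondeg a b c ==> xm a b c z = xm a b c w ==> z = w"
proof -
 assume nd: "nondeg a b c" and "xm a b c z = xm a b c w"
 then have "Re (z - w) *\<^sub>R (b - a) + Im (z - w) *\<^sub>R (c - a) = 0" using xm_diff[of a b c z w] by simp
 then have "Re (z - w) = 0 \<and> Im (z - w) = 0" using nd unfolding nondeg_def by blast
 then show "z = w" by (simp add: complex_eq_iff)
qed

lemma xm_vertices [simp]: "xm a b c 0 = a" "xm a b c 1 = b" "xm a b c \<i> = c"
 by (simp_all add: xm_def)

lemma continuous_xm [continuous_intros]: "continuous_on S (xm (a::'a::real_normed_vector) b c)"
 unfolding xm_def by (intro continuous_intros)

lemma compact_Del: "compact Del"
proof -
 have "Del = convex hull {0, 1, \<i>}"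
 proof (intro equalityI subsetI)
  fix z assume "z \<in> Del"
  then have "z = (1 - Re z - Im z) *\<^sub>R 0 + Re z *\<^sub>R 1 + Im z *\<^sub>R \<i>" "0 \<le> 1 - Re z - Im z" "0 \<le> Re z" "0 \<le> Im z" "(1 - Re z - Im z) + Re z + Im z = 1"
   by (simp_all add: Del_def complex_eq_iff)
  then show "z \<in> convex hull {0, 1, \<i>}" unfolding convex_hull_3 by blast
 next
  fix z :: complex assume "z \<in> convex hull {0, 1, \<i>}"
  then obtain u v w where "z = u *\<^sub>R 0 + v *\<^sub>R 1 + w *\<^sub>R \<i>" "0 \<le> u" "0 \<le> v" "0 \<le> w" "u + v + w = 1" unfolding convex_hull_3 by auto
  then show "z \<in> Del" by (simp add: Del_def)
 qed
 moreover have "compact (convex hull {0, 1, \<i>})" by (intro compact_convex_hull finite_imp_compact) simp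
 ultimately show ?thesis by simp
qed

lemma compact_tconv: "compact (tconv (f :: 'a::euclidean_space tri))"
proof -
 have "finite (tverts f)" by (cases f) auto
 then show ?thesis unfolding tconv_def by (intro compact_convex_hull finite_imp_compact)
qed

lemma xm_rotate: "xm b c a (Complex (Im z) (1 - Re z - Im z)) = xm a b c z"
 by (simp add: xm_def algebra_simps)

lemma nondeg_rotate: "nondeg a b (c::'a::euclidean_space) ==> nondeg b c a"
 by (simp add: nondeg_iff_not_collinear insert_commute)

text \<open>If a vertex is missing from S, the point lies on the segment of the other two, and
  coordinates are unique in a nondegenerate face. This turns the intersection condition of a
  triangulation into equations for coordinates.\<close>

lemma hull_pair_coords:
 fixes a b c :: "'a::euclidean_space"
 assumes nd: "nondeg a b c" and S: "S \<subseteq> {a, b, c}" and z: "xm a b c z \<in> convex hull S"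
 shows "a \<notin> S ==> Re z + Im z = 1" "b \<notin> S ==> Re z = 0" "c \<notin> S ==> Im z = 0"
proof -
 have seg: "xm a b c z \<in> closed_segment p q" if "S \<subseteq> {p, q}" for p q
  using hull_mono[OF that, of convex] z by (auto simp: segment_convex_hull)
 show "Re z + Im z = 1" if "a \<notin> S"
 proof -
  have "xm a b c z \<in> closed_segment b c" using S that by (intro seg) auto
  then obtain u where u: "xm a b c z = (1 - u) *\<^sub>R b + u *\<^sub>R c" unfolding closed_segment_def by auto
  have "(1 - u) *\<^sub>R b + u *\<^sub>R c = xm a b c (Complex (1 - u) u)" by (simp add: xm_def algebra_simps)
  then have "z = Complex (1 - u) u" using u xm_inj[OF nd] by metis
  then show ?thesis by simp
 qed
 show "Re z = 0" if "b \<notin> S"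
 proof -
  have "xm a b c z \<in> closed_segment a c" using S that by (intro seg) auto
  then obtain u where u: "xm a b c z = (1 - u) *\<^sub>R a + u *\<^sub>R c" unfolding closed_segment_def by auto
  have "(1 - u) *\<^sub>R a + u *\<^sub>R c = xm a b c (Complex 0 u)" by (simp add: xm_def algebra_simps)
  then have "z = Complex 0 u" using u xm_inj[OF nd] by metis
  then show ?thesis by simp
 qed
 show "Im z = 0" if "c \<notin> S"
 proof -
  have "xm a b c z \<in> closed_segment a b" using S that by (intro seg) auto
  then obtain u where u: "xm a b c z = (1 - u) *\<^sub>R a + u *\<^sub>R b" unfolding closed_segment_def by auto
  have "(1 - u) *\<^sub>R a + u *\<^sub>R b = xm a b c (Complex u 0)" by (simp add: xm_def algebra_simps)
  then have "z = Complex u 0" using u xm_inj[OF nd] by metis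
  then show ?thesis by simp
 qed
qed

text \<open>Gram-Schmidt: the first edge goes to the positive real axis, and C consists of the
  projection and the height of the second edge, the height being positive by nondegeneracy. The
  normalisation of B lets two faces be unfolded along a common edge.\<close>

lemma flat_coordinates:
 fixes a b c :: "'a::euclidean_space"
 assumes nd: "nondeg a b c"
 obtains B C where "Im (cnj B * C) > 0" "B = of_real (norm (b - a))"
  "\<And>z. norm (Re z *\<^sub>R (b - a) + Im z *\<^sub>R (c - a)) = norm (tmap B C z)"
proof -
 define e where "e = b - a" define w where "w = c - a"
 have e0: "e \<noteq> 0"
 proof
  assume "e = 0"
  then have "1 *\<^sub>R (b - a) + 0 *\<^sub>R (c - a) = 0" by (simp add: e_def)
  then show False using nd unfolding nondeg_def by (metis zero_neq_one)
 qed
 define p where "p = (e \<bullet> w) / norm e"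
 have pe: "p * norm e = e \<bullet> w" using e0 by (simp add: p_def)
 have lt: "p\<^sup>2 < (norm w)\<^sup>2"
 proof -
  define t where "t = (e \<bullet> w) / (norm e)\<^sup>2"
  have "w - t *\<^sub>R e \<noteq> 0"
  proof
   assume "w - t *\<^sub>R e = 0"
   then have "(- t) *\<^sub>R (b - a) + 1 *\<^sub>R (c - a) = 0" by (simp add: e_def w_def)
   then show False using nd unfolding nondeg_def by (metis zero_neq_one)
  qed
  then have "0 < (norm (w - t *\<^sub>R e))\<^sup>2" by simp
  also have "(norm (w - t *\<^sub>R e))\<^sup>2 = (norm w)\<^sup>2 - 2 * t * (e \<bullet> w) + t\<^sup>2 * (norm e)\<^sup>2"
   unfolding power2_norm_eq_inner
   by (simp add: inner_diff_left inner_diff_right inner_commute power2_eq_square algebra_simps)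
  also have "\<dots> = (norm w)\<^sup>2 - p\<^sup>2"
   using e0 by (simp add: t_def p_def power2_eq_square field_simps)
  finally show ?thesis by simp
 qed
 define q where "q = sqrt ((norm w)\<^sup>2 - p\<^sup>2)"
 have q: "q > 0" "q\<^sup>2 = (norm w)\<^sup>2 - p\<^sup>2" using lt by (simp_all add: q_def)
 show ?thesis
 proof (rule that[of "of_real (norm e)" "Complex p q"])
  show "Im (cnj (of_real (norm e)) * Complex p q) > 0" using q e0 by simp
  show "of_real (norm e) = of_real (norm (b - a))" by (simp add: e_def)
  fix z
  have "(norm (Re z *\<^sub>R e + Im z *\<^sub>R w))\<^sup>2 = (Re z)\<^sup>2 * (norm e)\<^sup>2 + 2 * Re z * Im z * (e \<bullet> w) + (Im z)\<^sup>2 * (norm w)\<^sup>2"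
   unfolding power2_norm_eq_inner
   by (simp add: inner_add_left inner_add_right inner_commute power2_eq_square algebra_simps)
  also have "\<dots> = (norm (tmap (of_real (norm e)) (Complex p q) z))\<^sup>2"
  proof -
   have "(norm w)\<^sup>2 = p\<^sup>2 + q\<^sup>2" using q(2) by simp
   then show ?thesis unfolding pe[symmetric] cmod_power2
    by (simp add: tmap_def power2_eq_square algebra_simps)
  qed
  finally show "norm (Re z *\<^sub>R (b - a) + Im z *\<^sub>R (c - a)) = norm (tmap (of_real (norm e)) (Complex p q) z)"
   by (simp add: e_def w_def)
 qed
qed

abbreviation xp :: "'a::real_vector => 'a => 'a => real => int => int => 'a" where
 "xp a b c N i j \<equiv> xm a b c (pt N i j)"

lemma xp_double: "xp a b c N i j = xp a b c (2 * N) (2 * i) (2 * j)"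
 by (simp add: xm_def pt_def)

lemma xp_midpoint: "midpoint (xp a b c N i j) (xp a b c N k l) = xp a b c (2 * N) (i + k) (j + l)"
proof -
 have "midpoint (xp a b c N i j) (xp a b c N k l) = xm a b c (midpoint (pt N i j) (pt N k l))"
  by (simp add: midpoint_def xm_def scaleR_add_right algebra_simps flip: scaleR_add_left)
 also have "midpoint (pt N i j) (pt N k l) = pt (2 * N) (i + k) (j + l)"
  by (simp add: midpoint_def pt_def complex_eq_iff add_divide_distrib)
 finally show ?thesis .
qed

lemma subdiv_rot:
 assumes "rot f t" "t' \<in> subdiv_face t"
 shows "\<exists>f'\<in>subdiv_face f. rot f' t'"
proof -
 obtain a b c where t: "t = (a, b, c)" by (cases t)
 from assms(1)[unfolded t] show ?thesis
  by (rule rot_cases) (use assms(2) in \<open>auto simp: t rot_def midpoint_sym\<close>)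
qed

lemma refine_Suc_iff: "f' \<in> (refine ^^ Suc n) F \<longleftrightarrow> (\<exists>h\<in>(refine ^^ n) F. f' \<in> subdiv_face h)"
 by (simp add: refine_def del: subdiv_face.simps)

lemma refine_mono: "F \<subseteq> G ==> (refine ^^ q) F \<subseteq> (refine ^^ q) G"
 by (induction q) (auto simp: refine_def)

text \<open>A lattice triangle of level q + 1 is a child of one of level q with halved indices, and
  the parities of i and j tell which child. Upward and downward triangles go through one induction,
  because the middle child points the other way than its parent.\<close>

lemma refine_lattice:
 fixes a b c :: "'a::real_vector"
 assumes "0 \<le> i" "0 \<le> j"
 shows "i + j + 1 \<le> 2 ^ q ==> \<exists>f\<in>(refine ^^ q) {(a, b, c)}. rot f (xp a b c (2^q) i j, xp a b c (2^q) (i+1) j, xp a b c (2^q) i (j+1))"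
  "i + j + 2 \<le> 2 ^ q ==> \<exists>f\<in>(refine ^^ q) {(a, b, c)}. rot f (xp a b c (2^q) (i+1) j, xp a b c (2^q) (i+1) (j+1), xp a b c (2^q) i (j+1))"
 using assms
proof (induction q arbitrary: i j)
 case 0
 {
  case 1
  then have "i = 0" "j = 0" by auto
  then show ?case by (simp add: pt_def xm_def rot_def)
 next
  case 2
  then show ?case by simp
 }
next
 case (Suc q)
 let ?N = "2 ^ q :: real"
 let ?R = "(refine ^^ q) {(a, b, c)}"
 let ?p = "xp a b c ?N" and ?r = "xp a b c (2 * ?N)"
 let ?up = "\<lambda>i j. (?p i j, ?p (i+1) j, ?p i (j+1))" and ?down = "\<lambda>i j. (?p (i+1) j, ?p (i+1) (j+1), ?p i (j+1))"
 have child: "\<exists>f\<in>(refine ^^ Suc q) {(a, b, c)}. rot f u"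
  if h: "f \<in> (refine ^^ q) {(a, b, c)}" "rot f t" "t' \<in> subdiv_face t" "rot t' u" for f t t' u
 proof -
  obtain f' where f': "f' \<in> subdiv_face f" "rot f' t'" using subdiv_rot[OF h(2,3)] by blast
  have "f' \<in> (refine ^^ Suc q) {(a, b, c)}" using f'(1) h(1) unfolding refine_Suc_iff by blast
  then show ?thesis using rot_trans[OF f'(2) h(4)] by blast
 qed
 have p2: "?p i j = ?r (2 * i) (2 * j)" for i j by (rule xp_double)
 {
  case 1
  define i' where "i' = i div 2" define j' where "j' = j div 2"
  have ij: "i = 2 * i' + i mod 2" "j = 2 * j' + j mod 2" by (simp_all add: i'_def j'_def)
  have nn: "0 \<le> i'" "0 \<le> j'" using 1 by (simp_all add: i'_def j'_def)
  have le: "i + j + 1 \<le> 2 * 2 ^ q" using 1 by simp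
  consider "i mod 2 = 0" "j mod 2 = 0" | "i mod 2 = 1" "j mod 2 = 0" | "i mod 2 = 0" "j mod 2 = 1" | "i mod 2 = 1" "j mod 2 = 1"
   by (metis mod_2_eq_odd of_bool_def)
  then show ?case
  proof cases
   case 1
   then have ij': "i = 2 * i'" "j = 2 * j'" using ij by auto
   then have "i' + j' + 1 \<le> 2 ^ q" using le by simp
   from Suc.IH(1)[OF this nn] obtain f where f: "f \<in> ?R" "rot f (?up i' j')" by blast
   show ?thesis by (rule child[OF f, of "(?p i' j', midpoint (?p i' j') (?p (i'+1) j'), midpoint (?p i' (j'+1)) (?p i' j'))"], simp, unfold xp_midpoint, unfold p2[of i' j'] ij', simp add: rot_def algebra_simps)
  next
   case 2
   then have ij': "i = 2 * i' + 1" "j = 2 * j'" using ij by auto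
   then have "i' + j' + 1 \<le> 2 ^ q" using le by simp
   from Suc.IH(1)[OF this nn] obtain f where f: "f \<in> ?R" "rot f (?up i' j')" by blast
   show ?thesis by (rule child[OF f, of "(midpoint (?p i' j') (?p (i'+1) j'), ?p (i'+1) j', midpoint (?p (i'+1) j') (?p i' (j'+1)))"], simp, unfold xp_midpoint, unfold p2[of "i'+1" j'] ij', simp add: rot_def algebra_simps)
  next
   case 3
   then have ij': "i = 2 * i'" "j = 2 * j' + 1" using ij by auto
   then have "i' + j' + 1 \<le> 2 ^ q" using le by simp
   from Suc.IH(1)[OF this nn] obtain f where f: "f \<in> ?R" "rot f (?up i' j')" by blast
   show ?thesis by (rule child[OF f, of "(midpoint (?p i' (j'+1)) (?p i' j'), midpoint (?p (i'+1) j') (?p i' (j'+1)), ?p i' (j'+1))"], simp, unfold xp_midpoint, unfold p2[of i' "j'+1"] ij', simp add: rot_def algebra_simps)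
  next
   case 4
   then have ij': "i = 2 * i' + 1" "j = 2 * j' + 1" using ij by auto
   then have "i' + j' + 2 \<le> 2 ^ q" using le by simp
   from Suc.IH(2)[OF this nn] obtain f where f: "f \<in> ?R" "rot f (?down i' j')" by blast
   show ?thesis by (rule child[OF f, of "(midpoint (?p (i'+1) j') (?p (i'+1) (j'+1)), midpoint (?p (i'+1) (j'+1)) (?p i' (j'+1)), midpoint (?p i' (j'+1)) (?p (i'+1) j'))"], simp, unfold xp_midpoint ij', simp add: rot_def algebra_simps)
  qed
 next
  case 2
  define i' where "i' = i div 2" define j' where "j' = j div 2"
  have ij: "i = 2 * i' + i mod 2" "j = 2 * j' + j mod 2" by (simp_all add: i'_def j'_def)
  have nn: "0 \<le> i'" "0 \<le> j'" using 2 by (simp_all add: i'_def j'_def)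
  have le: "i + j + 2 \<le> 2 * 2 ^ q" using 2 by simp
  consider "i mod 2 = 0" "j mod 2 = 0" | "i mod 2 = 1" "j mod 2 = 0" | "i mod 2 = 0" "j mod 2 = 1" | "i mod 2 = 1" "j mod 2 = 1"
   by (metis mod_2_eq_odd of_bool_def)
  then show ?case
  proof cases
   case 1
   then have ij': "i = 2 * i'" "j = 2 * j'" using ij by auto
   then have "i' + j' + 1 \<le> 2 ^ q" using le by simp
   from Suc.IH(1)[OF this nn] obtain f where f: "f \<in> ?R" "rot f (?up i' j')" by blast
   show ?thesis by (rule child[OF f, of "(midpoint (?p i' j') (?p (i'+1) j'), midpoint (?p (i'+1) j') (?p i' (j'+1)), midpoint (?p i' (j'+1)) (?p i' j'))"], simp, unfold xp_midpoint ij', simp add: rot_def algebra_simps)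
  next
   case 2
   then have ij': "i = 2 * i' + 1" "j = 2 * j'" using ij by auto
   then have "i' + j' + 2 \<le> 2 ^ q" using le by simp
   from Suc.IH(2)[OF this nn] obtain f where f: "f \<in> ?R" "rot f (?down i' j')" by blast
   show ?thesis by (rule child[OF f, of "(?p (i'+1) j', midpoint (?p (i'+1) j') (?p (i'+1) (j'+1)), midpoint (?p i' (j'+1)) (?p (i'+1) j'))"], simp, unfold xp_midpoint, unfold p2[of "i'+1" j'] ij', simp add: rot_def algebra_simps)
  next
   case 3
   then have ij': "i = 2 * i'" "j = 2 * j' + 1" using ij by auto
   then have "i' + j' + 2 \<le> 2 ^ q" using le by simp
   from Suc.IH(2)[OF this nn] obtain f where f: "f \<in> ?R" "rot f (?down i' j')" by blast
   show ?thesis by (rule child[OF f, of "(midpoint (?p i' (j'+1)) (?p (i'+1) j'), midpoint (?p (i'+1) (j'+1)) (?p i' (j'+1)), ?p i' (j'+1))"], simp, unfold xp_midpoint, unfold p2[of i' "j'+1"] ij', simp add: rot_def algebra_simps)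
  next
   case 4
   then have ij': "i = 2 * i' + 1" "j = 2 * j' + 1" using ij by auto
   then have "i' + j' + 2 \<le> 2 ^ q" using le by simp
   from Suc.IH(2)[OF this nn] obtain f where f: "f \<in> ?R" "rot f (?down i' j')" by blast
   show ?thesis by (rule child[OF f, of "(midpoint (?p (i'+1) j') (?p (i'+1) (j'+1)), ?p (i'+1) (j'+1), midpoint (?p (i'+1) (j'+1)) (?p i' (j'+1)))"], simp, unfold xp_midpoint, unfold p2[of "i'+1" "j'+1"] ij', simp add: rot_def algebra_simps)
  qed
 }
qed

lemma subdiv_tconv: "f' \<in> subdiv_face f ==> tconv f' \<subseteq> tconv f"
proof -
 assume f': "f' \<in> subdiv_face f"
 obtain a b c where f: "f = (a, b, c)" by (cases f)
 have v: "a \<in> tconv f" "b \<in> tconv f" "c \<in> tconv f" using tverts_subset_tconv[of f] by (auto simp: f)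
 have cv: "convex (tconv f)" by (simp add: tconv_def)
 have m: "midpoint x y \<in> tconv f" if "x \<in> tconv f" "y \<in> tconv f" for x y
  using cv that midpoints_in_convex_hull[of x "tconv f" y] by (simp add: hull_same)
 have "tverts f' \<subseteq> tconv f" using f' v m by (auto simp: f)
 then show ?thesis unfolding tconv_def[of f'] using cv by (rule hull_minimal)
qed

fun nondeg_tri :: "'a::real_vector tri => bool" where "nondeg_tri (a, b, c) = nondeg a b c"

lemma nondeg_scale:
 assumes "nondeg a b c" "r \<noteq> 0" "b' - a' = r *\<^sub>R (b - a)" "c' - a' = r *\<^sub>R (c - a)"
 shows "nondeg a' b' c'"
 unfolding nondeg_def
proof (intro allI impI)
 fix s t assume "s *\<^sub>R (b' - a') + t *\<^sub>R (c' - a') = 0"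
 then have "r *\<^sub>R (s *\<^sub>R (b - a) + t *\<^sub>R (c - a)) = 0"
  unfolding assms(3,4) by (simp only: scaleR_add_right scaleR_scaleR mult.commute)
 then have "s *\<^sub>R (b - a) + t *\<^sub>R (c - a) = 0" using assms(2) by simp
 then show "s = 0 \<and> t = 0" using assms(1) unfolding nondeg_def by blast
qed

lemma subdiv_nondeg:
 fixes f :: "'a::euclidean_space tri"
 shows "nondeg_tri f ==> f' \<in> subdiv_face f ==> nondeg_tri f'"
proof -
 assume nd: "nondeg_tri f" and f': "f' \<in> subdiv_face f"
 obtain a b c where f: "f = (a, b, c)" by (cases f)
 have nd: "nondeg a b c" using nd by (simp add: f)
 have half: "(1 / 2) *\<^sub>R x + (1 / 2) *\<^sub>R x = x" for x :: 'a by (simp flip: scaleR_left_distrib)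
 have 1: "nondeg a (midpoint a b) (midpoint c a)"
  by (rule nondeg_scale[OF nd, of "1/2"]) (simp_all add: midpoint_def algebra_simps half)
 have 2: "nondeg (midpoint a b) b (midpoint b c)"
  by (rule nondeg_scale[OF nd, of "1/2"]) (simp_all add: midpoint_def algebra_simps half)
 have 3: "nondeg (midpoint c a) (midpoint b c) c"
  by (rule nondeg_scale[OF nd, of "1/2"]) (simp_all add: midpoint_def algebra_simps half)
 have 4: "nondeg (midpoint b c) (midpoint c a) (midpoint a b)"
  by (rule nondeg_scale[OF nd, of "-1/2"]) (simp_all add: midpoint_def algebra_simps half)
 show ?thesis using f' 1 2 3 nondeg_rotate[OF nondeg_rotate[OF 4]] by (auto simp: f)
qed

lemma refine_ancestor:
 fixes f :: "'a::euclidean_space tri"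
 assumes "f' \<in> (refine ^^ (p + r)) {f}"
 obtains g where "g \<in> (refine ^^ r) {f}" "tconv f' \<subseteq> tconv g"
 using assms
proof (induction p arbitrary: f' thesis)
 case (Suc p)
 from Suc.prems(2) obtain h where h: "h \<in> (refine ^^ (p + r)) {f}" "f' \<in> subdiv_face h" unfolding add_Suc refine_Suc_iff by blast
 from Suc.IH[OF _ h(1)] obtain g where "g \<in> (refine ^^ r) {f}" "tconv h \<subseteq> tconv g" by blast
 then show ?case using Suc.prems(1) subdiv_tconv[OF h(2)] by blast
qed auto

lemma refine_props:
 fixes f :: "'a::euclidean_space tri"
 assumes "f' \<in> (refine ^^ r) {f}"
 shows "tconv f' \<subseteq> tconv f" "nondeg_tri f ==> nondeg_tri f'"
proof -
 have "tconv f' \<subseteq> tconv f \<and> (nondeg_tri f --> nondeg_tri f')" using assms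
 proof (induction r arbitrary: f')
  case (Suc r)
  then obtain h where h: "h \<in> (refine ^^ r) {f}" "f' \<in> subdiv_face h" unfolding refine_Suc_iff by blast
  then show ?case using Suc.IH[OF h(1)] subdiv_tconv[OF h(2)] subdiv_nondeg[OF _ h(2)] by blast
 qed auto
 then show "tconv f' \<subseteq> tconv f" "nondeg_tri f ==> nondeg_tri f'" by auto
qed

section \<open>Oriented triangulations\<close>

lemma opp_simps:
 assumes "nondeg a b (c::'a::euclidean_space)" "rot f (a, b, c)"
 shows "opp a f = (b, c)" "opp b f = (c, a)" "opp c f = (a, b)"
proof -
 have "\<not> collinear {a, b, c}" using assms(1) nondeg_iff_not_collinear by blast
 then have "a \<noteq> b" "b \<noteq> c" "a \<noteq> c" by (auto simp: insert_commute)
 with assms(2) show "opp a f = (b, c)" "opp b f = (c, a)" "opp c f = (a, b)"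
  by (auto elim!: rot_cases)
qed

lemma rot_at_vertex:
 assumes "v \<in> tverts f"
 obtains b c where "rot f (v, b, c)"
 using assms by (cases f) (auto simp: rot_def)

locale triangulated =
 fixes F :: "'a::euclidean_space tri set"
 assumes tri: "oriented_triangulation F"
begin

lemma finite_F: "finite F" and F_nonempty: "F \<noteq> {}" using tri by (auto simp: oriented_triangulation_def)

lemma face_noncollinear: "f \<in> F ==> \<not> collinear (tverts f)" using tri by (auto simp: oriented_triangulation_def)

lemma face_nondeg: "f \<in> F ==> rot f (a, b, c) ==> nondeg a b c"
 using face_noncollinear[of f] rot_tverts[of f "(a,b,c)"] by (simp add: nondeg_iff_not_collinear)

lemma face_eqI: "f \<in> F ==> g \<in> F ==> tverts f = tverts g ==> f = g"
 using tri by (auto simp: oriented_triangulation_def inj_on_def)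

lemma face_inter: "f \<in> F ==> g \<in> F ==> f \<noteq> g ==> tconv f \<inter> tconv g = convex hull (tverts f \<inter> tverts g)"
 using tri by (auto simp: oriented_triangulation_def)

lemma dedge_unique: "f \<in> F ==> g \<in> F ==> e \<in> dedges_face f ==> e \<in> dedges_face g ==> f = g"
 using tri unfolding oriented_triangulation_def by blast

lemma card_tverts: assumes "f \<in> F" shows "card (tverts f) = 3" "finite (tverts f)"
proof -
 obtain a b c where f: "f = (a, b, c)" by (cases f)
 have "\<not> collinear {a, b, c}" using face_noncollinear[OF assms] by (simp add: f)
 then have "a \<noteq> b" "b \<noteq> c" "a \<noteq> c" by (auto simp: insert_commute)
 then show "card (tverts f) = 3" "finite (tverts f)" by (simp_all add: f)
qed

text \<open>Different faces share at most two vertices, so their intersection is collinear and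
  cannot contain a nondegenerate triangle. This identifies the original face that contains a refined
  one.\<close>

lemma tconv_eq_imp_subset:
 assumes "f \<in> F" "g \<in> F" "nondeg_tri h" "tconv h \<subseteq> tconv f" "tconv h \<subseteq> tconv g"
 shows "f = g"
proof (rule ccontr)
 assume ne: "f \<noteq> g"
 define S where "S = tverts f \<inter> tverts g"
 obtain a b c where h: "h = (a, b, c)" by (cases h)
 have nc: "\<not> collinear {a, b, c}" using assms(3) by (simp add: h nondeg_iff_not_collinear)
 have "S \<noteq> tverts f"
 proof
  assume "S = tverts f"
  then have "tverts f \<subseteq> tverts g" by (auto simp: S_def)
  then have "tverts f = tverts g" using card_tverts[OF assms(1)] card_tverts[OF assms(2)] by (metis card_subset_eq)
  then show False using face_eqI assms ne by blast
 qed
 then have "S \<subset> tverts f" by (auto simp: S_def)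
 then have "card S < 3" using card_tverts[OF assms(1)] psubset_card_mono by metis
 moreover have fS: "finite S" using card_tverts[OF assms(1)] by (simp add: S_def)
 ultimately have "collinear S"
 proof -
  have "card S = 0 \<or> card S = 1 \<or> card S = 2" using \<open>card S < 3\<close> by linarith
  then show ?thesis using fS by (auto simp: card_1_singleton_iff card_2_iff)
 qed
 then have "aff_dim S \<le> 1" by (simp add: collinear_aff_dim)
 then have "aff_dim (convex hull S) \<le> 1" by (simp add: aff_dim_convex_hull)
 then have "collinear (convex hull S)" by (simp add: collinear_aff_dim)
 moreover have "tverts h \<subseteq> convex hull S"
  using assms(4,5) face_inter[OF assms(1,2) ne] tverts_subset_tconv[of h] by (auto simp: S_def)
 ultimately show False using nc collinear_subset[of "convex hull S" "{a, b, c}"] by (simp add: h)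
qed

lemma coords:
 assumes f: "f \<in> F" "rot f (a, b, c)" and x: "x \<in> tconv f"
 obtains z where "z \<in> Del" "x = xm a b c z"
 using x rot_tconv[OF f(2)] tconv_eq[of a b c] by auto

lemma xm_in_surface: "f \<in> F ==> rot f (a, b, c) ==> z \<in> Del ==> xm a b c z \<in> tconv f \<and> xm a b c z \<in> surface F"
 using rot_tconv[of f "(a,b,c)"] tconv_eq[of a b c] by (auto simp: surface_def)

lemma vertex_in_face:
 assumes v: "v \<in> verts F" and f: "f \<in> F" "v \<in> tconv f"
 shows "v \<in> tverts f"
proof -
 obtain g where g: "g \<in> F" "v \<in> tverts g" using v by (auto simp: verts_def)
 show ?thesis
 proof (cases "f = g")
  case False
  obtain b c where r: "rot g (v, b, c)" using rot_at_vertex[OF g(2)] .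
  have nd: "nondeg v b c" by (rule face_nondeg[OF g(1) r])
  have "v \<in> convex hull (tverts g \<inter> tverts f)"
   using face_inter[OF g(1) f(1)] False f(2) g(2) tverts_subset_tconv[of g] by blast
  moreover have "tverts g \<inter> tverts f \<subseteq> {v, b, c}" using rot_tverts[OF r] by auto
  ultimately have "v \<notin> tverts g \<inter> tverts f ==> Re 0 + Im 0 = (1::real)"
   using hull_pair_coords(1)[OF nd, of "tverts g \<inter> tverts f" 0] by simp
  then show ?thesis by auto
 qed (use g in auto)
qed

lemma xm_vertex:
 assumes f: "f \<in> F" "rot f (a, b, c)" and z: "z \<in> Del" "xm a b c z \<in> verts F"
 shows "z \<in> {0, 1, \<i>}"
proof -
 have nd: "nondeg a b c" by (rule face_nondeg[OF f])
 have "xm a b c z \<in> tverts f" using vertex_in_face[OF z(2) f(1)] xm_in_surface[OF f z(1)] by blast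
 then have "xm a b c z \<in> {a, b, c}" using rot_tverts[OF f(2)] by auto
 then have "xm a b c z = xm a b c 0 \<or> xm a b c z = xm a b c 1 \<or> xm a b c z = xm a b c \<i>" by simp
 then show ?thesis using xm_inj[OF nd] by blast
qed

lemma edge_point_in_face:
 assumes f: "f \<in> F" "rot f (a, b, c)" and z: "Im z = 0" "0 < Re z" "Re z < 1" and g: "g \<in> F" "xm a b c z \<in> tconv g"
 shows "a \<in> tverts g" "b \<in> tverts g"
proof -
 have nd: "nondeg a b c" by (rule face_nondeg[OF f])
 have "z \<in> Del" using z by (simp add: Del_def)
 then have xf: "xm a b c z \<in> tconv f" using xm_in_surface[OF f] by blast
 have ab: "a \<in> tverts f" "b \<in> tverts f" using rot_tverts[OF f(2)] by auto
 have "a \<in> tverts g \<and> b \<in> tverts g"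
 proof (cases "f = g")
  case False
  have "xm a b c z \<in> convex hull (tverts f \<inter> tverts g)" using face_inter[OF f(1) g(1) False] xf g(2) by blast
  moreover have "tverts f \<inter> tverts g \<subseteq> {a, b, c}" using rot_tverts[OF f(2)] by auto
  ultimately show ?thesis using hull_pair_coords(1,2)[OF nd, of "tverts f \<inter> tverts g" z] z by fastforce
 qed (use ab in auto)
 then show "a \<in> tverts g" "b \<in> tverts g" by auto
qed

lemma interior_point_in_face:
 assumes f: "f \<in> F" "rot f (a, b, c)" and z: "0 < Im z" "0 < Re z" "Re z + Im z < 1" and g: "g \<in> F" "xm a b c z \<in> tconv g"
 shows "g = f"
proof (rule ccontr)
 assume ne: "g \<noteq> f"
 have nd: "nondeg a b c" by (rule face_nondeg[OF f])
 have "z \<in> Del" using z by (simp add: Del_def)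
 then have xf: "xm a b c z \<in> tconv f" using xm_in_surface[OF f] by blast
 have h: "xm a b c z \<in> convex hull (tverts f \<inter> tverts g)" using face_inter[OF f(1) g(1)] ne xf g(2) by blast
 have S: "tverts f \<inter> tverts g \<subseteq> {a, b, c}" using rot_tverts[OF f(2)] by auto
 have "a \<in> tverts g" "b \<in> tverts g" "c \<in> tverts g"
  using hull_pair_coords[OF nd S h] z by fastforce+
 then have "tverts f \<subseteq> tverts g" using rot_tverts[OF f(2)] by auto
 then have "tverts f = tverts g" using card_tverts[OF f(1)] card_tverts[OF g(1)] by (metis card_subset_eq)
 then show False using face_eqI f g ne by blast
qed

text \<open>A directed edge belongs to one face only, so a second face at the same edge must
  traverse it backwards.\<close>

lemma neighbour_orientation:
 assumes f: "f \<in> F" "rot f (a, b, c)" and g: "g \<in> F" "g \<noteq> f" "a \<in> tverts g" "b \<in> tverts g"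
 obtains d where "rot g (b, a, d)" "(b, a) \<in> dedges F"
proof -
 have nd: "nondeg a b c" by (rule face_nondeg[OF f])
 have ab: "a \<noteq> b" using nd by (auto simp: nondeg_iff_not_collinear)
 obtain x y where r: "rot g (a, x, y)" using rot_at_vertex[OF g(3)] .
 have "(a, b) \<in> dedges_face f" using rot_dedges[OF f(2)] by auto
 then have nab: "(a, b) \<notin> dedges_face g" using dedge_unique[OF f(1) g(1)] g(2) by blast
 have "b \<in> {a, x, y}" using g(4) rot_tverts[OF r] by auto
 moreover have "b \<noteq> x" using nab rot_dedges[OF r] by auto
 ultimately have "b = y" using ab by auto
 then have r': "rot g (b, a, x)" using rot_trans[OF r, of "(b, a, x)"] by (simp add: rot_def)
 moreover have "(b, a) \<in> dedges F" unfolding dedges_def using rot_dedges[OF r'] g(1) by auto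
 ultimately show ?thesis using that by blast
qed

end

section \<open>Cone charts\<close>

text \<open>B and C are the edge vectors of a positively oriented isometric copy of the face with
  \<open>a\<close> at 0. Equality of the norms of all combinations expresses the isometry.\<close>

definition flat :: "'a::euclidean_space => 'a => 'a => complex => complex => bool" where
 "flat a b c B C \<longleftrightarrow> Im (cnj B * C) > 0 \<and> (\<forall>z. norm (Re z *\<^sub>R (b - a) + Im z *\<^sub>R (c - a)) = norm (tmap B C z))"

lemma flat_exists: assumes "nondeg a b c" obtains B C where "flat a b c B C"
 using flat_coordinates[OF assms] unfolding flat_def by metis

lemma flat_rotate:
 assumes "flat a b c B C"
 shows "flat b c a (C - B) (- B)"
 unfolding flat_def
proof (intro conjI allI)
 show "0 < Im (cnj (C - B) * - B)" using assms by (simp add: flat_def algebra_simps)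
 fix z
 have "Re z *\<^sub>R (c - b) + Im z *\<^sub>R (a - b) = Re (Complex (- Re z - Im z) (Re z)) *\<^sub>R (b - a) + Im (Complex (- Re z - Im z) (Re z)) *\<^sub>R (c - a)"
  by (simp add: algebra_simps)
 also have "norm \<dots> = norm (tmap B C (Complex (- Re z - Im z) (Re z)))" using assms unfolding flat_def by blast
 also have "tmap B C (Complex (- Re z - Im z) (Re z)) = tmap (C - B) (- B) z" by (simp add: tmap_def algebra_simps)
 finally show "norm (Re z *\<^sub>R (c - b) + Im z *\<^sub>R (a - b)) = norm (tmap (C - B) (- B) z)" .
qed

lemma tmap_rotate: "tmap (C - B) (- B) (Complex (Im z) (1 - Re z - Im z)) = tmap B C z - B"
 by (simp add: tmap_def algebra_simps)

lemma tmap_inj: assumes "Im (cnj B * C) > 0" "tmap B C z = tmap B C w" shows "z = w"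
proof -
 have "tmap B C (z - w) = 0" using assms(2) linear_diff[OF linear_tmap, of B C z w] by simp
 then have e: "Re (z - w) *\<^sub>R B + Im (z - w) *\<^sub>R C = 0" by (simp add: tmap_def)
 then have "Im (cnj (Re (z - w) *\<^sub>R B + Im (z - w) *\<^sub>R C) * C) = 0" "Im (cnj B * (Re (z - w) *\<^sub>R B + Im (z - w) *\<^sub>R C)) = 0"
  unfolding e by simp_all
 then have "Re (z - w) * Im (cnj B * C) = 0" "Im (z - w) * Im (cnj B * C) = 0"
  by (simp_all add: algebra_simps)
 then show ?thesis using assms(1) by (simp add: complex_eq_iff)
qed

lemma flat_dist: "flat a b c B C ==> dist (xm a b c z) (xm a b c w) = norm (tmap B C z - tmap B C w)"
 unfolding dist_norm xm_diff linear_diff[OF linear_tmap, symmetric] flat_def by blast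

lemma flat_inner:
 assumes "flat a b c B C"
 shows "(xm a b c z - a) \<bullet> (xm a b c w - a) = Re (cnj (tmap B C z) * tmap B C w)"
proof -
 have n: "norm (xm a b c z - a) = norm (tmap B C z)" for z
  using flat_dist[OF assms, of z 0] by (simp add: dist_norm tmap_def)
 have d: "norm (xm a b c z - xm a b c w) = norm (tmap B C z - tmap B C w)"
  using flat_dist[OF assms, of z w] by (simp add: dist_norm)
 have "2 * ((xm a b c z - a) \<bullet> (xm a b c w - a)) = (norm (xm a b c z - a))\<^sup>2 + (norm (xm a b c w - a))\<^sup>2 - (norm (xm a b c z - xm a b c w))\<^sup>2"
  unfolding power2_norm_eq_inner by (simp add: inner_diff_left inner_diff_right inner_commute)
 also have "\<dots> = 2 * Re (cnj (tmap B C z) * tmap B C w)"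
  unfolding n d cmod_power2 by (simp add: power2_eq_square algebra_simps)
 finally show ?thesis by simp
qed

lemma arccos_eq_Arg:
 assumes "Im w \<ge> 0" "w \<noteq> 0"
 shows "arccos (Re w / norm w) = Arg w"
proof -
 have "Arg w \<ge> 0" "Arg w \<le> pi" using assms Arg_le_pi[of w] Arg_less_0[of w] by simp_all
 moreover have "cos (Arg w) = Re w / norm w" using assms(2) by (simp add: cos_Arg)
 ultimately show ?thesis using arccos_cos[of "Arg w"] by simp
qed

lemma Im_tmap_div:
 assumes "Im (cnj B * C) > 0"
 shows "Im (tmap B C z / B) = Im z * (Im (cnj B * C) / (norm B)\<^sup>2)"
proof -
 have "tmap B C z / B = (tmap B C z * cnj B) / of_real ((norm B)\<^sup>2)" by (subst complex_div_cnj) simp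
 then have "Im (tmap B C z / B) = Im (tmap B C z * cnj B) / (norm B)\<^sup>2" by (simp only: Im_divide_of_real)
 also have "Im (tmap B C z * cnj B) = Im z * Im (cnj B * C)" by (simp add: tmap_def algebra_simps)
 finally show ?thesis by simp
qed

text \<open>Isometries preserve inner products, and for numbers in the upper half plane the arccos
  of the normalised real part is the principal argument. Dividing by B turns the first edge to the
  positive real axis.\<close>

lemma flat_angle:
 assumes fl: "flat a b c B C" and z: "Im z \<ge> 0" "z \<noteq> 0"
 shows "vec_angle (b - a) (xm a b c z - a) = Arg (tmap B C z / B)"
proof -
 have \<Delta>: "Im (cnj B * C) > 0" using fl by (simp add: flat_def)
 have B0: "B \<noteq> 0" using \<Delta> by auto
 have T0: "tmap B C z \<noteq> 0" using tmap_inj[OF \<Delta>, of z 0] z by (auto simp: tmap_def)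
 have b: "b - a = xm a b c 1 - a" by simp
 have n: "norm (xm a b c z - a) = norm (tmap B C z)" for z
  using flat_dist[OF fl, of z 0] by (simp add: dist_norm tmap_def)
 have "(b - a) \<bullet> (xm a b c z - a) = Re (cnj B * tmap B C z)"
  unfolding b flat_inner[OF fl] by (simp add: tmap_def)
 moreover have "norm (b - a) = norm B" unfolding b n by (simp add: tmap_def)
 moreover have Re_of_real_mult: "Re (of_real r * w) = r * Re w" for r w by simp
 have "cnj B * tmap B C z = of_real ((norm B)\<^sup>2) * (tmap B C z / B)"
  using B0 complex_norm_square[of B] by (simp add: field_simps)
 then have "Re (cnj B * tmap B C z) = (norm B)\<^sup>2 * Re (tmap B C z / B)" by (simp only: Re_complex_of_real Re_of_real_mult)
 ultimately have "((b - a) \<bullet> (xm a b c z - a)) / (norm (b - a) * norm (xm a b c z - a)) = Re (tmap B C z / B) / norm (tmap B C z / B)"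
  using B0 n[of z] by (simp add: norm_divide power2_eq_square)
 then show ?thesis unfolding vec_angle_def
  using arccos_eq_Arg[of "tmap B C z / B"] Im_tmap_div[OF \<Delta>, of z] \<Delta> z B0 T0 by simp
qed

lemma Arg_mono_upper:
 assumes U: "Im U \<ge> 0" "U \<noteq> 0" and C: "Im C > 0"
 shows "Im (C * cnj U) \<ge> 0 ==> Arg U \<le> Arg C" "Im (C * cnj U) > 0 ==> Arg U < Arg C"
proof -
 define s where "s = Arg C - Arg U"
 have "Arg U \<ge> 0" "Arg U \<le> pi" using U Arg_le_pi[of U] Arg_less_0[of U] by simp_all
 moreover have "0 < Arg C" "Arg C < pi" using C Arg_lt_pi[of C] by simp_all
 ultimately have s: "- pi < s" "s < pi" by (simp_all add: s_def)
 have "C * cnj U = of_real (norm C * norm U) * cis s"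
 proof -
  have "C = of_real (norm C) * cis (Arg C)" "U = of_real (norm U) * cis (Arg U)"
   using rcis_cmod_Arg[of C] rcis_cmod_Arg[of U] by (simp_all add: rcis_def)
  then have "C * cnj U = (of_real (norm C) * cis (Arg C)) * cnj (of_real (norm U) * cis (Arg U))" by simp
  also have "\<dots> = of_real (norm C * norm U) * (cis (Arg C) * cis (- Arg U))" by (simp add: cis_cnj)
  also have "cis (Arg C) * cis (- Arg U) = cis s" by (simp add: cis_mult s_def)
  finally show ?thesis .
 qed
 then have im: "Im (C * cnj U) = (norm C * norm U) * sin s" by simp
 have "C \<noteq> 0" using C by auto
 then have pos: "norm C * norm U > 0" using U by simp
 have neg: "sin s < 0" if "s < 0" using sin_gt_zero[of "- s"] s that by simp
 show "Arg U \<le> Arg C" if "Im (C * cnj U) \<ge> 0"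
 proof -
  have "sin s \<ge> 0" using that pos unfolding im by (simp add: zero_le_mult_iff)
  then show ?thesis using neg by (force simp: s_def)
 qed
 show "Arg U < Arg C" if "Im (C * cnj U) > 0"
 proof -
  have "sin s > 0" using that pos unfolding im by (simp add: zero_less_mult_iff)
  then have "\<not> s < 0" "s \<noteq> 0" using neg by auto
  then show ?thesis by (simp add: s_def)
 qed
qed

lemma flat_angle_bounds:
 assumes fl: "flat a b c B C" and z: "0 \<le> Re z" "0 \<le> Im z" "z \<noteq> 0"
 shows "0 \<le> Arg (tmap B C z / B)" "Arg (tmap B C z / B) \<le> Arg (C / B)" "0 < Arg (C / B)" "Arg (C / B) < pi"
  "0 < Im z ==> 0 < Arg (tmap B C z / B)" "0 < Re z ==> Arg (tmap B C z / B) < Arg (C / B)"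
proof -
 have \<Delta>: "Im (cnj B * C) > 0" using fl by (simp add: flat_def)
 have B0: "B \<noteq> 0" using \<Delta> by auto
 define k where "k = Im (cnj B * C) / (norm B)\<^sup>2"
 have k: "k > 0" using \<Delta> B0 by (simp add: k_def)
 have imz: "Im (tmap B C z / B) = Im z * k" for z using Im_tmap_div[OF \<Delta>] by (simp add: k_def)
 have "tmap B C \<i> = C" by (simp add: tmap_def)
 then have imC: "Im (C / B) > 0" using imz[of \<i>] k by simp
 have T0: "tmap B C z / B \<noteq> 0" using tmap_inj[OF \<Delta>, of z 0] z B0 by (auto simp: tmap_def)
 have U: "tmap B C z / B = of_real (Re z) + of_real (Im z) * (C / B)"
  using B0 by (simp add: tmap_def scaleR_conv_of_real field_simps)
 have "Im (W * cnj (of_real x + of_real y * W)) = x * Im W" for x y W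
  by (simp add: algebra_simps)
 from this[of "C/B" "Re z" "Im z"] have imCU: "Im ((C / B) * cnj (tmap B C z / B)) = Re z * Im (C / B)"
  unfolding U by simp
 show "0 \<le> Arg (tmap B C z / B)" using imz[of z] k z(2) Arg_less_0[of "tmap B C z / B"] by simp
 show "0 < Arg (C / B)" "Arg (C / B) < pi" using imC Arg_lt_pi[of "C / B"] by simp_all
 have im0: "Im (tmap B C z / B) \<ge> 0" using imz[of z] k z(2) by simp
 show "Arg (tmap B C z / B) \<le> Arg (C / B)" using imCU imC z(1) by (intro Arg_mono_upper(1)[OF im0 T0 imC]) simp
 show "0 < Arg (tmap B C z / B)" if "0 < Im z"
 proof -
  have "Im (tmap B C z / B) > 0" using imz[of z] k that by simp
  then show ?thesis using Arg_lt_pi[of "tmap B C z / B"] by simp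
 qed
 show "Arg (tmap B C z / B) < Arg (C / B)" if "0 < Re z" using imCU imC that by (intro Arg_mono_upper(2)[OF im0 T0 imC]) simp
qed

lemma polar_powr:
 assumes "w \<noteq> 0"
 shows "w powr (of_real g) = of_real (norm w powr g) * cis (g * Arg w)"
 using assms by (simp add: powr_def Ln_Arg exp_add cis_conv_exp exp_of_real[symmetric] powr_real_def algebra_simps flip: of_real_mult)

locale disk_surface = triangulated F for F :: "'a::euclidean_space tri set" +
 fixes v1 v2 v3 :: 'a and \<zeta> :: real
 assumes disk: "surface F homeomorphic cball (0::complex) 1"
  and marked: "v1 \<in> verts F \<inter> bdry F" "v2 \<in> verts F \<inter> bdry F" "v3 \<in> verts F \<inter> bdry F"
  and zeta: "0 < \<zeta>" "\<zeta> < 1/4"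
begin

section \<open>Faces around a vertex\<close>

definition star :: "'a => 'a tri set" where "star v = {f \<in> F. v \<in> tverts f}"
text \<open>A face is traversed as v, \<open>pv v f\<close>, \<open>nx v f\<close>: turning
  positively about v it is entered through the edge to \<open>pv v f\<close> and left through the
  edge to \<open>nx v f\<close>. A successor g of f thus has \<open>pv v g = nx v f\<close>.\<close>

abbreviation pv :: "'a => 'a tri => 'a" where "pv v f \<equiv> fst (opp v f)"
abbreviation nx :: "'a => 'a tri => 'a" where "nx v f \<equiv> snd (opp v f)"
abbreviation cht :: "'a => 'a => complex" where "cht \<equiv> chart F v1 v2 v3 \<zeta>"
abbreviation Om :: "'a => 'a set" where "Om \<equiv> Omega F \<zeta>"
abbreviation \<gamma> :: "'a => real" where "\<gamma> v \<equiv> cone_gamma F v1 v2 v3 v"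

lemma finite_star [simp]: "finite (star v)" using finite_F by (simp add: star_def)

lemma star_rot: assumes "f \<in> star v" shows "rot f (v, pv v f, nx v f)" "nondeg v (pv v f) (nx v f)"
proof -
 have f: "f \<in> F" "v \<in> tverts f" using assms by (auto simp: star_def)
 obtain b c where r: "rot f (v, b, c)" using rot_at_vertex[OF f(2)] .
 have nd: "nondeg v b c" by (rule face_nondeg[OF f(1) r])
 show "rot f (v, pv v f, nx v f)" "nondeg v (pv v f) (nx v f)" using r nd opp_simps(1)[OF nd r] by simp_all
qed

lemma star_rotI: assumes "f \<in> F" "rot f (v, b, c)" shows "f \<in> star v" "pv v f = b" "nx v f = c"
 using assms opp_simps(1)[OF face_nondeg[OF assms] assms(2)] rot_tverts[OF assms(2)] by (auto simp: star_def)

lemma star_tverts: "f \<in> star v ==> tverts f = {v, pv v f, nx v f}"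
 using rot_tverts[OF star_rot(1)[of f v]] by (cases "opp v f") simp

lemma star_dedges: assumes "f \<in> star v" shows "(v, pv v f) \<in> dedges_face f" "(nx v f, v) \<in> dedges_face f" "(pv v f, nx v f) \<in> dedges_face f"
 unfolding rot_dedges[OF star_rot(1)[OF assms], symmetric] by (cases "opp v f"; simp)+

lemma pv_inj: "f \<in> star v ==> g \<in> star v ==> pv v f = pv v g ==> f = g"
 using dedge_unique[of f g "(v, pv v f)"] star_dedges(1)[of f v] star_dedges(1)[of g v] by (auto simp: star_def)

lemma nx_inj: "f \<in> star v ==> g \<in> star v ==> nx v f = nx v g ==> f = g"
 using dedge_unique[of f g "(nx v f, v)"] star_dedges(2)[of f v] star_dedges(2)[of g v] by (auto simp: star_def)

lemma star_distinct_verts: assumes "f \<in> star v" shows "v \<noteq> pv v f" "v \<noteq> nx v f" "pv v f \<noteq> nx v f"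
 using star_rot(2)[OF assms] by (auto simp: nondeg_iff_not_collinear insert_commute)

lemma surface_near_vertex:
 assumes v: "v \<in> verts F"
 obtains r where "r > 0" "surface F \<inter> ball v r \<subseteq> \<Union> (tconv ` star v)"
proof -
 define K where "K = (\<Union>f\<in>{f\<in>F. v \<notin> tconv f}. tconv f)"
 have cK: "closed K" unfolding K_def using finite_F compact_tconv compact_imp_closed by (intro closed_UN) auto
 have "v \<in> - K" by (auto simp: K_def)
 then obtain r where r: "r > 0" "ball v r \<subseteq> - K" using cK open_contains_ball[of "- K"] by (auto simp: open_Compl)
 show ?thesis
 proof (rule that[OF r(1)])
  show "surface F \<inter> ball v r \<subseteq> \<Union> (tconv ` star v)"
  proof
   fix x assume x: "x \<in> surface F \<inter> ball v r"
   then obtain f where f: "f \<in> F" "x \<in> tconv f" by (auto simp: surface_def)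
   have "v \<in> tconv f" using r(2) x f by (auto simp: K_def)
   then have "f \<in> star v" using vertex_in_face[OF v f(1)] f(1) by (simp add: star_def)
   then show "x \<in> \<Union> (tconv ` star v)" using f by blast
  qed
 qed
qed

lemma faces_meet_at_vertex:
 assumes f: "f \<in> star v" and g: "g \<in> star v" and fg: "f \<noteq> g" "nx v f \<noteq> pv v g" "nx v g \<noteq> pv v f"
 shows "tconv f \<inter> tconv g = {v}"
proof -
 have "pv v f \<noteq> pv v g" "nx v f \<noteq> nx v g" using pv_inj[OF f g] nx_inj[OF f g] fg by auto
 then have "tverts f \<inter> tverts g = {v}"
  unfolding star_tverts[OF f] star_tverts[OF g]
  using fg star_distinct_verts[OF f] star_distinct_verts[OF g] by auto
 then show ?thesis using face_inter[of f g] f g fg by (simp add: star_def)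
qed

text \<open>A punctured neighbourhood of a point of the disk is connected, so the faces around a vertex
 cannot split into two groups that only meet at the vertex.\<close>
lemma link_connected:
 assumes v: "v \<in> verts F" and AB: "A \<union> B = star v" "A \<noteq> {}" "B \<noteq> {}" "A \<inter> B = {}"
 obtains f g where "f \<in> A" "g \<in> B" "nx v f = pv v g \<or> nx v g = pv v f"
proof -
 have False if no: "\<And>f g. f \<in> A ==> g \<in> B ==> nx v f \<noteq> pv v g \<and> nx v g \<noteq> pv v f"
 proof -
  obtain h h' where hom: "homeomorphism (surface F) (cball (0::complex) 1) h h'" using disk by (auto simp: homeomorphic_def)
  have conth: "continuous_on (surface F) h" and him: "h ` surface F = cball 0 1" and h'h: "\<And>x. x \<in> surface F ==> h' (h x) = x"
   and conth': "continuous_on (cball 0 1) h'" and h'im: "h' ` cball 0 1 = surface F" and hh': "\<And>y. y \<in> cball 0 1 ==> h (h' y) = y"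
   using hom unfolding homeomorphism_def by auto
  define UA where "UA = \<Union> (tconv ` A)" define UB where "UB = \<Union> (tconv ` B)"
  have AF: "A \<subseteq> F" "B \<subseteq> F" using AB(1) by (auto simp: star_def)
  have fin: "finite A" "finite B" using AF finite_F finite_subset by auto
  have cU: "compact UA" "compact UB" unfolding UA_def UB_def using fin compact_tconv by (auto intro!: compact_Union)
  have subS: "UA \<subseteq> surface F" "UB \<subseteq> surface F" using AF by (auto simp: UA_def UB_def surface_def)
  have vt: "v \<in> tconv f" if "f \<in> star v" for f using that tverts_subset_tconv[of f] by (auto simp: star_def)
  have vUA: "v \<in> UA" "v \<in> UB" using AB vt unfolding UA_def UB_def by blast+
  have vS: "v \<in> surface F" using vUA subS by auto
  have inter: "UA \<inter> UB \<subseteq> {v}"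
  proof
   fix x assume "x \<in> UA \<inter> UB"
   then obtain f g where fg: "f \<in> A" "g \<in> B" "x \<in> tconv f" "x \<in> tconv g" by (auto simp: UA_def UB_def)
   then have "f \<noteq> g" "f \<in> star v" "g \<in> star v" using AB by auto
   then have "tconv f \<inter> tconv g = {v}" using no[OF fg(1,2)] by (intro faces_meet_at_vertex) auto
   then show "x \<in> {v}" using fg by blast
  qed
  obtain r where r: "r > 0" "surface F \<inter> ball v r \<subseteq> \<Union> (tconv ` star v)" using surface_near_vertex[OF v] .
  define p where "p = h v"
  have p: "p \<in> cball 0 1" using him vS by (auto simp: p_def)
  have h'p: "h' p = v" using h'h[OF vS] by (simp add: p_def)
  obtain s where s: "s > 0" "\<And>y. y \<in> cball 0 1 ==> dist y p < s ==> dist (h' y) v < r"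
   using conth'[unfolded continuous_on_iff, rule_format, OF p r(1)] unfolding h'p by blast
  \<comment> \<open>v may correspond to a point of the boundary circle, so the neighbourhood is a
    ball cut with the closed disc. It is convex and not contained in a line, which is enough for it
    to stay connected without p.\<close>
  define W where "W = ball p s \<inter> cball 0 1"
  have "p \<in> closure (ball 0 1)" using p by simp
  then obtain y where y: "y \<in> ball 0 1" "dist y p < s" using s(1) unfolding closure_approachable by blast
  have "\<not> collinear W"
  proof
   assume c: "collinear W"
   have o: "open (ball p s \<inter> ball 0 1)" by auto
   have "y \<in> ball p s \<inter> ball 0 1" using y by (auto simp: dist_commute)
   then have ne: "ball p s \<inter> ball 0 1 \<noteq> {}" by blast
   have "collinear (ball p s \<inter> ball 0 1)" by (rule collinear_subset[OF c]) (auto simp: W_def)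
   then have "aff_dim (ball p s \<inter> ball 0 1) \<le> 1" by (simp only: collinear_aff_dim)
   then show False unfolding aff_dim_open[OF o ne] by simp
  qed
  moreover have "convex W" by (simp add: W_def convex_Int)
  ultimately have con: "connected (W - {p})" using connected_convex_diff_countable[of W "{p}"] by simp
  have clA: "closed (h ` UA)" "closed (h ` UB)"
   using cU subS conth by (meson compact_continuous_image compact_imp_closed continuous_on_subset)+
  have cov: "W - {p} \<subseteq> h ` UA \<union> h ` UB"
  proof
   fix y assume y: "y \<in> W - {p}"
   then have "y \<in> cball 0 1" "dist (h' y) v < r" using s(2)[of y] by (auto simp: W_def dist_commute)
   then have "h' y \<in> surface F \<inter> ball v r" using h'im by (auto simp: dist_commute)
   then have "h' y \<in> \<Union> (tconv ` (A \<union> B))" using r(2) unfolding AB(1) by (rule rev_subsetD)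
   then have "h' y \<in> UA \<union> UB" by (simp add: UA_def UB_def image_Un)
   then show "y \<in> h ` UA \<union> h ` UB" using hh'[OF \<open>y \<in> cball 0 1\<close>] by (metis UnE UnI1 UnI2 imageI)
  qed
  have dis: "h ` UA \<inter> h ` UB \<inter> (W - {p}) = {}"
  proof (rule ccontr)
   assume "\<not> ?thesis"
   then obtain a b where ab: "a \<in> UA" "b \<in> UB" "h a = h b" "h a \<noteq> p" by auto
   then have "a = b" using h'h subS by (metis subsetD)
   then have "a = v" using inter ab by auto
   then show False using ab by (simp add: p_def)
  qed
  \<comment> \<open>Points on an edge at v tend to v without reaching it, so every nonempty group of
    faces has points in the punctured neighbourhood.\<close>
  have meet: "h ` \<Union> (tconv ` X) \<inter> (W - {p}) \<noteq> {}" if X: "X \<subseteq> star v" "X \<noteq> {}" for X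
  proof -
   obtain f where f: "f \<in> X" using X by auto
   then have fs: "f \<in> star v" using X by auto
   define x where "x n = v + (1 / real (Suc n)) *\<^sub>R (pv v f - v)" for n
   have lim: "x \<longlonglongrightarrow> v"
   proof -
    have "(\<lambda>n. v + (1 / real (Suc n)) *\<^sub>R (pv v f - v)) \<longlonglongrightarrow> v + 0 *\<^sub>R (pv v f - v)"
     by (intro tendsto_intros LIMSEQ_Suc[OF lim_1_over_n])
    moreover have "x = (\<lambda>n. v + (1 / real (Suc n)) *\<^sub>R (pv v f - v))" by (rule ext) (rule x_def)
    ultimately show ?thesis by (simp only: scaleR_zero_left add_0_right)
   qed
   have xf: "x n \<in> tconv f" for n
   proof -
    have "x n = xm v (pv v f) (nx v f) (Complex (1 / real (Suc n)) 0)" by (simp add: x_def xm_def)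
    moreover have "Complex (1 / real (Suc n)) 0 \<in> Del" by (simp add: Del_def)
    ultimately show ?thesis using xm_in_surface[OF _ star_rot(1)[OF fs]] fs by (simp add: star_def)
   qed
   have xS: "x n \<in> surface F" for n using xf fs by (auto simp: surface_def star_def)
   have "(\<lambda>n. h (x n)) \<longlonglongrightarrow> h v"
    by (rule continuous_on_tendsto_compose[OF conth lim vS]) (simp add: xS)
   then obtain n where n: "dist (h (x n)) p < s" using s(1) unfolding p_def by (meson lim_sequentially order_refl)
   have "x n \<noteq> v" using star_distinct_verts(1)[OF fs] by (simp add: x_def)
   then have "h (x n) \<noteq> p" using h'h[OF xS] h'p by metis
   moreover have "h (x n) \<in> W" using n him xS by (auto simp: W_def dist_commute)
   ultimately show ?thesis using xf f by blast
  qed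
  have "h ` UA \<inter> (W - {p}) \<noteq> {}" "h ` UB \<inter> (W - {p}) \<noteq> {}"
   unfolding UA_def UB_def using AB by (intro meet; auto)+
  then show False using con clA cov dis unfolding connected_closed by blast
 qed
 then show ?thesis using that by blast
qed

lemma pred_of_interior:
 assumes v: "v \<notin> bdry F" and f: "f \<in> star v"
 obtains g where "g \<in> star v" "nx v g = pv v f"
proof -
 have fF: "f \<in> F" using f by (simp add: star_def)
 have "(v, pv v f) \<in> dedges F" using star_dedges(1)[OF f] fF by (auto simp: dedges_def)
 moreover have "v \<in> closed_segment v (pv v f)" by simp
 ultimately have "(pv v f, v) \<in> dedges F" using v unfolding bdry_def bd_edges_def by blast
 then obtain g where g: "g \<in> F" "(pv v f, v) \<in> dedges_face g" by (auto simp: dedges_def)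
 obtain x y z where gg: "g = (x, y, z)" by (cases g)
 have "\<exists>w. rot g (v, w, pv v f)" using g(2) unfolding gg by (auto simp: rot_def)
 then obtain w where "rot g (v, w, pv v f)" by blast
 from star_rotI[OF g(1) this] show ?thesis using that by blast
qed

text \<open>v is an end of a boundary edge. If the edge leaves v, its face has no predecessor. If it
  enters v, its face has no successor; were every face preceded by some face, the predecessor map
  would be an injection of a finite set into itself, hence onto, and this face would have a
  successor after all.\<close>

lemma no_pred_of_boundary:
 assumes vv: "v \<in> verts F" and v: "v \<in> bdry F"
 obtains f where "f \<in> star v" "\<And>g. g \<in> star v ==> nx v g \<noteq> pv v f"
proof -
 obtain x y where xy: "(x, y) \<in> dedges F" "(y, x) \<notin> dedges F" "v \<in> closed_segment x y"
  using v unfolding bdry_def bd_edges_def by blast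
 obtain f where f: "f \<in> F" "(x, y) \<in> dedges_face f" using xy(1) by (auto simp: dedges_def)
 obtain p q r where ff: "f = (p, q, r)" by (cases f)
 have "\<exists>w. rot f (x, y, w)" using f(2) unfolding ff by (auto simp: rot_def)
 then obtain w where r: "rot f (x, y, w)" by blast
 have nd: "nondeg x y w" by (rule face_nondeg[OF f(1) r])
 have "closed_segment x y \<subseteq> tconv f"
  unfolding tconv_def rot_tverts[OF r, symmetric] segment_convex_hull by (intro hull_mono) auto
 then have "v \<in> tverts f" using vertex_in_face[OF vv f(1)] xy(3) by blast
 then have "v \<in> {x, y, w}" using rot_tverts[OF r] by simp
 moreover have "v \<noteq> w"
 proof
  assume "v = w"
  then have "xm x y w \<i> \<in> convex hull {x, y}" using xy(3) by (simp add: segment_convex_hull)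
  moreover have "w \<notin> {x, y}" using nd by (auto simp: nondeg_iff_not_collinear insert_commute)
  ultimately show False using hull_pair_coords(3)[OF nd, of "{x,y}" \<i>] by auto
 qed
 ultimately consider "v = x" | "v = y" by auto
 then show ?thesis
 proof cases
  case 1
  have fs: "f \<in> star v" "pv v f = y" using star_rotI[OF f(1), of v y w] r 1 by auto
  show ?thesis
  proof (rule that[OF fs(1)])
   fix g assume g: "g \<in> star v"
   show "nx v g \<noteq> pv v f"
   proof
    assume "nx v g = pv v f"
    then have "(y, x) \<in> dedges F" using star_dedges(2)[OF g] fs 1 g by (auto simp: dedges_def star_def)
    then show False using xy(2) by simp
   qed
  qed
 next
  case 2
  have "rot f (v, w, x)" using rot_trans[OF r, of "(y, w, x)"] 2 by (simp add: rot_def)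
  then have fs: "f \<in> star v" "nx v f = x" using star_rotI[OF f(1), of v w x] by auto
  have nosucc: "pv v g \<noteq> nx v f" if g: "g \<in> star v" for g
  proof
   assume "pv v g = nx v f"
   then have "(y, x) \<in> dedges F" using star_dedges(1)[OF g] fs 2 g by (auto simp: dedges_def star_def)
   then show False using xy(2) by simp
  qed
  show ?thesis
  proof (rule ccontr)
   assume "\<not> thesis"
   then have "\<forall>f\<in>star v. \<exists>g\<in>star v. nx v g = pv v f" using that by blast
   then obtain pr where pr: "\<And>f. f \<in> star v ==> pr f \<in> star v \<and> nx v (pr f) = pv v f" by metis
   have "inj_on pr (star v)" using pr pv_inj unfolding inj_on_def by metis
   then have "pr ` star v = star v" using pr by (intro endo_inj_surj) auto
   then obtain g where "g \<in> star v" "pr g = f" using fs(1) by (metis imageE)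
   then show False using pr[of g] nosucc[of g] by auto
  qed
 qed
qed

lemma boundary_star_first:
 assumes "v \<in> verts F" "v \<in> bdry F"
 shows "\<exists>f\<in>star v. \<forall>g\<in>star v. nx v g \<noteq> pv v f"
 by (rule no_pred_of_boundary[OF assms]) blast

text \<open>A longest chain of consecutive faces covers the star: otherwise
  \<open>link_connected\<close> yields a face outside that is adjacent to a member, and both
  possible adjacencies contradict maximality. At a boundary vertex the chain starts at a face
  without predecessor, so it cannot close up; the last clause records this.\<close>

lemma star_enumeration:
 assumes v: "v \<in> verts F"
 obtains fs where "fs \<noteq> []" "distinct fs" "set fs = star v"
  "\<forall>k. Suc k < length fs --> nx v (fs ! k) = pv v (fs ! Suc k)"
  "nx v (last fs) = pv v (hd fs) --> v \<notin> bdry F"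
proof -
 obtain f1 where f1: "f1 \<in> star v" using v by (auto simp: verts_def star_def)
 have "\<exists>f0. f0 \<in> star v \<and> (v \<in> bdry F --> (\<forall>g\<in>star v. nx v g \<noteq> pv v f0))"
 proof (cases "v \<in> bdry F")
  case True
  then show ?thesis using boundary_star_first[OF v] by blast
 qed (use f1 in blast)
 then obtain f0 where f00: "f0 \<in> star v" "v \<in> bdry F --> (\<forall>g\<in>star v. nx v g \<noteq> pv v f0)" by blast
 have f0: "f0 \<in> star v" "v \<in> bdry F ==> g \<in> star v ==> nx v g \<noteq> pv v f0" for g using f00 by auto
 define Q where "Q fs \<longleftrightarrow> fs \<noteq> [] \<and> distinct fs \<and> set fs \<subseteq> star v \<and> hd fs = f0 \<and>
  (\<forall>k. Suc k < length fs --> nx v (fs ! k) = pv v (fs ! Suc k))" for fs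
 have "Q [f0]" using f0 by (simp add: Q_def)
 moreover have "length fs < Suc (card (star v))" if "Q fs" for fs
  using that distinct_card[of fs] card_mono[of "star v" "set fs"] by (simp add: Q_def)
 ultimately obtain fs where Q: "Q fs" and mx: "\<And>gs. Q gs ==> length gs \<le> length fs"
  using ex_has_greatest_nat[of Q "[f0]" length "Suc (card (star v))"] by (metis less_imp_le)
 define n where "n = length fs"
 have n: "n > 0" using Q by (simp add: Q_def n_def)
 have fsS: "fs ! k \<in> star v" if "k < n" for k using Q that nth_mem by (force simp: Q_def n_def)
 have "fs \<noteq> []" using Q by (simp add: Q_def)
 then have lst: "last fs = fs ! (n - 1)" "hd fs = fs ! 0" unfolding n_def by (rule last_conv_nth, rule hd_conv_nth)
 have ext: "g \<in> set fs" if "g \<in> star v" "nx v (last fs) = pv v g" for g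
 proof (rule ccontr)
  assume g: "g \<notin> set fs"
  have "Q (fs @ [g])" unfolding Q_def
  proof (intro conjI allI impI)
   fix k assume k: "Suc k < length (fs @ [g])"
   show "nx v ((fs @ [g]) ! k) = pv v ((fs @ [g]) ! Suc k)"
   proof (cases "Suc k < n")
    case True
    then show ?thesis using Q by (simp add: Q_def n_def nth_append)
   next
    case False
    then have "k = n - 1" "Suc k = n" using k n by (auto simp: n_def)
    then show ?thesis using that lst n by (simp add: nth_append n_def)
   qed
  qed (use Q g that in \<open>auto simp: Q_def\<close>)
  from mx[OF this] show False by simp
 qed
 have "set fs = star v"
 proof (rule ccontr)
  assume "set fs \<noteq> star v"
  then have "star v - set fs \<noteq> {}" "set fs \<union> (star v - set fs) = star v" "set fs \<noteq> {}" using Q by (auto simp: Q_def)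
  from link_connected[OF v this(2,3,1)]
  obtain f g where fg: "f \<in> set fs" "g \<in> star v" "g \<notin> set fs" "nx v f = pv v g \<or> nx v g = pv v f" by blast
  obtain k where k: "k < n" "f = fs ! k" using fg(1) by (auto simp: in_set_conv_nth n_def)
  from fg(4) show False
  proof
   assume a: "nx v f = pv v g"
   show False
   proof (cases "Suc k < n")
    case True
    then have "pv v g = pv v (fs ! Suc k)" using Q a k by (simp add: Q_def n_def)
    then have "g = fs ! Suc k" using pv_inj[OF fg(2) fsS[OF True]] by simp
    then show False using fg(3) True by (simp add: n_def)
   next
    case False
    then have "k = n - 1" using k by simp
    then show False using ext[OF fg(2)] a k lst fg(3) by simp
   qed
  next
   assume a: "nx v g = pv v f"
   show False
   proof (cases "k = 0")
    case False
    then have kk: "Suc (k - 1) = k" "k - 1 < n" "Suc (k - 1) < length fs" using k by (auto simp: n_def)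
    then have "nx v (fs ! (k - 1)) = pv v f" using Q k unfolding Q_def by metis
    then have "g = fs ! (k - 1)" using nx_inj[OF fg(2) fsS[OF kk(2)]] a by simp
    then show False using fg(3) kk by (simp add: n_def)
   next
    case True
    \<comment> \<open>An outside face precedes the first one, so v is interior and every face has a
      predecessor. The predecessor map is onto, hence the last face has a successor, which is in the
      chain by maximality. If that is the first face, the outside face equals the last one; if not,
      the last face occurs twice.\<close>
    then have ff0: "f = f0" using k lst Q by (simp add: Q_def)
    then have vb: "v \<notin> bdry F" using f0(2)[OF _ fg(2)] a by blast
    then have "\<forall>f\<in>star v. \<exists>g\<in>star v. nx v g = pv v f" using pred_of_interior by metis
    then obtain pr where pr: "\<And>f. f \<in> star v ==> pr f \<in> star v \<and> nx v (pr f) = pv v f" by metis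
    have "inj_on pr (star v)" using pr pv_inj unfolding inj_on_def by metis
    then have "pr ` star v = star v" using pr by (intro endo_inj_surj) auto
    moreover have ls: "last fs \<in> star v" using fsS n lst by simp
    ultimately obtain g' where g': "g' \<in> star v" "pr g' = last fs" by (metis imageE)
    then have ng: "nx v (last fs) = pv v g'" using pr[of g'] by auto
    then have "g' \<in> set fs" using ext g' by blast
    then obtain j where j: "j < n" "g' = fs ! j" by (auto simp: in_set_conv_nth n_def)
    show False
    proof (cases "j = 0")
     case True
     then have "g' = f0" using j lst Q by (simp add: Q_def)
     then have "nx v (last fs) = nx v g" using ng a ff0 by simp
     then have "g = last fs" using nx_inj[OF fg(2) ls] by simp
     then show False using fg(3) Q by (simp add: Q_def)
    next
     case False
     then have jj: "Suc (j - 1) = j" "j - 1 < n" "Suc (j - 1) < length fs" using j by (auto simp: n_def)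
     then have "nx v (fs ! (j - 1)) = pv v g'" using Q j unfolding Q_def by metis
     then have "fs ! (j - 1) = fs ! (n - 1)" using nx_inj[OF fsS[OF jj(2)] ls] ng lst by simp
     then show False using Q jj j n unfolding Q_def n_def by (simp add: nth_eq_iff_index_eq)
    qed
   qed
  qed
 qed
 moreover have "v \<notin> bdry F" if "nx v (last fs) = pv v (hd fs)"
  using f0(2)[of "last fs"] that Q fsS[of "n - 1"] lst n by (auto simp: Q_def)
 moreover have "nx v (fs ! k) = pv v (fs ! Suc k)" if "Suc k < length fs" for k using Q that by (simp add: Q_def)
 moreover have "fs \<noteq> []" "distinct fs" using Q by (simp_all add: Q_def)
 ultimately show ?thesis using that[of fs] by blast
qed

end

context disk_surface
begin

section \<open>Angles at a vertex and the shape of the charts\<close>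

abbreviation ang :: "'a => 'a tri => 'a => real" where "ang v f x \<equiv> vec_angle (pv v f - v) (x - v)"
abbreviation \<theta> :: "'a => 'a tri => real" where "\<theta> v f \<equiv> corner_angle v f"

lemma star_coords:
 assumes f: "f \<in> star v" and x: "x \<in> tconv f" "x \<noteq> v"
 obtains z where "z \<in> Del" "z \<noteq> 0" "x = xm v (pv v f) (nx v f) z"
proof -
 have "f \<in> F" using f by (simp add: star_def)
 from coords[OF this star_rot(1)[OF f] x(1)] obtain z where "z \<in> Del" "x = xm v (pv v f) (nx v f) z" .
 then show ?thesis using that x(2) by (metis xm_vertices(1))
qed

lemma star_flat: assumes "f \<in> star v" obtains B C where "flat v (pv v f) (nx v f) B C" "\<theta> v f = Arg (C / B)" "B \<noteq> 0" "Im (cnj B * C) > 0"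
proof -
 obtain B C where fl: "flat v (pv v f) (nx v f) B C" using flat_exists[OF star_rot(2)[OF assms]] .
 have "\<theta> v f = Arg (C / B)"
  using flat_angle[OF fl, of \<i>] by (simp add: corner_angle_def tmap_def)
 moreover have "Im (cnj B * C) > 0" using fl by (simp add: flat_def)
 moreover then have "B \<noteq> 0" by auto
 ultimately show ?thesis using that fl by blast
qed

lemma \<theta>_bounds: assumes "f \<in> star v" shows "0 < \<theta> v f" "\<theta> v f < pi"
proof -
 obtain B C where fl: "flat v (pv v f) (nx v f) B C" "\<theta> v f = Arg (C / B)" using star_flat[OF assms] .
 show "0 < \<theta> v f" "\<theta> v f < pi" using flat_angle_bounds(3,4)[OF fl(1), of 1] unfolding fl(2) by simp_all
qed

lemma ang_bounds:
 assumes f: "f \<in> star v" and x: "x \<in> tconv f" "x \<noteq> v"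
 shows "0 \<le> ang v f x" "ang v f x \<le> \<theta> v f"
proof -
 obtain B C where fl: "flat v (pv v f) (nx v f) B C" "\<theta> v f = Arg (C / B)" using star_flat[OF f] .
 obtain z where z: "z \<in> Del" "z \<noteq> 0" "x = xm v (pv v f) (nx v f) z" using star_coords[OF f x] .
 have zz: "0 \<le> Re z" "0 \<le> Im z" using z(1) by (auto simp: Del_def)
 show "0 \<le> ang v f x" "ang v f x \<le> \<theta> v f"
  unfolding fl(2) z(3) flat_angle[OF fl(1) zz(2) z(2)] using flat_angle_bounds(1,2)[OF fl(1) zz z(2)] by simp_all
qed

lemma ang_strict:
 assumes f: "f \<in> star v" and z: "0 < Re z" "0 < Im z"
 shows "0 < ang v f (xm v (pv v f) (nx v f) z)" "ang v f (xm v (pv v f) (nx v f) z) < \<theta> v f"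
proof -
 obtain B C where fl: "flat v (pv v f) (nx v f) B C" "\<theta> v f = Arg (C / B)" using star_flat[OF f] .
 have "z \<noteq> 0" using z by auto
 then show "0 < ang v f (xm v (pv v f) (nx v f) z)" "ang v f (xm v (pv v f) (nx v f) z) < \<theta> v f"
  unfolding fl(2) using flat_angle[OF fl(1), of z] flat_angle_bounds(5,6)[OF fl(1), of z] z by simp_all
qed

lemma polar_inj:
 assumes f: "f \<in> star v" and x: "x \<in> tconv f" "x \<noteq> v" and y: "y \<in> tconv f" "y \<noteq> v"
  and eq: "norm (x - v) = norm (y - v)" "ang v f x = ang v f y"
 shows "x = y"
proof -
 obtain B C where fl: "flat v (pv v f) (nx v f) B C" "B \<noteq> 0" "Im (cnj B * C) > 0" using star_flat[OF f] by metis
 obtain z where z: "z \<in> Del" "z \<noteq> 0" "x = xm v (pv v f) (nx v f) z" using star_coords[OF f x] .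
 obtain w where w: "w \<in> Del" "w \<noteq> 0" "y = xm v (pv v f) (nx v f) w" using star_coords[OF f y] .
 have n: "norm (xm v (pv v f) (nx v f) z - v) = norm (tmap B C z)" for z
  using flat_dist[OF fl(1), of z 0] by (simp add: dist_norm tmap_def)
 have "Im z \<ge> 0" "Im w \<ge> 0" using z w by (auto simp: Del_def)
 then have "Arg (tmap B C z / B) = Arg (tmap B C w / B)"
  using eq(2) flat_angle[OF fl(1) _ z(2)] flat_angle[OF fl(1) _ w(2)] z(3) w(3) by simp
 moreover have "norm (tmap B C z / B) = norm (tmap B C w / B)" using eq(1) n z(3) w(3) by (simp add: norm_divide)
 ultimately have "rcis (norm (tmap B C z / B)) (Arg (tmap B C z / B)) = rcis (norm (tmap B C w / B)) (Arg (tmap B C w / B))" by (simp only:)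
 then have "tmap B C z / B = tmap B C w / B" by (simp only: rcis_cmod_Arg)
 then have "tmap B C z = tmap B C w" using fl(2) by simp
 then show ?thesis using tmap_inj[OF fl(3)] z(3) w(3) by blast
qed

lemma ang_on_edges:
 assumes f: "f \<in> star v" and t: "t > 0"
 shows "ang v f (xm v (pv v f) (nx v f) (Complex t 0)) = 0" "ang v f (xm v (pv v f) (nx v f) (Complex 0 t)) = \<theta> v f"
proof -
 obtain B C where fl: "flat v (pv v f) (nx v f) B C" "\<theta> v f = Arg (C / B)" "B \<noteq> 0" using star_flat[OF f] by metis
 have nz: "Complex t 0 \<noteq> 0" "Complex 0 t \<noteq> 0" using t by (auto simp: complex_eq_iff)
 have "tmap B C (Complex t 0) / B = of_real t" using fl(3) by (simp add: tmap_def scaleR_conv_of_real)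
 then show "ang v f (xm v (pv v f) (nx v f) (Complex t 0)) = 0"
  using flat_angle[OF fl(1) _ nz(1)] t by (simp add: Arg_of_real)
 have e: "tmap B C (Complex 0 t) / B = of_real t * (C / B)" by (simp add: tmap_def scaleR_conv_of_real)
 have "ang v f (xm v (pv v f) (nx v f) (Complex 0 t)) = Arg (tmap B C (Complex 0 t) / B)"
  by (rule flat_angle[OF fl(1) _ nz(2)]) (use t in simp)
 also have "\<dots> = Arg (C / B)" unfolding e using t by (simp only: Arg_times_of_real)
 finally show "ang v f (xm v (pv v f) (nx v f) (Complex 0 t)) = \<theta> v f" using fl(2) by simp
qed

text \<open>Common points of consecutive faces lie on the shared edge, which is the last ray of one
  sector and the first ray of the next. This is where unfolded sectors fit together.\<close>

lemma shared_edge_angles: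
 assumes f: "f \<in> star v" and g: "g \<in> star v" and fg: "f \<noteq> g" "nx v f = pv v g" and x: "x \<in> tconv f" "x \<in> tconv g" "x \<noteq> v"
 shows "ang v f x = \<theta> v f" "ang v g x = 0"
proof -
 have F: "f \<in> F" "g \<in> F" using f g by (auto simp: star_def)
 have h: "x \<in> convex hull (tverts f \<inter> tverts g)" using face_inter[OF F fg(1)] x by blast
 have ne: "tverts f \<noteq> tverts g" using face_eqI[OF F] fg(1) by blast
 have p: "pv v f \<notin> tverts g" "nx v g \<notin> tverts f"
  using ne fg(2) star_distinct_verts[OF f] star_distinct_verts[OF g] unfolding star_tverts[OF f] star_tverts[OF g] by auto
 obtain z where z: "z \<in> Del" "z \<noteq> 0" "x = xm v (pv v f) (nx v f) z" using star_coords[OF f x(1,3)] .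
 have "Re z = 0"
  using hull_pair_coords(2)[OF star_rot(2)[OF f], of "tverts f \<inter> tverts g" z] h z(3) p star_tverts[OF f] by auto
 then have "z = Complex 0 (Im z)" "Im z > 0" using z by (auto simp: complex_eq_iff Del_def)
 then show "ang v f x = \<theta> v f" using ang_on_edges(2)[OF f, of "Im z"] z(3) by simp
 obtain w where w: "w \<in> Del" "w \<noteq> 0" "x = xm v (pv v g) (nx v g) w" using star_coords[OF g x(2,3)] .
 have "Im w = 0"
  using hull_pair_coords(3)[OF star_rot(2)[OF g], of "tverts f \<inter> tverts g" w] h w(3) p star_tverts[OF g] by auto
 then have "w = Complex (Re w) 0" "Re w > 0" using w by (auto simp: complex_eq_iff Del_def)
 then show "ang v g x = 0" using ang_on_edges(1)[OF g, of "Re w"] w(3) by simp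
qed

lemma total_angle_star: "total_angle F v = (\<Sum>f\<in>star v. \<theta> v f)"
 by (simp add: total_angle_def star_def)

text \<open>The exponent scales the total angle to the target angle. At interior vertices this is
  exactly 2 pi, as marked vertices lie on the boundary, and only then can the chart close up around
  the vertex.\<close>

lemma \<gamma>_pos: assumes v: "v \<in> verts F" shows "\<gamma> v > 0" "\<gamma> v * total_angle F v \<le> 2 * pi" "v \<notin> bdry F ==> \<gamma> v * total_angle F v = 2 * pi"
proof -
 have "star v \<noteq> {}" using v unfolding verts_def star_def by blast
 then have t: "total_angle F v > 0" unfolding total_angle_star using \<theta>_bounds(1) by (intro sum_pos) auto
 then show "\<gamma> v > 0" by (simp add: cone_gamma_def target_angle_def)
 have g: "\<gamma> v * total_angle F v = target_angle F v1 v2 v3 v" using t by (simp add: cone_gamma_def)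
 show "\<gamma> v * total_angle F v \<le> 2 * pi" unfolding g by (simp add: target_angle_def)
 show "\<gamma> v * total_angle F v = 2 * pi" if "v \<notin> bdry F" unfolding g using that marked by (auto simp: target_angle_def)
qed

text \<open>The part of the star with \<open>Re z + Im z \<ge> 1 - \<zeta>\<close> is compact and
  misses v; the rest is covered by the hulls in the definition, which are the faces shrunk towards v
  by the factor 1 - \<zeta>. A relatively open ball inside them lies in the relative
  interior.\<close>

lemma Omega_near_vertex:
 assumes v: "v \<in> verts F"
 obtains r where "r > 0" "surface F \<inter> ball v r \<subseteq> Om v"
proof -
 define Y where "Y = (\<Union>f\<in>{f\<in>F. v \<in> tverts f}. convex hull {v, \<zeta> *\<^sub>R v + (1 - \<zeta>) *\<^sub>R fst (opp v f), \<zeta> *\<^sub>R v + (1 - \<zeta>) *\<^sub>R snd (opp v f)})"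
 obtain r0 where r0: "r0 > 0" "surface F \<inter> ball v r0 \<subseteq> \<Union> (tconv ` star v)" using surface_near_vertex[OF v] .
 define K where "K = (\<Union>f\<in>star v. xm v (pv v f) (nx v f) ` (Del \<inter> {z. Re z + Im z \<ge> 1 - \<zeta>}))"
 have "closed {z. Re z + Im z \<ge> 1 - \<zeta>}" by (intro closed_Collect_le continuous_intros)
 then have cD: "compact (Del \<inter> {z. Re z + Im z \<ge> 1 - \<zeta>})" using compact_Del by (simp add: compact_Int_closed)
 have "closed K" unfolding K_def
  by (intro closed_UN finite_star ballI compact_imp_closed compact_continuous_image continuous_xm cD)
 moreover have "v \<notin> K"
 proof
  assume "v \<in> K"
  then obtain f z where fz: "f \<in> star v" "Re z + Im z \<ge> 1 - \<zeta>" "xm v (pv v f) (nx v f) z = xm v (pv v f) (nx v f) 0" by (auto simp: K_def)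
  then have "z = 0" using xm_inj[OF star_rot(2)] by blast
  then show False using fz(2) zeta by simp
 qed
 ultimately obtain r1 where r1: "r1 > 0" "ball v r1 \<subseteq> - K" using open_contains_ball[of "- K"] by (auto simp: open_Compl)
 have sub: "surface F \<inter> ball v (min r0 r1) \<subseteq> Y"
 proof
  fix x assume x: "x \<in> surface F \<inter> ball v (min r0 r1)"
  then obtain f where f: "f \<in> star v" "x \<in> tconv f" using r0(2) by auto
  then obtain z where z: "z \<in> Del" "x = xm v (pv v f) (nx v f) z"
   using coords[OF _ star_rot(1)[OF f(1)] f(2)] by (auto simp: star_def)
  have "x \<notin> K" using x r1 by auto
  then have lt: "Re z + Im z < 1 - \<zeta>" using f z by (force simp: K_def)
  define s where "s = Re z / (1 - \<zeta>)" define t where "t = Im z / (1 - \<zeta>)"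
  have st: "Re z = s * (1 - \<zeta>)" "Im z = t * (1 - \<zeta>)" using zeta by (simp_all add: s_def t_def)
  have nn: "0 \<le> s" "0 \<le> t" using z(1) zeta by (auto simp: s_def t_def Del_def)
  have "s + t < 1" using lt zeta unfolding s_def t_def add_divide_distrib[symmetric] by simp
  moreover have "x = (1 - s - t) *\<^sub>R v + s *\<^sub>R (\<zeta> *\<^sub>R v + (1 - \<zeta>) *\<^sub>R pv v f) + t *\<^sub>R (\<zeta> *\<^sub>R v + (1 - \<zeta>) *\<^sub>R nx v f)"
   unfolding z(2) xm_def st by (simp add: algebra_simps)
  moreover have "(1 - s - t) + s + t = 1" by simp
  ultimately have "x \<in> convex hull {v, \<zeta> *\<^sub>R v + (1 - \<zeta>) *\<^sub>R pv v f, \<zeta> *\<^sub>R v + (1 - \<zeta>) *\<^sub>R nx v f}"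
   unfolding convex_hull_3 using nn by (smt (verit, ccfv_threshold) mem_Collect_eq)
  moreover have "f \<in> {f \<in> F. v \<in> tverts f}" using f(1) by (simp add: star_def)
  ultimately show "x \<in> Y" unfolding Y_def by (rule UN_I[rotated])
 qed
 have op: "openin (top_of_set (surface F)) (surface F \<inter> ball v (min r0 r1))" by (simp add: openin_open_Int)
 have "surface F \<inter> ball v (min r0 r1) \<subseteq> Om v"
  unfolding Omega_def Y_def[symmetric] using interior_of_maximal[OF sub op] .
 moreover have "min r0 r1 > 0" using r0 r1 by simp
 ultimately show ?thesis using that by blast
qed

lemma Omega_subset_star: "Om v \<subseteq> \<Union> (tconv ` star v)"
proof -
 have "convex hull {v, \<zeta> *\<^sub>R v + (1 - \<zeta>) *\<^sub>R pv v f, \<zeta> *\<^sub>R v + (1 - \<zeta>) *\<^sub>R nx v f} \<subseteq> tconv f" if f: "f \<in> star v" for f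
 proof (rule hull_minimal)
  have cv: "convex (tconv f)" by (simp add: tconv_def)
  have m: "v \<in> tconv f" "pv v f \<in> tconv f" "nx v f \<in> tconv f" using star_tverts[OF f] tverts_subset_tconv[of f] by auto
  show "{v, \<zeta> *\<^sub>R v + (1 - \<zeta>) *\<^sub>R pv v f, \<zeta> *\<^sub>R v + (1 - \<zeta>) *\<^sub>R nx v f} \<subseteq> tconv f"
   using m zeta convexD[OF cv m(1) m(2), of \<zeta> "1 - \<zeta>"] convexD[OF cv m(1) m(3), of \<zeta> "1 - \<zeta>"] by simp
  show "convex (tconv f)" by (rule cv)
 qed
 then have "(\<Union>f\<in>star v. convex hull {v, \<zeta> *\<^sub>R v + (1 - \<zeta>) *\<^sub>R pv v f, \<zeta> *\<^sub>R v + (1 - \<zeta>) *\<^sub>R nx v f}) \<subseteq> \<Union> (tconv ` star v)"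
  by (rule UN_mono[OF order_refl])
 moreover have "Om v \<subseteq> (\<Union>f\<in>star v. convex hull {v, \<zeta> *\<^sub>R v + (1 - \<zeta>) *\<^sub>R pv v f, \<zeta> *\<^sub>R v + (1 - \<zeta>) *\<^sub>R nx v f})"
  unfolding Omega_def star_def by (rule interior_of_subset)
 ultimately show ?thesis by (rule order_trans[rotated])
qed

text \<open>The angle need not have a limit at v, but the modulus tends to 0 there because g is
  positive. Elsewhere the angle is the arccos of a continuous quotient that stays in
  [-1, 1].\<close>

lemma sector_map_continuous:
 assumes g: "g > 0"
 shows "continuous_on UNIV (\<lambda>x::'a. complex_of_real (norm (x - v) powr g) * cis (g * (\<beta> + vec_angle u (x - v))))"
proof -
 let ?\<phi> = "\<lambda>x::'a. complex_of_real (norm (x - v) powr g) * cis (g * (\<beta> + vec_angle u (x - v)))"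
 have cp: "continuous_on UNIV (\<lambda>x::'a. norm (x - v) powr g)"
  using g by (intro continuous_on_powr' continuous_intros) auto
 have va: "continuous_on (- {v}) (\<lambda>x. vec_angle u (x - v))"
 proof (cases "u = 0")
  case True
  then have "(\<lambda>x. vec_angle u (x - v)) = (\<lambda>x. arccos 0)" by (simp add: vec_angle_def)
  then show ?thesis by (simp only: continuous_on_const)
 next
  case False
  have "continuous_on (- {v}) (\<lambda>x. arccos ((u \<bullet> (x - v)) / (norm u * norm (x - v))))"
  proof (rule continuous_on_arccos, intro continuous_intros)
   show "\<forall>x\<in>- {v}. norm u * norm (x - v) \<noteq> 0" using False by auto
   show "\<forall>x\<in>- {v}. - 1 \<le> u \<bullet> (x - v) / (norm u * norm (x - v)) \<and> u \<bullet> (x - v) / (norm u * norm (x - v)) \<le> 1"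
   proof
    fix x assume "x \<in> - {v}"
    then have p: "norm u * norm (x - v) > 0" using False by simp
    have "\<bar>u \<bullet> (x - v)\<bar> \<le> norm u * norm (x - v)" by (rule Cauchy_Schwarz_ineq2)
    then show "- 1 \<le> u \<bullet> (x - v) / (norm u * norm (x - v)) \<and> u \<bullet> (x - v) / (norm u * norm (x - v)) \<le> 1"
     using p by (simp add: pos_le_divide_eq pos_divide_le_eq abs_le_iff)
   qed
  qed
  then show ?thesis by (simp add: vec_angle_def)
 qed
 have away: "continuous_on (- {v}) ?\<phi>"
 proof -
  have "continuous_on (- {v}) (\<lambda>x. cis (g * (\<beta> + vec_angle u (x - v))))" by (intro continuous_intros va)
  moreover have "continuous_on (- {v}) (\<lambda>x. complex_of_real (norm (x - v) powr g))"
   by (intro continuous_intros continuous_on_subset[OF cp]) auto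
  ultimately show ?thesis by (rule continuous_on_mult[rotated])
 qed
 have "isCont ?\<phi> x" for x
 proof (cases "x = v")
  case True
  have "((\<lambda>x. norm (x - v) powr g) \<longlongrightarrow> norm (v - v) powr g) (at v)"
   using cp unfolding continuous_on_eq_continuous_at[OF open_UNIV] isCont_def by blast
  then have "((\<lambda>x. norm (?\<phi> x)) \<longlongrightarrow> 0) (at v)" by (simp add: norm_mult)
  then have "(?\<phi> \<longlongrightarrow> 0) (at v)" by (rule tendsto_norm_zero_cancel)
  then show ?thesis unfolding True isCont_def by simp
 next
  case False
  then show ?thesis using away by (simp add: continuous_on_eq_continuous_at open_Compl)
 qed
 then show ?thesis by (simp add: continuous_on_eq_continuous_at)
qed

text \<open>The offset of the k-th face is the sum of the angles of the faces before it, as in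
  cutting the cone open and laying it flat; \<kappa> is the rotation that the definition of a chart
  leaves free.\<close>

definition unfolded :: "'a => 'a tri list => complex => bool" where
 "unfolded v fs \<kappa> \<longleftrightarrow> (\<forall>k x. k < length fs --> x \<in> Om v --> x \<in> tconv (fs ! k) -->
  cht v x = \<kappa> * of_real (norm (x - v) powr \<gamma> v) * cis (\<gamma> v * ((\<Sum>j<k. \<theta> v (fs ! j)) + ang v (fs ! k) x)))"

text \<open>\<open>chart\<close> is a choice among all solutions, so two facts are needed. A
  solution exists, namely the unfolding along \<open>star_enumeration\<close>. Any solution equals
  it up to one rotation: on a shared edge the formulas of both faces hold, which determines the
  offset of a face from that of its predecessor up to the period of \<open>cis\<close>.\<close>

lemma chart_structure:
 assumes v: "v \<in> verts F"
 obtains fs \<kappa> where "distinct fs" "set fs = star v" "norm \<kappa> = 1"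
  "unfolded v fs \<kappa>"
proof -
 obtain fs where fs: "fs \<noteq> []" "distinct fs" "set fs = star v"
  "\<forall>k. Suc k < length fs --> nx v (fs ! k) = pv v (fs ! Suc k)"
  "nx v (last fs) = pv v (hd fs) --> v \<notin> bdry F" using star_enumeration[OF v] .
 define n where "n = length fs"
 define \<beta> where "\<beta> k = (\<Sum>j<k. \<theta> v (fs ! j))" for k
 have \<beta>S: "\<beta> (Suc k) = \<beta> k + \<theta> v (fs ! k)" for k by (simp add: \<beta>_def)
 have fsS: "fs ! k \<in> star v" if "k < n" for k unfolding fs(3)[symmetric] using that by (simp add: n_def)
 have idx: "k = l" if "fs ! k = fs ! l" "k < n" "l < n" for k l using that fs(2) by (simp add: n_def nth_eq_iff_index_eq)
 have tot: "\<beta> n = total_angle F v"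
  unfolding total_angle_star fs(3)[symmetric] \<beta>_def n_def
  using sum.distinct_set_conv_list[OF fs(2), of "\<theta> v"] sum_list_sum_nth[of "map (\<theta> v) fs"] by (simp add: atLeast0LessThan)
 have g0: "\<gamma> v > 0" by (rule \<gamma>_pos(1)[OF v])
 define form where "form f b x = complex_of_real (norm (x - v) powr \<gamma> v) * cis (\<gamma> v * (b + ang v f x))" for f b x
 have form_v: "form f b v = 0" for f b by (simp add: form_def)
 \<comment> \<open>Two faces meet off v only if they are neighbours about v. For consecutive ones
   the angles agree; for the last and the first one they differ by the total angle, which the
   exponent turns into 2 pi.\<close>
 have wd1: "cis (\<gamma> v * (\<beta> k + ang v (fs ! k) x)) = cis (\<gamma> v * (\<beta> l + ang v (fs ! l) x))"
  if kl: "k < l" "l < n" and x: "x \<in> tconv (fs ! k)" "x \<in> tconv (fs ! l)" "x \<noteq> v" for k l x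
 proof -
  have kS: "fs ! k \<in> star v" and lS: "fs ! l \<in> star v" using fsS kl by auto
  have ne: "fs ! k \<noteq> fs ! l" using idx[of k l] kl by auto
  have "nx v (fs ! k) = pv v (fs ! l) \<or> nx v (fs ! l) = pv v (fs ! k)"
   using faces_meet_at_vertex[OF kS lS ne] x by blast
  then show ?thesis
  proof
   assume a: "nx v (fs ! k) = pv v (fs ! l)"
   have k1: "Suc k < n" using kl by simp
   have "pv v (fs ! l) = pv v (fs ! Suc k)" using fs(4)[rule_format, of k] k1 a by (simp add: n_def)
   then have "l = Suc k" using pv_inj[OF lS fsS[OF k1]] idx[OF _ kl(2) k1] by blast
   then show ?thesis using shared_edge_angles[OF kS lS ne a x] \<beta>S[of k] by simp
  next
   assume a: "nx v (fs ! l) = pv v (fs ! k)"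
   have "\<not> Suc l < n"
   proof
    assume l1: "Suc l < n"
    have "pv v (fs ! k) = pv v (fs ! Suc l)" using fs(4)[rule_format, of l] l1 a by (simp add: n_def)
    then have "k = Suc l" using pv_inj[OF kS fsS[OF l1]] idx[of k "Suc l"] kl l1 by simp
    then show False using kl by simp
   qed
   then have ln: "Suc l = n" using kl by simp
   have "k = 0"
   proof (rule ccontr)
    assume "k \<noteq> 0"
    then obtain k' where k': "k = Suc k'" by (cases k) auto
    then have "nx v (fs ! k') = nx v (fs ! l)" using fs(4)[rule_format, of k'] kl a by (simp add: n_def)
    then have "fs ! k' = fs ! l" using nx_inj[OF fsS lS, of k'] kl k' by simp
    then show False using idx[of k' l] kl k' by simp
   qed
   have "last fs = fs ! l" "hd fs = fs ! 0" using fs(1) ln by (simp_all add: last_conv_nth hd_conv_nth n_def[symmetric] flip: ln)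
   then have "v \<notin> bdry F" using fs(5) a \<open>k = 0\<close> by simp
   then have full: "\<gamma> v * \<beta> n = 2 * pi" using \<gamma>_pos(3)[OF v] tot by simp
   have angs: "ang v (fs ! l) x = \<theta> v (fs ! l)" "ang v (fs ! k) x = 0"
    using shared_edge_angles[OF lS kS ne[symmetric] a x(2,1,3)] by auto
   have "\<beta> l + ang v (fs ! l) x = \<beta> n" using \<beta>S[of l] ln angs by simp
   moreover have "\<beta> k + ang v (fs ! k) x = 0" using angs \<open>k = 0\<close> by (simp add: \<beta>_def)
   ultimately show ?thesis using full by simp
  qed
 qed
 have wd: "form (fs ! k) (\<beta> k) x = form (fs ! l) (\<beta> l) x"
  if kl: "k < n" "l < n" and x: "x \<in> tconv (fs ! k)" "x \<in> tconv (fs ! l)" for k l x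
 proof (cases "x = v")
  case False
  then have "cis (\<gamma> v * (\<beta> k + ang v (fs ! k) x)) = cis (\<gamma> v * (\<beta> l + ang v (fs ! l) x))"
  proof (cases k l rule: linorder_cases)
   case less
   then show ?thesis by (rule wd1[OF _ kl(2) x False])
  next
   case greater
   then show ?thesis by (rule wd1[OF _ kl(1) x(2,1) False, symmetric])
  qed simp
  then show ?thesis by (simp only: form_def)
 qed (simp add: form_v)
 define \<phi>0 where "\<phi>0 x = (let k = (SOME k. k < n \<and> x \<in> tconv (fs ! k)) in form (fs ! k) (\<beta> k) x)" for x
 have \<phi>0: "\<phi>0 x = form (fs ! k) (\<beta> k) x" if "k < n" "x \<in> tconv (fs ! k)" for k x
 proof -
  have "\<exists>k. k < n \<and> x \<in> tconv (fs ! k)" using that by blast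
  from someI_ex[OF this] show ?thesis unfolding \<phi>0_def Let_def using that by (intro wd) auto
 qed
 have cont\<phi>0: "continuous_on (\<Union>k\<in>{..<n}. tconv (fs ! k)) \<phi>0"
 proof (rule continuous_on_closed_Union)
  fix k assume k: "k \<in> {..<n}"
  show "closed (tconv (fs ! k))" using compact_tconv compact_imp_closed by blast
  have "continuous_on (tconv (fs ! k)) (form (fs ! k) (\<beta> k))"
   unfolding form_def by (rule continuous_on_subset[OF sector_map_continuous[OF g0]]) simp
  then show "continuous_on (tconv (fs ! k)) \<phi>0"
   by (rule continuous_on_eq) (use \<phi>0 k in auto)
 qed simp
 have cov: "\<Union> (tconv ` star v) = (\<Union>k\<in>{..<n}. tconv (fs ! k))"
 proof -
  have "set fs = (\<lambda>k. fs ! k) ` {..<n}" unfolding n_def set_conv_nth by blast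
  then show ?thesis unfolding fs(3)[symmetric] by (simp only: image_image)
 qed
 have "is_chart F v1 v2 v3 \<zeta> v \<phi>0"
  unfolding is_chart_def
 proof (intro conjI ballI impI)
  show "continuous_on (Om v) \<phi>0"
   using Omega_subset_star[of v] cov by (intro continuous_on_subset[OF cont\<phi>0]) simp
  fix f assume "f \<in> F" "v \<in> tverts f"
  then have "f \<in> set fs" using fs(3) by (simp add: star_def)
  then obtain k where k: "k < n" "fs ! k = f" by (auto simp: in_set_conv_nth n_def)
  show "\<exists>\<beta>. \<forall>x\<in>Om v \<inter> tconv f. \<phi>0 x = complex_of_real (norm (x - v) powr \<gamma> v) * cis (\<gamma> v * (\<beta> + vec_angle (fst (opp v f) - v) (x - v)))"
   by (rule exI[of _ "\<beta> k"]) (use \<phi>0[OF k(1)] k(2) in \<open>auto simp: form_def\<close>)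
 qed
 \<comment> \<open>Existence of one chart is what transfers the defining property to the chosen
   chart.\<close>
 then have ch: "is_chart F v1 v2 v3 \<zeta> v (cht v)" unfolding chart_def by (rule someI[of "is_chart F v1 v2 v3 \<zeta> v"])
 then have "\<forall>f. \<exists>b. f \<in> star v --> (\<forall>x\<in>Om v \<inter> tconv f. cht v x = form f b x)"
  unfolding is_chart_def form_def star_def by blast
 then obtain bet where bet: "\<And>f x. f \<in> star v ==> x \<in> Om v ==> x \<in> tconv f ==> cht v x = form f (bet f) x"
  by (metis IntI)
 define \<kappa> where "\<kappa> = cis (\<gamma> v * bet (fs ! 0))"
 obtain r where r: "r > 0" "surface F \<inter> ball v r \<subseteq> Om v" using Omega_near_vertex[OF v] .
 have rel: "cis (\<gamma> v * bet (fs ! k)) = \<kappa> * cis (\<gamma> v * \<beta> k)" if "k < n" for k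
  using that
 proof (induction k)
  case 0
  then show ?case by (simp add: \<kappa>_def \<beta>_def)
 next
  case (Suc k)
  then have kn: "k < n" by simp
  define f where "f = fs ! k" define g where "g = fs ! Suc k"
  have fS: "f \<in> star v" and gS: "g \<in> star v" using fsS Suc.prems kn by (auto simp: f_def g_def)
  have fg: "nx v f = pv v g" using fs(4) Suc.prems by (simp add: f_def g_def n_def)
  have cne: "pv v g - v \<noteq> 0" using star_distinct_verts(1)[OF gS] by simp
  \<comment> \<open>Puts the comparison point on the shared edge within distance r of v, hence into
    the domain of the chart.\<close>
  define t where "t = min 1 (r / (2 * norm (pv v g - v)))"
  have t: "0 < t" "t \<le> 1" using r cne by (simp_all add: t_def)
  define x where "x = v + t *\<^sub>R (pv v g - v)"
  have xf: "x = xm v (pv v f) (nx v f) (Complex 0 t)" and xg: "x = xm v (pv v g) (nx v g) (Complex t 0)"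
   by (simp_all add: x_def xm_def fg)
  have D: "Complex 0 t \<in> Del" "Complex t 0 \<in> Del" using t by (simp_all add: Del_def)
  have xtf: "x \<in> tconv f" and xtg: "x \<in> tconv g" and xS: "x \<in> surface F"
   using xm_in_surface[OF _ star_rot(1)[OF fS] D(1)] xm_in_surface[OF _ star_rot(1)[OF gS] D(2)] fS gS xf xg
   by (auto simp: star_def)
  have "norm (x - v) = t * norm (pv v g - v)" using t by (simp add: x_def)
  also have "\<dots> \<le> r / (2 * norm (pv v g - v)) * norm (pv v g - v)" by (intro mult_right_mono) (auto simp: t_def)
  also have "\<dots> < r" using cne r by simp
  finally have "x \<in> Om v" using r(2) xS by (auto simp: dist_norm norm_minus_commute)
  then have eq: "form f (bet f) x = form g (bet g) x" using bet fS gS xtf xtg by metis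
  have "x \<noteq> v" using cne t by (simp add: x_def)
  then have "norm (x - v) powr \<gamma> v \<noteq> 0" by simp
  then have "cis (\<gamma> v * (bet f + ang v f x)) = cis (\<gamma> v * (bet g + ang v g x))" using eq by (simp add: form_def)
  moreover have "ang v f x = \<theta> v f" "ang v g x = 0" using ang_on_edges[OF fS t(1)] ang_on_edges[OF gS t(1)] xf xg by simp_all
  ultimately have "cis (\<gamma> v * bet g) = cis (\<gamma> v * bet f) * cis (\<gamma> v * \<theta> v f)" by (simp add: distrib_left cis_mult)
  also have "\<dots> = \<kappa> * (cis (\<gamma> v * \<beta> k) * cis (\<gamma> v * \<theta> v f))" using Suc.IH[OF kn] by (simp add: f_def)
  also have "\<dots> = \<kappa> * cis (\<gamma> v * \<beta> (Suc k))" by (simp add: cis_mult \<beta>S f_def distrib_left)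
  finally show ?case by (simp add: g_def)
 qed
 show ?thesis
 proof (rule that[OF fs(2,3)])
  show "norm \<kappa> = 1" by (simp add: \<kappa>_def)
  show "unfolded v fs \<kappa>" unfolding unfolded_def
  proof (intro allI impI)
  fix k x assume k: "k < length fs" and x: "x \<in> Om v" "x \<in> tconv (fs ! k)"
  have kn: "k < n" using k by (simp add: n_def)
  have "cht v x = of_real (norm (x - v) powr \<gamma> v) * (cis (\<gamma> v * bet (fs ! k)) * cis (\<gamma> v * ang v (fs ! k) x))"
   using bet[OF fsS[OF kn] x] by (simp add: form_def cis_mult distrib_left)
  also have "\<dots> = \<kappa> * of_real (norm (x - v) powr \<gamma> v) * (cis (\<gamma> v * \<beta> k) * cis (\<gamma> v * ang v (fs ! k) x))"
   unfolding rel[OF kn] by (simp add: mult_ac)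
  also have "cis (\<gamma> v * \<beta> k) * cis (\<gamma> v * ang v (fs ! k) x) = cis (\<gamma> v * (\<beta> k + ang v (fs ! k) x))"
   by (simp add: cis_mult distrib_left)
  finally show "cht v x = \<kappa> * of_real (norm (x - v) powr \<gamma> v) * cis (\<gamma> v * ((\<Sum>j<k. \<theta> v (fs ! j)) + ang v (fs ! k) x))"
   by (simp add: \<beta>_def)
  qed
 qed
qed

text \<open>The planar coordinate divided by B lies in the closed upper half plane with the angle
  from the first edge as principal argument, so the polar form is a principal power. The offset of
  the face and the length of B go into the constant.\<close>

lemma chart_on_face:
 assumes v: "v \<in> verts F" and f: "f \<in> F" "rot f (v, b, c)" and fl: "flat v b c B C"
 obtains \<kappa> where "\<kappa> \<noteq> 0" "\<And>z. z \<in> Del ==> xm v b c z \<in> Om v ==>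
  cht v (xm v b c z) = \<kappa> * (tmap B C z / B) powr of_real (\<gamma> v)"
proof -
 note s = star_rotI[OF f]
 have \<Delta>: "Im (cnj B * C) > 0" using fl by (simp add: flat_def)
 then have B0: "B \<noteq> 0" by auto
 obtain fs \<kappa> where cs: "distinct fs" "set fs = star v" "norm \<kappa> = 1"
  "unfolded v fs \<kappa>"
  by (rule chart_structure[OF v])
 obtain k where k: "k < length fs" "fs ! k = f" using s(1) cs(2) by (metis in_set_conv_nth)
 define b0 where "b0 = (\<Sum>j<k. \<theta> v (fs ! j))"
 show ?thesis
 proof (rule that[of "\<kappa> * cis (\<gamma> v * b0) * of_real (norm B powr \<gamma> v)"])
  show "\<kappa> * cis (\<gamma> v * b0) * of_real (norm B powr \<gamma> v) \<noteq> 0" using cs(3) B0 by auto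
  fix z assume z: "z \<in> Del" and zO: "xm v b c z \<in> Om v"
  have xt: "xm v b c z \<in> tconv f" using xm_in_surface[OF f z] by blast
  have n: "norm (xm v b c z - v) = norm (tmap B C z)" using flat_dist[OF fl, of z 0] by (simp add: dist_norm tmap_def)
  have ch: "cht v (xm v b c z) = \<kappa> * of_real (norm (tmap B C z) powr \<gamma> v) * cis (\<gamma> v * (b0 + ang v f (xm v b c z)))"
   using cs(4)[unfolded unfolded_def, rule_format, OF k(1) zO] xt unfolding k(2) n b0_def by simp
  show "cht v (xm v b c z) = \<kappa> * cis (\<gamma> v * b0) * of_real (norm B powr \<gamma> v) * (tmap B C z / B) powr of_real (\<gamma> v)"
  proof (cases "z = 0")
   case True
   then have "tmap B C z = 0" by (simp add: tmap_def)
   then show ?thesis using ch by simp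
  next
   case False
   have T0: "tmap B C z / B \<noteq> 0" using tmap_inj[OF \<Delta>, of z 0] False B0 by (auto simp: tmap_def)
   have "Im z \<ge> 0" using z by (simp add: Del_def)
   then have "ang v f (xm v b c z) = Arg (tmap B C z / B)" using flat_angle[OF fl _ False] s(2) by simp
   then have "cis (\<gamma> v * (b0 + ang v f (xm v b c z))) = cis (\<gamma> v * b0) * cis (\<gamma> v * Arg (tmap B C z / B))"
    by (simp add: cis_mult distrib_left)
   moreover have "norm (tmap B C z) powr \<gamma> v = norm B powr \<gamma> v * norm (tmap B C z / B) powr \<gamma> v"
    using B0 by (simp add: powr_mult[symmetric] norm_divide)
   ultimately show ?thesis unfolding ch polar_powr[OF T0] by (simp add: mult_ac)
  qed
 qed
qed

text \<open>Scaled angles lie in [0, 2 pi], and strictly between the ends for a point inside a face;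
  so equal directions mean equal unfolded angles, the same sector and the same point. This evaluates
  \<open>inv_into\<close> of the chart, where y is an unknown point of the whole domain and may lie
  on any face.\<close>

lemma chart_inj_on_face:
 assumes v: "v \<in> verts F" and f: "f \<in> F" "rot f (v, b, c)" and z: "z \<in> Del" "Re z > 0" "Im z > 0"
  and xO: "xm v b c z \<in> Om v" and y: "y \<in> Om v" "cht v y = cht v (xm v b c z)"
 shows "y = xm v b c z"
proof -
 note s = star_rotI[OF f]
 have g0: "\<gamma> v > 0" by (rule \<gamma>_pos(1)[OF v])
 define x where "x = xm v b c z"
 obtain fs \<kappa> where cs: "distinct fs" "set fs = star v" "norm \<kappa> = 1"
  "unfolded v fs \<kappa>"
  by (rule chart_structure[OF v])
 define \<beta> where "\<beta> k = (\<Sum>j<k. \<theta> v (fs ! j))" for k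
 have fsS: "fs ! k \<in> star v" if "k < length fs" for k unfolding cs(2)[symmetric] using that by simp
 have \<beta>S: "\<beta> (Suc k) = \<beta> k + \<theta> v (fs ! k)" for k by (simp add: \<beta>_def)
 have \<beta>mono: "\<beta> k \<le> \<beta> l" if "k \<le> l" "l \<le> length fs" for k l
  unfolding \<beta>_def
 proof (rule sum_mono2)
  fix j assume "j \<in> {..<l} - {..<k}"
  then have "fs ! j \<in> star v" using that by (intro fsS) auto
  then show "0 \<le> \<theta> v (fs ! j)" by (rule less_imp_le[OF \<theta>_bounds(1)])
 qed (use that in auto)
 have \<beta>0: "\<beta> k \<ge> 0" if "k \<le> length fs" for k using \<beta>mono[of 0 k] that by (simp add: \<beta>_def)
 have tot: "\<beta> (length fs) = total_angle F v"
  unfolding total_angle_star cs(2)[symmetric] \<beta>_def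
  using sum.distinct_set_conv_list[OF cs(1), of "\<theta> v"] sum_list_sum_nth[of "map (\<theta> v) fs"] by (simp add: atLeast0LessThan)
 obtain k where k: "k < length fs" "fs ! k = f" using s(1) cs(2) by (metis in_set_conv_nth)
 obtain g where g: "g \<in> star v" "y \<in> tconv g" using y(1) Omega_subset_star by blast
 obtain l where l: "l < length fs" "fs ! l = g" using g(1) cs(2) by (metis in_set_conv_nth)
 have xt: "x \<in> tconv f" using xm_in_surface[OF f z(1)] by (simp add: x_def)
 have nd: "nondeg v b c" by (rule face_nondeg[OF f])
 have xv: "x \<noteq> v" using xm_inj[OF nd, of z 0] z by (auto simp: x_def)
 define ax where "ax = \<beta> k + ang v f x" define ay where "ay = \<beta> l + ang v g y"
 have cx: "cht v x = \<kappa> * of_real (norm (x - v) powr \<gamma> v) * cis (\<gamma> v * ax)"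
  using cs(4)[unfolded unfolded_def, rule_format, OF k(1), of x] xO xt k(2) by (simp add: x_def ax_def \<beta>_def)
 have cy: "cht v y = \<kappa> * of_real (norm (y - v) powr \<gamma> v) * cis (\<gamma> v * ay)"
  using cs(4)[unfolded unfolded_def, rule_format, OF l(1), of y] y(1) g(2) l(2) by (simp add: ay_def \<beta>_def)
 have eq: "of_real (norm (y - v) powr \<gamma> v) * cis (\<gamma> v * ay) = of_real (norm (x - v) powr \<gamma> v) * cis (\<gamma> v * ax)"
  using y(2) cs(3) unfolding x_def[symmetric] cx cy by (auto simp: mult.assoc)
 then have "norm (of_real (norm (y - v) powr \<gamma> v) * cis (\<gamma> v * ay)) = norm (of_real (norm (x - v) powr \<gamma> v) * cis (\<gamma> v * ax))" by (rule arg_cong)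
 then have pw: "norm (y - v) powr \<gamma> v = norm (x - v) powr \<gamma> v" by (simp add: norm_mult)
 have nn: "norm (y - v) = norm (x - v)"
 proof -
  have "(norm (y - v) powr \<gamma> v) powr (1 / \<gamma> v) = (norm (x - v) powr \<gamma> v) powr (1 / \<gamma> v)" by (simp only: pw)
  then show ?thesis using g0 by (simp add: powr_powr)
 qed
 then have yv: "y \<noteq> v" using xv by auto
 have ceq: "cis (\<gamma> v * ay) = cis (\<gamma> v * ax)" using eq pw xv by simp
 have a1: "0 < ang v f x" "ang v f x < \<theta> v f" using ang_strict[OF s(1) z(2,3)] s(2,3) by (simp_all add: x_def)
 have a2: "0 \<le> ang v g y" "ang v g y \<le> \<theta> v g" using ang_bounds[OF g(1,2) yv] by auto
 have ub: "\<gamma> v * \<beta> (length fs) \<le> 2 * pi" unfolding tot by (rule \<gamma>_pos(2)[OF v])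
 have ax: "0 < ax" "ax < \<beta> (length fs)"
  using a1 \<beta>0[of k] \<beta>S[of k] \<beta>mono[of "Suc k" "length fs"] k by (simp_all add: ax_def)
 have ay: "0 \<le> ay" "ay \<le> \<beta> (length fs)"
  using a2 \<beta>0[of l] \<beta>S[of l] \<beta>mono[of "Suc l" "length fs"] l by (simp_all add: ay_def)
 have "\<gamma> v * ay - \<gamma> v * ax = 0"
 proof -
  have "cis (\<gamma> v * ay - \<gamma> v * ax) = 1" using ceq by (simp add: cis_divide[symmetric])
  then have "cos (\<gamma> v * ay - \<gamma> v * ax) = 1" by (metis cis.sel(1) one_complex.sel(1))
  then obtain m :: int where m: "\<gamma> v * ay - \<gamma> v * ax = of_int m * 2 * pi" using cos_one_2pi_int by auto
  have p1: "0 < \<gamma> v * ax" "\<gamma> v * ax < 2 * pi"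
   using mult_pos_pos[OF g0 ax(1)] ub mult_strict_left_mono[OF ax(2) g0] by linarith+
  have p2: "0 \<le> \<gamma> v * ay" "\<gamma> v * ay \<le> 2 * pi"
   using mult_nonneg_nonneg[OF less_imp_le[OF g0] ay(1)] ub mult_left_mono[OF ay(2) less_imp_le[OF g0]] by linarith+
  have "\<bar>of_int m * 2 * pi\<bar> < 2 * pi" using m p1 p2 by linarith
  then have "\<bar>of_int m\<bar> * (2 * pi) < 1 * (2 * pi)" by (simp add: abs_mult)
  then have "\<bar>real_of_int m\<bar> < 1" by (rule mult_right_less_imp_less) simp
  then have "m = 0" by linarith
  then show ?thesis using m by simp
 qed
 then have ae: "ay = ax" using g0 by simp
 have "l = k"
 proof (rule linorder_cases[of l k])
  assume "l < k"
  then have "\<beta> (Suc l) \<le> \<beta> k" using k by (intro \<beta>mono) auto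
  then show "l = k" using ae a1 a2 \<beta>S[of l] l(2) unfolding ax_def ay_def by simp
 next
  assume "k < l"
  then have "\<beta> (Suc k) \<le> \<beta> l" using l by (intro \<beta>mono) auto
  then show "l = k" using ae a1 a2 \<beta>S[of k] k(2) unfolding ax_def ay_def by simp
 qed
 then have "g = f" "ang v f y = ang v f x" using l k ae by (auto simp: ax_def ay_def)
 then have "y = x" using polar_inj[OF s(1) _ yv xt xv nn] g(2) by simp
 then show ?thesis by (simp add: x_def)
qed

end

section \<open>Discrete maps in face coordinates\<close>

text \<open>Charts are power maps at the vertices, so uniform estimates are available only with
  discs about the three vertices removed.\<close>

definition Dels :: "real => complex set" where
 "Dels \<rho> = {z\<in>Del. \<rho> \<le> norm z \<and> \<rho> \<le> norm (z - 1) \<and> \<rho> \<le> norm (z - \<i>)}"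

lemma compact_Dels: "compact (Dels \<rho>)"
proof -
 have "closed ({z. \<rho> \<le> norm z} \<inter> {z. \<rho> \<le> norm (z - 1)} \<inter> {z. \<rho> \<le> norm (z - \<i>)})"
  by (intro closed_Int closed_Collect_le continuous_intros)
 moreover have "Dels \<rho> = Del \<inter> ({z. \<rho> \<le> norm z} \<inter> {z. \<rho> \<le> norm (z - 1)} \<inter> {z. \<rho> \<le> norm (z - \<i>)})"
  by (auto simp: Dels_def)
 ultimately show ?thesis using compact_Del by (simp add: compact_Int_closed)
qed

locale conformal_setup = disk_surface F v1 v2 v3 \<zeta>
 for F :: "'a::euclidean_space tri set" and v1 v2 v3 :: 'a and \<zeta> :: real +
 fixes assoc :: "'a tri => 'a" and \<Psi> :: "'a => complex" and K :: "nat => real" and \<Phi> :: "nat => 'a => complex"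
  and Q :: nat and \<kappa> :: real
 assumes assoc: "admissible_assoc F \<zeta> assoc"
  and Psi_hom: "\<exists>\<Psi>'. homeomorphism (surface F) Tri \<Psi> \<Psi>'"
  and Psi_corners: "\<Psi> v1 = tcorner 1" "\<Psi> v2 = tcorner 2" "\<Psi> v3 = tcorner 3"
  and Psi_conf: "\<forall>v\<in>verts F.
    (\<Psi> \<circ> inv_into (Omega F \<zeta> v) (chart F v1 v2 v3 \<zeta> v)) holomorphic_on
     (chart F v1 v2 v3 \<zeta> v ` (Omega F \<zeta> v - bdry F))"
  and kappa: "\<kappa> > 0"
  and K: "(\<lambda>q. K q - 1) \<in> O(\<lambda>q. 2 powr (- \<kappa> * real q))"
  and Phi: "\<forall>q\<ge>Q. \<Phi> q \<in> FK F v1 v2 v3 \<zeta> assoc q (K q)"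
begin

lemma K_eventually: assumes "\<eta> > 0" shows "eventually (\<lambda>q. K q \<le> 1 + \<eta>) sequentially"
proof -
 have "(\<lambda>q. 2 powr (- \<kappa> * real q)) \<longlonglongrightarrow> 0"
 proof -
  have "(\<lambda>q. (2 powr (- \<kappa>)) ^ q) \<longlonglongrightarrow> 0"
   using kappa by (intro LIMSEQ_power_zero) (simp add: powr_less_one)
  moreover have "(2 powr (- \<kappa>)) ^ q = 2 powr (- \<kappa> * real q)" for q
   by (simp add: powr_realpow[symmetric] powr_powr)
  ultimately show ?thesis by simp
 qed
 then have "(\<lambda>q. 2 powr (- \<kappa> * real q)) \<in> o(\<lambda>_. 1::real)" by (intro smalloI_tendsto) auto
 then have "(\<lambda>q. K q - 1) \<in> o(\<lambda>_. 1)" using K landau_o.big_small_trans by blast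
 then have "(\<lambda>q. (K q - 1) / 1) \<longlonglongrightarrow> 0" by (rule smalloD_tendsto)
 then have "eventually (\<lambda>q. \<bar>K q - 1\<bar> < \<eta>) sequentially" using assms unfolding tendsto_iff dist_real_def by simp
 then show ?thesis by eventually_elim auto
qed

lemma Phi_props:
 assumes "q \<ge> Q"
 shows "continuous_on (surface F) (\<Phi> q)" "inj_on (\<Phi> q) (surface F)" "\<Phi> q ` surface F = Tri"
  "\<Phi> q ` bdry F = frontier Tri"
  "\<Phi> q v1 = tcorner 1" "\<Phi> q v2 = tcorner 2" "\<Phi> q v3 = tcorner 3"
  "\<And>f. f \<in> level F q ==> \<exists>L c. linear L \<and> (\<forall>x\<in>tconv f. \<Phi> q x = L x + c)"
  "\<And>f g. f \<in> level F q ==> g \<in> level F 2 ==> tconv f \<subseteq> tconv g ==>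
   orient_pos (face_lin (\<Phi> q) (cht (assoc g)) f) \<and> dcd (face_lin (\<Phi> q) (cht (assoc g)) f) \<le> K q"
proof -
 have m: "\<Phi> q \<in> FK F v1 v2 v3 \<zeta> assoc q (K q)" using Phi assms by blast
 then obtain \<Phi>' where h: "homeomorphism (surface F) Tri (\<Phi> q) \<Phi>'" unfolding FK_def by blast
 show "continuous_on (surface F) (\<Phi> q)" "\<Phi> q ` surface F = Tri" using h by (auto simp: homeomorphism_def)
 show "inj_on (\<Phi> q) (surface F)" using h unfolding homeomorphism_def by (metis inj_on_inverseI)
 show "\<Phi> q ` bdry F = frontier Tri" using m unfolding FK_def bij_betw_def by blast
 show "\<Phi> q v1 = tcorner 1" "\<Phi> q v2 = tcorner 2" "\<Phi> q v3 = tcorner 3" using m unfolding FK_def by auto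
 show "\<exists>L c. linear L \<and> (\<forall>x\<in>tconv f. \<Phi> q x = L x + c)" if "f \<in> level F q" for f using m that unfolding FK_def by blast
 show "orient_pos (face_lin (\<Phi> q) (cht (assoc g)) f) \<and> dcd (face_lin (\<Phi> q) (cht (assoc g)) f) \<le> K q"
  if "f \<in> level F q" "g \<in> level F 2" "tconv f \<subseteq> tconv g" for f g using m that unfolding FK_def by blast
qed

text \<open>The unfolded face without its vertex avoids the negative real axis, where the principal
  power has its cut. The expression is therefore holomorphic on an open set containing it, with
  nonvanishing derivative.\<close>

lemma chart_local_base:
 assumes v: "v \<in> verts F" and f: "f \<in> F" "rot f (v, b, c)" and fl: "flat v b c B C"
 shows "\<exists>\<psi> V. open V \<and> \<psi> holomorphic_on V \<and> (\<forall>u\<in>V. deriv \<psi> u \<noteq> 0) \<and> (\<forall>z\<in>Del. z \<noteq> 0 --> tmap B C z \<in> V) \<and>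
  (\<forall>z\<in>Del. xm v b c z \<in> Om v --> cht v (xm v b c z) = \<psi> (tmap B C z))"
proof -
 obtain k where k: "k \<noteq> 0" "\<forall>z. z \<in> Del --> xm v b c z \<in> Om v -->
  cht v (xm v b c z) = k * (tmap B C z / B) powr of_real (\<gamma> v)"
 proof (rule chart_on_face[OF v f fl], goal_cases)
  case (1 k)
  show ?case by (rule 1(1)[OF 1(2)]) (use 1(3) in simp)
 qed
 have \<Delta>: "Im (cnj B * C) > 0" using fl by (simp add: flat_def)
 then have B0: "B \<noteq> 0" by auto
 have g0: "\<gamma> v > 0" by (rule \<gamma>_pos(1)[OF v])
 define V where "V = {u. u / B \<in> - \<real>\<^sub>\<le>\<^sub>0}"
 have "open ((\<lambda>u. u / B) -` (- \<real>\<^sub>\<le>\<^sub>0))"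
  using B0 by (intro continuous_open_vimage) (auto intro!: continuous_intros simp: open_Compl)
 then have oV: "open V" by (simp add: V_def vimage_def)
 define \<psi> where "\<psi> u = k * (u / B) powr of_real (\<gamma> v)" for u
 have der: "(\<psi> has_field_derivative k * (of_real (\<gamma> v) * (u / B) powr (of_real (\<gamma> v) - 1)) * (1 / B)) (at u)" if "u \<in> V" for u
  unfolding \<psi>_def using that B0 by (auto intro!: derivative_eq_intros simp: V_def)
 have hol: "\<psi> holomorphic_on V" using der oV by (auto simp: holomorphic_on_open)
 have dn0: "deriv \<psi> u \<noteq> 0" if "u \<in> V" for u
 proof -
  have "u / B \<noteq> 0" using that by (auto simp: V_def)
  then show ?thesis unfolding DERIV_imp_deriv[OF der[OF that]] using k(1) g0 B0 by simp
 qed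
 have inV: "tmap B C z \<in> V" if z: "z \<in> Del" "z \<noteq> 0" for z
 proof -
  have im: "Im (tmap B C z / B) = Im z * (Im (cnj B * C) / (norm B)\<^sup>2)" by (rule Im_tmap_div[OF \<Delta>])
  have p: "Im (cnj B * C) / (norm B)\<^sup>2 > 0" using \<Delta> B0 by simp
  have "tmap B C z / B \<notin> \<real>\<^sub>\<le>\<^sub>0"
  proof
   assume n: "tmap B C z / B \<in> \<real>\<^sub>\<le>\<^sub>0"
   then have "Im (tmap B C z / B) = 0" "Re (tmap B C z / B) \<le> 0" by (auto simp: complex_nonpos_Reals_iff)
   then have "Im z * (Im (cnj B * C) / (norm B)\<^sup>2) = 0" using im by (simp only:)
   then have i0: "Im z = 0" using p by (metis mult_eq_0_iff less_irrefl)
   then have "tmap B C z / B = of_real (Re z)" using B0 by (simp add: tmap_def scaleR_conv_of_real)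
   then have "Re z \<le> 0" using \<open>Re (tmap B C z / B) \<le> 0\<close> by simp
   then show False using z i0 by (auto simp: Del_def complex_eq_iff)
  qed
  then show ?thesis by (simp add: V_def)
 qed
 show ?thesis
  by (rule exI[of _ \<psi>], rule exI[of _ V]) (use oV hol dn0 inV k(2) in \<open>auto simp: \<psi>_def\<close>)
qed

text \<open>Cyclic rotation moves v to the first place; the planar coordinate changes only by a
  translation, since \<open>flat_rotate\<close> keeps the same copy of the face. \<open>zv\<close>
  is the coordinate of v, the only point where conformality may fail.\<close>

lemma chart_local:
 assumes f: "f \<in> F" "rot f (a, b, c)" and fl: "flat a b c B C" and v: "v \<in> {a, b, c}"
 shows "\<exists>\<psi> V zv. zv \<in> {0, 1, \<i>} \<and> open V \<and> \<psi> holomorphic_on V \<and> (\<forall>u\<in>V. deriv \<psi> u \<noteq> 0) \<and>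
  (\<forall>z\<in>Del. z \<noteq> zv --> tmap B C z \<in> V) \<and>
  (\<forall>z\<in>Del. xm a b c z \<in> Om v --> cht v (xm a b c z) = \<psi> (tmap B C z))"
proof -
 have vV: "v \<in> verts F" using v f(1) rot_tverts[OF f(2)] by (auto simp: verts_def)
 have shift: ?thesis
  if h: "rot f (v, b', c')" "flat v b' c' B' C'" "zv \<in> {0, 1, \<i>}" "\<And>z. xm v b' c' (\<sigma> z) = xm a b c z"
   "\<And>z. tmap B' C' (\<sigma> z) = tmap B C z - uv" "\<And>z. z \<in> Del ==> \<sigma> z \<in> Del" "\<And>z. z \<noteq> zv ==> \<sigma> z \<noteq> 0" for b' c' B' C' zv \<sigma> uv
 proof -
  obtain \<psi> V where p: "open V" "\<psi> holomorphic_on V" "\<forall>u\<in>V. deriv \<psi> u \<noteq> 0" "\<forall>z\<in>Del. z \<noteq> 0 --> tmap B' C' z \<in> V"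
   "\<forall>z\<in>Del. xm v b' c' z \<in> Om v --> cht v (xm v b' c' z) = \<psi> (tmap B' C' z)"
   using chart_local_base[OF vV f(1) h(1,2)] by blast
  define V' where "V' = (\<lambda>u. u - uv) -` V"
  have o: "open V'" unfolding V'_def using p(1) by (intro continuous_open_vimage) (auto intro!: continuous_intros)
  have hol: "(\<lambda>u. \<psi> (u - uv)) holomorphic_on V'"
   by (rule holomorphic_on_compose_gen[OF _ p(2), of "\<lambda>u. u - uv", unfolded o_def]) (auto intro!: holomorphic_intros simp: V'_def)
  have dn: "deriv (\<lambda>u. \<psi> (u - uv)) u \<noteq> 0" if "u \<in> V'" for u
  proof -
   have uV: "u - uv \<in> V" using that by (simp add: V'_def)
   have "(\<psi> has_field_derivative deriv \<psi> (u - uv)) (at (u - uv))" using holomorphic_derivI[OF p(2,1) uV] .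
   then have "((\<lambda>u. \<psi> (u - uv)) has_field_derivative deriv \<psi> (u - uv) * 1) (at u)"
    by (rule DERIV_chain'[rotated]) (auto intro!: derivative_eq_intros)
   from DERIV_imp_deriv[OF this] show ?thesis using p(3) uV by simp
  qed
  show ?thesis
  proof (intro exI conjI ballI impI)
   show "zv \<in> {0, 1, \<i>}" "open V'" "(\<lambda>u. \<psi> (u - uv)) holomorphic_on V'" by (fact h o hol)+
   show "deriv (\<lambda>u. \<psi> (u - uv)) u \<noteq> 0" if "u \<in> V'" for u by (rule dn[OF that])
   fix z assume z: "z \<in> Del"
   show "tmap B C z \<in> V'" if "z \<noteq> zv"
   proof -
    have "tmap B' C' (\<sigma> z) \<in> V" using p(4) h(6)[OF z] h(7)[OF that] by blast
    then show ?thesis unfolding h(5) V'_def by simp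
   qed
   show "cht v (xm a b c z) = \<psi> (tmap B C z - uv)" if "xm a b c z \<in> Om v"
    using p(5)[rule_format, OF h(6)[OF z]] that unfolding h(4,5) by blast
  qed
 qed
 \<comment> \<open>One cyclic rotation of the barycentric coordinates, applied once for v = b and
   twice for v = c.\<close>
 define \<sigma> where "\<sigma> z = Complex (Im z) (1 - Re z - Im z)" for z
 have sD: "\<sigma> z \<in> Del" if "z \<in> Del" for z using that by (auto simp: \<sigma>_def Del_def)
 have r2: "rot f (b, c, a)" using rot_trans[OF f(2), of "(b,c,a)"] by (simp add: rot_def)
 have r3: "rot f (c, a, b)" using rot_trans[OF f(2), of "(c,a,b)"] by (simp add: rot_def)
 from v consider "v = a" | "v = b" | "v = c" by auto
 then show ?thesis
 proof cases
  case 1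
  show ?thesis by (rule shift[of b c B C 0 "\<lambda>z. z" 0]) (use f fl 1 in auto)
 next
  case 2
  show ?thesis
  proof (rule shift[of c a "C - B" "- B" 1 \<sigma> B])
   show "rot f (v, c, a)" using r2 2 by simp
   show "flat v c a (C - B) (- B)" using flat_rotate[OF fl] 2 by simp
   show "xm v c a (\<sigma> z) = xm a b c z" for z unfolding 2 \<sigma>_def by (rule xm_rotate)
   show "tmap (C - B) (- B) (\<sigma> z) = tmap B C z - B" for z unfolding \<sigma>_def by (rule tmap_rotate)
   show "\<sigma> z \<noteq> 0" if "z \<noteq> 1" for z using that by (auto simp: \<sigma>_def complex_eq_iff)
  qed (use sD in auto)
 next
  case 3
  show ?thesis
  proof (rule shift[of a b "- B - (C - B)" "- (C - B)" \<i> "\<lambda>z. \<sigma> (\<sigma> z)" C])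
   show "rot f (v, a, b)" using r3 3 by simp
   show "flat v a b (- B - (C - B)) (- (C - B))" using flat_rotate[OF flat_rotate[OF fl]] 3 by simp
   show "xm v a b (\<sigma> (\<sigma> z)) = xm a b c z" for z unfolding 3 \<sigma>_def xm_rotate by (rule refl)
   show "tmap (- B - (C - B)) (- (C - B)) (\<sigma> (\<sigma> z)) = tmap B C z - C" for z
    unfolding \<sigma>_def tmap_rotate by simp
   show "\<sigma> (\<sigma> z) \<noteq> 0" if "z \<noteq> \<i>" for z using that by (auto simp: \<sigma>_def complex_eq_iff)
  qed (use sD in auto)
 qed
qed

text \<open>Edge vectors, in units of the mesh, of an upward triangle from its lower left corner and
  of a downward one from its lower right corner. Both pairs have determinant 1, so in the planar
  coordinate both give the same \<Delta>.\<close>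

definition small_pair :: "complex => complex => bool" where
 "small_pair d2 d3 \<longleftrightarrow> (d2 = 1 \<and> d3 = \<i>) \<or> (d2 = \<i> \<and> d3 = \<i> - 1)"

text \<open>Named so that constants can be chosen at once for the three vertices of a face, whose
  charts may be used by different subfaces.\<close>

definition vertex_est :: "'a => 'a => 'a => complex => complex => real => real => 'a => real => real => bool" where
 "vertex_est a b c B C \<rho> \<tau> v \<eta> h0 \<longleftrightarrow> (\<forall>K' h z z2 z3 d2 d3 w1 w2 w3.
  K' \<le> 1 + \<eta> --> 0 < h --> h < h0 --> z \<in> Dels \<rho> --> z2 \<in> Del --> z3 \<in> Del -->
  {xm a b c z, xm a b c z2, xm a b c z3} \<subseteq> Om v --> small_pair d2 d3 -->
  z2 - z = of_real h * d2 --> z3 - z = of_real h * d3 -->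
  orient_pos (lin_part (cht v (xm a b c z)) (cht v (xm a b c z2)) (cht v (xm a b c z3)) w1 w2 w3) -->
  dcd (lin_part (cht v (xm a b c z)) (cht v (xm a b c z2)) (cht v (xm a b c z3)) w1 w2 w3) \<le> K' -->
  (\<exists>\<alpha> \<beta>. norm \<beta> \<le> \<tau> * norm \<alpha> \<and> w2 - w1 = \<alpha> * tmap B C (z2 - z) + \<beta> * cnj (tmap B C (z2 - z)) \<and>
    w3 - w1 = \<alpha> * tmap B C (z3 - z) + \<beta> * cnj (tmap B C (z3 - z))))"

lemma vertex_estimate:
 assumes f: "f \<in> F" "rot f (a, b, c)" and fl: "flat a b c B C" and v: "v \<in> {a, b, c}" and \<rho>: "\<rho> > 0" and \<tau>: "\<tau> > 0"
 shows "\<exists>\<eta> h0. \<eta> > 0 \<and> h0 > 0 \<and> vertex_est a b c B C \<rho> \<tau> v \<eta> h0"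
proof -
 obtain \<psi> V zv where p: "zv \<in> {0, 1, \<i>}" "open V" "\<psi> holomorphic_on V" "\<forall>u\<in>V. deriv \<psi> u \<noteq> 0"
  "\<forall>z\<in>Del. z \<noteq> zv --> tmap B C z \<in> V"
  "\<forall>z\<in>Del. xm a b c z \<in> Om v --> cht v (xm a b c z) = \<psi> (tmap B C z)"
  using chart_local[OF f fl v] by blast
 define Kc where "Kc = tmap B C ` Dels \<rho>"
 have "continuous_on (Dels \<rho>) (tmap B C)" using linear_tmap by (simp add: linear_continuous_on linear_conv_bounded_linear)
 then have cKc: "compact Kc" unfolding Kc_def using compact_Dels by (rule compact_continuous_image)
 have KcV: "Kc \<subseteq> V"
 proof
  fix u assume "u \<in> Kc"
  then obtain z where z: "z \<in> Dels \<rho>" "u = tmap B C z" by (auto simp: Kc_def)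
  have "z \<noteq> zv" using z(1) p(1) \<rho> by (auto simp: Dels_def)
  then show "u \<in> V" using p(5) z by (auto simp: Dels_def)
 qed
 define M where "M = max (norm B) (max (norm C) (norm (C - B))) + 1"
 have M: "M > 0" "norm B \<le> M" "norm C \<le> M" "norm (C - B) \<le> M" 
  using norm_ge_zero[of B] unfolding M_def by linarith+
 have \<Delta>: "Im (cnj B * C) > 0" using fl by (simp add: flat_def)
 obtain \<eta> h0 where e: "\<eta> > 0" "h0 > 0"
  "\<And>K h u D2 D3 w1 w2 w3. K \<le> 1 + \<eta> ==> 0 < h ==> h < h0 ==> u \<in> Kc ==> norm D2 \<le> M ==> norm D3 \<le> M ==>
   Im (cnj D2 * D3) = Im (cnj B * C) ==>
   orient_pos (lin_part (\<psi> u) (\<psi> (u + of_real h * D2)) (\<psi> (u + of_real h * D3)) w1 w2 w3) ==>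
   dcd (lin_part (\<psi> u) (\<psi> (u + of_real h * D2)) (\<psi> (u + of_real h * D3)) w1 w2 w3) \<le> K ==>
   \<exists>\<alpha> \<beta>. norm \<beta> \<le> \<tau> * norm \<alpha> \<and> w2 - w1 = \<alpha> * (of_real h * D2) + \<beta> * cnj (of_real h * D2) \<and>
      w3 - w1 = \<alpha> * (of_real h * D3) + \<beta> * cnj (of_real h * D3)"
 proof (rule distortion_estimate[OF p(2,3) cKc KcV _ \<tau> \<Delta> M(1)], goal_cases)
  case (1 u) then show ?case using p(4) KcV by blast
 next
  case (2 \<eta> h0) show ?case by (rule 2(1)[OF 2(2,3)]) (rule 2(4))
 qed
 show ?thesis unfolding vertex_est_def
 proof (rule exI[of _ \<eta>], rule exI[of _ h0], intro conjI allI impI)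
  show "\<eta> > 0" "h0 > 0" by (fact e)+
  fix K' h z z2 z3 d2 d3 w1 w2 w3
  assume K': "K' \<le> 1 + \<eta>" and h: "0 < h" "h < h0" and z: "z \<in> Dels \<rho>" "z2 \<in> Del" "z3 \<in> Del"
   and O: "{xm a b c z, xm a b c z2, xm a b c z3} \<subseteq> Om v" and sp: "small_pair d2 d3"
   and d: "z2 - z = of_real h * d2" "z3 - z = of_real h * d3"
   and op: "orient_pos (lin_part (cht v (xm a b c z)) (cht v (xm a b c z2)) (cht v (xm a b c z3)) w1 w2 w3)"
   and dc: "dcd (lin_part (cht v (xm a b c z)) (cht v (xm a b c z2)) (cht v (xm a b c z3)) w1 w2 w3) \<le> K'"
  have zD: "z \<in> Del" using z(1) by (simp add: Dels_def)
  define D2 where "D2 = tmap B C d2" define D3 where "D3 = tmap B C d3"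
  have td: "tmap B C (of_real h * d) = of_real h * tmap B C d" for d
   using linear_scale[OF linear_tmap, of B C h d] by (simp add: scaleR_conv_of_real)
  have t2: "tmap B C z2 = tmap B C z + of_real h * D2" and t3: "tmap B C z3 = tmap B C z + of_real h * D3"
   using d td[of d2] td[of d3] linear_diff[OF linear_tmap, of B C z2 z] linear_diff[OF linear_tmap, of B C z3 z]
   by (simp_all add: D2_def D3_def algebra_simps)
  have ch: "cht v (xm a b c z) = \<psi> (tmap B C z)"
   "cht v (xm a b c z2) = \<psi> (tmap B C z + of_real h * D2)"
   "cht v (xm a b c z3) = \<psi> (tmap B C z + of_real h * D3)"
   using p(6) O zD z t2 t3 by auto
  have DD: "norm D2 \<le> M" "norm D3 \<le> M" "Im (cnj D2 * D3) = Im (cnj B * C)"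

  proof -
   have t: "tmap B C 1 = B" "tmap B C \<i> = C" "tmap B C (\<i> - 1) = C - B" by (simp_all add: tmap_def)
   have i: "Im (cnj C * (C - B)) = Im (cnj B * C)" by (simp add: algebra_simps)
   from sp show "norm D2 \<le> M" "norm D3 \<le> M" "Im (cnj D2 * D3) = Im (cnj B * C)"
    unfolding small_pair_def D2_def D3_def using t i M(2-4) by (elim disjE conjE; simp only:)+
  qed
  have uK: "tmap B C z \<in> Kc" using z(1) by (simp add: Kc_def)
  have dt: "tmap B C (z2 - z) = of_real h * D2" "tmap B C (z3 - z) = of_real h * D3"
   unfolding d td by (simp_all add: D2_def D3_def)
  show "\<exists>\<alpha> \<beta>. norm \<beta> \<le> \<tau> * norm \<alpha> \<and> w2 - w1 = \<alpha> * tmap B C (z2 - z) + \<beta> * cnj (tmap B C (z2 - z)) \<and>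
    w3 - w1 = \<alpha> * tmap B C (z3 - z) + \<beta> * cnj (tmap B C (z3 - z))"
   unfolding dt by (rule e(3)[OF K' h uK DD]) (use op dc in \<open>simp_all only: ch\<close>)
 qed
qed

lemma refine_rot:
 assumes "rot f t" "t' \<in> (refine ^^ q) {t}"
 shows "\<exists>f'\<in>(refine ^^ q) {f}. rot f' t'"
 using assms(2)
proof (induction q arbitrary: t')
 case (Suc q)
 obtain s where s: "s \<in> (refine ^^ q) {t}" "t' \<in> subdiv_face s" using Suc.prems unfolding refine_Suc_iff by (elim bexE)
 from Suc.IH[OF s(1)] obtain g where g: "g \<in> (refine ^^ q) {f}" "rot g s" by blast
 from subdiv_rot[OF g(2) s(2)] obtain f' where "f' \<in> subdiv_face g" "rot f' t'" by blast
 then show ?case using g(1) refine_Suc_iff by metis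
next
 case 0
 then have "t' = t" by simp
 then show ?case using assms(1) by (intro bexI[of _ f]) simp_all
qed

lemma face_lin_rot: "rot f t ==> face_lin \<Phi>' \<phi> f = face_lin \<Phi>' \<phi> t"
proof -
 have r: "face_lin \<Phi>' \<phi> (rotl g) = face_lin \<Phi>' \<phi> g" for g
 proof (cases g)
  case (fields x y z)
  show ?thesis unfolding fields rotl.simps face_lin.simps by (rule lin_part_rotate)
 qed
 show "rot f t ==> face_lin \<Phi>' \<phi> f = face_lin \<Phi>' \<phi> t" unfolding rot_def by (elim disjE) (simp_all only: r)
qed

lemma xm_hull: "xm a b c ` (convex hull S) = convex hull (xm a b c ` S)"
proof -
 have "linear (\<lambda>z. Re z *\<^sub>R (b - a) + Im z *\<^sub>R (c - a))" by (rule linearI) (simp_all add: algebra_simps)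
 from convex_hull_linear_image[OF this, of S] have "convex hull ((\<lambda>z. Re z *\<^sub>R (b - a) + Im z *\<^sub>R (c - a)) ` S) = (\<lambda>z. Re z *\<^sub>R (b - a) + Im z *\<^sub>R (c - a)) ` (convex hull S)" by simp
 then have "convex hull ((+) a ` (\<lambda>z. Re z *\<^sub>R (b - a) + Im z *\<^sub>R (c - a)) ` S) = (+) a ` (\<lambda>z. Re z *\<^sub>R (b - a) + Im z *\<^sub>R (c - a)) ` (convex hull S)"
  by (simp only: convex_hull_translation)
 then show ?thesis by (simp add: image_image xm_def add.assoc)
qed

text \<open>The difference between the affine map and the desired form is linear in the displacement
  and vanishes on two independent vectors.\<close>

lemma aff_on_from_pair:
 assumes L: "linear L" "\<And>x. x \<in> xm a b c ` S ==> G x = L x + k" and sp: "small_pair d2 d3" and h: "h \<noteq> (0::real)"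
  and z: "z \<in> S" "z2 \<in> S" "z3 \<in> S" "z2 - z = of_real h * d2" "z3 - z = of_real h * d3"
  and e: "G (xm a b c z2) - G (xm a b c z) = \<alpha> * tmap B C (z2 - z) + \<beta> * cnj (tmap B C (z2 - z))"
   "G (xm a b c z3) - G (xm a b c z) = \<alpha> * tmap B C (z3 - z) + \<beta> * cnj (tmap B C (z3 - z))"
 shows "aff_on (G \<circ> xm a b c) B C \<alpha> \<beta> S"
proof -
 define \<Lambda> where "\<Lambda> d = L (Re d *\<^sub>R (b - a) + Im d *\<^sub>R (c - a)) - (\<alpha> * tmap B C d + \<beta> * cnj (tmap B C d))" for d
 have lx: "linear (\<lambda>d. Re d *\<^sub>R (b - a) + Im d *\<^sub>R (c - a))" by (rule linearI) (simp_all add: algebra_simps)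
 have lin: "linear \<Lambda>"
 proof -
  have 1: "linear (\<lambda>d. L (Re d *\<^sub>R (b - a) + Im d *\<^sub>R (c - a)))" using linear_compose[OF lx L(1)] by (simp only: o_def)
  have 2: "linear (\<lambda>d. \<alpha> * tmap B C d + \<beta> * cnj (tmap B C d))"
   by (rule linearI) (simp_all add: linear_add[OF linear_tmap] linear_scale[OF linear_tmap] algebra_simps)
  show ?thesis unfolding \<Lambda>_def by (rule linear_compose_sub[OF 1 2])
 qed
 have GL: "G (xm a b c p) - G (xm a b c q) = L (Re (p - q) *\<^sub>R (b - a) + Im (p - q) *\<^sub>R (c - a))" if "p \<in> S" "q \<in> S" for p q
  unfolding xm_diff[symmetric] linear_diff[OF L(1)] using L(2)[of "xm a b c p"] L(2)[of "xm a b c q"] that by simp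
 have "\<Lambda> (z2 - z) = 0" "\<Lambda> (z3 - z) = 0" using e GL z by (simp_all add: \<Lambda>_def)
 then have "h *\<^sub>R \<Lambda> d2 = 0" "h *\<^sub>R \<Lambda> d3 = 0"
  using linear_scale[OF lin, of h d2] linear_scale[OF lin, of h d3] z(4,5) by (simp_all add: scaleR_conv_of_real)
 then have d0: "\<Lambda> d2 = 0" "\<Lambda> d3 = 0" using h by auto
 have "\<Lambda> 1 = 0" "\<Lambda> \<i> = 0"
  using sp d0 linear_diff[OF lin, of \<i> "\<i> - 1"] unfolding small_pair_def by auto
 then have "\<Lambda> d = 0" for d
 proof -
  have "d = Re d *\<^sub>R 1 + Im d *\<^sub>R \<i>" by (simp add: complex_eq_iff)
  then have "\<Lambda> d = Re d *\<^sub>R \<Lambda> 1 + Im d *\<^sub>R \<Lambda> \<i>" using linear_add[OF lin] linear_scale[OF lin] by metis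
  then show ?thesis using \<open>\<Lambda> 1 = 0\<close> \<open>\<Lambda> \<i> = 0\<close> by simp
 qed
 then have Lz: "L (Re d *\<^sub>R (b - a) + Im d *\<^sub>R (c - a)) = \<alpha> * tmap B C d + \<beta> * cnj (tmap B C d)" for d
  unfolding \<Lambda>_def by (simp only: right_minus_eq)
 show ?thesis unfolding aff_on_def o_apply by (intro ballI) (simp only: GL Lz)
qed

text \<open>A face of level q uses the chart of its ancestor of level 2, so every half cell falls
  under \<open>vertex_estimate\<close> for one of three vertices. The smallest of their constants
  gives a threshold for q that is the same for all half cells.\<close>

lemma face_estimate:
 assumes f: "f \<in> F" "rot f (a, b, c)" and fl: "flat a b c B C" and \<rho>: "\<rho> > 0" and \<tau>: "\<tau> > 0"
 shows "eventually (\<lambda>q. \<forall>i j. lcell (real (2^q)) i j \<subseteq> Dels \<rho> --> (\<exists>\<alpha> \<beta> \<alpha>' \<beta>'. norm \<beta> \<le> \<tau> * norm \<alpha> \<and> norm \<beta>' \<le> \<tau> * norm \<alpha>' \<and>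
   aff_on (\<Phi> q \<circ> xm a b c) B C \<alpha> \<beta> (up_tri (real (2^q)) i j) \<and> aff_on (\<Phi> q \<circ> xm a b c) B C \<alpha>' \<beta>' (down_tri (real (2^q)) i j))) sequentially"
proof -
 let ?P = "vertex_est a b c B C \<rho> \<tau>"
 have "\<forall>v. \<exists>\<eta> h0. v \<in> {a,b,c} --> \<eta> > 0 \<and> h0 > 0 \<and> ?P v \<eta> h0"

 proof
  fix v
  show "\<exists>\<eta> h0. v \<in> {a,b,c} --> \<eta> > 0 \<and> h0 > 0 \<and> ?P v \<eta> h0"
  proof (cases "v \<in> {a,b,c}")
   case True
   from vertex_estimate[OF f fl True \<rho> \<tau>] show ?thesis by iprover
  qed simp
 qed
 then obtain \<eta> h0 where eh: "\<And>v. v \<in> {a,b,c} ==> \<eta> v > 0 \<and> h0 v > 0 \<and> ?P v (\<eta> v) (h0 v)" by metis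
 define \<eta>0 where "\<eta>0 = min (\<eta> a) (min (\<eta> b) (\<eta> c))"
 define h00 where "h00 = min (h0 a) (min (h0 b) (h0 c))"
 have pos: "\<eta>0 > 0" "h00 > 0" using eh by (auto simp: \<eta>0_def h00_def)
 have lim: "(\<lambda>q. 1 / real (2 ^ q)) \<longlonglongrightarrow> 0" using LIMSEQ_divide_realpow_zero[of 2 1] by simp
 have ev: "eventually (\<lambda>q. K q \<le> 1 + \<eta>0 \<and> 1 / real (2 ^ q) < h00 \<and> q \<ge> max 2 Q) sequentially"
  using K_eventually[OF pos(1)] order_tendstoD(2)[OF lim pos(2)] eventually_ge_at_top[of "max 2 Q"] by eventually_elim auto
 then show ?thesis
 proof eventually_elim
  case (elim q)
  define N where "N = real (2 ^ q)"
  have N0: "N > 0" by (simp add: N_def)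
  have qQ: "q \<ge> Q" and q2: "q \<ge> 2" using elim by auto
  define h where "h = 1 / N"
  have h: "0 < h" "h < h00" using elim N0 by (auto simp: h_def N_def)
  have ndf: "nondeg_tri f"
   using face_noncollinear[OF f(1)] by (cases f) (simp add: nondeg_iff_not_collinear)
  have tri_case: "\<exists>\<alpha> \<beta>. norm \<beta> \<le> \<tau> * norm \<alpha> \<and> aff_on (\<Phi> q \<circ> xm a b c) B C \<alpha> \<beta> (convex hull {z, z2, z3})"
   if z: "z \<in> Dels \<rho>" "z2 \<in> Del" "z3 \<in> Del" and sp: "small_pair d2 d3" "z2 - z = of_real h * d2" "z3 - z = of_real h * d3"
    and f0: "f0 \<in> (refine ^^ q) {(a, b, c)}" "rot f0 (xm a b c z, xm a b c z2, xm a b c z3)" for z z2 z3 d2 d3 f0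
  proof -
   let ?t = "(xm a b c z, xm a b c z2, xm a b c z3)"
   obtain f' where f': "f' \<in> (refine ^^ q) {f}" "rot f' f0" using refine_rot[OF f(2) f0(1)] by blast
   have rt: "rot f' ?t" using rot_trans[OF f'(2) f0(2)] .
   have lev: "f' \<in> level F q" using f'(1) refine_mono[of "{f}" F q] f(1) by (auto simp: level_def)
   have "f' \<in> (refine ^^ ((q - 2) + 2)) {f}" using f'(1) by (simp only: le_add_diff_inverse2[OF q2])
   then obtain g where g: "g \<in> (refine ^^ 2) {f}" "tconv f' \<subseteq> tconv g" by (rule refine_ancestor)
   have glev: "g \<in> level F 2" using g(1) refine_mono[of "{f}" F 2] f(1) by (auto simp: level_def)
   note gp = refine_props[OF g(1)]
   obtain f1 where f1: "f1 \<in> F" "tconv g \<subseteq> tconv f1" "assoc g \<in> tverts f1" "closure (tconv g) \<subseteq> Om (assoc g)"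
    using assoc glev unfolding admissible_assoc_def by blast
   \<comment> \<open>The original face named by \<open>admissible_assoc\<close> is f itself, so the
     chart belongs to one of a, b, c.\<close>
   have "f1 = f" using tconv_eq_imp_subset[OF f1(1) f(1) gp(2)[OF ndf] f1(2) gp(1)] .
   define v where "v = assoc g"
   have v: "v \<in> {a, b, c}" using f1(3) \<open>f1 = f\<close> rot_tverts[OF f(2)] by (simp add: v_def)
   have tO: "tconv f' \<subseteq> Om v" using g(2) f1(4) closure_subset[of "tconv g"] by (auto simp: v_def)
   have tt: "tconv f' = xm a b c ` (convex hull {z, z2, z3})"
    using rot_tconv[OF rt] by (simp add: tconv_def xm_hull)
   have O: "{xm a b c z, xm a b c z2, xm a b c z3} \<subseteq> Om v"
    using tO tverts_subset_tconv[of f'] rot_tverts[OF rt] by auto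
   have fk: "orient_pos (face_lin (\<Phi> q) (cht v) ?t)" "dcd (face_lin (\<Phi> q) (cht v) ?t) \<le> K q"
    using Phi_props(9)[OF qQ lev glev g(2)] face_lin_rot[OF rt] by (auto simp: v_def)
   have Pv: "?P v (\<eta> v) (h0 v)" using eh[OF v] by blast
   have "K q \<le> 1 + \<eta> v" "h < h0 v" using elim h v by (auto simp: \<eta>0_def h00_def)
   with Pv[unfolded vertex_est_def, rule_format, OF _ h(1) _ z O sp, of "K q" "\<Phi> q (xm a b c z)" "\<Phi> q (xm a b c z2)" "\<Phi> q (xm a b c z3)"] fk
   obtain \<alpha> \<beta> where ab: "norm \<beta> \<le> \<tau> * norm \<alpha>"
    "\<Phi> q (xm a b c z2) - \<Phi> q (xm a b c z) = \<alpha> * tmap B C (z2 - z) + \<beta> * cnj (tmap B C (z2 - z))"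
    "\<Phi> q (xm a b c z3) - \<Phi> q (xm a b c z) = \<alpha> * tmap B C (z3 - z) + \<beta> * cnj (tmap B C (z3 - z))" by auto
   obtain L k where L: "linear L" "\<forall>x\<in>tconv f'. \<Phi> q x = L x + k" using Phi_props(8)[OF qQ lev] by blast
   have "aff_on (\<Phi> q \<circ> xm a b c) B C \<alpha> \<beta> (convex hull {z, z2, z3})"
    by (rule aff_on_from_pair[OF L(1) _ sp(1) _ _ _ _ sp(2,3) ab(2,3)]) (use L(2) tt h in \<open>auto simp: hull_inc\<close>)
   then show ?thesis using ab(1) by blast
  qed
  show ?case
  proof (intro allI impI)
   fix i j assume cell: "lcell (real (2^q)) i j \<subseteq> Dels \<rho>"
   have corners: "pt N i' j' \<in> lcell N i j" if "i' \<in> {i, i+1}" "j' \<in> {j, j+1}" for i' j'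
    using that N0 by (auto simp: pt_def in_cbox_complex_iff divide_right_mono)
   have inD: "pt N i' j' \<in> Dels \<rho>" if "i' \<in> {i, i+1}" "j' \<in> {j, j+1}" for i' j'
    using corners[OF that] cell by (auto simp: N_def)
   have inDel: "pt N i' j' \<in> Del" if "i' \<in> {i, i+1}" "j' \<in> {j, j+1}" for i' j'
    using inD[OF that] by (simp add: Dels_def)
   have "0 \<le> real_of_int i / N" "0 \<le> real_of_int j / N" using inDel[of i j] by (auto simp: Del_def pt_def)
   then have ij: "0 \<le> i" "0 \<le> j" using N0 by (auto simp: zero_le_divide_iff)
   have "(real_of_int (i + 1) + real_of_int (j + 1)) / N \<le> 1" using inDel[of "i+1" "j+1"] by (simp add: Del_def pt_def add_divide_distrib)
   then have "real_of_int (i + j + 2) \<le> N" using N0 by (simp add: pos_divide_le_eq)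
   then have "real_of_int (i + j + 2) \<le> real_of_int (2 ^ q)" by (simp add: N_def)
   then have le: "i + j + 2 \<le> 2 ^ q" by (simp only: of_int_le_iff)
   have N2: "(2::real) ^ q = N" by (simp add: N_def)
   obtain f1 where f1: "f1 \<in> (refine ^^ q) {(a, b, c)}" "rot f1 (xp a b c N i j, xp a b c N (i+1) j, xp a b c N i (j+1))"
    using refine_lattice(1)[OF ij, of q a b c] le unfolding N2 by auto
   obtain f2 where f2: "f2 \<in> (refine ^^ q) {(a, b, c)}" "rot f2 (xp a b c N (i+1) j, xp a b c N (i+1) (j+1), xp a b c N i (j+1))"
    using refine_lattice(2)[OF ij le, of a b c] unfolding N2 by auto
   have "\<exists>\<alpha> \<beta>. norm \<beta> \<le> \<tau> * norm \<alpha> \<and> aff_on (\<Phi> q \<circ> xm a b c) B C \<alpha> \<beta> (up_tri N i j)"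
    unfolding up_tri_def
   proof (rule tri_case[of _ _ _ 1 \<i>, OF _ _ _ _ _ _ f1])
    show "pt N i j \<in> Dels \<rho>" "pt N (i+1) j \<in> Del" "pt N i (j+1) \<in> Del" using inD[of i j] inDel[of "i+1" j] inDel[of i "j+1"] by simp_all
    show "small_pair 1 \<i>" by (simp add: small_pair_def)
    show "pt N (i+1) j - pt N i j = of_real h * 1" "pt N i (j+1) - pt N i j = of_real h * \<i>"
     by (simp_all add: pt_def h_def complex_eq_iff add_divide_distrib)
   qed
   moreover have "\<exists>\<alpha> \<beta>. norm \<beta> \<le> \<tau> * norm \<alpha> \<and> aff_on (\<Phi> q \<circ> xm a b c) B C \<alpha> \<beta> (down_tri N i j)"
    unfolding down_tri_def
   proof (rule tri_case[of _ _ _ \<i> "\<i> - 1", OF _ _ _ _ _ _ f2])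
    show "pt N (i+1) j \<in> Dels \<rho>" "pt N (i+1) (j+1) \<in> Del" "pt N i (j+1) \<in> Del" using inD[of "i+1" j] inDel[of "i+1" "j+1"] inDel[of i "j+1"] by simp_all
    show "small_pair \<i> (\<i> - 1)" by (simp add: small_pair_def)
    show "pt N (i+1) (j+1) - pt N (i+1) j = of_real h * \<i>" "pt N i (j+1) - pt N (i+1) j = of_real h * (\<i> - 1)"
     by (simp_all add: pt_def h_def complex_eq_iff add_divide_distrib)
   qed
   ultimately show "\<exists>\<alpha> \<beta> \<alpha>' \<beta>'. norm \<beta> \<le> \<tau> * norm \<alpha> \<and> norm \<beta>' \<le> \<tau> * norm \<alpha>' \<and>
    aff_on (\<Phi> q \<circ> xm a b c) B C \<alpha> \<beta> (up_tri (real (2^q)) i j) \<and> aff_on (\<Phi> q \<circ> xm a b c) B C \<alpha>' \<beta>' (down_tri (real (2^q)) i j)"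
    unfolding N_def by blast
  qed
 qed
qed

definition face_est :: "'a => 'a => 'a => complex => complex => real => real => complex set => nat => bool" where
 "face_est a b c B C A \<epsilon> Q' q \<longleftrightarrow> (\<exists>r. lat_weights (\<Phi> q \<circ> xm a b c) (2^q) A r Q' \<and>
  (\<forall>i j. lcell (real (2^q)) i j \<subseteq> Q' --> norm (cell_circ B C (\<Phi> q \<circ> xm a b c) (real (2^q)) (i, j)) \<le> \<epsilon> * (r (i, j) / real (2^q))))"

text \<open>The area bound A depends on the shape of the face alone, while the circulation bound
  carries \<tau>, which can be made arbitrarily small at the cost of starting at a later
  level.\<close>

lemma face_weights:
 assumes f: "f \<in> F" "rot f (a, b, c)" and fl: "flat a b c B C" and \<rho>: "\<rho> > 0"
 obtains A E where "A \<ge> 0" "E \<ge> 0"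
  "\<And>\<tau>. 0 < \<tau> ==> \<tau> \<le> 1/2 ==> eventually (\<lambda>q. \<forall>Q'. Q' \<subseteq> Dels \<rho> --> face_est a b c B C A (\<tau> * E) Q' q) sequentially"
proof -
 define M where "M = max (norm B) (norm C)"
 have M: "norm B \<le> M" "norm C \<le> M" by (auto simp: M_def)
 have \<Delta>: "Im (cnj B * C) > 0" using fl by (simp add: flat_def)
 have nd: "nondeg a b c" by (rule face_nondeg[OF f])
 show ?thesis
 proof (rule that[of "8192 * M^4 / (Im (cnj B * C))\<^sup>2" "Im (cnj B * C) / M"])
  show "8192 * M^4 / (Im (cnj B * C))\<^sup>2 \<ge> 0" by simp
  have "M \<ge> 0" using M(1) norm_ge_zero order_trans by blast
  then show "Im (cnj B * C) / M \<ge> 0" using \<Delta> by simp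
  fix \<tau> :: real assume \<tau>: "0 < \<tau>" "\<tau> \<le> 1/2"
  from face_estimate[OF f fl \<rho> \<tau>(1)] eventually_ge_at_top[of Q]
  show "eventually (\<lambda>q. \<forall>Q'. Q' \<subseteq> Dels \<rho> --> face_est a b c B C (8192 * M^4 / (Im (cnj B * C))\<^sup>2) (\<tau> * (Im (cnj B * C) / M)) Q' q) sequentially"
  proof eventually_elim
   case (elim q)
   show ?case
   proof (intro allI impI)
    fix Q' assume Q': "Q' \<subseteq> Dels \<rho>"
    have QD: "Q' \<subseteq> Del" using Q' by (auto simp: Dels_def)
    have xS: "xm a b c ` Q' \<subseteq> surface F" using QD xm_in_surface[OF f] by blast
    have inj: "inj_on (\<Phi> q \<circ> xm a b c) Q'"
    proof (rule comp_inj_on)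
     show "inj_on (xm a b c) Q'" using xm_inj[OF nd] by (auto simp: inj_on_def)
     show "inj_on (\<Phi> q) (xm a b c ` Q')" using Phi_props(2)[OF elim(2)] xS inj_on_subset by blast
    qed
    have GQ: "(\<Phi> q \<circ> xm a b c) ` Q' \<subseteq> cball 0 1"
    proof -
     have "\<Phi> q ` xm a b c ` Q' \<subseteq> Tri" using Phi_props(3)[OF elim(2)] xS by blast
     then show ?thesis using Tri_norm by (force simp: image_comp)
    qed
    have N: "(2::nat)^q > 0" by simp
    have aff: "\<exists>\<alpha> \<beta> \<alpha>' \<beta>'. norm \<beta> \<le> \<tau> * norm \<alpha> \<and> norm \<beta>' \<le> \<tau> * norm \<alpha>' \<and>
     aff_on (\<Phi> q \<circ> xm a b c) B C \<alpha> \<beta> (up_tri (real (2^q)) i j) \<and> aff_on (\<Phi> q \<circ> xm a b c) B C \<alpha>' \<beta>' (down_tri (real (2^q)) i j)"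
     if "lcell (real (2^q)) i j \<subseteq> Q'" for i j
     using elim(1)[rule_format, of i j] that Q' by (meson order_trans)
    obtain r where "lat_weights (\<Phi> q \<circ> xm a b c) (2^q) (8192 * M^4 / (Im (cnj B * C))\<^sup>2) r Q'"
     "\<And>i j. lcell (real (2^q)) i j \<subseteq> Q' ==> norm (cell_circ B C (\<Phi> q \<circ> xm a b c) (real (2^q)) (i, j)) \<le> \<tau> * (Im (cnj B * C) / M) * (r (i, j) / real (2^q))"
     using cell_weights[OF refl \<Delta> M less_imp_le[OF \<tau>(1)] \<tau>(2) N inj GQ aff] by metis
    then show "face_est a b c B C (8192 * M^4 / (Im (cnj B * C))\<^sup>2) (\<tau> * (Im (cnj B * C) / M)) Q' q"
     unfolding face_est_def by blast
   qed
  qed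
 qed
qed

end

section \<open>Locally uniform limits\<close>

lemma eventually_ball_compact:
 assumes "compact S" "\<forall>x\<in>S. \<exists>\<delta>>0. eventually (\<lambda>n. \<forall>w\<in>ball x \<delta>. P n w) sequentially"
 shows "eventually (\<lambda>n. \<forall>w\<in>S. P n w) sequentially"
proof -
 obtain \<delta> where \<delta>: "\<forall>x\<in>S. \<delta> x > 0 \<and> eventually (\<lambda>n. \<forall>w\<in>ball x (\<delta> x). P n w) sequentially"
  using bchoice[OF assms(2)[unfolded Bex_def]] by blast
 have cov: "S \<subseteq> (\<Union>x\<in>S. ball x (\<delta> x))" using \<delta> by (meson UN_I centre_in_ball subsetI)
 obtain T where T: "T \<subseteq> S" "finite T" "S \<subseteq> (\<Union>x\<in>T. ball x (\<delta> x))"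
  by (rule compactE_image[OF assms(1) _ cov]) auto
 have "eventually (\<lambda>n. \<forall>x\<in>T. \<forall>w\<in>ball x (\<delta> x). P n w) sequentially"
  using T \<delta> by (intro eventually_ball_finite) auto
 then show ?thesis by eventually_elim (use T(3) in blast)
qed

text \<open>Comparing all values near w with the single number \<open>H w\<close> combines locally
  uniform convergence with continuity of the limit, and allows evaluation at moving points.\<close>

definition cconv :: "(nat => complex => complex) => (complex => complex) => complex set => bool" where
 "cconv g H D \<longleftrightarrow> (\<forall>w\<in>D. \<forall>e>0. \<exists>\<delta>>0. eventually (\<lambda>n. \<forall>w'\<in>ball w \<delta>. norm (g n w' - H w) < e) sequentially)"

lemma cconv_tendsto:
 assumes "cconv g H D" "w \<in> D" "x \<longlonglongrightarrow> w"
 shows "(\<lambda>n. g n (x n)) \<longlonglongrightarrow> H w"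
proof (rule tendstoI)
 fix e :: real assume "e > 0"
 then obtain \<delta> where d: "\<delta> > 0" "eventually (\<lambda>n. \<forall>w'\<in>ball w \<delta>. norm (g n w' - H w) < e) sequentially"
  using assms(1,2) unfolding cconv_def by blast
 from d(2) tendstoD[OF assms(3) d(1)] show "eventually (\<lambda>n. dist (g n (x n)) (H w) < e) sequentially"
 proof eventually_elim
  case (elim n)
  then have "x n \<in> ball w \<delta>" by (simp add: dist_commute)
  then show ?case using elim(1) unfolding dist_norm by blast
 qed
qed

lemma cconv_continuous:
 assumes "cconv g H D"
 shows "continuous_on D H"
 unfolding continuous_on_iff
proof (intro ballI allI impI)
 fix w and e :: real assume w: "w \<in> D" and e: "e > 0"
 then obtain \<delta> where d: "\<delta> > 0" "eventually (\<lambda>n. \<forall>w'\<in>ball w \<delta>. norm (g n w' - H w) < e/2) sequentially"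
  using assms unfolding cconv_def by (meson half_gt_zero)
 show "\<exists>d>0. \<forall>x'\<in>D. dist x' w < d --> dist (H x') (H w) < e"
 proof (intro exI[of _ \<delta>] conjI ballI impI d(1))
  fix w' assume w': "w' \<in> D" "dist w' w < \<delta>"
  have "(\<lambda>n. norm (g n w' - H w)) \<longlonglongrightarrow> norm (H w' - H w)"
   by (intro tendsto_intros cconv_tendsto[OF assms w'(1)])
  moreover have "eventually (\<lambda>n. norm (g n w' - H w) \<le> e/2) sequentially"
   using d(2)
  proof eventually_elim
   case (elim n)
   have "w' \<in> ball w \<delta>" using w' by (simp add: dist_commute)
   then show ?case using elim less_imp_le by blast
  qed
  ultimately have "norm (H w' - H w) \<le> e/2" by (intro tendsto_upperbound) auto
  then show "dist (H w') (H w) < e" using e by (simp add: dist_norm)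
 qed
qed

text \<open>Arzela-Ascoli, with a diagonal sequence on a countable dense set. Equicontinuity is
  asked only from some index on, depending on w and e, since the length-area bound needs a fine
  enough mesh.\<close>

lemma equicontinuous_subsequence:
 assumes bnd: "\<And>n w. w \<in> D ==> norm (g n w) \<le> 1"
  and equi: "\<And>w e. w \<in> D ==> e > 0 ==> \<exists>\<delta>>0. eventually (\<lambda>n. \<forall>w'\<in>ball w \<delta>. norm (g n w' - g n w) \<le> e) sequentially"
 obtains k H where "strict_mono k" "cconv (\<lambda>n. g (k n)) H D"
proof -
 obtain T where T: "countable T" "T \<subseteq> D" "D \<subseteq> closure T" by (rule separable[of D])
 obtain k where k: "strict_mono k" "\<And>x. x \<in> T ==> \<exists>l. (\<lambda>n. g (k n) x) \<longlonglongrightarrow> l"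
  by (rule function_convergent_subsequence[OF T(1), of g 1]) (use T(2) bnd in blast)+
 have equi': "\<exists>\<delta>>0. eventually (\<lambda>n. \<forall>w'\<in>ball w \<delta>. norm (g (k n) w' - g (k n) w) \<le> e) sequentially" if we: "w \<in> D" "e > 0" for w e
 proof -
  obtain \<delta> where d: "\<delta> > 0" "eventually (\<lambda>n. \<forall>w'\<in>ball w \<delta>. norm (g n w' - g n w) \<le> e) sequentially" using equi[OF we] by blast
  show ?thesis by (intro exI[of _ \<delta>] conjI d(1) eventually_subseq[OF k(1) d(2)])
 qed
 have "convergent (\<lambda>n. g (k n) w)" if w: "w \<in> D" for w
 proof -
  have "Cauchy (\<lambda>n. g (k n) w)"
  proof (rule CauchyI)
   fix e :: real assume e: "e > 0"
   then have e4: "e/4 > 0" by simp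
   obtain \<delta> where d: "\<delta> > 0" "eventually (\<lambda>n. \<forall>w'\<in>ball w \<delta>. norm (g (k n) w' - g (k n) w) \<le> e/4) sequentially"
    using equi'[OF w e4] by blast
   obtain t where t: "t \<in> T" "dist t w < \<delta>" using T(3) w d(1) unfolding closure_approachable by (meson closure_approachable subsetD)
   have tb: "t \<in> ball w \<delta>" using t(2) by (simp add: dist_commute)
   obtain l where l: "(\<lambda>n. g (k n) t) \<longlonglongrightarrow> l" using k(2)[OF t(1)] by blast
   have "eventually (\<lambda>n. norm (g (k n) w - l) < e/2) sequentially"
    using d(2) tendstoD[OF l e4]
   proof eventually_elim
    case (elim n)
    have "norm (g (k n) t - g (k n) w) \<le> e/4" using elim(1) tb by blast
    moreover have "norm (g (k n) t - l) < e/4" using elim(2) unfolding dist_norm .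
    ultimately show ?case using norm_triangle_ineq4[of "g (k n) t - l" "g (k n) t - g (k n) w"] by simp
   qed
   then obtain N where N: "\<And>n. n \<ge> N ==> norm (g (k n) w - l) < e/2" unfolding eventually_sequentially by blast
   show "\<exists>M. \<forall>m\<ge>M. \<forall>n\<ge>M. norm (g (k m) w - g (k n) w) < e"
   proof (intro exI[of _ N] allI impI)
    fix m n assume "m \<ge> N" "n \<ge> N"
    then show "norm (g (k m) w - g (k n) w) < e"
     using N[of m] N[of n] norm_triangle_ineq4[of "g (k m) w - l" "g (k n) w - l"] by simp
   qed
  qed
  then show ?thesis by (simp add: Cauchy_convergent_iff)
 qed
 then have H: "(\<lambda>n. g (k n) w) \<longlonglongrightarrow> lim (\<lambda>n. g (k n) w)" if "w \<in> D" for w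
  using that by (simp add: convergent_LIMSEQ_iff)
 have "cconv (\<lambda>n. g (k n)) (\<lambda>w. lim (\<lambda>n. g (k n) w)) D"
  unfolding cconv_def
 proof (intro ballI allI impI)
  fix w and e :: real assume w: "w \<in> D" and e: "e > 0"
  then have e2: "e/2 > 0" by simp
  obtain \<delta> where d: "\<delta> > 0" "eventually (\<lambda>n. \<forall>w'\<in>ball w \<delta>. norm (g (k n) w' - g (k n) w) \<le> e/2) sequentially"
   using equi'[OF w e2] by blast
  show "\<exists>\<delta>>0. eventually (\<lambda>n. \<forall>w'\<in>ball w \<delta>. norm (g (k n) w' - lim (\<lambda>n. g (k n) w)) < e) sequentially"
  proof (intro exI[of _ \<delta>] conjI d(1))
   show "eventually (\<lambda>n. \<forall>w'\<in>ball w \<delta>. norm (g (k n) w' - lim (\<lambda>n. g (k n) w)) < e) sequentially"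
    using d(2) tendstoD[OF H[OF w] e2]
   proof eventually_elim
    case (elim n)
    show ?case
    proof
     fix w' assume "w' \<in> ball w \<delta>"
     then have "norm (g (k n) w' - g (k n) w) \<le> e/2" using elim(1) by blast
     moreover have "norm (g (k n) w - lim (\<lambda>n. g (k n) w)) < e/2" using elim(2) unfolding dist_norm .
     ultimately show "norm (g (k n) w' - lim (\<lambda>n. g (k n) w)) < e"
      using norm_triangle_ineq[of "g (k n) w' - g (k n) w" "g (k n) w - lim (\<lambda>n. g (k n) w)"] by simp
    qed
   qed
  qed
 qed
 then show ?thesis by (rule that[OF k(1)])
qed

text \<open>An injective holomorphic map has a holomorphic inverse, so holomorphy can be tested
  after a change of coordinate.\<close>

lemma holomorphic_transfer:
 assumes U: "open U" and R: "R holomorphic_on U" "inj_on R U" and HR: "(H \<circ> R) holomorphic_on U"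
 shows "H holomorphic_on R ` U"
proof -
 obtain g where g: "g holomorphic_on (R ` U)" "\<And>z. z \<in> U ==> g (R z) = z"
  by (rule holomorphic_has_inverse[OF R(1) U R(2)]) blast
 have "((H \<circ> R) \<circ> g) holomorphic_on R ` U"
  by (rule holomorphic_on_compose_gen[OF g(1) HR]) (use g(2) in auto)
 then show ?thesis by (rule holomorphic_transform) (use g(2) in auto)
qed

text \<open>The inverse of \<open>tmap B C\<close>, by Cramer's rule.\<close>

definition ucoord :: "complex => complex => complex => complex" where
 "ucoord B C u = Complex (Im (cnj u * C) / Im (cnj B * C)) (Im (cnj B * u) / Im (cnj B * C))"

lemma linear_ucoord: "linear (ucoord B C)"
 by (rule linearI) (simp_all add: ucoord_def complex_eq_iff add_divide_distrib diff_divide_distrib algebra_simps)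

lemma continuous_ucoord: "continuous_on S f ==> continuous_on S (\<lambda>x. ucoord B C (f x))"
 using bounded_linear.continuous_on[OF linear_ucoord[of B C, unfolded linear_conv_bounded_linear]] .

lemma tmap_ucoord:
 assumes "Im (cnj B * C) > 0"
 shows "tmap B C (ucoord B C u) = u"
proof -
 have 1: "Im (cnj u * C) * Re B + Im (cnj B * u) * Re C = Re u * Im (cnj B * C)" by (simp add: algebra_simps)
 have 2: "Im (cnj u * C) * Im B + Im (cnj B * u) * Im C = Im u * Im (cnj B * C)" by (simp add: algebra_simps)
 have "\<Delta> \<noteq> 0 ==> p / \<Delta> * x + q / \<Delta> * y = z" if "p * x + q * y = z * \<Delta>" for p q x y z \<Delta> :: real
  using that by (simp add: field_simps)
 from this[OF 1] this[OF 2] assms show ?thesis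
  unfolding tmap_def ucoord_def complex_eq_iff by simp
qed

lemma ucoord_tmap:
 assumes "Im (cnj B * C) > 0"
 shows "ucoord B C (tmap B C z) = z"
 using tmap_inj[OF assms tmap_ucoord[OF assms]] .

lemma ucoord_unique:
 assumes "Im (cnj B * C) > 0" shows "Re (ucoord B C u) *\<^sub>R B + Im (ucoord B C u) *\<^sub>R C = u"
 using tmap_ucoord[OF assms] by (simp add: tmap_def)

lemma side_fn_affine:
 assumes "u + v = 1"
 shows "side_fn l (u *\<^sub>R x + v *\<^sub>R y) = u * side_fn l x + v * side_fn l y"
proof -
 have "v = 1 - u" using assms by simp
 then show ?thesis by (simp add: side_fn_def inner_add_right algebra_simps)
qed

lemma two_sides_corner:
 assumes "l \<in> {1,2,3}" "m \<in> {1,2,3}" "l \<noteq> m" "side_fn l p = 0" "side_fn m p = 0"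
 shows "p \<in> {tcorner 1, tcorner 2, tcorner 3}"
proof -
 have s: "sqrt 3 * (sqrt 3 * x) = 3 * x" for x :: real by (simp flip: mult.assoc)
 have 12: "p = tcorner 3" if "side_fn 1 p = 0" "side_fn 2 p = 0"
 proof -
  have "Re p = -1/2" "sqrt 3 * Im p = - 3/2" using that unfolding side_fn_simps by auto
  moreover from this(2) have "sqrt 3 * (sqrt 3 * Im p) = sqrt 3 * (- 3/2)" by simp
  ultimately show ?thesis unfolding tcorner_simps complex_eq_iff s by simp
 qed
 have 13: "p = tcorner 2" if "side_fn 1 p = 0" "side_fn 3 p = 0"
 proof -
  have "Re p = -1/2" "sqrt 3 * Im p = 3/2" using that unfolding side_fn_simps by auto
  moreover from this(2) have "sqrt 3 * (sqrt 3 * Im p) = sqrt 3 * (3/2)" by simp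
  ultimately show ?thesis unfolding tcorner_simps complex_eq_iff s by simp
 qed
 have 23: "p = tcorner 1" if "side_fn 2 p = 0" "side_fn 3 p = 0"
 proof -
  have "- Re p / 2 + y / 2 + 1/2 = 0 ==> - Re p / 2 - y / 2 + 1/2 = 0 ==> y = 0 \<and> Re p = 1" for y by auto
  from this[of "sqrt 3 * Im p"] that have "sqrt 3 * Im p = 0 \<and> Re p = 1" unfolding side_fn_simps by simp
  then show ?thesis unfolding tcorner_simps complex_eq_iff by simp
 qed
 show ?thesis using assms 12 13 23 by auto
qed

lemma frontier_Tri_minus: "frontier Tri = Tri - interior Tri"
 by (simp add: frontier_def closure_closed closed_Tri)

text \<open>Invariance of domain sends interior points to interior points, for the map and for its
  inverse.\<close>

lemma homeomorphism_Tri_frontier: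
 assumes "homeomorphism Tri Tri f g"
 shows "f ` frontier Tri = frontier Tri"
proof -
 have int: "f ` interior Tri \<subseteq> interior Tri" if "homeomorphism Tri Tri f g" for f g
 proof -
  have c: "continuous_on Tri f" "f ` Tri = Tri" "\<And>x. x \<in> Tri ==> g (f x) = x" using that by (auto simp: homeomorphism_def)
  have "inj_on f (interior Tri)" using c(3) interior_subset by (metis inj_on_def subsetD)
  then have "open (f ` interior Tri)"
   using continuous_on_subset[OF c(1) interior_subset] by (intro invariance_of_domain) auto
  then show ?thesis using c(2) interior_subset[of Tri] by (intro interior_maximal) blast+
 qed
 have fg: "f ` frontier Tri \<subseteq> frontier Tri" if h: "homeomorphism Tri Tri f g" for f g
 proof
  fix y assume "y \<in> f ` frontier Tri"
  then obtain x where x: "x \<in> Tri" "x \<notin> interior Tri" "y = f x" unfolding frontier_Tri_minus by blast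
  have "g y = x" "y \<in> Tri" using h x by (auto simp: homeomorphism_def)
  moreover have "y \<notin> interior Tri" using int[OF homeomorphism_symD[OF h]] \<open>g y = x\<close> x(2) by blast
  ultimately show "y \<in> frontier Tri" unfolding frontier_Tri_minus by blast
 qed
 show ?thesis
 proof
  show "f ` frontier Tri \<subseteq> frontier Tri" by (rule fg[OF assms])
  show "frontier Tri \<subseteq> f ` frontier Tri"
  proof
   fix y assume y: "y \<in> frontier Tri"
   then have "g y \<in> frontier Tri" using fg[OF homeomorphism_symD[OF assms]] by blast
   moreover have "f (g y) = y" using assms y unfolding frontier_Tri_minus homeomorphism_def by blast
   ultimately show "y \<in> f ` frontier Tri" by (metis imageI)
  qed
 qed
qed

text \<open>The image of an open side lies on the frontier and misses the corners, which are fixed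
  and attained only by themselves; by connectedness it stays on one closed side m. If m differed
  from l, then \<open>tcorner m\<close> would be a limit of the open side l, so this fixed corner
  would lie on side m, to which it is opposite.\<close>

lemma open_side_in_closed_side:
 assumes g: "continuous_on Tri g" "inj_on g Tri" "g ` frontier Tri \<subseteq> frontier Tri" "\<forall>m\<in>{1,2,3}. g (tcorner m) = tcorner m"
  and l: "l \<in> {1,2,3}" and w: "side_fn l w = 0" "\<forall>m\<in>{1,2,3}-{l}. side_fn m w > 0"
 shows "side_fn l (g w) = 0"
proof (rule ccontr)
 assume non: "side_fn l (g w) \<noteq> 0"
 define Os where "Os = {w. side_fn l w = 0 \<and> (\<forall>m\<in>{1,2,3}-{l}. side_fn m w > 0)}"
 have wO: "w \<in> Os" using w by (simp add: Os_def)
 have OT: "x \<in> Tri" "x \<in> frontier Tri" if "x \<in> Os" for x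
 proof -
  have "side_fn m x \<ge> 0" if "m \<in> {1,2,3}" for m using \<open>x \<in> Os\<close> that unfolding Os_def by (cases "m = l") (auto simp: less_imp_le)
  then show "x \<in> Tri" unfolding Tri_eq by blast
  then show "x \<in> frontier Tri" unfolding frontier_Tri using l that by (auto simp: Os_def)
 qed
 have cT: "tcorner m \<in> Tri" if "m \<in> {1,2,3}" for m unfolding Tri_eq using corner_sides[OF that] by (auto split: if_splits)
 have convO: "convex Os"
 proof (rule convexI)
  fix x y :: complex and u v :: real assume h: "x \<in> Os" "y \<in> Os" "0 \<le> u" "0 \<le> v" "u + v = 1"
  have "side_fn m (u *\<^sub>R x + v *\<^sub>R y) > 0" if "m \<in> {1,2,3}-{l}" for m
  proof -
   have "side_fn m x > 0" "side_fn m y > 0" using h that by (auto simp: Os_def)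
   then show ?thesis unfolding side_fn_affine[OF h(5)] using h(3-5)
    by (smt (verit) mult_nonneg_nonneg mult_pos_pos)
  qed
  moreover have "side_fn l (u *\<^sub>R x + v *\<^sub>R y) = 0" unfolding side_fn_affine[OF h(5)] using h by (simp add: Os_def)
  ultimately show "u *\<^sub>R x + v *\<^sub>R y \<in> Os" by (simp add: Os_def)
 qed
 have nocorner: "g x \<noteq> tcorner m" if "x \<in> Os" "m \<in> {1,2,3}" for x m
 proof
  assume "g x = tcorner m"
  then have "g x = g (tcorner m)" using g(4) that(2) by metis
  then have "x = tcorner m" using inj_onD[OF g(2)] OT[OF that(1)] cT[OF that(2)] by blast
  then have p: "side_fn k (tcorner m) > 0" if "k \<in> {1,2,3}" "k \<noteq> l" for k using that \<open>x \<in> Os\<close> unfolding Os_def by blast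
  have "(1::nat) \<noteq> 2" "(2::nat) \<noteq> 3" "(1::nat) \<noteq> 3" by simp_all
  then obtain k where k: "k \<in> {1,2,3}" "k \<noteq> l" "k \<noteq> m" by (metis insertCI)
  show False using p[OF k(1,2)] corner_sides[OF that(2) k(1)] k(3) by simp
 qed
 have gf: "\<exists>m\<in>{1,2,3}. side_fn m (g x) = 0" if "x \<in> Os" for x
  using g(3) OT(2)[OF that] unfolding frontier_Tri by blast
 obtain m where m: "m \<in> {1,2,3}" "side_fn m (g w) = 0" using gf[OF wO] by blast
 have ml: "m \<noteq> l" using m non by auto
 define Z where "Z j = {x\<in>Tri. side_fn j (g x) = 0}" for j
 have clZ: "closed (Z j)" for j
 proof -
  have "closed (Tri \<inter> (\<lambda>x. side_fn j (g x)) -` {0})"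
   by (rule continuous_closed_preimage[OF continuous_side_fn[OF g(1)] closed_Tri]) simp
  moreover have "Z j = Tri \<inter> (\<lambda>x. side_fn j (g x)) -` {0}" by (auto simp: Z_def)
  ultimately show ?thesis by simp
 qed
 define Y where "Y = (\<Union>j\<in>{1,2,3}-{m}. Z j)"
 have clY: "closed Y" unfolding Y_def using clZ by (intro closed_UN) auto
 have cov: "Os \<subseteq> Z m \<union> Y"
 proof
  fix x assume x: "x \<in> Os"
  obtain j where "j \<in> {1,2,3}" "side_fn j (g x) = 0" using gf[OF x] by blast
  then show "x \<in> Z m \<union> Y" using OT(1)[OF x] by (auto simp: Z_def Y_def)
 qed
 have dis: "Z m \<inter> Y \<inter> Os = {}"
 proof (rule ccontr)
  assume "Z m \<inter> Y \<inter> Os \<noteq> {}"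
  then obtain x j where x: "x \<in> Os" "side_fn m (g x) = 0" "j \<in> {1,2,3}" "j \<noteq> m" "side_fn j (g x) = 0" by (auto simp: Z_def Y_def)
  have "g x \<in> {tcorner 1, tcorner 2, tcorner 3}" using two_sides_corner[OF m(1) x(3) _ x(2,5)] x(4) by blast
  then show False using nocorner[OF x(1)] by auto
 qed
 have "Z m \<inter> Os \<noteq> {}" using wO OT(1)[OF wO] m(2) by (auto simp: Z_def)
 then have "Y \<inter> Os = {}" using convex_connected[OF convO] clZ[of m] clY cov dis unfolding connected_closed by blast
 then have OZ: "Os \<subseteq> Z m" using cov by blast
 have mc: "tcorner m \<in> closure Os"
 proof -
  define x where "x n = (1 / real (Suc n)) *\<^sub>R w + (1 - 1 / real (Suc n)) *\<^sub>R tcorner m" for n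
  have "x n \<in> Os" for n
  proof -
   have u: "1 / real (Suc n) > 0" "1 - 1 / real (Suc n) \<ge> 0" "1 / real (Suc n) + (1 - 1 / real (Suc n)) = 1" by (simp_all add: field_simps)
   have "side_fn l (x n) = 0" unfolding x_def side_fn_affine[OF u(3)] using w(1) corner_sides[OF m(1) l] ml by simp
   moreover have "side_fn k (x n) > 0" if "k \<in> {1,2,3}-{l}" for k
   proof -
    have "side_fn k w > 0" using w(2) that by blast
    moreover have "side_fn k (tcorner m) \<ge> 0" using corner_sides[OF m(1), of k] that by auto
    ultimately show ?thesis unfolding x_def side_fn_affine[OF u(3)] using u
     by (intro add_pos_nonneg mult_pos_pos mult_nonneg_nonneg)
   qed
   ultimately show ?thesis by (simp add: Os_def)
  qed
  moreover have "x \<longlonglongrightarrow> 0 *\<^sub>R w + (1 - 0) *\<^sub>R tcorner m"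
   unfolding x_def by (intro tendsto_intros LIMSEQ_Suc lim_1_over_n)
  ultimately show ?thesis unfolding closure_sequential by auto
 qed
 have "closure Os \<subseteq> Z m" by (rule closure_minimal[OF OZ clZ])
 then have "side_fn m (g (tcorner m)) = 0" using mc by (auto simp: Z_def)
 then show False using g(4) m(1) corner_sides[OF m(1) m(1)] by auto
qed

section \<open>Gluing two lattices across an edge\<close>

lemma seg_ok_cong:
 assumes "\<And>z. z \<in> closed_segment p q ==> G z = G' z" "seg_ok G s p q"
 shows "seg_ok G' s p q"
proof -
 have "G' ` closed_segment p q = G ` closed_segment p q" using assms(1) by (intro image_cong) auto
 moreover have "G p = G' p" "G q = G' q" using assms(1) by auto
 ultimately show ?thesis using assms(2) by (simp add: seg_ok_def)
qed

lemma seg_ok_commute: "seg_ok G s p q ==> seg_ok G s q p"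
 by (simp add: seg_ok_def closed_segment_commute norm_minus_commute)

lemma seg_ok_reflect:
 assumes "seg_ok G s (1 - p) (1 - q)"
 shows "seg_ok (\<lambda>z. G (1 - z)) s p q"
proof -
 have "1 - z \<in> closed_segment (1 - p) (1 - q)" if zs: "z \<in> closed_segment p q" for z
 proof -
  obtain u where "0 \<le> u" "u \<le> 1" "z = (1 - u) *\<^sub>R p + u *\<^sub>R q" using zs unfolding in_segment by blast
  then show ?thesis unfolding in_segment by (intro exI[of _ u]) (simp add: scaleR_conv_of_real algebra_simps)
 qed
 then show ?thesis using assms unfolding seg_ok_def by blast
qed

lemma pt_reflect: "N > 0 ==> 1 - pt (real N) i j = pt (real N) (int N - i) (- j)"
 by (simp add: pt_def complex_eq_iff diff_divide_distrib)

lemma cell_ok_cong: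
 assumes N: "N > 0" and G: "\<And>z. z \<in> lcell N i j ==> G z = G' z" and r: "r (i, j) = r' (i, j)" and ok: "cell_ok G N r (i, j)"
 shows "cell_ok G' N r' (i, j)"
proof -
 have c: "pt N i' j' \<in> lcell N i j" if "i' \<in> {i, i+1}" "j' \<in> {j, j+1}" for i' j'
  using that N by (auto simp: pt_def in_cbox_complex_iff divide_right_mono)
 have s: "closed_segment p q \<subseteq> lcell N i j" if "p \<in> lcell N i j" "q \<in> lcell N i j" for p q
  using that by (rule closed_segment_subset) simp
 have t: "seg_ok G s p q ==> seg_ok G' s p q" if "p \<in> lcell N i j" "q \<in> lcell N i j" for p q s
  by (rule seg_ok_cong[of _ _ G]) (use G s[OF that] in auto)
 show ?thesis using ok unfolding cell_ok.simps r by (elim conjE, intro conjI) (erule t[rotated 2], (rule c; simp), (rule c; simp))+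
qed

lemma cell_ok_reflect:
 assumes N: "N > 0" and ok: "cell_ok G (real N) r (int N - 1 - i, - 1 - j)"
 shows "cell_ok (\<lambda>z. G (1 - z)) (real N) (\<lambda>_. r (int N - 1 - i, - 1 - j)) (i, j)"
proof -
 have e: "int N - (i + 1) = int N - 1 - i" "int N - i = int N - 1 - i + 1" "- (j + 1) = - 1 - j" "- j = - 1 - j + 1" by simp_all
 show ?thesis using ok unfolding cell_ok.simps
  by (elim conjE, intro conjI) (rule seg_ok_reflect, unfold pt_reflect[OF N] e, erule seg_ok_commute)+
qed

text \<open>Below the axis the coordinates of the neighbouring face are used after the half turn
  \<open>1 - z\<close>. It preserves the lattice and sends cell (i, j) to (N - 1 - i, -1 - j), the
  shift by 1 coming from naming cells by their lower left corner. No cell straddles the axis, so the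
  two sums of squares add up.\<close>

lemma lat_weights_glue:
 assumes N: "N > 0" and w1: "lat_weights G1 N A1 r1 Q1" and w2: "lat_weights G2 N A2 r2 Q2"
  and up: "\<And>z. z \<in> Q ==> Im z \<ge> 0 ==> z \<in> Q1 \<and> G z = G1 z"
  and down: "\<And>z. z \<in> Q ==> Im z \<le> 0 ==> 1 - z \<in> Q2 \<and> G z = G2 (1 - z)"
 shows "lat_weights G N (A1 + A2) (\<lambda>c. if snd c \<ge> 0 then r1 c else r2 (int N - 1 - fst c, - 1 - snd c)) Q"
proof -
 have N': "real N > 0" using N by simp
 have hi: "Im z \<ge> 0" if "z \<in> lcell (real N) i j" "j \<ge> 0" for z i j
 proof -
  have "real_of_int j / real N \<le> Im z" using that(1) by (simp add: pt_def in_cbox_complex_iff)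
  moreover have "real_of_int j / real N \<ge> 0" using that(2) by simp
  ultimately show ?thesis by linarith
 qed
 have lo: "Im z \<le> 0" if "z \<in> lcell (real N) i j" "j < 0" for z i j
 proof -
  have "Im z \<le> real_of_int (j + 1) / real N" using that(1) by (simp add: pt_def in_cbox_complex_iff)
  moreover have "real_of_int (j + 1) / real N \<le> 0" using that(2) by (intro divide_nonpos_nonneg) auto
  ultimately show ?thesis by linarith
 qed
 have upQ: "lcell (real N) i j \<subseteq> Q1" if "lcell (real N) i j \<subseteq> Q" "j \<ge> 0" for i j
  using that up hi[OF _ that(2)] by blast
 have rc: "lcell (real N) (int N - 1 - i) (- 1 - j) \<subseteq> Q2" if cQ: "lcell (real N) i j \<subseteq> Q" "j < 0" for i j
 proof
  fix z assume "z \<in> lcell (real N) (int N - 1 - i) (- 1 - j)"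
  then have "1 - z \<in> lcell (real N) i j"
   using N by (simp add: pt_def in_cbox_complex_iff diff_divide_distrib add_divide_distrib)
  then have "1 - (1 - z) \<in> Q2" using down[of "1 - z"] lo[OF _ that(2)] cQ(1) by blast
  then show "z \<in> Q2" by simp
 qed
 show ?thesis unfolding lat_weights_def
 proof (intro conjI allI impI)
  show "(if snd c \<ge> 0 then r1 c else r2 (int N - 1 - fst c, - 1 - snd c)) \<ge> 0" for c
   using lat_weightsD(1)[OF w1] lat_weightsD(1)[OF w2] by simp
  fix i j assume cQ: "lcell (real N) i j \<subseteq> Q"
  show "cell_ok G (real N) (\<lambda>c. if snd c \<ge> 0 then r1 c else r2 (int N - 1 - fst c, - 1 - snd c)) (i, j)"
  proof (cases "j \<ge> 0")
   case True
   show ?thesis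
   proof (rule cell_ok_cong[OF N' _ _ lat_weightsD(2)[OF w1 upQ[OF cQ True]]])
    show "G1 z = G z" if "z \<in> lcell (real N) i j" for z using up[of z] that cQ hi[OF that True] by auto
   qed (use True in simp)
  next
   case False
   then have j: "j < 0" by simp
   show ?thesis
   proof (rule cell_ok_cong[OF N' _ _ cell_ok_reflect[OF N lat_weightsD(2)[OF w2 rc[OF cQ j]]]])
    show "G2 (1 - z) = G z" if "z \<in> lcell (real N) i j" for z using down[of z] that cQ lo[OF that j] by auto
   qed (use j in simp)
  qed
 next
  fix S assume S: "finite S" "\<forall>(i,j)\<in>S. lcell (real N) i j \<subseteq> Q"
  define \<sigma> where "\<sigma> c = (int N - 1 - fst c, - 1 - snd c)" for c :: "int \<times> int"
  have inj: "inj_on \<sigma> T" for T by (auto simp: inj_on_def \<sigma>_def prod_eq_iff)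
  define S1 where "S1 = {c\<in>S. snd c \<ge> 0}"
  define S2 where "S2 = {c\<in>S. snd c < 0}"
  have f12: "finite S1" "finite S2" using S(1) by (auto simp: S1_def S2_def)
  have SU: "S = S1 \<union> S2" "S1 \<inter> S2 = {}" by (auto simp: S1_def S2_def)
  let ?r = "\<lambda>c. if snd c \<ge> 0 then r1 c else r2 (int N - 1 - fst c, - 1 - snd c)"
  have "(\<Sum>c\<in>S. (?r c)\<^sup>2) = (\<Sum>c\<in>S1. (?r c)\<^sup>2) + (\<Sum>c\<in>S2. (?r c)\<^sup>2)"
   using sum.union_disjoint[OF f12 SU(2), of "\<lambda>c. (?r c)\<^sup>2"] SU(1) by simp
  also have "(\<Sum>c\<in>S1. (?r c)\<^sup>2) = (\<Sum>c\<in>S1. (r1 c)\<^sup>2)" by (rule sum.cong) (auto simp: S1_def)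
  also have "(\<Sum>c\<in>S2. (?r c)\<^sup>2) = (\<Sum>c\<in>S2. (r2 (\<sigma> c))\<^sup>2)" by (rule sum.cong) (auto simp: S2_def \<sigma>_def)
  also have "\<dots> = (\<Sum>c\<in>\<sigma> ` S2. (r2 c)\<^sup>2)" by (simp add: sum.reindex[OF inj])
  also have "(\<Sum>c\<in>S1. (r1 c)\<^sup>2) \<le> A1"
  proof (rule lat_weightsD(3)[OF w1 f12(1)])
   fix i j assume "(i, j) \<in> S1"
   then have "(i, j) \<in> S" "j \<ge> 0" by (auto simp: S1_def)
   then show "lcell (real N) i j \<subseteq> Q1" using upQ S(2) by blast
  qed
  also have "(\<Sum>c\<in>\<sigma> ` S2. (r2 c)\<^sup>2) \<le> A2"
  proof (rule lat_weightsD(3)[OF w2])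
   show "finite (\<sigma> ` S2)" using f12 by simp
   fix i j assume "(i, j) \<in> \<sigma> ` S2"
   then obtain i' j' where h: "(i', j') \<in> S" "j' < 0" "i = int N - 1 - i'" "j = - 1 - j'" by (auto simp: S2_def \<sigma>_def)
   have "lcell (real N) i' j' \<subseteq> Q" using S(2) h(1) by blast
   from rc[OF this h(2)] show "lcell (real N) i j \<subseteq> Q2" by (simp add: h)
  qed
  finally show "(\<Sum>c\<in>S. (?r c)\<^sup>2) \<le> A1 + A2" by simp
 qed
qed

definition openDel :: "complex set" where "openDel = {z. 0 < Re z \<and> 0 < Im z \<and> Re z + Im z < 1}"

lemma openDel_subset: "openDel \<subseteq> Del" by (auto simp: openDel_def Del_def)

lemma open_openDel: "open openDel"
proof -
 have "open ({z. 0 < Re z} \<inter> {z. 0 < Im z} \<inter> {z. Re z + Im z < 1})"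
  by (intro open_Int open_Collect_less continuous_intros)
 moreover have "openDel = {z. 0 < Re z} \<inter> {z. 0 < Im z} \<inter> {z. Re z + Im z < 1}" by (auto simp: openDel_def)
 ultimately show ?thesis by simp
qed

lemma DelsI:
 assumes "z \<in> Del" "\<rho> \<le> \<bar>Re z\<bar>" "\<rho> \<le> \<bar>Re z - 1\<bar> \<or> \<rho> \<le> \<bar>Im z\<bar>"
 shows "z \<in> Dels \<rho>"
proof -
 have "\<rho> \<le> norm z" "\<rho> \<le> norm (z - \<i>)" using abs_Re_le_cmod[of z] abs_Re_le_cmod[of "z - \<i>"] assms(2) by auto
 moreover have "\<rho> \<le> norm (z - 1)" using abs_Re_le_cmod[of "z - 1"] abs_Im_le_cmod[of "z - 1"] assms(3) by auto
 ultimately show ?thesis using assms(1) by (simp add: Dels_def)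
qed

lemma interior_sbox:
 assumes "z0 \<in> openDel"
 obtains d where "d > 0" "sbox z0 d \<subseteq> Dels d" "sbox z0 d \<subseteq> openDel"
proof -
 define d where "d = min (Re z0) (min (Im z0) (1 - Re z0 - Im z0)) / 3"
 have d: "d > 0" "3 * d \<le> Re z0" "3 * d \<le> Im z0" "3 * d \<le> 1 - Re z0 - Im z0" using assms by (auto simp: d_def openDel_def)
 have o: "2 * d \<le> Re z \<and> 2 * d \<le> Im z \<and> Re z + Im z \<le> 1 - d" if "z \<in> sbox z0 d" for z
  using that d unfolding sbox_def mem_Collect_eq abs_le_iff by linarith
 show ?thesis
 proof (rule that[OF d(1)])
  show "sbox z0 d \<subseteq> Dels d"
  proof
   fix z assume "z \<in> sbox z0 d"
   from o[OF this] d(1) have "z \<in> Del" "d \<le> \<bar>Re z\<bar>" "d \<le> \<bar>Re z - 1\<bar> \<or> d \<le> \<bar>Im z\<bar>" by (auto simp: Del_def)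
   then show "z \<in> Dels d" by (rule DelsI)
  qed
  show "sbox z0 d \<subseteq> openDel"
  proof
   fix z assume "z \<in> sbox z0 d"
   from o[OF this] d(1) show "z \<in> openDel" by (auto simp: openDel_def)
  qed
 qed
qed

text \<open>A quarter of the distance to the nearer end keeps both halves of the box inside their
  faces and away from the vertices. By the last clause, points off the axis belong to the open
  faces.\<close>

lemma edge_sbox:
 assumes "Im z0 = 0" "0 < Re z0" "Re z0 < 1"
 obtains d where "d > 0" "sbox z0 d \<inter> {z. Im z \<ge> 0} \<subseteq> Dels d" "(\<lambda>z. 1 - z) ` (sbox z0 d \<inter> {z. Im z \<le> 0}) \<subseteq> Dels d"
  "\<forall>z\<in>sbox z0 d. 0 < Re z \<and> Re z + \<bar>Im z\<bar> < 1 \<and> 0 < Re (1 - z) \<and> Re (1 - z) + \<bar>Im z\<bar> < 1"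
proof -
 define d where "d = min (Re z0) (1 - Re z0) / 4"
 have d: "d > 0" "4 * d \<le> Re z0" "4 * d \<le> 1 - Re z0" using assms by (auto simp: d_def)
 have o: "2 * d \<le> Re z \<and> Re z + \<bar>Im z\<bar> \<le> 1 - 2 * d \<and> 2 * d \<le> 1 - Re z \<and> \<bar>Im z\<bar> - Re z \<le> - 2 * d" if "z \<in> sbox z0 d" for z
  using that d assms(1) unfolding sbox_def mem_Collect_eq by linarith
 show ?thesis
 proof (rule that[OF d(1)])
  show "sbox z0 d \<inter> {z. Im z \<ge> 0} \<subseteq> Dels d"
  proof
   fix z assume z: "z \<in> sbox z0 d \<inter> {z. Im z \<ge> 0}"
   then have "z \<in> sbox z0 d" by simp
   from o[OF this] d(1) z have "z \<in> Del" "d \<le> \<bar>Re z\<bar>" "d \<le> \<bar>Re z - 1\<bar> \<or> d \<le> \<bar>Im z\<bar>" by (auto simp: Del_def)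
   then show "z \<in> Dels d" by (rule DelsI)
  qed
  show "(\<lambda>z. 1 - z) ` (sbox z0 d \<inter> {z. Im z \<le> 0}) \<subseteq> Dels d"
  proof
   fix w assume "w \<in> (\<lambda>z. 1 - z) ` (sbox z0 d \<inter> {z. Im z \<le> 0})"
   then obtain z where z: "z \<in> sbox z0 d" "Im z \<le> 0" "w = 1 - z" by blast
   from o[OF z(1)] d(1) z(2) have "w \<in> Del" "d \<le> \<bar>Re w\<bar>" "d \<le> \<bar>Re w - 1\<bar> \<or> d \<le> \<bar>Im w\<bar>" unfolding z(3) by (auto simp: Del_def)
   then show "w \<in> Dels d" by (rule DelsI)
  qed
  show "\<forall>z\<in>sbox z0 d. 0 < Re z \<and> Re z + \<bar>Im z\<bar> < 1 \<and> 0 < Re (1 - z) \<and> Re (1 - z) + \<bar>Im z\<bar> < 1"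
  proof
   fix z assume z: "z \<in> sbox z0 d"
   show "0 < Re z \<and> Re z + \<bar>Im z\<bar> < 1 \<and> 0 < Re (1 - z) \<and> Re (1 - z) + \<bar>Im z\<bar> < 1" using o[OF z] d(1) by simp
  qed
 qed
qed

text \<open>Coordinates across the edge \<open>ab\<close>: the face \<open>(a, b, c)\<close> for \<open>Im z \<ge> 0\<close>, its neighbour \<open>(b, a, d)\<close> for \<open>Im z \<le> 0\<close>.\<close>
definition EX2 :: "'a::real_normed_vector => 'a => 'a => 'a => complex => 'a" where
 "EX2 a b c d z = (if Im z \<ge> 0 then xm a b c z else xm b a d (1 - z))"

lemma EX2_simps: "Im z \<ge> 0 ==> EX2 a b c d z = xm a b c z" "Im z \<le> 0 ==> EX2 a b c d z = xm b a d (1 - z)"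
proof -
 show "Im z \<ge> 0 ==> EX2 a b c d z = xm a b c z" by (simp add: EX2_def)
 have "xm a b c z = xm b a d (1 - z)" if "Im z = 0" using that by (simp add: xm_def algebra_simps)
 then show "Im z \<le> 0 ==> EX2 a b c d z = xm b a d (1 - z)" by (auto simp: EX2_def)
qed

lemma continuous_EX2: "continuous_on S (EX2 a b c d)"
proof -
 have h: "closed {z. Im z \<ge> 0}" "closed {z. Im z \<le> 0}" by (intro closed_Collect_le continuous_intros)+
 have "continuous_on {z. Im z \<ge> 0} (EX2 a b c d)"
  by (rule continuous_on_eq[OF continuous_xm[of _ a b c]]) (simp add: EX2_simps)
 moreover have "continuous_on {z. Im z \<le> 0} (EX2 a b c d)"
 proof (rule continuous_on_eq)
  show "continuous_on {z. Im z \<le> 0} (xm b a d \<circ> (\<lambda>z. 1 - z))"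
   by (intro continuous_on_compose continuous_xm continuous_intros)
 qed (simp add: EX2_simps)
 ultimately have "continuous_on ({z. Im z \<ge> 0} \<union> {z. Im z \<le> 0}) (EX2 a b c d)"
  by (rule continuous_on_closed_Un[OF h])
 then show ?thesis by (rule continuous_on_subset) auto
qed

context conformal_setup
begin

text \<open>A coincidence between the two halves lies in the hull of the common vertices of the
  faces. The third vertex d is not common, so the point is on the shared edge, where the halves
  agree anyway.\<close>

lemma inj_EX2:
 assumes f: "f \<in> F" "rot f (a, b, c)" and g: "g \<in> F" "rot g (b, a, d)" and fg: "f \<noteq> g"
  and S: "\<And>z. z \<in> S ==> Im z \<ge> 0 ==> z \<in> Del" "\<And>z. z \<in> S ==> Im z \<le> 0 ==> 1 - z \<in> Del"
 shows "inj_on (EX2 a b c d) S"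
proof -
 have ndf: "nondeg a b c" and ndg: "nondeg b a d" by (rule face_nondeg[OF f], rule face_nondeg[OF g])
 have tf: "tverts f = {a, b, c}" and tg: "tverts g = {b, a, d}" using rot_tverts[OF f(2)] rot_tverts[OF g(2)] by simp_all
 have dn: "d \<notin> tverts f"
 proof
  assume "d \<in> tverts f"
  then have "tverts g \<subseteq> tverts f" unfolding tf tg by auto
  then have "tverts g = tverts f" using card_tverts[OF f(1)] card_tverts[OF g(1)] by (metis card_subset_eq)
  then show False using face_eqI[OF g(1) f(1)] fg by simp
 qed
 have cross: False if z: "z \<in> S" "Im z \<ge> 0" and w: "w \<in> S" "Im w < 0" and e: "xm a b c z = xm b a d (1 - w)" for z w
 proof -
  have "xm b a d (1 - w) \<in> tconv f" using xm_in_surface[OF f S(1)[OF z]] e by simp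
  moreover have "xm b a d (1 - w) \<in> tconv g" using xm_in_surface[OF g S(2)[OF w(1)]] w(2) by simp
  ultimately have "xm b a d (1 - w) \<in> convex hull (tverts f \<inter> tverts g)" using face_inter[OF f(1) g(1) fg] by blast
  moreover have "tverts f \<inter> tverts g \<subseteq> {b, a, d}" using tg by auto
  ultimately have "Im (1 - w) = 0" using hull_pair_coords(3)[OF ndg, of "tverts f \<inter> tverts g" "1 - w"] dn by blast
  then show False using w(2) by simp
 qed
 show ?thesis
 proof (rule inj_onI)
  fix z w assume z: "z \<in> S" and w: "w \<in> S" and e: "EX2 a b c d z = EX2 a b c d w"
  consider "Im z \<ge> 0" "Im w \<ge> 0" | "Im z \<ge> 0" "Im w < 0" | "Im z < 0" "Im w \<ge> 0" | "Im z < 0" "Im w < 0" by linarith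
  then show "z = w"
  proof cases
   case 1 then show ?thesis using e xm_inj[OF ndf] by (simp add: EX2_simps)
  next
   case 2 then show ?thesis using e cross[OF z _ w] by (simp add: EX2_simps)
  next
   case 3 then show ?thesis using e cross[OF w _ z] by (simp add: EX2_simps)
  next
   case 4 then have "xm b a d (1 - z) = xm b a d (1 - w)" using e by (simp add: EX2_simps)
   from xm_inj[OF ndg this] show ?thesis by simp
  qed
 qed
qed

lemma face_lat:
 assumes f: "f \<in> F" "rot f (a, b, c)" and \<rho>: "\<rho> > 0"
 obtains A where "eventually (\<lambda>q. \<forall>Q'. Q' \<subseteq> Dels \<rho> --> (\<exists>r. lat_weights (\<Phi> q \<circ> xm a b c) (2^q) A r Q')) sequentially"
proof -
 obtain B C where fl: "flat a b c B C" using flat_exists[OF face_nondeg[OF f]] .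
 show ?thesis
 proof (rule face_weights[OF f fl \<rho>], goal_cases)
  case (1 A E)
  have "eventually (\<lambda>q. \<forall>Q'. Q' \<subseteq> Dels \<rho> --> (\<exists>r. lat_weights (\<Phi> q \<circ> xm a b c) (2^q) A r Q')) sequentially"
  proof (rule eventually_mono[OF 1(3)[of "1/2"]])
   fix q assume "\<forall>Q'. Q' \<subseteq> Dels \<rho> --> face_est a b c B C A (1/2 * E) Q' q"
   then show "\<forall>Q'. Q' \<subseteq> Dels \<rho> --> (\<exists>r. lat_weights (\<Phi> q \<circ> xm a b c) (2^q) A r Q')" unfolding face_est_def by iprover
  qed simp_all
  then show ?case by (rule that)
 qed
qed

text \<open>A coordinate box about a surface point, inside a face or across an edge, with one area
  bound A for all large q. Equicontinuity needs nothing else about the surface.\<close>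

definition patch :: "(complex => 'a) => complex => real => real => bool" where
 "patch X z0 d A \<longleftrightarrow> d > 0 \<and> continuous_on (sbox z0 d) X \<and> inj_on X (sbox z0 d) \<and> X ` sbox z0 d \<subseteq> surface F \<and>
  eventually (\<lambda>q. \<exists>r. lat_weights (\<Phi> q \<circ> X) (2^q) A r (sbox z0 d)) sequentially"

lemma interior_patch:
 assumes f: "f \<in> F" "rot f (a, b, c)" and z0: "z0 \<in> openDel"
 shows "\<exists>d A. patch (xm a b c) z0 d A"
proof -
 obtain d where d: "d > 0" "sbox z0 d \<subseteq> Dels d" "sbox z0 d \<subseteq> openDel" by (rule interior_sbox[OF z0])
 obtain A where A: "eventually (\<lambda>q. \<forall>Q'. Q' \<subseteq> Dels d --> (\<exists>r. lat_weights (\<Phi> q \<circ> xm a b c) (2^q) A r Q')) sequentially"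
  by (rule face_lat[OF f d(1)])
 have "xm a b c ` sbox z0 d \<subseteq> surface F" using d(3) openDel_subset xm_in_surface[OF f] by blast
 moreover have "inj_on (xm a b c) (sbox z0 d)" using xm_inj[OF face_nondeg[OF f]] by (auto simp: inj_on_def)
 moreover have "eventually (\<lambda>q. \<exists>r. lat_weights (\<Phi> q \<circ> xm a b c) (2^q) A r (sbox z0 d)) sequentially"
  using A d(2) by (rule_tac eventually_mono) blast+
 ultimately show ?thesis unfolding patch_def using d(1) continuous_xm by blast
qed

lemma edge_patch:
 assumes f: "f \<in> F" "rot f (a, b, c)" and g: "g \<in> F" "rot g (b, a, d)" and fg: "f \<noteq> g"
  and z0: "Im z0 = 0" "0 < Re z0" "Re z0 < 1"
 shows "\<exists>\<delta> A. patch (EX2 a b c d) z0 \<delta> A"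
proof -
 obtain \<delta> where d: "\<delta> > 0" "sbox z0 \<delta> \<inter> {z. Im z \<ge> 0} \<subseteq> Dels \<delta>" "(\<lambda>z. 1 - z) ` (sbox z0 \<delta> \<inter> {z. Im z \<le> 0}) \<subseteq> Dels \<delta>"
  by (rule edge_sbox[OF z0])
 define Q2 where "Q2 = (\<lambda>z. 1 - z) ` (sbox z0 \<delta> \<inter> {z. Im z \<le> 0})"
 obtain A1 where A1: "eventually (\<lambda>q. \<forall>Q'. Q' \<subseteq> Dels \<delta> --> (\<exists>r. lat_weights (\<Phi> q \<circ> xm a b c) (2^q) A1 r Q')) sequentially"
  by (rule face_lat[OF f d(1)])
 obtain A2 where A2: "eventually (\<lambda>q. \<forall>Q'. Q' \<subseteq> Dels \<delta> --> (\<exists>r. lat_weights (\<Phi> q \<circ> xm b a d) (2^q) A2 r Q')) sequentially"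
  by (rule face_lat[OF g d(1)])
 have D1: "z \<in> Del" if "z \<in> sbox z0 \<delta>" "Im z \<ge> 0" for z using d(2) that by (auto simp: Dels_def)
 have D2: "1 - z \<in> Del" if "z \<in> sbox z0 \<delta>" "Im z \<le> 0" for z
 proof -
  have "1 - z \<in> Dels \<delta>" using d(3) that by blast
  then show ?thesis by (simp add: Dels_def)
 qed
 have sub: "EX2 a b c d ` sbox z0 \<delta> \<subseteq> surface F"
 proof
  fix x assume "x \<in> EX2 a b c d ` sbox z0 \<delta>"
  then obtain z where z: "z \<in> sbox z0 \<delta>" "x = EX2 a b c d z" by blast
  show "x \<in> surface F"
  proof (cases "Im z \<ge> 0")
   case True then show ?thesis using z D1 xm_in_surface[OF f] by (simp add: EX2_simps)
  next
   case False then show ?thesis using z D2 xm_in_surface[OF g] by (simp add: EX2_simps)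
  qed
 qed
 have lw: "eventually (\<lambda>q. \<exists>r. lat_weights (\<Phi> q \<circ> EX2 a b c d) (2^q) (A1 + A2) r (sbox z0 \<delta>)) sequentially"
  using A1 A2
 proof eventually_elim
  case (elim q)
  obtain r1 where r1: "lat_weights (\<Phi> q \<circ> xm a b c) (2^q) A1 r1 (sbox z0 \<delta> \<inter> {z. Im z \<ge> 0})" using elim(1) d(2) by blast
  obtain r2 where r2: "lat_weights (\<Phi> q \<circ> xm b a d) (2^q) A2 r2 Q2" using elim(2) d(3) unfolding Q2_def by blast
  have "(2::nat)^q > 0" by simp
  from lat_weights_glue[OF this r1 r2, of "sbox z0 \<delta>" "\<Phi> q \<circ> EX2 a b c d"]
  show ?case by (auto simp: EX2_simps Q2_def)
 qed
 show ?thesis unfolding patch_def using d(1) continuous_EX2 inj_EX2[OF f g fg D1 D2] sub lw by blast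
qed

end

section \<open>Equicontinuity and boundary behaviour\<close>

context conformal_setup
begin

lemma dedge_face:
 assumes "(x, y) \<in> dedges F"
 obtains f c where "f \<in> F" "rot f (x, y, c)"
proof -
 obtain f where f: "f \<in> F" "(x, y) \<in> dedges_face f" using assms by (auto simp: dedges_def)
 obtain p q r where t: "f = (p, q, r)" by (cases f)
 have "(x = p \<and> y = q) \<or> (x = q \<and> y = r) \<or> (x = r \<and> y = p)" using f(2) unfolding t by simp
 then have "\<exists>c. rot f (x, y, c)" unfolding t rot_def rotl.simps prod.inject by blast
 then show ?thesis using f(1) that by blast
qed

lemma bd_edge_face:
 assumes "x \<in> bdry F"
 obtains a b c f where "(a, b) \<in> bd_edges F" "f \<in> F" "rot f (a, b, c)" "x \<in> closed_segment a b"
proof -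
 obtain a b where ab: "(a, b) \<in> bd_edges F" "x \<in> closed_segment a b" using assms by (auto simp: bdry_def)
 then have "(a, b) \<in> dedges F" by (simp add: bd_edges_def)
 then obtain f c where f: "f \<in> F" "rot f (a, b, c)" by (rule dedge_face)
 show ?thesis by (rule that[OF ab(1) f ab(2)])
qed

lemma edge_in_tconv:
 assumes "rot f (a, b, c)" "x \<in> closed_segment a b"
 shows "x \<in> tconv f"
proof -
 have "{a, b} \<subseteq> tverts f" using rot_tverts[OF assms(1)] by auto
 then have "convex hull {a, b} \<subseteq> convex hull (tverts f)" by (rule hull_mono)
 then show ?thesis using assms(2) by (auto simp: tconv_def segment_convex_hull)
qed

lemma bdry_subset: "bdry F \<subseteq> surface F"
proof
 fix x assume "x \<in> bdry F"
 then obtain a b c f where f: "f \<in> F" "rot f (a, b, c)" "x \<in> closed_segment a b" by (rule bd_edge_face)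
 show "x \<in> surface F" using edge_in_tconv[OF f(2,3)] f(1) unfolding surface_def by blast
qed

lemma verts_subset: "verts F \<subseteq> surface F"
 using tverts_subset_tconv by (force simp: verts_def surface_def)

lemma finite_verts: "finite (verts F)"
 unfolding verts_def using finite_F card_tverts(2) by blast

lemma distinct_face_verts:
 assumes "f \<in> F" "rot f (a, b, c)"
 shows "a \<noteq> b" "b \<noteq> c" "a \<noteq> c"
proof -
 have "card {a, b, c} = 3" using card_tverts(1)[OF assms(1)] rot_tverts[OF assms(2)] by simp
 then show "a \<noteq> b" "b \<noteq> c" "a \<noteq> c" by (auto simp: card_insert_if split: if_splits)
qed

lemma open_face_not_bdry:
 assumes f: "f \<in> F" "rot f (a, b, c)" and z: "z \<in> openDel"
 shows "xm a b c z \<notin> bdry F"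
proof
 assume "xm a b c z \<in> bdry F"
 then obtain x y w g where g: "g \<in> F" "rot g (x, y, w)" "xm a b c z \<in> closed_segment x y" by (rule bd_edge_face)
 have zz: "0 < Im z" "0 < Re z" "Re z + Im z < 1" using z by (auto simp: openDel_def)
 have "g = f" by (rule interior_point_in_face[OF f zz g(1) edge_in_tconv[OF g(2,3)]])
 then have s: "{x, y} \<subseteq> {a, b, c}" using rot_tverts[OF g(2)] rot_tverts[OF f(2)] by auto
 have h: "xm a b c z \<in> convex hull {x, y}" using g(3) by (simp add: segment_convex_hull)
 note hp = hull_pair_coords[OF face_nondeg[OF f] s h]
 have "a \<in> {x, y}" "b \<in> {x, y}" "c \<in> {x, y}" using hp zz by fastforce+
 then show False using distinct_face_verts[OF f] by auto
qed

text \<open>Rotating the face cyclically brings any edge point that is not a vertex to the first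
  edge, so only one kind of edge point remains.\<close>

lemma point_cases:
 assumes x: "x0 \<in> surface F" "x0 \<notin> verts F"
 obtains f a b c z where "f \<in> F" "rot f (a, b, c)" "x0 = xm a b c z" "z \<in> openDel"
 | f a b c z where "f \<in> F" "rot f (a, b, c)" "x0 = xm a b c z" "Im z = 0" "0 < Re z" "Re z < 1"
proof -
 obtain f where f: "f \<in> F" "x0 \<in> tconv f" using x(1) by (auto simp: surface_def)
 obtain a b c where t: "f = (a, b, c)" by (cases f)
 have r: "rot f (a, b, c)" "rot f (b, c, a)" "rot f (c, a, b)" by (simp_all add: t rot_def)
 obtain z where z: "z \<in> Del" "x0 = xm a b c z" using coords[OF f(1) r(1) f(2)] by blast
 have vs: "{a, b, c} \<subseteq> verts F" using f(1) rot_tverts[OF r(1)] unfolding verts_def by auto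
 have n: "z \<noteq> 0" "z \<noteq> 1" "z \<noteq> \<i>" using x(2) vs unfolding z(2) by (auto simp: xm_vertices)
 have zD: "0 \<le> Re z" "0 \<le> Im z" "Re z + Im z \<le> 1" using z(1) by (auto simp: Del_def)
 have x2: "x0 = xm b c a (Complex (Im z) (1 - Re z - Im z))" unfolding xm_rotate by (rule z(2))
 have x3: "x0 = xm c a b (Complex (1 - Re z - Im z) (Re z))"
  using xm_rotate[of c a b "Complex (Im z) (1 - Re z - Im z)"] x2 by simp
 show ?thesis
 proof (cases "z \<in> openDel")
  case True
  show ?thesis by (rule that(1)[OF f(1) r(1) z(2) True])
 next
  case False
  then consider "Im z = 0" | "Re z = 0" | "Re z + Im z = 1" using zD by (force simp: openDel_def)
  then show ?thesis
  proof cases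
   case 1
   have "Re z \<noteq> 0" "Re z \<noteq> 1" using n 1 by (auto simp: complex_eq_iff)
   then show ?thesis using that(2)[OF f(1) r(1) z(2) 1] zD 1 by simp
  next
   case 2
   have "Im z \<noteq> 0" "Im z \<noteq> 1" using n 2 by (auto simp: complex_eq_iff)
   then show ?thesis using that(2)[OF f(1) r(3) x3] zD 2 by simp
  next
   case 3
   have "Re z \<noteq> 0"
   proof
    assume "Re z = 0"
    then show False using n(3) 3 by (simp add: complex_eq_iff)
   qed
   moreover have "Im z \<noteq> 0" using n(2) 3 by (auto simp: complex_eq_iff)
   ultimately show ?thesis using that(2)[OF f(1) r(2) x2] zD 3 by simp
  qed
 qed
qed

lemma edge_neighbour:
 assumes f: "f \<in> F" "rot f (a, b, c)" and z: "Im z = 0" "0 < Re z" "Re z < 1" and nb: "xm a b c z \<notin> bdry F"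
 obtains g d where "g \<in> F" "rot g (b, a, d)" "f \<noteq> g"
proof -
 have seg: "xm a b c z \<in> closed_segment a b"
  unfolding in_segment xm_def using z by (intro exI[of _ "Re z"]) (simp add: algebra_simps)
 have "(a, b) \<in> dedges_face f" using rot_dedges[OF f(2)] by auto
 then have "(a, b) \<in> dedges F" using f(1) by (auto simp: dedges_def)
 then have "(b, a) \<in> dedges F" using seg nb by (auto simp: bdry_def bd_edges_def)
 then obtain g d where g: "g \<in> F" "rot g (b, a, d)" by (rule dedge_face)
 have "f \<noteq> g"
 proof
  assume "f = g"
  then have "rot (a, b, c) (b, a, d)" using rot_trans[OF rot_sym[OF f(2)]] g(2) by blast
  then show False using distinct_face_verts[OF f] unfolding rot_def rotl.simps by auto
 qed
 then show ?thesis by (rule that[OF g])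
qed

lemma patch_exists:
 assumes x: "x0 \<in> surface F" "x0 \<notin> verts F" "x0 \<notin> bdry F"
 shows "\<exists>X z0 d A. patch X z0 d A \<and> X z0 = x0"
proof (rule point_cases[OF x(1,2)])
 fix f a b c z assume f: "f \<in> F" "rot f (a, b, c)" and z: "x0 = xm a b c z" "z \<in> openDel"
 obtain d A where "patch (xm a b c) z d A" using interior_patch[OF f z(2)] by blast
 then show ?thesis using z(1) by blast
next
 fix f a b c z assume f: "f \<in> F" "rot f (a, b, c)" and z: "x0 = xm a b c z" and zz: "Im z = 0" "0 < Re z" "Re z < 1"
 obtain g d where g: "g \<in> F" "rot g (b, a, d)" "f \<noteq> g" by (rule edge_neighbour[OF f zz x(3)[unfolded z]])
 obtain \<delta> A where "patch (EX2 a b c d) z \<delta> A" using edge_patch[OF f g zz] by blast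
 moreover have "EX2 a b c d z = x0" using zz z by (simp add: EX2_simps)
 ultimately show ?thesis by blast
qed

section \<open>The maps \<open>h q\<close> on the target triangle\<close>

definition \<Psi>i :: "complex => 'a" where "\<Psi>i = inv_into (surface F) \<Psi>"

lemma Psi_homeo: "homeomorphism (surface F) Tri \<Psi> \<Psi>i"
proof -
 obtain \<Psi>' where h: "homeomorphism (surface F) Tri \<Psi> \<Psi>'" using Psi_hom by blast
 have inj: "inj_on \<Psi> (surface F)" using h unfolding homeomorphism_def by (metis inj_on_inverseI)
 have "\<Psi>i y = \<Psi>' y" if "y \<in> Tri" for y
  unfolding \<Psi>i_def using h that by (intro inv_into_f_eq[OF inj]) (auto simp: homeomorphism_def)
 then show ?thesis by (intro homeomorphism_cong[OF h]) auto
qed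

lemma Psi_facts:
 shows "continuous_on (surface F) \<Psi>" "continuous_on Tri \<Psi>i" "inj_on \<Psi> (surface F)"
  "x \<in> surface F ==> \<Psi> x \<in> Tri" "x \<in> surface F ==> \<Psi>i (\<Psi> x) = x"
  "w \<in> Tri ==> \<Psi>i w \<in> surface F" "w \<in> Tri ==> \<Psi> (\<Psi>i w) = w"
 using Psi_homeo unfolding homeomorphism_def by (auto intro: inj_on_inverseI)

definition h :: "nat => complex => complex" where "h q = \<Phi> q \<circ> \<Psi>i"

lemma h_Psi: "x \<in> surface F ==> h q (\<Psi> x) = \<Phi> q x"
 by (simp add: h_def Psi_facts)

lemma h_facts:
 assumes "q \<ge> Q"
 shows "continuous_on Tri (h q)" "inj_on (h q) Tri" "w \<in> Tri ==> h q w \<in> Tri" "h q ` frontier Tri = frontier Tri"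
  "m \<in> {1,2,3} ==> h q (tcorner m) = tcorner m"
proof -
 have "\<Phi> q \<in> FK F v1 v2 v3 \<zeta> assoc q (K q)" using Phi assms by blast
 then obtain \<Phi>' where p: "homeomorphism (surface F) Tri (\<Phi> q) \<Phi>'" unfolding FK_def by blast
 have hh: "homeomorphism Tri Tri (h q) (\<Psi> \<circ> \<Phi>')"
  unfolding h_def by (rule homeomorphism_compose[OF homeomorphism_symD[OF Psi_homeo] p])
 then show "continuous_on Tri (h q)" "w \<in> Tri ==> h q w \<in> Tri" by (auto simp: homeomorphism_def)
 show "inj_on (h q) Tri" using hh unfolding homeomorphism_def by (metis inj_on_inverseI)
 show "h q ` frontier Tri = frontier Tri" by (rule homeomorphism_Tri_frontier[OF hh])
 have vs: "v1 \<in> surface F" "v2 \<in> surface F" "v3 \<in> surface F" using marked verts_subset by auto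
 have "h q (tcorner 1) = tcorner 1" "h q (tcorner 2) = tcorner 2" "h q (tcorner 3) = tcorner 3"
  using h_Psi[OF vs(1), of q] h_Psi[OF vs(2), of q] h_Psi[OF vs(3), of q] Phi_props(5-7)[OF assms]
  unfolding Psi_corners by simp_all
 then show "m \<in> {1,2,3} ==> h q (tcorner m) = tcorner m" by blast
qed

text \<open>The hypotheses on \<Psi> do not mention \<open>bdry F\<close>. But
  \<open>\<Phi> Q\<close> maps it onto the frontier, and \<open>h Q\<close>, a homeomorphism of the
  triangle, preserves the frontier by invariance of domain; comparing the two identifies the image
  under \<Psi>.\<close>

lemma Psi_bdry: "\<Psi> ` bdry F = frontier Tri"
proof -
 have fT: "frontier Tri \<subseteq> Tri" unfolding frontier_Tri_minus by blast
 have "\<Phi> Q ` bdry F = \<Phi> Q ` (\<Psi>i ` frontier Tri)"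
  using Phi_props(4)[of Q] h_facts(4)[of Q] by (simp add: h_def image_comp)
 moreover have "\<Psi>i ` frontier Tri \<subseteq> surface F" using Psi_facts(6) fT by blast
 ultimately have "bdry F = \<Psi>i ` frontier Tri"
  using inj_on_image_eq_iff[OF Phi_props(2)[of Q] bdry_subset] by simp
 then have "\<Psi> ` bdry F = (\<lambda>w. \<Psi> (\<Psi>i w)) ` frontier Tri" by (simp add: image_image)
 also have "\<dots> = (\<lambda>w. w) ` frontier Tri" using Psi_facts(7) fT by (intro image_cong) auto
 finally show ?thesis by simp
qed

definition E :: "complex set" where "E = \<Psi> ` verts F"
definition D :: "complex set" where "D = interior Tri - E"

lemma finite_E: "finite E" by (simp add: E_def finite_verts)

lemma corners_E: "tcorner 1 \<in> E" "tcorner 2 \<in> E" "tcorner 3 \<in> E"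
 unfolding E_def Psi_corners[symmetric] using marked by auto

lemma open_D: "open D" unfolding D_def by (intro open_Diff finite_imp_closed finite_E) simp

lemma D_subset: "D \<subseteq> Tri" unfolding D_def using interior_subset by blast

lemma D_point:
 assumes "w \<in> D"
 shows "\<Psi>i w \<in> surface F" "\<Psi>i w \<notin> verts F" "\<Psi>i w \<notin> bdry F" "\<Psi> (\<Psi>i w) = w"
proof -
 have wT: "w \<in> Tri" using assms D_subset by blast
 show "\<Psi>i w \<in> surface F" "\<Psi> (\<Psi>i w) = w" using Psi_facts wT by auto
 then show "\<Psi>i w \<notin> verts F" using assms unfolding D_def E_def by (metis DiffD2 imageI)
 show "\<Psi>i w \<notin> bdry F"
 proof
  assume "\<Psi>i w \<in> bdry F"
  then have "w \<in> frontier Tri" using Psi_bdry \<open>\<Psi> (\<Psi>i w) = w\<close> by (metis imageI)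
  then show False using assms unfolding frontier_Tri_minus D_def by blast
 qed
qed

lemma D_memberI: "x \<in> surface F ==> x \<notin> verts F ==> x \<notin> bdry F ==> \<Psi> x \<in> D"
proof -
 assume x: "x \<in> surface F" "x \<notin> verts F" "x \<notin> bdry F"
 have "\<Psi> x \<notin> \<Psi> ` verts F" "\<Psi> x \<notin> \<Psi> ` bdry F"
  using inj_on_image_mem_iff[OF Psi_facts(3) x(1)] verts_subset bdry_subset x by blast+
 then show ?thesis using Psi_facts(4)[OF x(1)] unfolding Psi_bdry D_def E_def frontier_Tri_minus by blast
qed

text \<open>The estimate in the coordinate box is carried to the triangle by
  \<open>\<Psi> \<circ> X\<close>, which does not depend on q; invariance of domain makes the image
  of the smaller box a neighbourhood of w0.\<close>

lemma h_equicontinuous: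
 assumes w0: "w0 \<in> D" and e: "e > 0"
 shows "\<exists>\<delta>>0. eventually (\<lambda>q. \<forall>w\<in>ball w0 \<delta>. norm (h q w - h q w0) \<le> e) sequentially"
proof -
 obtain X z0 d A where X: "patch X z0 d A" "X z0 = \<Psi>i w0" using patch_exists[OF D_point(1-3)[OF w0]] by blast
 have p: "d > 0" "continuous_on (sbox z0 d) X" "inj_on X (sbox z0 d)" "X ` sbox z0 d \<subseteq> surface F"
  "eventually (\<lambda>q. \<exists>r. lat_weights (\<Phi> q \<circ> X) (2^q) A r (sbox z0 d)) sequentially" using X(1) by (auto simp: patch_def)
 show ?thesis
 proof (rule equicontinuity_at_point[OF p(1) e, of A], goal_cases)
  case (1 \<delta> N0)
  define U where "U = {z. \<bar>Re z - Re z0\<bar> < \<delta> \<and> \<bar>Im z - Im z0\<bar> < \<delta>}"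
  have "open ({z. \<bar>Re z - Re z0\<bar> < \<delta>} \<inter> {z. \<bar>Im z - Im z0\<bar> < \<delta>})"
   by (intro open_Int open_Collect_less continuous_intros)
  then have oU: "open U" unfolding U_def by (simp add: Collect_conj_eq)
  have Us: "U \<subseteq> sbox z0 \<delta>" "U \<subseteq> sbox z0 d" using 1(2) by (auto simp: U_def sbox_def)
  have c: "continuous_on U (\<Psi> \<circ> X)"
   using p(2,4) Us(2) by (intro continuous_on_compose continuous_on_subset[OF Psi_facts(1)]) (auto intro: continuous_on_subset)
  have i: "inj_on (\<Psi> \<circ> X) U"
   using p(3,4) Us(2) by (intro comp_inj_on inj_on_subset[OF Psi_facts(3)]) (auto intro: inj_on_subset)
  have "open ((\<Psi> \<circ> X) ` U)" by (rule invariance_of_domain[OF c oU i])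
  moreover have "w0 \<in> (\<Psi> \<circ> X) ` U"
  proof
   show "z0 \<in> U" using 1(1) by (simp add: U_def)
   show "w0 = (\<Psi> \<circ> X) z0" using X(2) D_point(4)[OF w0] by simp
  qed
  ultimately obtain \<eta> where \<eta>: "\<eta> > 0" "ball w0 \<eta> \<subseteq> (\<Psi> \<circ> X) ` U" by (rule openE)
  have "eventually (\<lambda>q. \<forall>w\<in>ball w0 \<eta>. norm (h q w - h q w0) \<le> e) sequentially"
   using p(5) eventually_ge_at_top[of Q] eventually_ge_at_top[of N0]
  proof eventually_elim
   case (elim q)
   obtain r where r: "lat_weights (\<Phi> q \<circ> X) (2^q) A r (sbox z0 d)" using elim(1) by blast
   have N: "(2::nat)^q \<ge> N0" using elim(3) less_exp[of q] by linarith
   have cq: "continuous_on (sbox z0 d) (\<Phi> q \<circ> X)" by (intro continuous_on_compose p(2) continuous_on_subset[OF Phi_props(1)[OF elim(2)] p(4)])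
   have iq: "inj_on (\<Phi> q \<circ> X) (sbox z0 d)" by (intro comp_inj_on p(3) inj_on_subset[OF Phi_props(2)[OF elim(2)] p(4)])
   show ?case
   proof
    fix w assume "w \<in> ball w0 \<eta>"
    then obtain z where z: "z \<in> U" "w = \<Psi> (X z)" using \<eta>(2) by auto
    have zs: "X z \<in> surface F" using p(4) Us(2) z(1) by blast
    have "norm ((\<Phi> q \<circ> X) z - (\<Phi> q \<circ> X) z0) \<le> e" by (rule 1(3)[OF N r cq iq]) (use z(1) Us(1) in blast)
    then show "norm (h q w - h q w0) \<le> e" unfolding z(2) h_Psi[OF zs] by (simp add: h_def X(2))
   qed
  qed
  then show ?case using \<eta>(1) by blast
 qed
qed


text \<open>Near a boundary point off the vertices the surface is a half box in one face, and on its
  axis \<open>\<Phi> q\<close> stays on side l. The claim is \<open>boundary_bound_at_point\<close>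
  for the functional \<open>tcorner l\<close> with bound -1/2. Only an upper bound is stated; the
  lower bound 0 comes from the values lying in the triangle.\<close>

lemma boundary_estimate:
 assumes z: "\<zeta>0 \<in> frontier Tri" "\<zeta>0 \<notin> E" and l: "l \<in> {1,2,3}" "side_fn l \<zeta>0 = 0" and e: "e > 0"
 shows "\<exists>\<eta>>0. eventually (\<lambda>q. \<forall>w\<in>Tri \<inter> ball \<zeta>0 \<eta>. side_fn l (h q w) \<le> e) sequentially"
proof -
 have zT: "\<zeta>0 \<in> Tri" using z(1) unfolding frontier_Tri_minus by blast
 obtain x0 where x0: "x0 \<in> bdry F" "\<Psi> x0 = \<zeta>0" using z(1) unfolding Psi_bdry[symmetric] by blast
 have xs: "x0 \<in> surface F" using x0(1) bdry_subset by blast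
 have xv: "x0 \<notin> verts F" using z(2) x0(2) by (auto simp: E_def)
 obtain a b c f where ab: "(a, b) \<in> bd_edges F" and f: "f \<in> F" "rot f (a, b, c)" and seg: "x0 \<in> closed_segment a b"
  by (rule bd_edge_face[OF x0(1)])
 have vs: "a \<in> verts F" "b \<in> verts F" using f(1) rot_tverts[OF f(2)] by (auto simp: verts_def)
 obtain t where t: "0 \<le> t" "t \<le> 1" "x0 = (1 - t) *\<^sub>R a + t *\<^sub>R b" using seg unfolding in_segment by blast
 have t01: "t \<noteq> 0" "t \<noteq> 1" using t(3) vs xv by auto
 define z0 where "z0 = Complex t 0"
 have z0: "Im z0 = 0" "0 < Re z0" "Re z0 < 1" using t t01 by (auto simp: z0_def)
 have xz: "xm a b c z0 = x0" unfolding t(3) by (simp add: xm_def z0_def algebra_simps)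
 have z0D: "z0 \<in> Del" using z0 by (simp add: Del_def)
 have base: "xm a b c z \<in> bdry F" if "Im z = 0" "0 \<le> Re z" "Re z \<le> 1" for z
 proof -
  have "xm a b c z \<in> closed_segment a b"
   unfolding in_segment xm_def using that by (intro exI[of _ "Re z"]) (simp add: algebra_simps)
  then show ?thesis using ab unfolding bdry_def by blast
 qed
 obtain d where d: "d > 0" "sbox z0 d \<inter> {z. Im z \<ge> 0} \<subseteq> Dels d" using edge_sbox[OF z0] by metis
 obtain A where A: "eventually (\<lambda>q. \<forall>Q'. Q' \<subseteq> Dels d --> (\<exists>r. lat_weights (\<Phi> q \<circ> xm a b c) (2^q) A r Q')) sequentially"
  by (rule face_lat[OF f d(1)])
 have DelS: "xm a b c ` Del \<subseteq> surface F" using xm_in_surface[OF f] by blast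
 have cDel: "continuous_on Del (\<lambda>z. \<Psi> (xm a b c z))"
  using continuous_on_compose2[OF Psi_facts(1) continuous_xm DelS] .
 \<comment> \<open>A point on two sides is a corner, and corners are in E. So the other two side
   functions are positive here and, by continuity, on a short piece of the edge, which pins that
   piece to the open side l.\<close>
 have oth: "side_fn m \<zeta>0 > 0" if "m \<in> {1,2,3} - {l}" for m
 proof -
  have "side_fn m \<zeta>0 \<noteq> 0" using two_sides_corner[OF l(1), of m \<zeta>0] that l(2) z(2) corners_E by auto
  moreover have "side_fn m \<zeta>0 \<ge> 0" using zT that unfolding Tri_eq by blast
  ultimately show ?thesis by linarith
 qed
 have "eventually (\<lambda>z. \<forall>m\<in>{1,2,3}-{l}. side_fn m (\<Psi> (xm a b c z)) > 0) (at z0 within Del)"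
 proof (intro eventually_ball_finite ballI)
  fix m assume m: "m \<in> {1,2,3} - {l}"
  have "((\<lambda>z. side_fn m (\<Psi> (xm a b c z))) \<longlongrightarrow> side_fn m (\<Psi> (xm a b c z0))) (at z0 within Del)"
   using continuous_side_fn[OF cDel] z0D unfolding continuous_on_def by blast
  then show "eventually (\<lambda>z. side_fn m (\<Psi> (xm a b c z)) > 0) (at z0 within Del)"
   by (rule order_tendstoD) (use oth[OF m] in \<open>simp add: xz x0(2)\<close>)
 qed simp
 then obtain d' where d': "d' > 0" "\<forall>z\<in>Del. z \<noteq> z0 \<and> dist z z0 < d' --> (\<forall>m\<in>{1,2,3}-{l}. side_fn m (\<Psi> (xm a b c z)) > 0)"
  unfolding eventually_at by blast
 define d2 where "d2 = min d (d' / 2)"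
 have d2: "d2 > 0" "d2 \<le> d" "d2 < d'" using d(1) d'(1) by (auto simp: d2_def min_def)
 have sub: "sbox z0 d2 \<inter> {z. Im z \<ge> 0} \<subseteq> Dels d" using d(2) d2(2) by (force simp: sbox_def)
 then have subD: "sbox z0 d2 \<inter> {z. Im z \<ge> 0} \<subseteq> Del" by (auto simp: Dels_def)
 have side0: "side_fn l (\<Phi> q (xm a b c z)) = 0" if q: "q \<ge> Q" and z: "z \<in> sbox z0 d2" "Im z = 0" for q z
 proof -
  have zD: "z \<in> Del" using subD z by auto
  then have xb: "xm a b c z \<in> bdry F" using base z(2) by (simp add: Del_def)
  then have xS: "xm a b c z \<in> surface F" using bdry_subset by blast
  have "norm (z - z0) = \<bar>Re z - Re z0\<bar>" using z(2) z0(1) by (simp add: cmod_def)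
  then have dz: "dist z z0 < d'" using z(1) d2(3) by (simp add: sbox_def dist_norm)
  have pos: "\<forall>m\<in>{1,2,3}-{l}. side_fn m (\<Psi> (xm a b c z)) > 0"
  proof (cases "z = z0")
   case True then show ?thesis using oth by (simp add: xz x0(2))
  next
   case False then show ?thesis using d'(2) zD dz by blast
  qed
  have "\<Psi> (xm a b c z) \<in> frontier Tri" using xb Psi_bdry by blast
  then obtain m where m: "m \<in> {1,2,3}" "side_fn m (\<Psi> (xm a b c z)) = 0" unfolding frontier_Tri by blast
  have "m = l" using pos m by (metis DiffI less_irrefl singletonD)
  then have s0: "side_fn l (\<Psi> (xm a b c z)) = 0" using m(2) by simp
  have "side_fn l (h q (\<Psi> (xm a b c z))) = 0"
  proof (rule open_side_in_closed_side[OF h_facts(1,2)[OF q] _ _ l(1) s0 pos])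
   show "h q ` frontier Tri \<subseteq> frontier Tri" using h_facts(4)[OF q] by simp
   show "\<forall>m\<in>{1,2,3}. h q (tcorner m) = tcorner m" using h_facts(5)[OF q] by blast
  qed
  then show ?thesis by (simp add: h_Psi[OF xS])
 qed
 show ?thesis
 proof (rule boundary_bound_at_point[OF d2(1) e, of A], goal_cases)
  case (1 \<delta> N0)
  \<comment> \<open>Everything outside the open half box: the other faces and the rest of f. It is
    closed and misses x0, because a boundary edge belongs to no second face; hence surface points
    near x0 have coordinates in the half box.\<close>
  define Kb where "Kb = (\<Union>g\<in>F-{f}. tconv g) \<union> xm a b c ` (Del \<inter> {z. \<delta> \<le> \<bar>Re z - Re z0\<bar> \<or> \<delta> \<le> \<bar>Im z\<bar>})"
  have "closed ({z. \<delta> \<le> \<bar>Re z - Re z0\<bar>} \<union> {z. \<delta> \<le> \<bar>Im z\<bar>})"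
   by (intro closed_Un closed_Collect_le continuous_intros)
  then have "compact (Del \<inter> {z. \<delta> \<le> \<bar>Re z - Re z0\<bar> \<or> \<delta> \<le> \<bar>Im z\<bar>})"
   using compact_Del by (simp add: compact_Int_closed Collect_disj_eq)
  then have "closed (xm a b c ` (Del \<inter> {z. \<delta> \<le> \<bar>Re z - Re z0\<bar> \<or> \<delta> \<le> \<bar>Im z\<bar>}))"
   by (intro compact_imp_closed compact_continuous_image continuous_xm)
  moreover have "closed (\<Union>g\<in>F-{f}. tconv g)" using finite_F compact_imp_closed[OF compact_tconv] by (intro closed_UN) auto
  ultimately have clK: "closed Kb" unfolding Kb_def using closed_Un by blast
  have nK: "x0 \<notin> Kb"
  proof
   assume "x0 \<in> Kb"
   then consider g where "g \<in> F" "g \<noteq> f" "x0 \<in> tconv g"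
    | z where "\<delta> \<le> \<bar>Re z - Re z0\<bar> \<or> \<delta> \<le> \<bar>Im z\<bar>" "xm a b c z = x0" unfolding Kb_def by blast
   then show False
   proof cases
    case (1 g)
    have av: "a \<in> tverts g" "b \<in> tverts g" using edge_point_in_face[OF f z0 1(1)] 1(3) xz by simp_all
    obtain d' where "rot g (b, a, d')" "(b, a) \<in> dedges F" by (rule neighbour_orientation[OF f 1(1,2) av])
    then show False using ab by (simp add: bd_edges_def)
   next
    case (2 z)
    then have "z = z0" using xm_inj[OF face_nondeg[OF f]] xz by simp
    then show False using 2(1) 1(1) z0(1) by simp
   qed
  qed
  obtain r where r: "r > 0" "ball x0 r \<inter> Kb = {}"
  proof -
   have "open (- Kb)" "x0 \<in> - Kb" using clK nK by (auto simp: open_Compl)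
   then obtain r where "r > 0" "ball x0 r \<subseteq> - Kb" by (rule openE)
   then show ?thesis using that by blast
  qed
  have "\<Psi>i \<zeta>0 = x0" using Psi_facts(5)[OF xs] x0(2) by simp
  then obtain \<eta> where \<eta>: "\<eta> > 0" "\<forall>w\<in>Tri. dist w \<zeta>0 < \<eta> --> dist (\<Psi>i w) x0 < r"
   using Psi_facts(2) zT r(1) unfolding continuous_on_iff by metis
  have "eventually (\<lambda>q. \<forall>w\<in>Tri \<inter> ball \<zeta>0 \<eta>. side_fn l (h q w) \<le> e) sequentially"
   using A eventually_ge_at_top[of Q] eventually_ge_at_top[of N0]
  proof eventually_elim
   case (elim q)
   obtain rr where rr: "lat_weights (\<Phi> q \<circ> xm a b c) (2^q) A rr (sbox z0 d2 \<inter> {z. Im z \<ge> 0})" using elim(1) sub by blast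
   have N: "(2::nat)^q \<ge> N0" using elim(3) less_exp[of q] by linarith
   have sS: "xm a b c ` (sbox z0 d2 \<inter> {z. Im z \<ge> 0}) \<subseteq> surface F" using subD DelS by blast
   have cq: "continuous_on (sbox z0 d2 \<inter> {z. Im z \<ge> 0}) (\<Phi> q \<circ> xm a b c)"
    by (intro continuous_on_compose continuous_xm continuous_on_subset[OF Phi_props(1)[OF elim(2)] sS])
   have ix: "inj_on (xm a b c) (sbox z0 d2 \<inter> {z. Im z \<ge> 0})" using xm_inj[OF face_nondeg[OF f]] by (auto simp: inj_on_def)
   have iq: "inj_on (\<Phi> q \<circ> xm a b c) (sbox z0 d2 \<inter> {z. Im z \<ge> 0})"
    by (intro comp_inj_on ix inj_on_subset[OF Phi_props(2)[OF elim(2)] sS])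
   have bs: "tcorner l \<bullet> (\<Phi> q \<circ> xm a b c) z \<le> - 1/2" if "z \<in> sbox z0 d2" "Im z = 0" for z
    using side0[OF elim(2) that] by (simp add: side_fn_def)
   show ?case
   proof
    fix w assume w: "w \<in> Tri \<inter> ball \<zeta>0 \<eta>"
    have wS: "\<Psi>i w \<in> surface F" using w Psi_facts(6) by blast
    have "dist (\<Psi>i w) x0 < r" using \<eta>(2) w by (simp add: dist_commute)
    then have nk: "\<Psi>i w \<notin> Kb" using r(2) by (auto simp: dist_commute)
    obtain g where g: "g \<in> F" "\<Psi>i w \<in> tconv g" using wS by (auto simp: surface_def)
    have "g = f" using nk g unfolding Kb_def by blast
    then obtain z where z: "z \<in> Del" "\<Psi>i w = xm a b c z" using coords[OF f] g(2) by blast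
    have zb: "\<not> (\<delta> \<le> \<bar>Re z - Re z0\<bar> \<or> \<delta> \<le> \<bar>Im z\<bar>)" using nk z unfolding Kb_def by blast
    have zs: "z \<in> sbox z0 \<delta>" "Im z \<ge> 0" using zb z(1) z0(1) by (auto simp: sbox_def Del_def)
    have "tcorner l \<bullet> (\<Phi> q \<circ> xm a b c) z \<le> - 1/2 + e"
     by (rule 1(3)[OF N z0(1) rr cq iq _ bs zs]) simp_all
    then show "side_fn l (h q w) \<le> e" by (simp add: side_fn_def h_def z(2))
   qed
  qed
  then show ?case using \<eta>(1) by blast
 qed
qed

end

section \<open>Holomorphy of the limit\<close>

context conformal_setup
begin

lemma openDel_rotate: "z \<in> openDel ==> Complex (Im z) (1 - Re z - Im z) \<in> openDel"
 by (simp add: openDel_def)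

lemma rot_coords:
 assumes "rot f (a, b, c)" "rot f (a', b', c')" "z \<in> openDel"
 shows "\<exists>z'\<in>openDel. xm a' b' c' z' = xm a b c z"
proof -
 have "rot (a, b, c) (a', b', c')" by (rule rot_trans[OF rot_sym[OF assms(1)] assms(2)])
 then consider "a' = a" "b' = b" "c' = c" | "a' = b" "b' = c" "c' = a" | "a' = c" "b' = a" "c' = b"
  unfolding rot_def rotl.simps prod.inject by blast
 then show ?thesis
 proof cases
  case 1 then show ?thesis using assms(3) by blast
 next
  case 2
  show ?thesis unfolding 2 using openDel_rotate[OF assms(3)] xm_rotate by blast
 next
  case 3
  show ?thesis unfolding 3 using openDel_rotate[OF openDel_rotate[OF assms(3)]] xm_rotate by metis
 qed
qed

text \<open>\<open>admissible_assoc\<close> covers faces of level 2 by chart domains, so the point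
  is located in one of the sixteen subfaces by rounding its coordinates to the lattice of mesh
  1/4.\<close>

lemma open_face_in_Omega:
 assumes f: "f \<in> F" "rot f (a, b, c)" and z: "z \<in> openDel"
 shows "\<exists>v\<in>{a, b, c}. xm a b c z \<in> Om v"
proof -
 define N where "N = (2::real) ^ 2"
 have N4: "N = 4" by (simp add: N_def)
 define i where "i = \<lfloor>Re z * N\<rfloor>"
 define j where "j = \<lfloor>Im z * N\<rfloor>"
 have zz: "0 < Re z" "0 < Im z" "Re z + Im z < 1" using z by (auto simp: openDel_def)
 have ij0: "0 \<le> i" "0 \<le> j" using zz by (auto simp: i_def j_def N4)
 have fl: "of_int i \<le> Re z * N" "Re z * N < of_int i + 1" "of_int j \<le> Im z * N" "Im z * N < of_int j + 1"
  unfolding i_def j_def by linarith+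
 have sN: "Re z * N + Im z * N < 4" using zz by (simp add: N4)
 have Np: "N > 0" by (simp add: N4)
 obtain f1 where f1: "f1 \<in> (refine ^^ 2) {(a, b, c)}" "xm a b c z \<in> tconv f1"
 proof (cases "Re z * N + Im z * N \<le> of_int i + of_int j + 1")
  case True
  have "i + j + 1 \<le> 2 ^ 2" using fl(1,3) sN by simp
  then obtain f1 where f1: "f1 \<in> (refine ^^ 2) {(a, b, c)}" "rot f1 (xp a b c N i j, xp a b c N (i+1) j, xp a b c N i (j+1))"
   using refine_lattice(1)[OF ij0, of 2 a b c] unfolding N_def[symmetric] by blast
  have "tconv f1 = xm a b c ` up_tri N i j" using rot_tconv[OF f1(2)] by (simp add: tconv_def up_tri_def xm_hull)
  moreover have "z \<in> up_tri N i j" using Np fl(1,3) True by (rule in_up_tri)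
  ultimately show ?thesis using that f1(1) by blast
 next
  case False
  then have "real_of_int (i + j + 1) < real_of_int 4" using sN by simp
  then have "i + j + 1 < 4" by (simp only: of_int_less_iff)
  then have "i + j + 2 \<le> 2 ^ 2" by simp
  then obtain f1 where f1: "f1 \<in> (refine ^^ 2) {(a, b, c)}" "rot f1 (xp a b c N (i+1) j, xp a b c N (i+1) (j+1), xp a b c N i (j+1))"
   using refine_lattice(2)[OF ij0, of 2 a b c] unfolding N_def[symmetric] by blast
  have "tconv f1 = xm a b c ` down_tri N i j" using rot_tconv[OF f1(2)] by (simp add: tconv_def down_tri_def xm_hull)
  moreover have "z \<in> down_tri N i j" by (rule in_down_tri[OF Np]) (use fl False in linarith)+
  ultimately show ?thesis using that f1(1) by blast
 qed
 obtain g where g: "g \<in> (refine ^^ 2) {f}" "rot g f1" using refine_rot[OF f(2) f1(1)] by blast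
 have xg: "xm a b c z \<in> tconv g" using f1(2) rot_tconv[OF g(2)] by simp
 have glev: "g \<in> level F 2" using g(1) refine_mono[of "{f}" F 2] f(1) by (auto simp: level_def)
 obtain f2 where f2: "f2 \<in> F" "tconv g \<subseteq> tconv f2" "assoc g \<in> tverts f2" "closure (tconv g) \<subseteq> Om (assoc g)"
  using assoc glev unfolding admissible_assoc_def by blast
 have ndf: "nondeg_tri f"
  using face_noncollinear[OF f(1)] by (cases f) (simp add: nondeg_iff_not_collinear)
 note gp = refine_props[OF g(1)]
 have "f2 = f" using tconv_eq_imp_subset[OF f2(1) f(1) gp(2)[OF ndf] f2(2) gp(1)] .
 then have "assoc g \<in> {a, b, c}" using f2(3) rot_tverts[OF f(2)] by simp
 moreover have "xm a b c z \<in> Om (assoc g)" using xg f2(4) closure_subset by blast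
 ultimately show ?thesis by blast
qed

lemma open_face_in_D:
 assumes f: "f \<in> F" "rot f (a, b, c)" and z: "z \<in> openDel"
 shows "\<Psi> (xm a b c z) \<in> D"
proof (rule D_memberI)
 have zD: "z \<in> Del" using z openDel_subset by blast
 show "xm a b c z \<in> surface F" using xm_in_surface[OF f zD] by simp
 show "xm a b c z \<notin> bdry F" by (rule open_face_not_bdry[OF f z])
 show "xm a b c z \<notin> verts F"
 proof
  assume "xm a b c z \<in> verts F"
  from xm_vertex[OF f zD this] show False using z by (auto simp: openDel_def)
 qed
qed

lemma open_ucoord_vimage: "open S ==> open (ucoord B C -` S)"
 by (rule open_vimage[OF _ continuous_ucoord[OF continuous_on_id]])

text \<open>Locally this is \<Psi> after the inverse of a chart, composed with the expression \<psi>
  of that chart in the planar coordinate. \<open>inv_into\<close> returns the original point by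
  \<open>chart_inj_on_face\<close>, which speaks of points strictly inside a face; edge points are
  reached later by pasting.\<close>

lemma Psi_holomorphic_on_face:
 assumes f: "f \<in> F" "rot f (a, b, c)" and fl: "flat a b c B C"
 shows "(\<lambda>u. \<Psi> (xm a b c (ucoord B C u))) holomorphic_on ucoord B C -` openDel"
 unfolding holomorphic_on_def
proof
 let ?P = "ucoord B C"
 define U where "U = ?P -` openDel"
 have \<Delta>: "Im (cnj B * C) > 0" using fl by (simp add: flat_def)
 have oU: "open U" unfolding U_def by (rule open_ucoord_vimage[OF open_openDel])
 fix u0 assume u0: "u0 \<in> ?P -` openDel"
 then have z0: "?P u0 \<in> openDel" by simp
 obtain v where v: "v \<in> {a, b, c}" "xm a b c (?P u0) \<in> Om v" using open_face_in_Omega[OF f z0] by blast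
 have vV: "v \<in> verts F" using v(1) f(1) rot_tverts[OF f(2)] by (auto simp: verts_def)
 define \<phi> where "\<phi> = cht v"
 define \<Omega> where "\<Omega> = Om v"
 have "openin (top_of_set (surface F)) \<Omega>" unfolding \<Omega>_def Omega_def by (rule openin_interior_of)
 then obtain T where T: "open T" "\<Omega> = surface F \<inter> T" unfolding openin_open by blast
 have cX: "continuous_on UNIV (\<lambda>u. xm a b c (?P u))"
  by (rule continuous_on_compose2[OF continuous_xm[of UNIV]]) (auto intro: continuous_ucoord continuous_on_id)
 define W where "W = U \<inter> (\<lambda>u. xm a b c (?P u)) -` T"
 have oW: "open W" unfolding W_def by (intro open_Int oU open_vimage[OF T(1) cX])
 have u0W: "u0 \<in> W" using u0 v(2) T(2) by (auto simp: W_def U_def \<Omega>_def)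
 obtain \<psi> V zv where p: "zv \<in> {0, 1, \<i>}" "open V" "\<psi> holomorphic_on V"
  "\<forall>z\<in>Del. z \<noteq> zv --> tmap B C z \<in> V"
  "\<forall>z\<in>Del. xm a b c z \<in> Om v --> cht v (xm a b c z) = \<psi> (tmap B C z)"
  using chart_local[OF f fl v(1)] by blast
 have W: "?P u \<in> openDel" "?P u \<in> Del" "xm a b c (?P u) \<in> \<Omega>" "xm a b c (?P u) \<notin> bdry F" "u \<in> V" "\<phi> (xm a b c (?P u)) = \<psi> u" if u: "u \<in> W" for u
 proof -
  show o: "?P u \<in> openDel" using u by (simp add: W_def U_def)
  then show oD: "?P u \<in> Del" using openDel_subset by blast
  show xo: "xm a b c (?P u) \<in> \<Omega>" using u xm_in_surface[OF f oD] T(2) by (simp add: W_def)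
  show "xm a b c (?P u) \<notin> bdry F" by (rule open_face_not_bdry[OF f o])
  have "?P u \<noteq> zv" using o p(1) by (auto simp: openDel_def)
  then show "u \<in> V" using p(4) oD tmap_ucoord[OF \<Delta>, of u] by metis
  show "\<phi> (xm a b c (?P u)) = \<psi> u" using p(5) oD xo tmap_ucoord[OF \<Delta>, of u] unfolding \<phi>_def \<Omega>_def by metis
 qed
 obtain b' c' where r: "rot f (v, b', c')" using rot_at_vertex[of v f] v(1) rot_tverts[OF f(2)] by auto
 have inv: "inv_into \<Omega> \<phi> (\<psi> u) = xm a b c (?P u)" if u: "u \<in> W" for u
 proof -
  obtain z' where z': "z' \<in> openDel" "xm v b' c' z' = xm a b c (?P u)" using rot_coords[OF f(2) r W(1)[OF u]] by blast
  have im: "\<psi> u \<in> \<phi> ` \<Omega>" using W(3,6)[OF u] by (metis imageI)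
  have y: "inv_into \<Omega> \<phi> (\<psi> u) \<in> \<Omega>" by (rule inv_into_into[OF im])
  have py: "\<phi> (inv_into \<Omega> \<phi> (\<psi> u)) = \<phi> (xm v b' c' z')" unfolding f_inv_into_f[OF im] z'(2) W(6)[OF u] ..
  have z'D: "z' \<in> Del" "Re z' > 0" "Im z' > 0" using z'(1) openDel_subset by (auto simp: openDel_def)
  have zO: "xm v b' c' z' \<in> Om v" using W(3)[OF u] unfolding z'(2) \<Omega>_def .
  show ?thesis
   using chart_inj_on_face[OF vV f(1) r z'D zO y[unfolded \<phi>_def \<Omega>_def] py[unfolded \<phi>_def \<Omega>_def]] unfolding z'(2) \<phi>_def \<Omega>_def .
 qed
 have h1: "(\<Psi> \<circ> inv_into \<Omega> \<phi>) holomorphic_on \<phi> ` (\<Omega> - bdry F)" using Psi_conf vV unfolding \<phi>_def \<Omega>_def by blast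
 have h2: "\<psi> holomorphic_on W" using p(3) W(5) by (meson holomorphic_on_subset subsetI)
 have sub: "\<psi> ` W \<subseteq> \<phi> ` (\<Omega> - bdry F)"
 proof
  fix y assume "y \<in> \<psi> ` W"
  then obtain u where u: "u \<in> W" "y = \<psi> u" by blast
  then show "y \<in> \<phi> ` (\<Omega> - bdry F)" using W(3,4,6)[OF u(1)] by (metis DiffI imageI)
 qed
 have "((\<Psi> \<circ> inv_into \<Omega> \<phi>) \<circ> \<psi>) holomorphic_on W" by (rule holomorphic_on_compose_gen[OF h2 h1 sub])
 then have "(\<lambda>u. \<Psi> (xm a b c (?P u))) holomorphic_on W"
  by (rule holomorphic_transform) (simp add: inv)
 then have "(\<lambda>u. \<Psi> (xm a b c (?P u))) field_differentiable at u0"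
  using oW u0W by (rule holomorphic_on_imp_differentiable_at)
 then show "(\<lambda>u. \<Psi> (xm a b c (?P u))) field_differentiable (at u0 within ?P -` openDel)"
  by (rule field_differentiable_at_within)
qed

lemma compact_subset_Dels:
 assumes "compact Kc" "Kc \<subseteq> openDel"
 obtains \<rho> where "\<rho> > 0" "Kc \<subseteq> Dels \<rho>"
proof -
 have cl: "closed Kc" by (rule compact_imp_closed[OF assms(1)])
 have n: "p \<notin> Kc" if "p \<in> {0, 1, \<i>}" for p using assms(2) that by (auto simp: openDel_def)
 have "\<exists>d>0. \<forall>x\<in>Kc. d \<le> norm (x - p)" if "p \<in> {0, 1, \<i>}" for p
  using separate_point_closed[OF cl n[OF that]] by (simp add: dist_norm norm_minus_commute)
 then obtain d0 d1 d2 where d: "d0 > 0" "\<forall>x\<in>Kc. d0 \<le> norm (x - 0)" "d1 > 0" "\<forall>x\<in>Kc. d1 \<le> norm (x - 1)" "d2 > 0" "\<forall>x\<in>Kc. d2 \<le> norm (x - \<i>)"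
  by (metis insertCI)
 show ?thesis
 proof (rule that[of "min d0 (min d1 d2)"])
  show "min d0 (min d1 d2) > 0" using d by simp
  show "Kc \<subseteq> Dels (min d0 (min d1 d2))"
  proof
   fix x assume x: "x \<in> Kc"
   have "x \<in> Del" using x assms(2) openDel_subset by blast
   moreover have "d0 \<le> norm x" "d1 \<le> norm (x - 1)" "d2 \<le> norm (x - \<i>)" using d x by auto
   ultimately show "x \<in> Dels (min d0 (min d1 d2))" unfolding Dels_def by (simp add: min.coboundedI1 min.coboundedI2 min_le_iff_disj)
  qed
 qed
qed

text \<open>A cell contributes at most \<open>\<tau> * E * r / N\<close>, and \<open>r / N\<close>
  is at most half of \<open>r^2 + 1 / N^2\<close>. The squares of the weights add up to at most A,
  the terms \<open>1 / N^2\<close> over at most N^2 cells to at most 1, so the whole sum is of order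
  \<tau>.\<close>

lemma face_circ_small:
 assumes f: "f \<in> F" "rot f (a, b, c)" and fl: "flat a b c B C" and Kc: "compact Kc" "Kc \<subseteq> openDel" and e: "e > 0"
 shows "eventually (\<lambda>q. \<forall>S. finite S --> (\<forall>c\<in>S. lat_cell (real (2^q)) c \<subseteq> Kc) -->
   (\<Sum>k\<in>S. norm (cell_circ B C (\<Phi> q \<circ> xm a b c) (real (2^q)) k)) \<le> e) sequentially"
proof -
 obtain \<rho> where \<rho>: "\<rho> > 0" "Kc \<subseteq> Dels \<rho>" by (rule compact_subset_Dels[OF Kc])
 show ?thesis
 proof (rule face_weights[OF f fl \<rho>(1)], goal_cases)
  case (1 A E)
  \<comment> \<open>Here \<open>E\<close> is the constant from \<open>face_weights\<close>, not the
    exceptional set. The last summand 1 keeps the denominator positive.\<close>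
  define \<tau> where "\<tau> = min (1/2) (e / (E * (A + 1) + 1))"
  have EA: "E * (A + 1) \<ge> 0" using 1(1,2) by simp
  have \<tau>: "0 < \<tau>" "\<tau> \<le> 1/2" "\<tau> * (E * (A + 1)) \<le> e"
  proof -
   show t0: "0 < \<tau>" using e EA by (auto simp: \<tau>_def)
   show "\<tau> \<le> 1/2" unfolding \<tau>_def by (rule min.cobounded1)
   have "\<tau> * (E * (A + 1)) \<le> \<tau> * (E * (A + 1) + 1)" using t0 by (intro mult_left_mono) auto
   also have "\<dots> \<le> e / (E * (A + 1) + 1) * (E * (A + 1) + 1)" using EA by (intro mult_right_mono) (auto simp: \<tau>_def)
   also have "\<dots> = e" using EA by (simp add: field_simps)
   finally show "\<tau> * (E * (A + 1)) \<le> e" .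
  qed
  from 1(3)[OF \<tau>(1,2)] show ?case
  proof eventually_elim
   case (elim q)
   define N where "N = real (2 ^ q)"
   have N0: "N > 0" by (simp add: N_def)
   have "face_est a b c B C A (\<tau> * E) Kc q" by (rule spec[OF elim, THEN mp, OF \<rho>(2)])
   then obtain r where r: "lat_weights (\<Phi> q \<circ> xm a b c) (2^q) A r Kc"
    "\<forall>i j. lcell (real (2^q)) i j \<subseteq> Kc --> norm (cell_circ B C (\<Phi> q \<circ> xm a b c) (real (2^q)) (i, j)) \<le> \<tau> * E * (r (i, j) / real (2^q))" unfolding face_est_def by (elim exE conjE)
   show ?case
   proof (intro allI impI)
    fix S :: "(int \<times> int) set" assume S: "finite S" "\<forall>c\<in>S. lat_cell (real (2^q)) c \<subseteq> Kc"
    have cell: "lcell N (fst k) (snd k) \<subseteq> Kc" if "k \<in> S" for k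
     using S(2) that unfolding pt_def N_def by blast
    \<comment> \<open>Cells inside the open face have indices between 0 and 2^q, so there are at
      most N^2 of them.\<close>
    have SB: "S \<subseteq> {0..<2^q} \<times> {0..<2^q}"
    proof
     fix k assume k: "k \<in> S"
     have "pt N (fst k) (snd k) \<in> lcell N (fst k) (snd k)" using N0 by (auto simp: pt_def in_cbox_complex_iff divide_right_mono)
     then have "pt N (fst k) (snd k) \<in> openDel" using cell[OF k] Kc(2) by blast
     then have h: "0 < real_of_int (fst k) / N" "0 < real_of_int (snd k) / N" "real_of_int (fst k) / N < 1" "real_of_int (snd k) / N < 1"
      by (auto simp: openDel_def pt_def)
     then have "0 < real_of_int (fst k)" "0 < real_of_int (snd k)" "real_of_int (fst k) < N" "real_of_int (snd k) < N"
      using N0 by (auto simp: zero_less_divide_iff)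
     then have "0 < fst k" "0 < snd k" "real_of_int (fst k) < real_of_int (2^q)" "real_of_int (snd k) < real_of_int (2^q)" by (simp_all add: N_def)
     then have "0 < fst k" "0 < snd k" "fst k < 2^q" "snd k < 2^q" unfolding of_int_less_iff by simp_all
     then show "k \<in> {0..<2^q} \<times> {0..<2^q}" by (simp add: mem_Times_iff)
    qed
    have "card S \<le> card ({0..<(2::int)^q} \<times> {0..<(2::int)^q})" by (rule card_mono[OF _ SB]) simp
    also have "\<dots> = 2^q * 2^q" by (simp add: card_cartesian_product nat_power_eq)
    finally have "real (card S) \<le> real (2^q * 2^q)" by (simp only: of_nat_le_iff)
    then have cS: "real (card S) \<le> N\<^sup>2" by (simp add: N_def power2_eq_square)
    have A: "(\<Sum>k\<in>S. (r k)\<^sup>2) \<le> A"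
    proof (rule lat_weightsD(3)[OF r(1) S(1)])
     fix i j assume "(i, j) \<in> S"
     from cell[OF this] show "lcell (real (2^q)) i j \<subseteq> Kc" by (simp add: N_def)
    qed
    have amgm: "r k / N \<le> ((r k)\<^sup>2 + 1 / N\<^sup>2) / 2" for k
     using sum_squares_bound[of "r k" "1/N"] by (simp add: power_divide mult.commute)
    have "(\<Sum>k\<in>S. norm (cell_circ B C (\<Phi> q \<circ> xm a b c) (real (2^q)) k)) \<le> (\<Sum>k\<in>S. \<tau> * E * (((r k)\<^sup>2 + 1 / N\<^sup>2) / 2))"
    proof (rule sum_mono)
     fix k assume k: "k \<in> S"
     have "norm (cell_circ B C (\<Phi> q \<circ> xm a b c) (real (2^q)) k) \<le> \<tau> * E * (r k / N)"
      using r(2)[rule_format, of "fst k" "snd k"] cell[OF k] by (simp add: N_def)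
     also have "\<dots> \<le> \<tau> * E * (((r k)\<^sup>2 + 1 / N\<^sup>2) / 2)" using \<tau>(1) 1(2) by (intro mult_left_mono amgm) simp
     finally show "norm (cell_circ B C (\<Phi> q \<circ> xm a b c) (real (2^q)) k) \<le> \<tau> * E * (((r k)\<^sup>2 + 1 / N\<^sup>2) / 2)" .
    qed
    also have "\<dots> = \<tau> * E * (((\<Sum>k\<in>S. (r k)\<^sup>2) + real (card S) * (1 / N\<^sup>2)) / 2)"
     by (simp add: sum_distrib_left[symmetric] sum_divide_distrib[symmetric] sum.distrib)
    also have "\<dots> \<le> \<tau> * E * ((A + 1) / 2)"
    proof -
     have "real (card S) * (1 / N\<^sup>2) \<le> 1" using cS N0 by simp
     then show ?thesis using A \<tau>(1) 1(2) by (intro mult_left_mono divide_right_mono add_mono) auto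
    qed
    also have "\<dots> \<le> \<tau> * (E * (A + 1))"
    proof -
     have "\<tau> * (E * (A + 1)) \<ge> 0" using EA \<tau>(1) by simp
     moreover have "\<tau> * E * ((A + 1) / 2) = \<tau> * (E * (A + 1)) / 2" by simp
     ultimately show ?thesis by linarith
    qed
    also have "\<dots> \<le> e" by (rule \<tau>(3))
    finally show "(\<Sum>k\<in>S. norm (cell_circ B C (\<Phi> q \<circ> xm a b c) (real (2^q)) k)) \<le> e" .
   qed
  qed
 qed
qed

text \<open>The discrete maps converge continuously in face coordinates and their circulations over
  the cells sum to a vanishing amount. The limit therefore has no circulation, and Morera's theorem
  applies in the planar coordinate.\<close>

lemma limit_holomorphic_on_face:
 assumes s: "strict_mono s" "\<And>n. s n \<ge> Q" and cc: "cconv (\<lambda>n. h (s n)) H D"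
  and f: "f \<in> F" "rot f (a, b, c)" and fl: "flat a b c B C"
 shows "(\<lambda>u. H (\<Psi> (xm a b c (ucoord B C u)))) holomorphic_on ucoord B C -` openDel"
proof -
 have \<Delta>: "Im (cnj B * C) > 0" using fl by (simp add: flat_def)
 define G where "G z = H (\<Psi> (xm a b c z))" for z
 define Gn where "Gn n = \<Phi> (s n) \<circ> xm a b c" for n
 have XS: "xm a b c ` openDel \<subseteq> surface F" using openDel_subset xm_in_surface[OF f] by blast
 have cX: "continuous_on openDel (\<lambda>z. \<Psi> (xm a b c z))"
  by (rule continuous_on_compose2[OF Psi_facts(1) continuous_xm XS])
 have XD: "\<Psi> (xm a b c z) \<in> D" if "z \<in> openDel" for z by (rule open_face_in_D[OF f that])
 have cG: "continuous_on openDel G" unfolding G_def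
  by (rule continuous_on_compose2[OF cconv_continuous[OF cc] cX]) (use XD in blast)
 have c1: "continuous_on openDel (Gn n)" for n
  unfolding Gn_def by (intro continuous_on_compose continuous_xm continuous_on_subset[OF Phi_props(1)[OF s(2)] XS])
 have b1: "norm (Gn n z) \<le> 1" if "z \<in> openDel" for n z
  using Phi_props(3)[OF s(2)[of n]] XS that Tri_norm by (auto simp: Gn_def)
 have lim: "(\<lambda>n. Gn n (x n)) \<longlonglongrightarrow> G z" if z: "z \<in> openDel" and x: "x \<longlonglongrightarrow> z" for x z
 proof -
  have ev: "eventually (\<lambda>n. x n \<in> openDel) sequentially" by (rule topological_tendstoD[OF x open_openDel z])
  have "isCont (\<lambda>z. \<Psi> (xm a b c z)) z" using cX open_openDel z by (simp add: continuous_on_eq_continuous_at)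
  then have "(\<lambda>n. \<Psi> (xm a b c (x n))) \<longlonglongrightarrow> \<Psi> (xm a b c z)" using x by (rule isCont_tendsto_compose)
  from cconv_tendsto[OF cc XD[OF z] this] have "(\<lambda>n. h (s n) (\<Psi> (xm a b c (x n)))) \<longlonglongrightarrow> G z" by (simp add: G_def)
  then show ?thesis
  proof (rule Lim_transform_eventually)
   show "eventually (\<lambda>n. h (s n) (\<Psi> (xm a b c (x n))) = Gn n (x n)) sequentially"
    using ev by eventually_elim (use XS in \<open>auto simp: Gn_def h_Psi\<close>)
  qed
 qed
 have Nlim: "filterlim (\<lambda>n. real (2 ^ s n)) at_top sequentially"
 proof (rule filterlim_at_top_mono)
  show "filterlim (\<lambda>n. real (s n)) at_top sequentially"
   by (rule filterlim_compose[OF filterlim_real_sequentially filterlim_subseq[OF s(1)]])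
  have "real (s n) \<le> real (2 ^ s n)" for n unfolding of_nat_le_iff using less_exp[of "s n"] by simp
  then show "eventually (\<lambda>n. real (s n) \<le> real (2 ^ s n)) sequentially" by simp
 qed
 have circ0: "circ B C G x0 x1 y0 y1 = 0" if "x0 \<le> x1" "y0 \<le> y1" "cbox (Complex x0 y0) (Complex x1 y1) \<subseteq> openDel" for x0 x1 y0 y1
 proof (rule circ_limit_zero[OF open_openDel c1 b1 lim Nlim _ _ that])
  fix Kc and e :: real assume "compact Kc" "Kc \<subseteq> openDel" "e > 0"
  from eventually_subseq[OF s(1) face_circ_small[OF f fl this]]
  show "eventually (\<lambda>n. \<forall>S. finite S --> (\<forall>c\<in>S. lat_cell (real (2 ^ s n)) c \<subseteq> Kc) -->
   (\<Sum>k\<in>S. norm (cell_circ B C (Gn n) (real (2 ^ s n)) k)) \<le> e) sequentially" unfolding Gn_def .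
 next
  fix n show "0 < real (2 ^ s n)" by simp
 qed
 have "(G \<circ> ucoord B C) holomorphic_on ucoord B C -` openDel"
  by (rule holomorphic_if_circ_zero[OF open_openDel cG circ0 linear_ucoord ucoord_unique[OF \<Delta>]])
 then show ?thesis by (simp add: o_def G_def)
qed

end

lemma holomorphic_transfer_at:
 assumes U: "open U" and R: "R holomorphic_on U" "inj_on R U" and HR: "(H \<circ> R) holomorphic_on U" and u: "u \<in> U"
 shows "H field_differentiable at (R u)"
proof (rule holomorphic_on_imp_differentiable_at)
 show "H holomorphic_on R ` U" by (rule holomorphic_transfer[OF U R HR])
 show "open (R ` U)" by (rule open_mapping_thm3[OF R(1) U R(2)])
 show "R u \<in> R ` U" using u by simp
qed

lemma flat_real_exists:
 assumes "nondeg a b c"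
 obtains C where "flat a b c (of_real (norm (b - a))) C"
proof (rule flat_coordinates[OF assms], goal_cases)
 case (1 B C)
 have "flat a b c B C" unfolding flat_def using 1(2,4) by blast
 then show ?case by (intro 1(1)) (simp only: 1(3))
qed

context conformal_setup
begin

lemma limit_differentiable_face:
 assumes s: "strict_mono s" "\<And>n. s n \<ge> Q" and cc: "cconv (\<lambda>n. h (s n)) H D"
  and f: "f \<in> F" "rot f (a, b, c)" and z: "z \<in> openDel"
 shows "H field_differentiable at (\<Psi> (xm a b c z))"
proof -
 obtain B C where fl: "flat a b c B C" using flat_exists[OF face_nondeg[OF f]] .
 have \<Delta>: "Im (cnj B * C) > 0" using fl by (simp add: flat_def)
 define U where "U = ucoord B C -` openDel"
 define R where "R u = \<Psi> (xm a b c (ucoord B C u))" for u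
 have oU: "open U" unfolding U_def by (rule open_ucoord_vimage[OF open_openDel])
 have R: "R holomorphic_on U" unfolding R_def U_def by (rule Psi_holomorphic_on_face[OF f fl])
 have inj: "inj_on R U"
 proof (rule inj_onI)
  fix u w assume uw: "u \<in> U" "w \<in> U" "R u = R w"
  have "xm a b c (ucoord B C u) \<in> surface F" "xm a b c (ucoord B C w) \<in> surface F"
   using uw(1,2) openDel_subset xm_in_surface[OF f] unfolding U_def by blast+
  then have "xm a b c (ucoord B C u) = xm a b c (ucoord B C w)" using inj_onD[OF Psi_facts(3)] uw(3) unfolding R_def by blast
  from xm_inj[OF face_nondeg[OF f] this] show "u = w" using tmap_ucoord[OF \<Delta>] by metis
 qed
 have HR: "(H \<circ> R) holomorphic_on U"
  using limit_holomorphic_on_face[OF s cc f fl] unfolding o_def R_def U_def .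
 have u: "tmap B C z \<in> U" "R (tmap B C z) = \<Psi> (xm a b c z)" using z by (simp_all add: U_def R_def ucoord_tmap[OF \<Delta>])
 show ?thesis using holomorphic_transfer_at[OF oU R inj HR u(1)] unfolding u(2) .
qed

text \<open>Both faces are unfolded into one plane with the shared edge on the real axis. There R is
  continuous and holomorphic off the axis, hence holomorphic across it, and so is
  \<open>H \<circ> R\<close>; as R is injective, H is differentiable at the image point. R needs the
  pasting too, because the charts have been inverted inside faces only.\<close>

lemma limit_differentiable_edge:
 assumes s: "strict_mono s" "\<And>n. s n \<ge> Q" and cc: "cconv (\<lambda>n. h (s n)) H D"
  and f: "f \<in> F" "rot f (a, b, c)" and g: "g \<in> F" "rot g (b, a, d)" and fg: "f \<noteq> g"
  and z: "Im z = 0" "0 < Re z" "Re z < 1" and inD: "\<Psi> (xm a b c z) \<in> D"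
 shows "H field_differentiable at (\<Psi> (xm a b c z))"
proof -
 have ndf: "nondeg a b c" and ndg: "nondeg b a d" by (rule face_nondeg[OF f], rule face_nondeg[OF g])
 define len where "len = norm (b - a)"
 have len: "len > 0" using distinct_face_verts(1)[OF f] by (simp add: len_def)
 obtain C where flf: "flat a b c (of_real len) C" unfolding len_def by (rule flat_real_exists[OF ndf])
 obtain C' where flg: "flat b a d (of_real len) C'" unfolding len_def norm_minus_commute[of b] by (rule flat_real_exists[OF ndg])
 have \<Delta>: "Im (cnj (of_real len) * C) > 0" "Im (cnj (of_real len) * C') > 0" using flf flg unfolding flat_def by blast+
 then have C0: "Im C > 0" "Im C' > 0" using len by (simp_all add: zero_less_mult_iff)
 let ?P = "ucoord (of_real len) C" and ?P' = "ucoord (of_real len) C'"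
 have ImP: "Im (?P u) = Im u / Im C" "Im (?P' u) = Im u / Im C'" for u using len by (simp_all add: ucoord_def)
 \<comment> \<open>Leads from the unfolded plane to the coordinates of \<open>EX2\<close>. Below the
   axis the flat position of the neighbour, which starts at b, is the half turn
   \<open>of_real len - u\<close>.\<close>
 define \<rho> where "\<rho> u = (if Im u \<ge> 0 then ?P u else 1 - ?P' (of_real len - u))" for u
 have real: "?P u = of_real (Re u / len)" "?P' (of_real len - u) = 1 - of_real (Re u / len)" if "Im u = 0" for u
  using that len C0 by (simp_all add: ucoord_def complex_eq_iff field_simps)
 have r1: "\<rho> u = ?P u" if "Im u \<ge> 0" for u using that by (simp add: \<rho>_def)
 have r2: "\<rho> u = 1 - ?P' (of_real len - u)" if "Im u \<le> 0" for u
 proof (cases "Im u = 0")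
  case True then show ?thesis using real[OF True] by (simp add: \<rho>_def)
 next
  case False then show ?thesis using that by (simp add: \<rho>_def)
 qed
 have cl: "closed {u. Im u \<ge> 0}" "closed {u. Im u \<le> 0}" by (intro closed_Collect_le continuous_intros)+
 have c1: "continuous_on {u. Im u \<ge> 0} \<rho>"
  by (rule continuous_on_eq[OF continuous_ucoord[OF continuous_on_id]]) (simp add: r1)
 have c2: "continuous_on {u. Im u \<le> 0} \<rho>"
 proof (rule continuous_on_eq)
  show "continuous_on {u. Im u \<le> 0} (\<lambda>u. 1 - ?P' (of_real len - u))" by (intro continuous_intros continuous_ucoord)
 qed (simp add: r2)
 have c\<rho>: "continuous_on UNIV \<rho>"
  by (rule continuous_on_subset[OF continuous_on_closed_Un[OF cl c1 c2]]) auto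
 have sg: "Im (\<rho> u) \<ge> 0" if "Im u \<ge> 0" for u using that C0 by (simp add: r1 ImP)
 have sgs: "Im (\<rho> u) > 0" if "Im u > 0" for u using that C0 by (simp add: r1 ImP)
 have sgs': "Im (\<rho> u) < 0" if "Im u < 0" for u using that C0 by (simp add: r2 ImP divide_neg_pos)
 have inj\<rho>: "u = w" if e: "\<rho> u = \<rho> w" for u w
 proof -
  consider "Im u \<ge> 0" "Im w \<ge> 0" | "Im u < 0" "Im w < 0"
   using sg[of u] sg[of w] sgs'[of u] sgs'[of w] e by fastforce
  then show ?thesis
  proof cases
   case 1
   then have "?P u = ?P w" using e by (simp add: r1)
   then show ?thesis using tmap_ucoord[OF \<Delta>(1)] by metis
  next
   case 2
   then have "?P' (of_real len - u) = ?P' (of_real len - w)" using e by (simp add: r2)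
   then have "of_real len - u = of_real len - w" using tmap_ucoord[OF \<Delta>(2)] by metis
   then show ?thesis by simp
  qed
 qed
 obtain \<delta> where d: "\<delta> > 0" "sbox z \<delta> \<inter> {z. Im z \<ge> 0} \<subseteq> Dels \<delta>" "(\<lambda>z. 1 - z) ` (sbox z \<delta> \<inter> {z. Im z \<le> 0}) \<subseteq> Dels \<delta>"
  "\<forall>w\<in>sbox z \<delta>. 0 < Re w \<and> Re w + \<bar>Im w\<bar> < 1 \<and> 0 < Re (1 - w) \<and> Re (1 - w) + \<bar>Im w\<bar> < 1"
  by (rule edge_sbox[OF z])
 define Ob where "Ob = {w. \<bar>Re w - Re z\<bar> < \<delta>} \<inter> {w. \<bar>Im w - Im z\<bar> < \<delta>}"
 have oOb: "open Ob" unfolding Ob_def by (intro open_Int open_Collect_less continuous_intros)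
 have Obs: "Ob \<subseteq> sbox z \<delta>" by (auto simp: Ob_def sbox_def)
 define W0 where "W0 = \<rho> -` Ob"
 have oW0: "open W0" unfolding W0_def by (rule open_vimage[OF oOb c\<rho>])
 have b: "\<rho> u \<in> sbox z \<delta>" if "u \<in> W0" for u using that Obs by (auto simp: W0_def)
 have DelU: "w \<in> Del" if "w \<in> sbox z \<delta>" "Im w \<ge> 0" for w using d(2) that by (auto simp: Dels_def)
 have DelL: "1 - w \<in> Del" if "w \<in> sbox z \<delta>" "Im w \<le> 0" for w
 proof -
  have "1 - w \<in> Dels \<delta>" using d(3) that by blast
  then show ?thesis by (simp add: Dels_def)
 qed
 have ES: "EX2 a b c d w \<in> surface F" if "w \<in> sbox z \<delta>" for w
 proof (cases "Im w \<ge> 0")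
  case True then show ?thesis using that DelU xm_in_surface[OF f] by (simp add: EX2_simps)
 next
  case False then show ?thesis using that DelL xm_in_surface[OF g] by (simp add: EX2_simps)
 qed
 define R where "R u = \<Psi> (EX2 a b c d (\<rho> u))" for u
 have cR0: "continuous_on W0 R"
  unfolding R_def
 proof (rule continuous_on_compose2[OF Psi_facts(1)])
  show "continuous_on W0 (\<lambda>u. EX2 a b c d (\<rho> u))"
   by (rule continuous_on_compose2[OF continuous_EX2[of UNIV] continuous_on_subset[OF c\<rho>]]) auto
  show "(\<lambda>u. EX2 a b c d (\<rho> u)) ` W0 \<subseteq> surface F" using ES b by blast
 qed
 \<comment> \<open>H is controlled on D only, so the neighbourhood is restricted to points that R
   sends into D.\<close>
 define W where "W = W0 \<inter> R -` D"
 have oW: "open W" unfolding W_def by (rule continuous_open_preimage[OF cR0 oW0 open_D])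
 have WW0: "W \<subseteq> W0" by (simp add: W_def)
 have cR: "continuous_on W R" by (rule continuous_on_subset[OF cR0 WW0])
 have injR: "inj_on R W"
 proof (rule inj_onI)
  fix u w assume uw: "u \<in> W" "w \<in> W" "R u = R w"
  have bb: "\<rho> u \<in> sbox z \<delta>" "\<rho> w \<in> sbox z \<delta>" using uw(1,2) b WW0 by blast+
  have "EX2 a b c d (\<rho> u) = EX2 a b c d (\<rho> w)" using inj_onD[OF Psi_facts(3) _ ES[OF bb(1)] ES[OF bb(2)]] uw(3) unfolding R_def by blast
  then have "\<rho> u = \<rho> w" using inj_onD[OF inj_EX2[OF f g fg DelU DelL, of "sbox z \<delta>"]] bb by blast
  then show "u = w" by (rule inj\<rho>)
 qed
 have up: "?P u \<in> openDel" "R u = \<Psi> (xm a b c (?P u))" if u: "u \<in> W" "Im u > 0" for u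
 proof -
  have bu: "\<rho> u \<in> sbox z \<delta>" using u(1) b WW0 by blast
  have "\<rho> u = ?P u" using r1 u(2) by simp
  then show "?P u \<in> openDel" "R u = \<Psi> (xm a b c (?P u))"
   using d(4)[rule_format, OF bu] sgs[OF u(2)] by (auto simp: openDel_def R_def EX2_simps)
 qed
 have low: "?P' (of_real len - u) \<in> openDel" "R u = \<Psi> (xm b a d (?P' (of_real len - u)))" if u: "u \<in> W" "Im u < 0" for u
 proof -
  have bu: "\<rho> u \<in> sbox z \<delta>" using u(1) b WW0 by blast
  have e: "1 - \<rho> u = ?P' (of_real len - u)" using r2[of u] u(2) by simp
  have "1 - \<rho> u \<in> openDel" using d(4)[rule_format, OF bu] sgs'[OF u(2)] by (auto simp: openDel_def)
  then show "?P' (of_real len - u) \<in> openDel" by (simp only: e)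
  have "EX2 a b c d (\<rho> u) = xm b a d (1 - \<rho> u)" using sgs'[OF u(2)] by (simp add: EX2_simps)
  then show "R u = \<Psi> (xm b a d (?P' (of_real len - u)))" by (simp add: R_def e)
 qed
 have halves: "{u. \<i> \<bullet> u < 0} = {u. Im u < 0}" "{u. 0 < \<i> \<bullet> u} = {u. Im u > 0}" by (simp_all add: inner_complex_def)
 \<comment> \<open>Used with Y the identity for R, and with Y = H for
   \<open>H \<circ> R\<close>.\<close>
 have paste: "(\<lambda>u. Y (R u)) holomorphic_on W"
  if Yc: "continuous_on D Y" and Yf: "(\<lambda>u. Y (\<Psi> (xm a b c (?P u)))) holomorphic_on ?P -` openDel"
   and Yg: "(\<lambda>u. Y (\<Psi> (xm b a d (?P' u)))) holomorphic_on ?P' -` openDel" for Y :: "complex => complex"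
 proof (rule holomorphic_on_paste_across_line[OF oW, of \<i> _ 0])
  show "continuous_on W (\<lambda>u. Y (R u))" by (rule continuous_on_compose2[OF Yc cR]) (auto simp: W_def)
  have "(\<lambda>u. Y (\<Psi> (xm a b c (?P u)))) holomorphic_on W \<inter> {u. Im u > 0}"
   by (rule holomorphic_on_subset[OF Yf]) (use up in auto)
  then show "(\<lambda>u. Y (R u)) holomorphic_on W \<inter> {u. 0 < \<i> \<bullet> u}"
   unfolding halves by (rule holomorphic_transform) (use up in auto)
  have "((\<lambda>u. Y (\<Psi> (xm b a d (?P' u)))) \<circ> (\<lambda>u. of_real len - u)) holomorphic_on W \<inter> {u. Im u < 0}"
   by (rule holomorphic_on_compose_gen[OF _ Yg]) (use low in \<open>auto intro!: holomorphic_intros\<close>)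
  then show "(\<lambda>u. Y (R u)) holomorphic_on W \<inter> {u. \<i> \<bullet> u < 0}"
   unfolding halves by (rule holomorphic_transform) (use low in auto)
 qed simp
 have Rhol: "R holomorphic_on W"
  by (rule paste[of "\<lambda>x. x"]) (use Psi_holomorphic_on_face[OF f flf] Psi_holomorphic_on_face[OF g flg] in \<open>auto intro: continuous_on_id\<close>)
 have HRhol: "(H \<circ> R) holomorphic_on W"
  unfolding o_def
  by (rule paste[OF cconv_continuous[OF cc] limit_holomorphic_on_face[OF s cc f flf] limit_holomorphic_on_face[OF s cc g flg]])
 define u0 where "u0 = tmap (of_real len) C z"
 have iu0: "Im u0 = 0" using z(1) by (simp add: u0_def tmap_def)
 have ru0: "\<rho> u0 = z" using iu0 by (simp add: r1 u0_def ucoord_tmap[OF \<Delta>(1)])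
 have Ru0: "R u0 = \<Psi> (xm a b c z)" using z(1) by (simp add: R_def ru0 EX2_simps)
 have "z \<in> Ob" using d(1) by (simp add: Ob_def)
 then have u0W: "u0 \<in> W" using inD by (simp add: W_def W0_def ru0 Ru0)
 show ?thesis using holomorphic_transfer_at[OF oW Rhol injR HRhol u0W] unfolding Ru0 .
qed

lemma limit_holomorphic:
 assumes s: "strict_mono s" "\<And>n. s n \<ge> Q" and cc: "cconv (\<lambda>n. h (s n)) H D"
 shows "H holomorphic_on D"
 unfolding holomorphic_on_def
proof
 fix w assume w: "w \<in> D"
 note p = D_point[OF w]
 have "H field_differentiable at w"
 proof (rule point_cases[OF p(1,2)])
  fix f a b c z assume f: "f \<in> F" "rot f (a, b, c)" and x: "\<Psi>i w = xm a b c z" and z: "z \<in> openDel"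
  show ?thesis using limit_differentiable_face[OF s cc f z] unfolding x[symmetric] p(4) .
 next
  fix f a b c z assume f: "f \<in> F" "rot f (a, b, c)" and x: "\<Psi>i w = xm a b c z" and z: "Im z = 0" "0 < Re z" "Re z < 1"
  obtain g d where g: "g \<in> F" "rot g (b, a, d)" "f \<noteq> g" by (rule edge_neighbour[OF f z p(3)[unfolded x]])
  have "\<Psi> (xm a b c z) \<in> D" using w p(4) unfolding x by simp
  from limit_differentiable_edge[OF s cc f g z this] show ?thesis unfolding x[symmetric] p(4) .
 qed
 then show "H field_differentiable (at w within D)" by (rule field_differentiable_at_within)
qed

text \<open>H maps into the triangle, so its side functions are nonnegative;
  \<open>boundary_estimate\<close> survives the limit as an upper bound, and together they give the
  boundary values that \<open>holomorphic_Tri_identity\<close> asks for.\<close>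

lemma limit_is_identity:
 assumes s: "strict_mono s" "\<And>n. s n \<ge> Q" and cc: "cconv (\<lambda>n. h (s n)) H D" and w: "w \<in> D"
 shows "H w = w"
proof -
 have lim: "(\<lambda>n. h (s n) z) \<longlonglongrightarrow> H z" if "z \<in> D" for z by (rule cconv_tendsto[OF cc that tendsto_const])
 have HT: "H z \<in> Tri" if z: "z \<in> D" for z
 proof (rule closed_sequentially[OF closed_Tri _ lim[OF z]])
  show "h (s n) z \<in> Tri" for n using h_facts(3)[OF s(2)] z D_subset by blast
 qed
 have bd: "((\<lambda>z. side_fn l (H z)) \<longlongrightarrow> 0) (at \<zeta>0 within D)"
  if l: "l \<in> {1,2,3}" and z: "\<zeta>0 \<in> frontier Tri - E" and sl: "side_fn l \<zeta>0 = 0" for l \<zeta>0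
 proof (rule tendstoI)
  fix e :: real assume e: "e > 0"
  then have e2: "e/2 > 0" by simp
  have z': "\<zeta>0 \<in> frontier Tri" "\<zeta>0 \<notin> E" using z by auto
  obtain \<eta> where \<eta>: "\<eta> > 0" "eventually (\<lambda>q. \<forall>w\<in>Tri \<inter> ball \<zeta>0 \<eta>. side_fn l (h q w) \<le> e/2) sequentially"
   using boundary_estimate[OF z' l sl e2] by blast
  show "eventually (\<lambda>z. dist (side_fn l (H z)) 0 < e) (at \<zeta>0 within D)"
   unfolding eventually_at
  proof (intro exI[of _ \<eta>] conjI ballI impI \<eta>(1))
   fix z assume zD: "z \<in> D" and dz: "z \<noteq> \<zeta>0 \<and> dist z \<zeta>0 < \<eta>"
   have zb: "z \<in> Tri \<inter> ball \<zeta>0 \<eta>" using zD D_subset dz by (auto simp: dist_commute)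
   have "(\<lambda>n. side_fn l (h (s n) z)) \<longlonglongrightarrow> side_fn l (H z)" unfolding side_fn_def by (intro tendsto_intros lim[OF zD])
   moreover have "eventually (\<lambda>n. side_fn l (h (s n) z) \<le> e/2) sequentially"
    using eventually_subseq[OF s(1) \<eta>(2)] by (rule eventually_mono) (use zb in blast)
   ultimately have "side_fn l (H z) \<le> e/2" by (intro tendsto_upperbound) auto
   moreover have "side_fn l (H z) \<ge> 0" using HT[OF zD] l unfolding Tri_eq by blast
   ultimately show "dist (side_fn l (H z)) 0 < e" using e by simp
  qed
 qed
 show ?thesis
  by (rule holomorphic_Tri_identity[OF finite_E limit_holomorphic[OF s cc, unfolded D_def] HT[unfolded D_def] bd[unfolded D_def] corners_E w[unfolded D_def]])
qed

text \<open>Failure of convergence leaves an infinite set of levels that violate one fixed e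
  somewhere on C. Enumerating it gives the sequence to which compactness is applied, and a single
  good index contradicts membership in that set.\<close>

lemma uniform_convergence:
 assumes C: "compact C" "C \<subseteq> interior Tri"
 shows "uniform_limit C h id sequentially"
proof (rule ccontr)
 assume "\<not> uniform_limit C h id sequentially"
 then obtain e where e: "e > 0" and "\<not> eventually (\<lambda>q. \<forall>x\<in>C. dist (h q x) x < e) sequentially"
  unfolding uniform_limit_iff by auto
 then have fr: "\<exists>q\<ge>n. \<not> (\<forall>x\<in>C. dist (h q x) x < e)" for n unfolding eventually_sequentially by blast
 define Bad where "Bad = {q. q \<ge> Q \<and> \<not> (\<forall>x\<in>C. dist (h q x) x < e)}"
 have inf: "infinite Bad"
  unfolding infinite_nat_iff_unbounded_le
 proof
  fix n obtain q where "q \<ge> max n Q" "\<not> (\<forall>x\<in>C. dist (h q x) x < e)" using fr[of "max n Q"] by blast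
  then show "\<exists>q\<ge>n. q \<in> Bad" by (intro exI[of _ q]) (simp add: Bad_def)
 qed
 define s0 where "s0 = enumerate Bad"
 have s0: "strict_mono s0" "\<And>n. s0 n \<in> Bad" unfolding s0_def using strict_mono_enumerate[OF inf] enumerate_in_set[OF inf] by auto
 have s0Q: "s0 n \<ge> Q" for n using s0(2)[of n] by (simp add: Bad_def)
 obtain k H where k: "strict_mono k" "cconv (\<lambda>n. h (s0 (k n))) H D"
 proof (rule equicontinuous_subsequence[of D "\<lambda>n. h (s0 n)"])
  show "norm (h (s0 n) w) \<le> 1" if "w \<in> D" for n w using h_facts(3)[OF s0Q] D_subset that Tri_norm by blast
  fix w and e :: real assume we: "w \<in> D" "e > 0"
  obtain \<delta> where d: "\<delta> > 0" "eventually (\<lambda>q. \<forall>w'\<in>ball w \<delta>. norm (h q w' - h q w) \<le> e) sequentially" using h_equicontinuous[OF we] by blast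
  show "\<exists>\<delta>>0. eventually (\<lambda>n. \<forall>w'\<in>ball w \<delta>. norm (h (s0 n) w' - h (s0 n) w) \<le> e) sequentially"
   by (intro exI[of _ \<delta>] conjI d(1) eventually_subseq[OF s0(1) d(2)])
 qed
 define s where "s n = s0 (k n)" for n
 have s: "strict_mono s" using strict_mono_o[OF s0(1) k(1)] unfolding s_def o_def .
 have sQ: "s n \<ge> Q" for n using s0Q by (simp add: s_def)
 have cc: "cconv (\<lambda>n. h (s n)) H D" using k(2) by (simp add: s_def)
 note H = limit_is_identity[OF s sQ cc]
 have inD: "\<exists>\<delta>>0. eventually (\<lambda>n. \<forall>w\<in>ball x \<delta>. norm (h (s n) w - w) < e') sequentially" if x: "x \<in> D" and e': "e' > 0" for x e'
 proof -
  have "e'/2 > 0" using e' by simp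
  then obtain \<delta> where d: "\<delta> > 0" "eventually (\<lambda>n. \<forall>w\<in>ball x \<delta>. norm (h (s n) w - H x) < e'/2) sequentially"
   using cc x unfolding cconv_def by blast
  show ?thesis
  proof (intro exI[of _ "min \<delta> (e'/2)"] conjI)
   show "eventually (\<lambda>n. \<forall>w\<in>ball x (min \<delta> (e'/2)). norm (h (s n) w - w) < e') sequentially"
    using d(2)
   proof eventually_elim
    case (elim n)
    show ?case
    proof
     fix w assume w: "w \<in> ball x (min \<delta> (e'/2))"
     then have "norm (h (s n) w - x) < e'/2" using elim H[OF x] by auto
     moreover have "norm (w - x) < e'/2" using w by (simp add: dist_norm norm_minus_commute)
     ultimately show "norm (h (s n) w - w) < e'" using norm_triangle_ineq4[of "h (s n) w - x" "w - x"] by simp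
    qed
   qed
  qed (use d e' in auto)
 qed
 have "\<exists>\<delta>>0. eventually (\<lambda>n. \<forall>w\<in>ball x \<delta>. norm (h (s n) w - w) < e) sequentially" if xC: "x \<in> C" for x
 proof (cases "x \<in> D")
  case True then show ?thesis using inD e by blast
 next
  case False
  have xI: "x \<in> interior Tri" using C(2) xC by blast
  obtain r1 where r1: "r1 > 0" "cball x r1 \<subseteq> interior Tri" using open_contains_cball[of "interior Tri"] xI by auto
  obtain r2 where r2: "r2 > 0" "\<forall>y\<in>E. y \<noteq> x --> r2 \<le> dist x y" using finite_set_avoid[OF finite_E, of x] by blast
  \<comment> \<open>The circle has to stay in the interior of the triangle, avoid E and have radius
    at most e/4. Its image is then within e/4 + e/4 of x, so is the image of the disc by the maximum
    principle, and points of the disc are within e/4 of x.\<close>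
  define \<rho> where "\<rho> = min r1 (min (r2/2) (e/4))"
  have \<rho>: "\<rho> > 0" "\<rho> \<le> r1" "\<rho> < r2" "\<rho> \<le> e/4" using r1(1) r2(1) e by (auto simp: \<rho>_def min_def)
  have cb: "cball x \<rho> \<subseteq> interior Tri" using r1(2) \<rho>(2) by (meson order_trans subset_cball)
  have "sphere x \<rho> \<subseteq> D"
  proof
   fix y assume y: "y \<in> sphere x \<rho>"
   have "y \<notin> E" using r2(2) y \<rho>(1,3) by force
   then show "y \<in> D" using cb y by (auto simp: D_def)
  qed
  then have "\<forall>y\<in>sphere x \<rho>. \<exists>\<delta>>0. eventually (\<lambda>n. \<forall>w\<in>ball y \<delta>. norm (h (s n) w - w) < e/4) sequentially"
   using inD[of _ "e/4"] e by auto
  from eventually_ball_compact[OF compact_sphere this]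
  have "eventually (\<lambda>n. \<forall>w\<in>sphere x \<rho>. norm (h (s n) w - w) < e/4) sequentially" .
  then have "eventually (\<lambda>n. \<forall>w\<in>ball x \<rho>. norm (h (s n) w - w) < e) sequentially"
  proof eventually_elim
   case (elim n)
   have cT: "cball x \<rho> \<subseteq> Tri" using cb interior_subset by blast
   have "norm (h (s n) w - x) \<le> e/2" if w: "w \<in> cball x \<rho>" for w
   proof (rule norm_max_principle[OF compact_cball open_ball ball_subset_cball _ _ _ w])
    show "continuous_on (cball x \<rho>) (h (s n))" by (rule continuous_on_subset[OF h_facts(1)[OF sQ] cT])
    show "inj_on (h (s n)) (ball x \<rho>)" using inj_on_subset[OF h_facts(2)[OF sQ]] cT ball_subset_cball by blast
    fix y assume "y \<in> cball x \<rho> - ball x \<rho>"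
    then have y: "y \<in> sphere x \<rho>" by auto
    then have "norm (h (s n) y - y) < e/4" using elim by blast
    moreover have "norm (y - x) \<le> e/4" using y \<rho>(4) by (simp add: dist_norm norm_minus_commute)
    ultimately show "norm (h (s n) y - x) \<le> e/2" using norm_triangle_ineq[of "h (s n) y - y" "y - x"] by simp
   qed (use e in simp)
   show ?case
   proof
    fix w assume w: "w \<in> ball x \<rho>"
    have "norm (h (s n) w - x) \<le> e/2" using \<open>\<And>w. w \<in> cball x \<rho> ==> norm (h (s n) w - x) \<le> e/2\<close> w by simp
    moreover have "norm (w - x) < e/4" using w \<rho>(4) by (simp add: dist_norm norm_minus_commute)
    ultimately show "norm (h (s n) w - w) < e" using norm_triangle_ineq4[of "h (s n) w - x" "w - x"] e by simp
   qed
  qed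
  then show ?thesis using \<rho>(1) by blast
 qed
 then have "eventually (\<lambda>n. \<forall>w\<in>C. norm (h (s n) w - w) < e) sequentially"
  by (intro eventually_ball_compact[OF C(1)]) blast
 then obtain n where "\<forall>w\<in>C. norm (h (s n) w - w) < e" unfolding eventually_sequentially by blast
 moreover have "s n \<in> Bad" using s0(2) by (simp add: s_def)
 ultimately show False by (auto simp: Bad_def dist_norm)
qed

end

theorem theorem4p1:
  fixes F :: "'a::euclidean_space tri set"
    and v1 v2 v3 :: 'a
    and \<zeta> \<kappa> :: real
    and assoc :: "'a tri \<Rightarrow> 'a"
    and \<Psi> :: "'a \<Rightarrow> complex"
    and K :: "nat \<Rightarrow> real"
    and \<Phi> :: "nat \<Rightarrow> 'a \<Rightarrow> complex"
    and Q :: nat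
  assumes tri: "oriented_triangulation F"
    and disk: "surface F homeomorphic cball (0::complex) 1"
    and marked: "v1 \<in> verts F \<inter> bdry F" "v2 \<in> verts F \<inter> bdry F" "v3 \<in> verts F \<inter> bdry F"
    and distinct: "v1 \<noteq> v2" "v2 \<noteq> v3" "v1 \<noteq> v3"
    and posord: "pos_ordered F v1 v2 v3"
    and zeta: "0 < \<zeta>" "\<zeta> < 1/4"
    and refined1: "\<forall>v\<in>verts F. \<forall>f\<in>F. v \<in> tverts f \<longrightarrow>
                     real_of_int \<lceil>cone_gamma F v1 v2 v3 v\<rceil> * corner_angle v f < pi / 2 \<and>
                     corner_angle v f < 60.4 * pi / 180"
    and refined2: "\<forall>v\<in>verts F. cone_gamma F v1 v2 v3 v \<noteq> 1 \<longrightarrow>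
                     (\<forall>f\<in>F. v \<in> tverts f \<longrightarrow> dist v (fst (opp v f)) = dist v (snd (opp v f)))"
    and assoc: "admissible_assoc F \<zeta> assoc"
    and Psi_hom: "\<exists>\<Psi>'. homeomorphism (surface F) Tri \<Psi> \<Psi>'"
    and Psi_corners: "\<Psi> v1 = tcorner 1" "\<Psi> v2 = tcorner 2" "\<Psi> v3 = tcorner 3"
    and Psi_conf: "\<forall>v\<in>verts F.
        (\<Psi> \<circ> inv_into (Omega F \<zeta> v) (chart F v1 v2 v3 \<zeta> v)) holomorphic_on
          (chart F v1 v2 v3 \<zeta> v ` (Omega F \<zeta> v - bdry F))"
    and kappa: "\<kappa> > 0"
    and K: "(\<lambda>q. K q - 1) \<in> O(\<lambda>q. 2 powr (- \<kappa> * real q))"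
    and Phi: "\<forall>q\<ge>Q. \<Phi> q \<in> FK F v1 v2 v3 \<zeta> assoc q (K q)"
  shows "\<forall>C. compact C \<and> C \<subseteq> interior Tri \<longrightarrow>
           uniform_limit C (\<lambda>q. \<Phi> q \<circ> inv_into (surface F) \<Psi>) id sequentially"
proof -
  interpret conformal_setup F v1 v2 v3 \<zeta> assoc \<Psi> K \<Phi> Q \<kappa>
    by unfold_locales (fact tri disk marked zeta assoc Psi_hom Psi_corners Psi_conf kappa K Phi)+
  have "h = (\<lambda>q. \<Phi> q \<circ> inv_into (surface F) \<Psi>)" by (simp add: fun_eq_iff h_def \<Psi>i_def)
  with uniform_convergence show ?thesis by simp
qed

end
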